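(* Let $0<l<1$ be a real number. There is no complete non-positively curved Ricci surface $M$ biholomorphic to $\mathbb{C}\setminus\{0,1\}$, with three catenoidal ends (at the punctures $0,1,\infty$), whose induced metric $(-K)g_M$ is reducible and whose total curvature is $-4\pi l$.
   Context: Ricci surface: an orientable Riemannian surface $(M,g_M)$ whose Gauss curvature $K$ satisfies $K\Delta K+g_M(dK,dK)+4K^3=0$, where $\Delta=-\mathrm{div}\,\mathrm{grad}$ is the nonnegative Laplacian. It is non-positively curved if $K\le 0$. $M$ is regarded as a Riemann surface through the conformal class of $g_M$ and an orientation. Its total curvature is $\int_M K\,dA$. Weierstrass data: let $\pi:\tilde M\to M$ be the universal cover of a non-positively curved Ricci surface. There are a meromorphic function $g$ and a holomorphic 1-form $\eta$ (locally $\eta=\alpha\,dz$) on $\tilde M$, where $\eta$ has a zero of order $2m$ at each pole of $g$ of order $m$ and no other zeros, such that $\pi^*g_M=\frac14|\alpha|^2(1+|g|^2)^2|dz|^2$. The pair $(g,\eta)$ is called the Weierstrass data of $M$; it is unique up to $\eta\mapsto e^{i\theta}\eta$ and up to $(g,\eta)\mapsto(\tilde g,\tilde\eta)$ with $\tilde g=\sigma\cdot g$ ($\sigma\in PSU(2)$ acting by Möbius transformations) and $\tilde\eta=Q/d\tilde g$, where $Q:=dg\otimes\eta$ is the Hopf differential. Catenoidal end: suppose $M$ has finite total curvature and is biholomorphic to $S_k\setminus\{p_1,\dots,p_r\}$, with $S_k$ a compact Riemann surface of genus $k$. The puncture $p_i$ is a catenoidal end if it has a neighbourhood on which $Q$ is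 well defined (single-valued on the punctured neighbourhood, descending from the universal cover) and meromorphic, with $\mathrm{ord}_{p_i}Q=-2$. Reducible: the metric $(-K)g_M$ has constant Gauss curvature $1$ (with conical singularities at zeros of $K$) and pulls back to $\frac{4\,dg\,d\bar g}{(1+|g|^2)^2}$ on $\tilde M$. There is a monodromy representation $\rho:\pi_1(M)\to PSU(2)$ with $g\circ\tau^{-1}=\rho(\tau)\cdot g$ for all $\tau\in\pi_1(M)$. The metric $(-K)g_M$ is reducible if the image of $\rho$ is abelian (possibly trivial). *)

theory Defs
  imports "HOL-Complex_Analysis.Complex_Analysis"
begin

definition pd :: "complex \<Rightarrow> (complex \<Rightarrow> real) \<Rightarrow> complex \<Rightarrow> real" where
  "pd v f z = frechet_derivative f (at z) v"

primrec Ck_on :: "nat \<Rightarrow> complex set \<Rightarrow> (complex \<Rightarrow> real) \<Rightarrow> bool" where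
  "Ck_on 0 M f \<longleftrightarrow> continuous_on M f"
| "Ck_on (Suc k) M f \<longleftrightarrow>
     (\<forall>z\<in>M. f differentiable (at z)) \<and> Ck_on k M (pd 1 f) \<and> Ck_on k M (pd \<i> f)"

definition smooth_on :: "complex set \<Rightarrow> (complex \<Rightarrow> real) \<Rightarrow> bool" where
  "smooth_on M f \<longleftrightarrow> (\<forall>k. Ck_on k M f)"

text \<open>
  A Riemannian surface that is biholomorphic, for the complex structure given by its conformal
  class and an orientation, to a plane domain \<open>M\<close> is \<open>M\<close> with a metric \<open>lam |dz|\<^sup>2\<close>, where
  \<open>lam\<close> is positive and smooth.
\<close>

definition conformal_metric :: "complex set \<Rightarrow> (complex \<Rightarrow> real) \<Rightarrow> bool" where
  "conformal_metric M lam \<longleftrightarrow>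
     open M \<and> connected M \<and> M \<noteq> {} \<and> smooth_on M lam \<and> (\<forall>z\<in>M. lam z > 0)"

text \<open>The nonnegative Laplacian \<open>- div grad\<close> of \<open>lam |dz|\<^sup>2\<close>.\<close>

definition laplacian :: "(complex \<Rightarrow> real) \<Rightarrow> (complex \<Rightarrow> real) \<Rightarrow> complex \<Rightarrow> real" where
  "laplacian lam f z = - (pd 1 (pd 1 f) z + pd \<i> (pd \<i> f) z) / lam z"

definition grad_inner ::
  "(complex \<Rightarrow> real) \<Rightarrow> (complex \<Rightarrow> real) \<Rightarrow> (complex \<Rightarrow> real) \<Rightarrow> complex \<Rightarrow> real" where
  "grad_inner lam f h z = (pd 1 f z * pd 1 h z + pd \<i> f z * pd \<i> h z) / lam z"

text \<open>
  In isothermal coordinates the metric \<open>exp (2 u) |dz|\<^sup>2\<close> has Gauss curvature \<open>- exp (- 2 u)\<close>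
  times the flat Laplacian (the sum of the second derivatives) of \<open>u\<close>; here \<open>u = ln lam / 2\<close>.
\<close>

definition gauss_curvature :: "(complex \<Rightarrow> real) \<Rightarrow> complex \<Rightarrow> real" where
  "gauss_curvature lam = laplacian lam (\<lambda>z. ln (lam z) / 2)"

definition ricci_surface :: "complex set \<Rightarrow> (complex \<Rightarrow> real) \<Rightarrow> bool" where
  "ricci_surface M lam \<longleftrightarrow> conformal_metric M lam \<and>
     (let K = gauss_curvature lam
      in \<forall>z\<in>M. K z * laplacian lam K z + grad_inner lam K K z + 4 * K z ^ 3 = 0)"

definition nonpositively_curved :: "complex set \<Rightarrow> (complex \<Rightarrow> real) \<Rightarrow> bool" where
  "nonpositively_curved M lam \<longleftrightarrow> (\<forall>z\<in>M. gauss_curvature lam z \<le> 0)"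

text \<open>The area element is \<open>dA = lam dx dy\<close>.\<close>

definition finite_total_curvature :: "complex set \<Rightarrow> (complex \<Rightarrow> real) \<Rightarrow> bool" where
  "finite_total_curvature M lam \<longleftrightarrow>
     (\<lambda>z. gauss_curvature lam z * lam z) absolutely_integrable_on M"

definition total_curvature :: "complex set \<Rightarrow> (complex \<Rightarrow> real) \<Rightarrow> real" where
  "total_curvature M lam = integral M (\<lambda>z. gauss_curvature lam z * lam z)"

text \<open>
  \<open>valid_path\<close> allows the speed to be unbounded near finitely many parameters. Using
  \<open>has_integral\<close> rather than \<open>integral\<close> discards the paths of infinite length, to which
  \<open>integral\<close> would assign the value 0.
\<close>

definition riemann_dist ::
  "complex set \<Rightarrow> (complex \<Rightarrow> real) \<Rightarrow> complex \<Rightarrow> complex \<Rightarrow> real" where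
  "riemann_dist M lam x y =
     Inf {L. \<exists>c. valid_path c \<and> path_image c \<subseteq> M \<and> pathstart c = x \<and> pathfinish c = y \<and>
       ((\<lambda>t. sqrt (lam (c t)) * norm (vector_derivative c (at t))) has_integral L) {0..1}}"

definition complete_metric :: "complex set \<Rightarrow> (complex \<Rightarrow> real) \<Rightarrow> bool" where
  "complete_metric M lam \<longleftrightarrow> Metric_space.mcomplete M (riemann_dist M lam)"

text \<open>
  By uniformization, the universal cover of a plane domain is biholomorphic to a
  simply connected plane domain \<open>U\<close>.
\<close>

definition universal_cover ::
  "complex set \<Rightarrow> (complex \<Rightarrow> complex) \<Rightarrow> complex set \<Rightarrow> bool" where
  "universal_cover U p M \<longleftrightarrow>
     open U \<and> simply_connected U \<and> p holomorphic_on U \<and> covering_space U p M"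

text \<open>
  The 1-form is \<open>\<eta> = \<alpha> dz\<close> in the coordinate of \<open>U\<close>. The metric identity is required off the
  poles of \<open>g\<close>, which are isolated; at the poles it then holds in the limit.
\<close>

definition weierstrass_data ::
  "complex set \<Rightarrow> (complex \<Rightarrow> real) \<Rightarrow> complex set \<Rightarrow> (complex \<Rightarrow> complex) \<Rightarrow>
   (complex \<Rightarrow> complex) \<Rightarrow> (complex \<Rightarrow> complex) \<Rightarrow> bool" where
  "weierstrass_data M lam U p g \<alpha> \<longleftrightarrow>
     universal_cover U p M \<and> g nicely_meromorphic_on U \<and> \<alpha> holomorphic_on U \<and>
     (\<forall>z\<in>U. if is_pole g z then zorder \<alpha> z = 2 * (- zorder g z) else \<alpha> z \<noteq> 0) \<and>
     (\<forall>z\<in>U. \<not> is_pole g z \<longrightarrow>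
        lam (p z) * (norm (deriv p z))\<^sup>2 = 1 / 4 * (norm (\<alpha> z))\<^sup>2 * (1 + (norm (g z))\<^sup>2)\<^sup>2)"

text \<open>
  The puncture is given by the inverse \<open>\<psi>\<close> of a holomorphic coordinate \<open>w\<close> centred at it.
  The Hopf differential on the universal cover is \<open>deriv g * \<alpha> dz\<^sup>2\<close>. It is single-valued on
  the punctured neighbourhood \<open>N\<close> if, on each connected component \<open>C\<close> of the preimage of \<open>N\<close>,
  it is the pullback \<open>q w * (p' z / \<psi>' w)\<^sup>2 dz\<^sup>2\<close> of some \<open>q(w) dw\<^sup>2\<close>.
  The conjunct \<open>is_pole q 0\<close> is needed because \<open>zorder\<close> is unspecified
  for functions that vanish identically.
\<close>

definition catenoidal_end ::
  "complex set \<Rightarrow> complex set \<Rightarrow> (complex \<Rightarrow> complex) \<Rightarrow> (complex \<Rightarrow> complex) \<Rightarrow>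
   (complex \<Rightarrow> complex) \<Rightarrow> (complex \<Rightarrow> complex) \<Rightarrow> bool" where
  "catenoidal_end M U p g \<alpha> \<psi> \<longleftrightarrow>
     (\<exists>r>0. \<psi> ` (ball 0 r - {0}) \<subseteq> M \<and>
        (\<forall>C \<in> components {z\<in>U. p z \<in> \<psi> ` (ball 0 r - {0})}.
          \<exists>q. q meromorphic_on ball 0 r \<and> is_pole q 0 \<and> zorder q 0 = -2 \<and>
            (\<forall>z\<in>C. \<forall>w \<in> ball 0 r - {0}. \<psi> w = p z \<and> \<not> is_pole g z \<longrightarrow>
               deriv g z * \<alpha> z = q w * (deriv p z / deriv \<psi> w)\<^sup>2)))"

text \<open>The Riemann sphere is \<open>complex option\<close>, with \<open>None\<close> as the point at infinity.\<close>

definition sphere_map :: "(complex \<Rightarrow> complex) \<Rightarrow> complex \<Rightarrow> complex option" where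
  "sphere_map g z = (if is_pole g z then None else Some (g z))"

definition SU2 :: "(complex^2^2) set" where
  "SU2 = {A. A ** (\<chi> i j. cnj (A $ j $ i)) = mat 1 \<and> det A = 1}"

fun moebius_action :: "complex^2^2 \<Rightarrow> complex option \<Rightarrow> complex option" where
  "moebius_action A None =
     (if A $ 2 $ 1 = 0 then None else Some (A $ 1 $ 1 / A $ 2 $ 1))"
| "moebius_action A (Some w) =
     (if A $ 2 $ 1 * w + A $ 2 $ 2 = 0 then None
      else Some ((A $ 1 $ 1 * w + A $ 1 $ 2) / (A $ 2 $ 1 * w + A $ 2 $ 2)))"

text \<open>
  The kernel of the action of \<open>SU2\<close> is \<open>{mat 1, - mat 1}\<close>, so \<open>PSU(2)\<close> is the group, under
  composition, of the induced maps of the sphere.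
\<close>

definition PSU2 :: "(complex option \<Rightarrow> complex option) set" where
  "PSU2 = moebius_action ` SU2"

text \<open>The fundamental group of \<open>M\<close>, acting on the universal cover.\<close>

definition deck :: "complex set \<Rightarrow> (complex \<Rightarrow> complex) \<Rightarrow> (complex \<Rightarrow> complex) set" where
  "deck U p = {\<tau> \<in> extensional U. (\<exists>\<tau>'. homeomorphism U U \<tau> \<tau>') \<and> (\<forall>z\<in>U. p (\<tau> z) = p z)}"

text \<open>
  With the convention \<open>g \<circ> \<tau>\<^sup>-\<^sup>1 = \<rho> \<tau> \<cdot> g\<close>, the map \<open>\<rho>\<close> is a homomorphism for the product on
  the fundamental group under which \<open>\<tau>\<close> times \<open>\<sigma>\<close> acts as \<open>\<sigma> \<circ> \<tau>\<close>.
  The choice is immaterial when the image of \<open>\<rho>\<close> is abelian.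
\<close>

definition monodromy_representation ::
  "complex set \<Rightarrow> (complex \<Rightarrow> complex) \<Rightarrow> (complex \<Rightarrow> complex) \<Rightarrow>
   ((complex \<Rightarrow> complex) \<Rightarrow> complex option \<Rightarrow> complex option) \<Rightarrow> bool" where
  "monodromy_representation U p g \<rho> \<longleftrightarrow>
     \<rho> \<in> deck U p \<rightarrow> PSU2 \<and>
     (\<forall>\<tau>\<in>deck U p. \<forall>\<sigma>\<in>deck U p. \<rho> (compose U \<sigma> \<tau>) = \<rho> \<tau> \<circ> \<rho> \<sigma>) \<and>
     (\<forall>\<tau>\<in>deck U p. \<forall>z\<in>U. sphere_map g (inv_into U \<tau> z) = \<rho> \<tau> (sphere_map g z))"

text \<open>
  Reducibility of the metric \<open>(-K) g\<^sub>M\<close>, which is the pullback of the spherical metric by its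
  developing map \<open>g\<close>.
\<close>

definition reducible ::
  "complex set \<Rightarrow> (complex \<Rightarrow> complex) \<Rightarrow> (complex \<Rightarrow> complex) \<Rightarrow> bool" where
  "reducible U p g \<longleftrightarrow>
     (\<exists>\<rho>. monodromy_representation U p g \<rho> \<and>
        (\<forall>\<sigma>\<in>deck U p. \<forall>\<tau>\<in>deck U p. \<rho> \<sigma> \<circ> \<rho> \<tau> = \<rho> \<tau> \<circ> \<rho> \<sigma>))"

end

theory Submission
  imports Defs "HOL-Real_Asymp.Real_Asymp"
begin

text \<open>
  Write \<open>M\<close> for the twice punctured plane. The modulus of the Hopf differential is determined by
  the metric, and the catenoidal ends control it at the punctures, so the Hopf differential
  descends to a quadratic differential \<open>Q dz\<^sup>2\<close> on \<open>M\<close>. An abelian subgroup of \<open>PSU(2)\<close>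
  preserves, after a rotation of the sphere, the pair \<open>{0, \<infinity>}\<close>; the square of the 1-form \<open>g \<eta>\<close>
  is then invariant and descends to \<open>E dz\<^sup>2\<close> on \<open>M\<close>. The square \<open>T = 1 - |E| / lam\<close> of the height
  of \<open>g\<close> on the unit sphere is a function on \<open>M\<close>.

  By Archimedes' theorem on the area of spherical zones and the vanishing of the integral of the
  Laplacian of a bounded function, the moments of \<open>T\<close> for the curvature measure \<open>-K dA\<close> are
  \<open>4 \<pi> l / (2 k + 1)\<close>, as if \<open>g\<close> covered the sphere \<open>l\<close> times. A zero of \<open>E\<close> at which \<open>g\<close> takes
  the value \<open>0\<close> or \<open>\<infinity>\<close> with multiplicity \<open>m\<close> contributes at least \<open>2 \<pi> m\<close> to the limit of
  \<open>(2 k + 1)\<close> times these moments, so \<open>E\<close> has at most one zero if \<open>l < 1\<close>, and it is a double one.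
  At an end without zeros of \<open>E\<close> a Courant--Lebesgue argument shows that \<open>|E|\<close> is bounded below
  by a multiple of \<open>1 / |\<xi>|\<^sup>2\<close>. Liouville's theorem then determines \<open>E\<close> up to a factor: without
  zeros this contradicts the bound at infinity, and with one double zero \<open>E\<close> is a square. Then the
  height of \<open>g\<close> itself is a function on \<open>M\<close>, and its odd moments vanish; hence the zero
  contributes \<open>4 \<pi>\<close>, which exceeds \<open>4 \<pi> l\<close>.
\<close>

section \<open>Calculus on plane domains\<close>

text \<open>The factor \<open>2 k + 1\<close> is Archimedes' theorem: in terms of the height h the
  area element is 2 pi dh up to rotation, so (2 k + 1) times the integral of h^(2 k) over a cap
  around a pole of the axis tends to 2 pi. The weighted moments thus count the points over the two
  poles. The obstacle is the developing map at the ends. Integration over all of M works instead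
  because the twice punctured plane is parabolic. The lower bound for |E| at an end uses the
  logarithm f of the rotated developing map in the logarithmic coordinate of the puncture: its
  derivative is Q / sqrt E, finite area yields vertical lines on which Re f is bounded on one side,
  and a one-sided bound limits the growth of f to a power of ln |\<xi>|, too slow for a pole.
  Multivalued objects are avoided by using squares (of the height, of the 1-form, of the derivative
  of f), which do not see the half-turns that exchange the poles.\<close>

lemma pd_has_derivative: "(f has_derivative f') (at z) \<Longrightarrow> pd v f z = f' v"
  by (simp add: pd_def frechet_derivative_at [symmetric])

text \<open>\<open>frechet_derivative\<close> chooses from the set of all derivatives at z, and
  functions that agree near z have the same set; so the equation holds even where neither function
  is differentiable.\<close>

lemma pd_cong_open:
  assumes "open S" "z \<in> S" "\<And>w. w \<in> S \<Longrightarrow> f w = h w"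
  shows "pd v f z = pd v h z"
proof -
  have "(f has_derivative D) (at z) \<longleftrightarrow> (h has_derivative D) (at z)" for D
    using has_derivative_transform_within_open[OF _ assms(1,2), of f D UNIV h]
      has_derivative_transform_within_open[OF _ assms(1,2), of h D UNIV f] assms(3) by metis
  then show ?thesis by (simp add: pd_def frechet_derivative_def)
qed

lemma differentiable_cong_open:
  assumes "open S" "z \<in> S" "\<And>w. w \<in> S \<Longrightarrow> f w = h w" "f differentiable (at z)"
  shows "h differentiable (at z)"
  using assms has_derivative_transform_within_open[OF _ assms(1,2), of f _ UNIV h]
  unfolding differentiable_def by metis

lemma Ck_on_cong:
  assumes "open S" "\<And>w. w \<in> S \<Longrightarrow> f w = h w" "Ck_on k S f"
  shows "Ck_on k S h"
  using assms(2,3)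
proof (induction k arbitrary: f h)
  case 0 then show ?case by (metis Ck_on.simps(1) continuous_on_cong)
next
  case (Suc k)
  have "Ck_on k S (pd v h)" if "Ck_on k S (pd v f)" for v
    by (rule Suc.IH[OF _ that]) (use pd_cong_open[OF assms(1)] Suc.prems(1) in blast)
  then show ?case
    using Suc.prems differentiable_cong_open[OF assms(1) _ Suc.prems(1)] by auto
qed

text \<open>For global functions, such as the squared height, that are described only by formulas on
  small discs.\<close>

lemma Ck_on_local:
  assumes "\<And>z. z \<in> S \<Longrightarrow> \<exists>T. open T \<and> z \<in> T \<and> Ck_on k T f"
  shows "Ck_on k S f"
  using assms
proof (induction k arbitrary: f)
  case 0
  have "isCont f z" if "z \<in> S" for z
    using 0[OF that] continuous_on_eq_continuous_at by auto
  then show ?case by (simp add: continuous_at_imp_continuous_on)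
next
  case (Suc k)
  have "Ck_on k S (pd 1 f)" "Ck_on k S (pd \<i> f)"
    by (rule Suc.IH; use Suc.prems in force)+
  then show ?case using Suc.prems by fastforce
qed

lemma Ck_on_continuous: "Ck_on k S f \<Longrightarrow> open S \<Longrightarrow> continuous_on S f"
proof (cases k)
  case (Suc n)
  assume "Ck_on k S f" "open S"
  then show ?thesis using Suc
    by (auto intro!: continuous_at_imp_continuous_on differentiable_imp_continuous_within)
qed auto

lemma Ck_on_Suc_imp: "Ck_on (Suc k) S f \<Longrightarrow> open S \<Longrightarrow> Ck_on k S f"
proof (induction k arbitrary: f)
  case 0 then show ?case using Ck_on_continuous[of "Suc 0" S f] by simp
next
  case (Suc k)
  have "Ck_on k S (pd v f)" if "Ck_on (Suc k) S (pd v f)" for v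
    using Suc.IH Suc.prems that by blast
  then show ?case using Suc.prems by (metis Ck_on.simps(2))
qed

section \<open>Rules for \<open>pd\<close> and closure properties of the classes C^k\<close>

lemma pd_add: "f differentiable (at z) \<Longrightarrow> h differentiable (at z) \<Longrightarrow>
  pd v (\<lambda>z. f z + h z) z = pd v f z + pd v h z"
  unfolding frechet_derivative_works
  by (drule (1) has_derivative_add) (simp add: pd_has_derivative, simp add: pd_def)

lemma pd_mult: "f differentiable (at z) \<Longrightarrow> h differentiable (at z) \<Longrightarrow>
  pd v (\<lambda>z. f z * h z) z = pd v f z * h z + f z * pd v h z"
  unfolding frechet_derivative_works
  by (drule (1) has_derivative_mult) (simp add: pd_has_derivative, simp add: pd_def add.commute)

lemma pd_const [simp]: "pd v (\<lambda>z. c) = (\<lambda>z. 0)"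
  by (simp add: pd_def fun_eq_iff)

lemma pd_compose:
  assumes "f differentiable (at z)" "(e has_real_derivative d) (at (f z))"
  shows "pd v (\<lambda>z. e (f z)) z = d * pd v f z"
    and "(\<lambda>z. e (f z)) differentiable (at z)"
proof -
  have "((\<lambda>z. e (f z)) has_derivative (\<lambda>h. d * frechet_derivative f (at z) h)) (at z)"
    using has_derivative_compose[of f _ z UNIV e "\<lambda>h. d * h"] assms
    by (simp add: frechet_derivative_works has_field_derivative_def)
  then show "pd v (\<lambda>z. e (f z)) z = d * pd v f z" "(\<lambda>z. e (f z)) differentiable (at z)"
    using pd_has_derivative by (auto simp: pd_def differentiable_def)
qed

lemma Ck_on_const [simp]: "Ck_on k S (\<lambda>z. c)"
  by (induction k arbitrary: c) auto

lemma Ck_on_add: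
  assumes "open S" "Ck_on k S f" "Ck_on k S h"
  shows "Ck_on k S (\<lambda>z. f z + h z)"
  using assms(2,3)
proof (induction k arbitrary: f h)
  case (Suc k)
  have "Ck_on k S (pd v (\<lambda>z. f z + h z))" if "Ck_on k S (pd v f)" "Ck_on k S (pd v h)" for v
    by (rule Ck_on_cong[OF assms(1) _ Suc.IH[OF that]]) (use Suc.prems in \<open>simp add: pd_add\<close>)
  then show ?case using Suc.prems by auto
qed (auto intro: continuous_intros)

lemma Ck_on_mult:
  assumes "open S" "Ck_on k S f" "Ck_on k S h"
  shows "Ck_on k S (\<lambda>z. f z * h z)"
  using assms(2,3)
proof (induction k arbitrary: f h)
  case (Suc k)
  have "Ck_on k S (pd v (\<lambda>z. f z * h z))" if "Ck_on k S (pd v f)" "Ck_on k S (pd v h)" for v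
  proof (rule Ck_on_cong[OF assms(1)])
    show "Ck_on k S (\<lambda>z. pd v f z * h z + f z * pd v h z)"
      using that Suc assms(1) by (intro Ck_on_add Suc.IH) (auto intro: Ck_on_Suc_imp)
    show "pd v f z * h z + f z * pd v h z = pd v (\<lambda>z. f z * h z) z" if "z \<in> S" for z
      using Suc.prems that by (simp add: pd_mult)
  qed
  then show ?case using Suc.prems by auto
qed (auto intro: continuous_intros)

lemma Ck_on_power: "open S \<Longrightarrow> Ck_on k S f \<Longrightarrow> Ck_on k S (\<lambda>z. f z ^ n)"
  by (induction n) (auto intro: Ck_on_mult)

lemma Ck_on_inverse:
  assumes "open S" "\<And>z. z \<in> S \<Longrightarrow> f z \<noteq> 0" "Ck_on k S f"
  shows "Ck_on k S (\<lambda>z. inverse (f z))"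
  using assms(3)
proof (induction k)
  case 0 then show ?case using assms by (auto intro!: continuous_intros)
next
  case (Suc k)
  have der: "(inverse has_real_derivative - (inverse (f z) * inverse (f z))) (at (f z))" if "z \<in> S" for z
    using assms(2)[OF that] DERIV_inverse[of "f z"] by (simp add: power2_eq_square)
  have k: "Ck_on k S (\<lambda>z. inverse (f z))" using Suc Ck_on_Suc_imp assms(1) by blast
  have "Ck_on k S (pd v (\<lambda>z. inverse (f z)))" if "Ck_on k S (pd v f)" for v
  proof (rule Ck_on_cong[OF assms(1)])
    show "Ck_on k S (\<lambda>z. (-1) * ((inverse (f z) * inverse (f z)) * pd v f z))"
      by (intro Ck_on_mult k that assms Ck_on_const)
    show "(-1) * ((inverse (f z) * inverse (f z)) * pd v f z) = pd v (\<lambda>z. inverse (f z)) z"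
      if "z \<in> S" for z
      using pd_compose(1)[where f = f and e = inverse, OF _ der[OF that]] Suc.prems that by simp
  qed
  then show ?case using Suc.prems pd_compose(2)[where f = f and e = inverse, OF _ der] by auto
qed

lemma Ck_on_ln:
  assumes "open S" "\<And>z. z \<in> S \<Longrightarrow> f z > 0" "Ck_on k S f"
  shows "Ck_on k S (\<lambda>z. ln (f z))"
proof (cases k)
  case 0 then show ?thesis using assms
    by (auto intro!: continuous_intros) (metis less_irrefl)
next
  case (Suc k')
  have der: "(ln has_real_derivative inverse (f z)) (at (f z))" if "z \<in> S" for z
    using assms(2)[OF that] DERIV_ln by blast
  have "Ck_on k' S (pd v (\<lambda>z. ln (f z)))" if "Ck_on k' S (pd v f)" for v
  proof (rule Ck_on_cong[OF assms(1)])
    show "Ck_on k' S (\<lambda>z. inverse (f z) * pd v f z)"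
      using Ck_on_Suc_imp[of k' S f] assms(1,3) Suc
      by (intro Ck_on_mult that Ck_on_inverse) (auto dest: assms(2))
    show "inverse (f z) * pd v f z = pd v (\<lambda>z. ln (f z)) z"
      if "z \<in> S" for z
      using pd_compose(1)[where f = f and e = ln, OF _ der[OF that]] assms Suc that by simp
  qed
  then show ?thesis using Suc assms pd_compose(2)[where f = f and e = ln, OF _ der] by auto
qed

text \<open>An exponent of at least 2 makes the difference quotient at the corner 0 at most
  \<open>\<bar>h\<bar> ^ (n + 1)\<close>, which tends to 0; elsewhere the function is locally a
  power or 0.\<close>

lemma DERIV_pos_part_power:
  "((\<lambda>x::real. max 0 x ^ (n + 2)) has_real_derivative real (n + 2) * max 0 x ^ (n + 1)) (at x)"
proof (cases "x = 0")
  case True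
  have "((\<lambda>h. (max 0 (0 + h) ^ (n + 2) - max 0 0 ^ (n + 2)) / h) \<longlongrightarrow> (0::real)) (at 0)"
  proof (rule Lim_null_comparison[where g = "\<lambda>h. \<bar>h\<bar> ^ (n + 1)"])
    have "norm ((max 0 (0 + h) ^ (n + 2) - max 0 0 ^ (n + 2)) / h) \<le> \<bar>h\<bar> ^ (n + 1)" for h :: real
      by (cases "h > 0") (auto simp: max_def power_add field_simps mult_nonpos_nonneg)
    then show "\<forall>\<^sub>F h in at 0. norm ((max 0 (0 + h) ^ (n + 2) - max 0 0 ^ (n + 2)) / h) \<le> \<bar>h\<bar> ^ (n + 1)"
      by (auto intro: always_eventually)
    show "((\<lambda>h::real. \<bar>h\<bar> ^ (n + 1)) \<longlongrightarrow> 0) (at 0)"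
      by (auto intro!: tendsto_eq_intros)
  qed
  then show ?thesis using True by (simp add: DERIV_def)
next
  case False
  show ?thesis
  proof (cases "x > 0")
    case True
    have "((\<lambda>x::real. x ^ (n + 2)) has_real_derivative real (n + 2) * x ^ (n + 1)) (at x)"
      by (rule derivative_eq_intros | simp)+
    then have "((\<lambda>x::real. max 0 x ^ (n + 2)) has_real_derivative real (n + 2) * x ^ (n + 1)) (at x)"
      by (rule has_field_derivative_transform_within_open[where S = "{0<..}"])
         (use True in \<open>auto simp: max_def\<close>)
    then show ?thesis using True by (simp add: max_def)
  next
    case f: False
    have "((\<lambda>x::real. 0) has_real_derivative 0) (at x)" by simp
    then have "((\<lambda>x::real. max 0 x ^ (n + 2)) has_real_derivative 0) (at x)"
      by (rule has_field_derivative_transform_within_open[where S = "{..<0}"])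
         (use f False in \<open>auto simp: max_def\<close>)
    then show ?thesis using f False by (simp add: max_def)
  qed
qed

text \<open>Each derivative lowers the exponent by one, and exponent 1 is still continuous. The case
  k = 2 supplies the cubic cutoff for integrals of Laplacians.\<close>

lemma Ck_on_pos_part_power:
  assumes "open S" "Ck_on k S f"
  shows "Ck_on k S (\<lambda>z. max 0 (f z) ^ (k + 1))"
  using assms(2)
proof (induction k)
  case 0 then show ?case by (auto intro!: continuous_intros)
next
  case (Suc k)
  have f: "f differentiable at z" if "z \<in> S" for z using Suc.prems that by auto
  note der = DERIV_pos_part_power[of k "f z" for z]
  have "Ck_on k S (pd v (\<lambda>z. max 0 (f z) ^ (k + 2)))" if "Ck_on k S (pd v f)" for v
  proof (rule Ck_on_cong[OF assms(1)])
    show "Ck_on k S (\<lambda>z. (real (k+2) * max 0 (f z) ^ (k+1)) * pd v f z)"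
      using Suc assms by (intro Ck_on_mult that Ck_on_const Suc.IH) (auto intro: Ck_on_Suc_imp)
    show "(real (k+2) * max 0 (f z) ^ (k+1)) * pd v f z = pd v (\<lambda>z. max 0 (f z) ^ (k + 2)) z"
      if "z \<in> S" for z
      using pd_compose(1)[where e = "\<lambda>x. max 0 x ^ (k+2)", OF f[OF that] der] by simp
  qed
  then show ?case using Suc.prems pd_compose(2)[where e = "\<lambda>x. max 0 x ^ (k+2)", OF f der] by auto
qed

section \<open>Laplacians and gradients of functions built from holomorphic maps\<close>

lemma
  assumes "(G has_field_derivative G') (at z)"
  shows has_derivative_Re_field: "((\<lambda>z. Re (G z)) has_derivative (\<lambda>h. Re (G' * h))) (at z)"
    and has_derivative_Im_field: "((\<lambda>z. Im (G z)) has_derivative (\<lambda>h. Im (G' * h))) (at z)"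
  using assms unfolding has_field_derivative_def
  by (blast intro: has_derivative_Re has_derivative_Im)+

lemma
  assumes "G holomorphic_on S" "open S" "z \<in> S"
  shows pd_Re: "pd v (\<lambda>z. Re (G z)) z = Re (deriv G z * v)"
    and pd_Im: "pd v (\<lambda>z. Im (G z)) z = Im (deriv G z * v)"
    and differentiable_Re: "(\<lambda>z. Re (G z)) differentiable at z"
    and differentiable_Im: "(\<lambda>z. Im (G z)) differentiable at z"
  using pd_has_derivative[OF has_derivative_Re_field] pd_has_derivative[OF has_derivative_Im_field]
    holomorphic_derivI[OF assms] has_derivative_Re_field has_derivative_Im_field
  unfolding differentiable_def by blast+

text \<open>The derivative of Re G in direction v is the real part of \<open>deriv G z * v\<close>,
  so partial derivatives stay within real and imaginary parts of holomorphic functions and the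
  induction closes.\<close>

lemma Ck_on_holomorphic:
  assumes "open S" "G holomorphic_on S"
  shows "Ck_on k S (\<lambda>z. Re (G z)) \<and> Ck_on k S (\<lambda>z. Im (G z))"
  using assms(2)
proof (induction k arbitrary: G)
  case 0 then show ?case by (auto intro!: continuous_intros holomorphic_on_imp_continuous_on)
next
  case (Suc k)
  have "Ck_on k S (pd v (\<lambda>z. Re (G z)))" "Ck_on k S (pd v (\<lambda>z. Im (G z)))" for v
  proof -
    have "(\<lambda>z. deriv G z * v) holomorphic_on S"
      using Suc.prems assms(1) by (auto intro!: holomorphic_intros)
    note * = Suc.IH[OF this]
    show "Ck_on k S (pd v (\<lambda>z. Re (G z)))"
      by (rule Ck_on_cong[OF assms(1) _ conjunct1[OF *]]) (use pd_Re Suc.prems assms(1) in auto)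
    show "Ck_on k S (pd v (\<lambda>z. Im (G z)))"
      by (rule Ck_on_cong[OF assms(1) _ conjunct2[OF *]]) (use pd_Im Suc.prems assms(1) in auto)
  qed
  then show ?case using differentiable_Re differentiable_Im Suc.prems assms(1) by auto
qed

text \<open>Opposite in sign to \<open>laplacian\<close> and free of the metric: its integral
  against dx dy is minus that of \<open>laplacian\<close> against the area element.\<close>

definition flat_laplacian :: "(complex \<Rightarrow> real) \<Rightarrow> complex \<Rightarrow> real" where
  "flat_laplacian f z = pd 1 (pd 1 f) z + pd \<i> (pd \<i> f) z"

definition grad_sq :: "(complex \<Rightarrow> real) \<Rightarrow> complex \<Rightarrow> real" where
  "grad_sq f z = (pd 1 f z)\<^sup>2 + (pd \<i> f z)\<^sup>2"

lemma flat_laplacian_cong: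
  assumes "open S" "z \<in> S" "\<And>w. w \<in> S \<Longrightarrow> f w = h w"
  shows "flat_laplacian f z = flat_laplacian h z"
  unfolding flat_laplacian_def
  by (intro arg_cong2[where f = "(+)"] pd_cong_open[OF assms(1,2)]) (use pd_cong_open[OF assms(1)] assms(3) in blast)+

lemma flat_laplacian_add:
  assumes "open S" "z \<in> S" "Ck_on 2 S f" "Ck_on 2 S h"
  shows "flat_laplacian (\<lambda>z. f z + h z) z = flat_laplacian f z + flat_laplacian h z"
proof -
  have "pd v (pd v (\<lambda>z. f z + h z)) z = pd v (pd v f) z + pd v (pd v h) z" if "v \<in> {1, \<i>}" for v
  proof -
    have "pd v (pd v (\<lambda>z. f z + h z)) z = pd v (\<lambda>z. pd v f z + pd v h z) z"
      by (rule pd_cong_open[OF assms(1,2)]) (use assms in \<open>auto simp: numeral_2_eq_2 pd_add\<close>)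
    also have "\<dots> = pd v (pd v f) z + pd v (pd v h) z"
      by (rule pd_add) (use assms that in \<open>auto simp: numeral_2_eq_2\<close>)
    finally show ?thesis .
  qed
  then show ?thesis by (simp add: flat_laplacian_def)
qed

lemma flat_laplacian_compose:
  assumes "open S" "z \<in> S" "Ck_on 2 S f"
    and "\<And>w. w \<in> S \<Longrightarrow> (e has_real_derivative e1 (f w)) (at (f w))"
    and "(e1 has_real_derivative e2) (at (f z))"
  shows "flat_laplacian (\<lambda>z. e (f z)) z = e2 * grad_sq f z + e1 (f z) * flat_laplacian f z"
proof -
  have "pd v (pd v (\<lambda>z. e (f z))) z = e2 * (pd v f z)\<^sup>2 + e1 (f z) * pd v (pd v f) z"
    if "v \<in> {1, \<i>}" for v
  proof -
    have "pd v (pd v (\<lambda>z. e (f z))) z = pd v (\<lambda>z. e1 (f z) * pd v f z) z"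
      by (rule pd_cong_open[OF assms(1,2)])
         (use assms in \<open>auto simp: numeral_2_eq_2 intro!: pd_compose(1)\<close>)
    also have "\<dots> = (e2 * pd v f z) * pd v f z + e1 (f z) * pd v (pd v f) z"
      using pd_compose[where f = f and e = e1, OF _ assms(5)] assms(2,3) that
      by (subst pd_mult) (auto simp: numeral_2_eq_2)
    finally show ?thesis by (simp add: power2_eq_square)
  qed
  then show ?thesis by (simp add: flat_laplacian_def grad_sq_def algebra_simps)
qed

lemma grad_sq_compose:
  assumes "f differentiable (at z)" "(e has_real_derivative d) (at (f z))"
  shows "grad_sq (\<lambda>z. e (f z)) z = d\<^sup>2 * grad_sq f z"
  by (simp add: grad_sq_def pd_compose(1)[OF assms] power_mult_distrib algebra_simps)

lemma flat_laplacian_mult: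
  assumes "open S" "z \<in> S" "Ck_on 2 S f" "Ck_on 2 S h"
  shows "flat_laplacian (\<lambda>z. f z * h z) z = flat_laplacian f z * h z + f z * flat_laplacian h z
     + 2 * (pd 1 f z * pd 1 h z + pd \<i> f z * pd \<i> h z)"
proof -
  have "pd v (pd v (\<lambda>z. f z * h z)) z = pd v (pd v f) z * h z + f z * pd v (pd v h) z
      + 2 * (pd v f z * pd v h z)" if "v \<in> {1, \<i>}" for v
  proof -
    have d: "f differentiable at w" "h differentiable at w" if "w \<in> S" for w
      using assms that by (auto simp: numeral_2_eq_2)
    have d': "pd v f differentiable at z" "pd v h differentiable at z"
      using assms that by (auto simp: numeral_2_eq_2)
    have "pd v (pd v (\<lambda>z. f z * h z)) z = pd v (\<lambda>z. pd v f z * h z + f z * pd v h z) z"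
      by (rule pd_cong_open[OF assms(1,2)]) (use d in \<open>simp add: pd_mult\<close>)
    also have "\<dots> = pd v (\<lambda>z. pd v f z * h z) z + pd v (\<lambda>z. f z * pd v h z) z"
      by (rule pd_add) (use d d' assms(2) in \<open>auto intro!: differentiable_mult\<close>)
    finally show ?thesis using d d' assms(2) by (simp add: pd_mult)
  qed
  then show ?thesis by (simp add: flat_laplacian_def algebra_simps)
qed

text \<open>The second derivative in direction v is the real or imaginary part of
  \<open>deriv (deriv G) z * v * v\<close>, and the squares of 1 and \<i> have sum 0.\<close>

lemma
  assumes "open S" "z \<in> S" "G holomorphic_on S"
  shows flat_laplacian_Re: "flat_laplacian (\<lambda>z. Re (G z)) z = 0"
    and flat_laplacian_Im: "flat_laplacian (\<lambda>z. Im (G z)) z = 0"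
proof -
  have h: "(\<lambda>z. deriv G z * v) holomorphic_on S" for v
    using assms by (auto intro!: holomorphic_intros)
  have "deriv (\<lambda>z. deriv G z * v) z = deriv (deriv G) z * v" for v
    using holomorphic_deriv[OF assms(3,1)] assms
    by (subst deriv_mult) (auto simp: holomorphic_on_imp_differentiable_at)
  then have "pd v (pd v (\<lambda>z. Re (G z))) z = Re (deriv (deriv G) z * v * v)"
    "pd v (pd v (\<lambda>z. Im (G z))) z = Im (deriv (deriv G) z * v * v)" for v
    using pd_cong_open[OF assms(1,2), of "pd v (\<lambda>z. Re (G z))" "\<lambda>z. Re (deriv G z * v)" v]
      pd_cong_open[OF assms(1,2), of "pd v (\<lambda>z. Im (G z))" "\<lambda>z. Im (deriv G z * v)" v]
      pd_Re[OF assms(3,1)] pd_Im[OF assms(3,1)] pd_Re[OF h assms(1,2)] pd_Im[OF h assms(1,2)] by auto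
  then show "flat_laplacian (\<lambda>z. Re (G z)) z = 0" "flat_laplacian (\<lambda>z. Im (G z)) z = 0"
    by (simp_all add: flat_laplacian_def)
qed

lemma Ck_on_norm_sq:
  assumes "open S" "G holomorphic_on S"
  shows "Ck_on k S (\<lambda>z. (norm (G z))\<^sup>2)"
  unfolding cmod_power2 using Ck_on_holomorphic[OF assms]
  by (intro Ck_on_add Ck_on_power assms) auto

lemma
  assumes "open S" "z \<in> S" "G holomorphic_on S"
  shows flat_laplacian_norm_sq: "flat_laplacian (\<lambda>z. (norm (G z))\<^sup>2) z = 4 * (norm (deriv G z))\<^sup>2"
    and grad_sq_norm_sq: "grad_sq (\<lambda>z. (norm (G z))\<^sup>2) z = 4 * (norm (G z))\<^sup>2 * (norm (deriv G z))\<^sup>2"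
proof -
  have C: "Ck_on 2 S (\<lambda>z. Re (G z))" "Ck_on 2 S (\<lambda>z. Im (G z))"
    using Ck_on_holomorphic[OF assms(1,3)] by auto
  have d: "(\<lambda>z. Re (G z)) differentiable at z" "(\<lambda>z. Im (G z)) differentiable at z"
    using differentiable_Re[OF assms(3,1,2)] differentiable_Im[OF assms(3,1,2)] .
  have pds: "pd 1 (\<lambda>z. Re (G z)) z = Re (deriv G z)" "pd \<i> (\<lambda>z. Re (G z)) z = - Im (deriv G z)"
    "pd 1 (\<lambda>z. Im (G z)) z = Im (deriv G z)" "pd \<i> (\<lambda>z. Im (G z)) z = Re (deriv G z)"
    using pd_Re[OF assms(3,1,2)] pd_Im[OF assms(3,1,2)] by auto
  have eq: "(\<lambda>z. (norm (G z))\<^sup>2) = (\<lambda>z. Re (G z) * Re (G z) + Im (G z) * Im (G z))"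
    by (simp add: cmod_power2 flip: power2_eq_square)
  have n2: "4 * (norm (deriv G z))\<^sup>2 = 4 * (Im (deriv G z) * Im (deriv G z)) + 4 * (Re (deriv G z) * Re (deriv G z))"
    by (simp add: cmod_power2 algebra_simps flip: power2_eq_square)
  show "flat_laplacian (\<lambda>z. (norm (G z))\<^sup>2) z = 4 * (norm (deriv G z))\<^sup>2"
    unfolding eq n2
    by (subst flat_laplacian_add[OF assms(1,2)])
       (use C assms in \<open>auto intro!: Ck_on_mult simp: flat_laplacian_mult[OF assms(1,2)] pds
         flat_laplacian_Re flat_laplacian_Im\<close>)
  have "pd v (\<lambda>z. (norm (G z))\<^sup>2) z = 2 * (Re (G z) * pd v (\<lambda>z. Re (G z)) z + Im (G z) * pd v (\<lambda>z. Im (G z)) z)" for v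
    unfolding eq using d by (subst pd_add) (auto intro!: differentiable_mult simp: pd_mult)
  note g = this
  show "grad_sq (\<lambda>z. (norm (G z))\<^sup>2) z = 4 * (norm (G z))\<^sup>2 * (norm (deriv G z))\<^sup>2"
    unfolding grad_sq_def g pds unfolding cmod_power2 by (simp add: power2_eq_square algebra_simps)
qed

lemma grad_sq_add_const: "grad_sq (\<lambda>z. c + f z) z = grad_sq f z"
proof (cases "f differentiable at z")
  case True then show ?thesis by (simp add: grad_sq_def pd_add)
next
  case False
  have "((\<lambda>z. c + f z) has_derivative D) (at z) \<longleftrightarrow> (f has_derivative D) (at z)" for D
    using has_derivative_add[of "\<lambda>z. c + f z" D "at z" "\<lambda>_. - c" "\<lambda>_. 0"]
      has_derivative_add[of f D "at z" "\<lambda>_. c" "\<lambda>_. 0"] by (auto simp: add.commute)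
  then show ?thesis by (simp add: grad_sq_def pd_def frechet_derivative_def)
qed

text \<open>ln (1 + |w|^2) is the potential of the round metric on the sphere, so its Laplacian
  after composition with G is the density of the spherical area pulled back by G. The height
  function and the Gauss curvature are both computed from it.\<close>

lemma
  assumes "open S" "G holomorphic_on S"
  shows Ck_on_ln_norm_sq_add1: "Ck_on k S (\<lambda>z. ln (1 + (norm (G z))\<^sup>2))"
    and flat_laplacian_ln_norm_sq_add1: "z \<in> S \<Longrightarrow> flat_laplacian (\<lambda>z. ln (1 + (norm (G z))\<^sup>2)) z
      = 4 * (norm (deriv G z))\<^sup>2 / (1 + (norm (G z))\<^sup>2)\<^sup>2"
    and grad_sq_ln_norm_sq_add1: "z \<in> S \<Longrightarrow> grad_sq (\<lambda>z. ln (1 + (norm (G z))\<^sup>2)) z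
      = 4 * (norm (G z))\<^sup>2 * (norm (deriv G z))\<^sup>2 / (1 + (norm (G z))\<^sup>2)\<^sup>2"
proof -
  have pos: "1 + (norm (G z))\<^sup>2 > 0" for z by (simp add: add_pos_nonneg)
  note N = Ck_on_norm_sq[OF assms]
  have N1: "Ck_on k S (\<lambda>z. 1 + (norm (G z))\<^sup>2)" for k
    by (intro Ck_on_add N assms Ck_on_const)
  show "Ck_on k S (\<lambda>z. ln (1 + (norm (G z))\<^sup>2))"
    by (rule Ck_on_ln[OF assms(1) pos N1])
  assume z: "z \<in> S"
  note L = flat_laplacian_norm_sq[OF assms(1) z assms(2)] grad_sq_norm_sq[OF assms(1) z assms(2)]
  have d: "(ln has_real_derivative inverse x) (at x)" if "x > 0" for x :: real
    using DERIV_ln[OF that] .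
  have d2: "(inverse has_real_derivative - (inverse (x^2))) (at x)" if "x > 0" for x :: real
    using DERIV_inverse[of x] that by (simp add: power_inverse numeral_2_eq_2)
  have "flat_laplacian (\<lambda>z. 1 + (norm (G z))\<^sup>2) z = 4 * (norm (deriv G z))\<^sup>2"
    by (subst flat_laplacian_add[OF assms(1) z Ck_on_const N])
       (simp add: L, simp add: flat_laplacian_def)
  moreover have "grad_sq (\<lambda>z. 1 + (norm (G z))\<^sup>2) z = 4 * (norm (G z))\<^sup>2 * (norm (deriv G z))\<^sup>2"
    by (simp add: grad_sq_add_const L)
  moreover have "flat_laplacian (\<lambda>z. ln (1 + (norm (G z))\<^sup>2)) z = - inverse ((1 + (norm (G z))\<^sup>2)\<^sup>2) * grad_sq (\<lambda>z. 1 + (norm (G z))\<^sup>2) z + inverse (1 + (norm (G z))\<^sup>2) * flat_laplacian (\<lambda>z. 1 + (norm (G z))\<^sup>2) z"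
    by (rule flat_laplacian_compose[OF assms(1) z N1]) (auto intro!: d d2 pos)
  ultimately show "flat_laplacian (\<lambda>z. ln (1 + (norm (G z))\<^sup>2)) z
      = 4 * (norm (deriv G z))\<^sup>2 / (1 + (norm (G z))\<^sup>2)\<^sup>2"
    using pos[of z] by (simp add: divide_simps power2_eq_square) (simp add: algebra_simps)
  have "(\<lambda>z. 1 + (norm (G z))\<^sup>2) differentiable at z"
    using N1[of 1] z by simp
  note g = grad_sq_compose[where e = ln, OF this d[OF pos]]
  show "grad_sq (\<lambda>z. ln (1 + (norm (G z))\<^sup>2)) z
      = 4 * (norm (G z))\<^sup>2 * (norm (deriv G z))\<^sup>2 / (1 + (norm (G z))\<^sup>2)\<^sup>2"
    unfolding g grad_sq_add_const L by (simp add: power_divide inverse_eq_divide)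
qed

lemma
  assumes "open S" "G holomorphic_on S" "\<And>z. z \<in> S \<Longrightarrow> G z \<noteq> 0"
  shows Ck_on_ln_norm_sq: "Ck_on k S (\<lambda>z. ln ((norm (G z))\<^sup>2))"
    and flat_laplacian_ln_norm_sq: "z \<in> S \<Longrightarrow> flat_laplacian (\<lambda>z. ln ((norm (G z))\<^sup>2)) z = 0"
proof -
  have pos: "(norm (G z))\<^sup>2 > 0" if "z \<in> S" for z using assms(3)[OF that] by simp
  note N = Ck_on_norm_sq[OF assms(1,2)]
  show "Ck_on k S (\<lambda>z. ln ((norm (G z))\<^sup>2))"
    by (rule Ck_on_ln[OF assms(1) pos N])
  assume z: "z \<in> S"
  note L = flat_laplacian_norm_sq[OF assms(1) z assms(2)] grad_sq_norm_sq[OF assms(1) z assms(2)]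
  have d: "(ln has_real_derivative inverse x) (at x)" if "x > 0" for x :: real
    using DERIV_ln[OF that] .
  have d2: "(inverse has_real_derivative - (inverse (x^2))) (at x)" if "x > 0" for x :: real
    using DERIV_inverse[of x] that by (simp add: power_inverse numeral_2_eq_2)
  have "flat_laplacian (\<lambda>z. ln ((norm (G z))\<^sup>2)) z = - inverse (((norm (G z))\<^sup>2)\<^sup>2) * grad_sq (\<lambda>z. (norm (G z))\<^sup>2) z + inverse ((norm (G z))\<^sup>2) * flat_laplacian (\<lambda>z. (norm (G z))\<^sup>2) z"
    by (rule flat_laplacian_compose[OF assms(1) z N]) (rule d d2 pos z | assumption)+
  then show "flat_laplacian (\<lambda>z. ln ((norm (G z))\<^sup>2)) z = 0"
    unfolding L using assms(3)[OF z] by (simp add: divide_simps power2_eq_square)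
qed

section \<open>Changes of variables\<close>

text \<open>The theorem on change of variables is about \<open>real^'n\<close>; this identification
  carries it over to the complex plane.\<close>

lemma lborel_complex_vec2:
  "distr lborel borel (\<lambda>x :: real^2. Complex (x $ 1) (x $ 2)) = (lborel :: complex measure)"
proof (rule lborel_eqI[symmetric])
  fix l u :: complex
  assume lu: "\<And>b. b \<in> Basis \<Longrightarrow> l \<bullet> b \<le> u \<bullet> b"
  have [measurable]: "(\<lambda>x :: real^2. Complex (x $ 1) (x $ 2)) \<in> borel_measurable borel"
    unfolding Complex_eq by measurable
  have le: "Re l \<le> Re u" "Im l \<le> Im u"
    using lu[of 1] lu[of \<i>] by (auto simp: Basis_complex_def)
  define L U :: "real^2" where "L = vector [Re l, Im l]" and "U = vector [Re u, Im u]"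
  have "(\<lambda>x :: real^2. Complex (x $ 1) (x $ 2)) -` box l u = box L U"
    by (auto simp: L_def U_def mem_box_cart forall_2 in_box_complex_iff)
  then have "emeasure (distr lborel borel (\<lambda>x :: real^2. Complex (x $ 1) (x $ 2))) (box l u)
     = emeasure lborel (box L U)"
    by (subst emeasure_distr) auto
  also have "\<dots> = (\<Prod>b\<in>Basis. (U - L) \<bullet> b)"
  proof (rule emeasure_lborel_box)
    have "\<forall>i. L $ i \<le> U $ i" using le by (simp add: forall_2 L_def U_def)
    then show "L \<bullet> b \<le> U \<bullet> b" if "b \<in> Basis" for b
      using that by (auto simp: Basis_vec_def inner_axis)
  qed
  also have "(\<Prod>b\<in>Basis. (U - L) \<bullet> b) = (\<Prod>i\<in>UNIV. (U - L) $ i)"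
  proof -
    have "(\<Prod>b\<in>(\<lambda>i :: 2. axis i (1 :: real)) ` UNIV. (U - L) \<bullet> b) = (\<Prod>i\<in>UNIV. (U - L) $ i)"
      by (subst prod.reindex) (auto simp: inj_on_def axis_eq_axis inner_axis)
    moreover have "(\<lambda>i :: 2. axis i (1 :: real)) ` UNIV = Basis" by (auto simp: Basis_vec_def)
    ultimately show ?thesis by metis
  qed
  also have "\<dots> = (\<Prod>b\<in>Basis. (u - l) \<bullet> b)"
    by (simp add: UNIV_2 Basis_complex_def L_def U_def complex_eq_iff)
  finally show "emeasure (distr lborel borel (\<lambda>x :: real^2. Complex (x $ 1) (x $ 2))) (box l u)
     = (\<Prod>b\<in>Basis. (u - l) \<bullet> b)" .
qed auto

text \<open>The product form of the plane, for Fubini's theorem in Cartesian coordinates.\<close>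

lemma lborel_complex_pair:
  "distr (lborel \<Otimes>\<^sub>M lborel) borel (\<lambda>(x, y). Complex x y) = (lborel :: complex measure)"
proof (rule lborel_eqI[symmetric])
  fix l u :: complex
  assume lu: "\<And>b. b \<in> Basis \<Longrightarrow> l \<bullet> b \<le> u \<bullet> b"
  have [measurable]: "(\<lambda>(x, y). Complex x y) \<in> borel_measurable (lborel \<Otimes>\<^sub>M lborel)"
    unfolding Complex_eq by measurable
  have le: "Re l \<le> Re u" "Im l \<le> Im u"
    using lu[of 1] lu[of \<i>] by (auto simp: Basis_complex_def)
  have "(\<lambda>(x, y). Complex x y) -` box l u = {Re l<..<Re u} \<times> {Im l<..<Im u}"
    by (auto simp: in_box_complex_iff)
  then have "emeasure (distr (lborel \<Otimes>\<^sub>M lborel) borel (\<lambda>(x, y). Complex x y)) (box l u)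
     = emeasure (lborel \<Otimes>\<^sub>M lborel) ({Re l<..<Re u} \<times> {Im l<..<Im u})"
    by (subst emeasure_distr) (auto simp: space_pair_measure)
  also have "\<dots> = ennreal (Re u - Re l) * ennreal (Im u - Im l)"
    using le by (subst lborel.emeasure_pair_measure_Times) auto
  also have "\<dots> = (\<Prod>b\<in>Basis. (u - l) \<bullet> b)"
    using le by (simp add: Basis_complex_def ennreal_mult complex_eq_iff)
  finally show "emeasure (distr (lborel \<Otimes>\<^sub>M lborel) borel (\<lambda>(x, y). Complex x y)) (box l u)
     = (\<Prod>b\<in>Basis. (u - l) \<bullet> b)" .
qed auto

text \<open>The Jacobian determinant of a holomorphic map is \<open>(norm (deriv f z))\<^sup>2\<close>.\<close>

lemma holomorphic_change_of_variables:
  fixes h :: "complex \<Rightarrow> real"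
  assumes S: "open S" and f: "f holomorphic_on S" and inj: "inj_on f S" and h: "continuous_on (f ` S) h"
  shows "((\<lambda>z. (norm (deriv f z))\<^sup>2 * h (f z)) absolutely_integrable_on S \<and>
      integral S (\<lambda>z. (norm (deriv f z))\<^sup>2 * h (f z)) = b) \<longleftrightarrow>
    h absolutely_integrable_on f ` S \<and> integral (f ` S) h = b"
proof -
  define T :: "real^2 \<Rightarrow> complex" where "T x = Complex (x $ 1) (x $ 2)" for x
  define T' :: "complex \<Rightarrow> real^2" where "T' z = vector [Re z, Im z]" for z
  have TT' [simp]: "T (T' z) = z" "T' (T x) = x" for z x
    by (auto simp: T_def T'_def complex_eq_iff vec_eq_iff forall_2)
  have linT: "bounded_linear T" "bounded_linear T'"
    unfolding linear_conv_bounded_linear[symmetric]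
    by (auto intro!: linearI simp: T_def T'_def complex_eq_iff vec_eq_iff forall_2)
  have T_meas [measurable]: "T \<in> borel_measurable borel"
    by (intro borel_measurable_continuous_onI linear_continuous_on linT)
  \<comment> \<open>The theorem to be transferred is for functions with values in
    \<open>real^'n\<close> as well, hence the passage to \<open>real^1\<close>.\<close>
  have transfer: "F absolutely_integrable_on A \<and> integral A F = b \<longleftrightarrow>
      (\<lambda>x. (\<chi> i. F (T x)) :: real^1) absolutely_integrable_on (T' ` A) \<and>
      integral (T' ` A) (\<lambda>x. (\<chi> i. F (T x)) :: real^1) = (\<chi> i. b)"
    if A: "open A" and F: "continuous_on A F" for A and F :: "complex \<Rightarrow> real"
  proof -
    have m: "(\<lambda>z. indicator A z *\<^sub>R F z) \<in> borel_measurable borel"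
      using borel_measurable_continuous_on_indicator[OF _ F] A by auto
    have TA: "T' ` A = T -` A" by (auto simp: image_iff) (metis TT'(2))
    have ind: "indicator (T' ` A) x = (indicator A (T x) :: real)" for x
      by (auto simp: TA indicator_def)
    have m2: "(\<lambda>x. indicator (T' ` A) x *\<^sub>R F (T x)) \<in> borel_measurable borel"
      unfolding ind using measurable_compose[OF T_meas m] by simp
    have i1: "F absolutely_integrable_on A \<longleftrightarrow> integrable lborel (\<lambda>z. indicator A z *\<^sub>R F z)"
      using m by (simp add: set_integrable_def integrable_completion)
    also have "\<dots> \<longleftrightarrow> integrable (distr lborel borel T) (\<lambda>z. indicator A z *\<^sub>R F z)"
      by (simp add: lborel_complex_vec2 T_def[abs_def])
    also have "\<dots> \<longleftrightarrow> integrable lborel (\<lambda>x. indicator (T' ` A) x *\<^sub>R F (T x))"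
      using m by (subst integrable_distr_eq) (auto simp: ind)
    also have i2: "\<dots> \<longleftrightarrow> (\<lambda>x. F (T x)) absolutely_integrable_on (T' ` A)"
      using m2 by (simp add: set_integrable_def integrable_completion)
    finally have ai: "F absolutely_integrable_on A \<longleftrightarrow> (\<lambda>x. F (T x)) absolutely_integrable_on (T' ` A)" .
    have int: "integral A F = integral (T' ` A) (\<lambda>x. F (T x))" if "F absolutely_integrable_on A"
    proof -
      have "integral A F = (\<integral>z. indicator A z *\<^sub>R F z \<partial>lborel)"
        using set_lebesgue_integral_eq_integral(2)[OF that] m
        by (simp add: set_lebesgue_integral_def integral_completion)
      also have "\<dots> = (\<integral>z. indicator A z *\<^sub>R F z \<partial>distr lborel borel T)"
        by (simp add: lborel_complex_vec2 T_def[abs_def])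
      also have "\<dots> = (\<integral>x. indicator (T' ` A) x *\<^sub>R F (T x) \<partial>lborel)"
        using m by (subst integral_distr) (auto simp: ind)
      also have "\<dots> = integral (T' ` A) (\<lambda>x. F (T x))"
        using set_lebesgue_integral_eq_integral(2)[OF that[unfolded ai]] m2
        by (simp add: set_lebesgue_integral_def integral_completion)
      finally show ?thesis .
    qed
    have comp: "(\<lambda>x. F (T x)) absolutely_integrable_on (T' ` A) \<longleftrightarrow>
        (\<lambda>x. (\<chi> i. F (T x)) :: real^1) absolutely_integrable_on (T' ` A)"
      by (subst (2) absolutely_integrable_componentwise_iff)
         (auto simp: Basis_vec_def inner_axis)
    have "integral (T' ` A) (\<lambda>x. (\<chi> i. F (T x)) :: real^1) $ i = integral (T' ` A) (\<lambda>x. F (T x))"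
      if "(\<lambda>x. (\<chi> i. F (T x)) :: real^1) absolutely_integrable_on (T' ` A)" for i
      using integral_component_eq_cart[OF set_lebesgue_integral_eq_integral(1)[OF that], of i] by simp
    then show ?thesis using ai int comp by (auto simp: vec_eq_iff)
  qed
  have der: "((T' \<circ> f \<circ> T) has_derivative (T' \<circ> (\<lambda>h. deriv f (T x) * h) \<circ> T)) (at x within T' ` S)"
    if "x \<in> T' ` S" for x
  proof -
    have "T x \<in> S" using that by auto
    then have "(f has_derivative (\<lambda>h. deriv f (T x) * h)) (at (T x))"
      using holomorphic_derivI[OF f S] by (simp add: has_field_derivative_def)
    then have "(f \<circ> T has_derivative (\<lambda>h. deriv f (T x) * h) \<circ> T) (at x)"
      by (rule diff_chain_at[OF bounded_linear_imp_has_derivative[OF linT(1)]])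
    then have "(T' \<circ> (f \<circ> T) has_derivative T' \<circ> ((\<lambda>h. deriv f (T x) * h) \<circ> T)) (at x)"
      by (rule diff_chain_at[OF _ bounded_linear_imp_has_derivative[OF linT(2)]])
    then show ?thesis by (simp add: o_assoc has_derivative_at_withinI)
  qed
  have det: "\<bar>det (matrix (T' \<circ> (\<lambda>h. c * h) \<circ> T))\<bar> = (norm c)\<^sup>2" for c
  proof -
    have "det (matrix (T' \<circ> (\<lambda>h. c * h) \<circ> T)) = (Re c)\<^sup>2 + (Im c)\<^sup>2"
      by (simp add: det_2 matrix_def T_def T'_def axis_def power2_eq_square)
    then show ?thesis by (simp add: cmod_power2)
  qed
  have inj': "inj_on (T' \<circ> f \<circ> T) (T' ` S)"
    using inj by (auto simp: inj_on_def) (metis TT'(1))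
  have oS: "open (T' ` S)"
  proof -
    have "T' ` S = T -` S" by (auto simp: image_iff) (metis TT'(2))
    then show ?thesis using open_vimage[OF S linear_continuous_on[OF linT(1)]] by simp
  qed
  have im: "(T' \<circ> f \<circ> T) ` (T' ` S) = T' ` f ` S" by (auto simp: image_iff)
  have of: "open (f ` S)" using open_mapping_thm3[OF f S inj] .
  have df: "continuous_on S (\<lambda>z. (norm (deriv f z))\<^sup>2 * h (f z))"
    using holomorphic_deriv[OF f S] f h
    by (intro continuous_intros holomorphic_on_imp_continuous_on continuous_on_compose2[OF h]) auto
  have "(\<lambda>x. \<bar>det (matrix (T' \<circ> (\<lambda>h. deriv f (T x) * h) \<circ> T))\<bar> *\<^sub>R ((\<chi> i. h (T ((T' \<circ> f \<circ> T) x))) :: real^1))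
     = (\<lambda>x. (\<chi> i. (norm (deriv f (T x)))\<^sup>2 * h (f (T x))))"
    unfolding det by (simp add: vec_eq_iff fun_eq_iff)
  with has_absolute_integral_change_of_variables[OF _ der inj', of "\<lambda>x. (\<chi> i. h (T x)) :: real^1" "\<chi> i. b"]
  show ?thesis
    using oS by (simp only: transfer[OF S df] transfer[OF of h] im) auto
qed

lemma integral_complex_iterated:
  fixes h :: "complex \<Rightarrow> real"
  assumes "integrable lborel h"
  shows "integrable lborel (\<lambda>x. \<integral>y. h (Complex x y) \<partial>lborel)"
    and "(\<integral>z. h z \<partial>lborel) = (\<integral>x. (\<integral>y. h (Complex x y) \<partial>lborel) \<partial>lborel)"
    and "AE x in lborel. integrable lborel (\<lambda>y. h (Complex x y))"
proof -
  have [measurable]: "(\<lambda>(x, y). Complex x y) \<in> borel_measurable (lborel \<Otimes>\<^sub>M lborel)"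
    unfolding Complex_eq by measurable
  have hm [measurable]: "h \<in> borel_measurable borel" using assms by auto
  have "integrable (lborel \<Otimes>\<^sub>M lborel) (\<lambda>p. h (case p of (x, y) \<Rightarrow> Complex x y))"
    using assms unfolding lborel_complex_pair[symmetric]
    by (subst (asm) integrable_distr_eq) auto
  then have i: "integrable (lborel \<Otimes>\<^sub>M lborel) (\<lambda>(x, y). h (Complex x y))"
    by (simp add: case_prod_unfold)
  show "integrable lborel (\<lambda>x. \<integral>y. h (Complex x y) \<partial>lborel)"
    using lborel_pair.integrable_fst'[OF i] by simp
  show "AE x in lborel. integrable lborel (\<lambda>y. h (Complex x y))"
    using lborel_pair.AE_integrable_fst'[OF i] by simp
  have "(\<integral>z. h z \<partial>lborel) = (\<integral>p. h (case p of (x, y) \<Rightarrow> Complex x y) \<partial>(lborel \<Otimes>\<^sub>M lborel))"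
    unfolding lborel_complex_pair[symmetric] by (subst integral_distr) auto
  also have "\<dots> = (\<integral>x. (\<integral>y. h (Complex x y) \<partial>lborel) \<partial>lborel)"
    using lborel_pair.integral_fst'[OF i] by (simp add: case_prod_unfold)
  finally show "(\<integral>z. h z \<partial>lborel) = (\<integral>x. (\<integral>y. h (Complex x y) \<partial>lborel) \<partial>lborel)" .
qed

lemma absolutely_integrable_on_lborel:
  fixes f :: "complex \<Rightarrow> real"
  assumes "continuous_on S f" "S \<in> sets borel"
  shows "f absolutely_integrable_on S \<longleftrightarrow> integrable lborel (\<lambda>z. indicator S z * f z)"
    and "f absolutely_integrable_on S \<Longrightarrow> integral S f = (\<integral>z. indicator S z * f z \<partial>lborel)"
proof -
  have m: "(\<lambda>z. indicator S z * f z) \<in> borel_measurable lborel"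
    using borel_measurable_continuous_on_indicator[OF assms(2,1)] by simp
  show "f absolutely_integrable_on S \<longleftrightarrow> integrable lborel (\<lambda>z. indicator S z * f z)"
    using m by (simp add: set_integrable_def integrable_completion)
  show "integral S f = (\<integral>z. indicator S z * f z \<partial>lborel)" if "f absolutely_integrable_on S"
    using set_lebesgue_integral_eq_integral(2)[OF that] m
    by (simp add: set_lebesgue_integral_def integral_completion)
qed

text \<open>The map w -> c + exp w carries a rectangle of height 2 pi injectively onto the annulus
  up to a ray, and turns a radial function into a function of Re w alone. A primitive \<Psi> of r
  f(r) then gives the integral in closed form.\<close>

lemma polar_integral:
  fixes f \<Psi> :: "real \<Rightarrow> real" and c :: complex
  assumes ab: "0 < a" "a < b" and f: "continuous_on {0<..} f"
    and \<Psi>: "\<And>r. 0 < r \<Longrightarrow> (\<Psi> has_real_derivative r * f r) (at r)"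
  shows "(\<lambda>z. f (dist c z)) absolutely_integrable_on {z. a < dist c z \<and> dist c z < b}"
    and "integral {z. a < dist c z \<and> dist c z < b} (\<lambda>z. f (dist c z)) = 2 * pi * (\<Psi> b - \<Psi> a)"
proof -
  define l u where "l = Complex (ln a) (-pi)" and "u = Complex (ln b) pi"
  define R where "R = box l u"
  define E where "E = (\<lambda>w. c + exp w)"
  define A where "A = {z. a < dist c z \<and> dist c z < b}"
  have R: "w \<in> R \<longleftrightarrow> ln a < Re w \<and> Re w < ln b \<and> - pi < Im w \<and> Im w < pi" for w
    by (auto simp: R_def l_def u_def in_box_complex_iff)
  have inj: "inj_on E R"
  proof (rule inj_onI)
    fix x y assume xy: "x \<in> R" "y \<in> R" "E x = E y"
    then obtain n :: int where n: "x = y + of_real (2 * n * pi) * \<i>"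
      by (auto simp: E_def exp_eq)
    then have "\<bar>2 * of_int n * pi\<bar> < 2 * pi" using xy(1,2) by (auto simp: R)
    then have "\<bar>real_of_int n\<bar> < 1" by (simp add: abs_mult)
    then have "n = 0" by linarith
    then show "x = y" using n by simp
  qed
  have dE: "dist c (E w) = exp (Re w)" for w
    by (simp add: E_def dist_norm)
  have EA: "E ` R \<subseteq> A"
    using ab by (auto simp: A_def dE R) (metis exp_less_cancel_iff exp_ln less_trans)+
  \<comment> \<open>Only points of argument pi are missed, by the position of the branch cut of
    \<open>Ln\<close>; they lie on a horizontal line.\<close>
  have AE: "A - E ` R \<subseteq> {z. Im z = Im c}"
  proof
    fix z assume z: "z \<in> A - E ` R"
    then have nz: "z - c \<noteq> 0" using ab by (auto simp: A_def)
    have E: "E (Ln (z - c)) = z" using nz by (simp add: E_def)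
    have "dist c z = exp (Re (Ln (z - c)))" by (metis E dE)
    then have "ln a < Re (Ln (z - c))" "Re (Ln (z - c)) < ln b"
      using z ab by (auto simp: A_def) (metis exp_ln exp_less_cancel_iff less_trans)+
    moreover have "Ln (z - c) \<notin> R" using z E by (metis DiffD2 imageI)
    ultimately have "\<not> Im (Ln (z - c)) < pi"
      using mpi_less_Im_Ln[OF nz] by (simp add: R)
    then have "Im (Ln (z - c)) = pi" using Im_Ln_le_pi[OF nz] by simp
    then show "z \<in> {z. Im z = Im c}" using nz Im_Ln_eq_pi[of "z - c"] by simp
  qed
  have negl: "negligible {z. Im z = Im c}"
    using negligible_hyperplane[of \<i> "Im c"] by (simp add: inner_complex_def)
  \<comment> \<open>One factor exp x belongs to the area r f(r) and the other to dr = exp x dx;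
    accordingly g is the derivative of \<Psi> after exp.\<close>
  define g where "g = (\<lambda>x. exp x * (exp x * f (exp x)))"
  have gc: "continuous_on X g" for X
    unfolding g_def by (intro continuous_intros continuous_on_compose2[OF f]) auto
  have holE: "E holomorphic_on R" unfolding E_def by (intro holomorphic_intros)
  have dE': "(norm (deriv E w))\<^sup>2 = exp (Re w) * exp (Re w)" for w
  proof -
    have "deriv E w = exp w" unfolding E_def
      by (rule DERIV_imp_deriv) (auto intro!: derivative_eq_intros)
    then show ?thesis by (simp add: power2_eq_square)
  qed
  have eq: "(norm (deriv E w))\<^sup>2 * f (dist c (E w)) = g (Re w)" for w
    by (simp add: dE' dE g_def)
  have cont: "continuous_on S (\<lambda>w. g (Re w))" for S
    by (intro continuous_on_compose2[OF gc[of UNIV]] continuous_intros) auto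
  have ai: "(\<lambda>w. g (Re w)) absolutely_integrable_on R"
    by (rule set_integrable_subset[OF absolutely_integrable_continuous[OF cont[of "cbox l u"]]])
       (auto simp: R_def box_subset_cbox)
  have "integral R (\<lambda>w. g (Re w)) = (\<integral>z. indicator R z * g (Re z) \<partial>lborel)"
    by (rule absolutely_integrable_on_lborel(2)[OF cont _ ai]) (simp add: R_def)
  also have "\<dots> = (\<integral>x. (\<integral>y. indicator R (Complex x y) * g x \<partial>lborel) \<partial>lborel)"
    using integral_complex_iterated(2) absolutely_integrable_on_lborel(1)[OF cont, of R] ai
    by (subst integral_complex_iterated(2)) (auto simp: R_def)
  also have "(\<lambda>x. (\<integral>y. indicator R (Complex x y) * g x \<partial>lborel)) = (\<lambda>x. 2 * pi * (indicator {ln a<..<ln b} x * g x))"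
  proof
    fix x
    have "(\<lambda>y. indicator R (Complex x y) * g x) = (\<lambda>y. (indicator {ln a<..<ln b} x * g x) * indicator {-pi<..<pi} y)"
      by (auto simp: R indicator_def fun_eq_iff)
    then show "(\<integral>y. indicator R (Complex x y) * g x \<partial>lborel) = 2 * pi * (indicator {ln a<..<ln b} x * g x)"
      by simp
  qed
  also have "(\<integral>x. 2 * pi * (indicator {ln a<..<ln b} x * g x) \<partial>lborel) = 2 * pi * (\<integral>x. indicator {ln a<..<ln b} x * g x \<partial>lborel)"
    by simp
  also have "(\<integral>x. indicator {ln a<..<ln b} x * g x \<partial>lborel) = (\<integral>x. g x * indicator {ln a..ln b} x \<partial>lborel)"
  proof (rule integral_cong_AE)
    have "AE x in lborel. x \<noteq> ln a \<and> x \<noteq> ln b"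
      by (intro AE_conjI AE_lborel_singleton)
    then show "AE x in lborel. indicator {ln a<..<ln b} x * g x = g x * indicator {ln a..ln b} x"
      by eventually_elim (auto simp: indicator_def)
  qed (use borel_measurable_continuous_onI[OF gc] in \<open>auto intro!: borel_measurable_times\<close>)
  also have "\<dots> = \<Psi> (exp (ln b)) - \<Psi> (exp (ln a))"
  proof (rule integral_FTC_Icc_real)
    show "((\<lambda>x. \<Psi> (exp x)) has_real_derivative g x) (at x)" for x
      using DERIV_chain2[OF \<Psi>[of "exp x"] DERIV_exp[of x]] by (simp add: g_def mult_ac)
    show "isCont g x" for x using gc[of UNIV] by (simp add: continuous_on_eq_continuous_at)
  qed (use ab in auto)
  finally have int: "integral R (\<lambda>w. g (Re w)) = 2 * pi * (\<Psi> b - \<Psi> a)"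
    using ab by simp
  have h: "continuous_on (E ` R) (\<lambda>z. f (dist c z))"
    by (intro continuous_intros continuous_on_compose2[OF f]) (auto simp: dE)
  from holomorphic_change_of_variables[OF _ holE inj h, of "2 * pi * (\<Psi> b - \<Psi> a)"] ai int
  have fin: "(\<lambda>z. f (dist c z)) absolutely_integrable_on (E ` R)"
    "integral (E ` R) (\<lambda>z. f (dist c z)) = 2 * pi * (\<Psi> b - \<Psi> a)"
    by (auto simp: eq R_def)
  have n: "negligible (A - E ` R)" "negligible (E ` R - A)"
    using negligible_subset[OF negl AE] EA by (auto simp: Diff_eq_empty_iff[THEN iffD2])
  have n2: "negligible {z \<in> E ` R - A. f (dist c z) \<noteq> 0}" "negligible {z \<in> A - E ` R. f (dist c z) \<noteq> 0}"
    using n by (auto intro: negligible_subset)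
  show "(\<lambda>z. f (dist c z)) absolutely_integrable_on {z. a < dist c z \<and> dist c z < b}"
    using absolutely_integrable_spike_set[OF fin(1) n2] by (simp add: A_def)
  show "integral {z. a < dist c z \<and> dist c z < b} (\<lambda>z. f (dist c z)) = 2 * pi * (\<Psi> b - \<Psi> a)"
    using integral_spike_set[OF n2] fin(2) by (simp add: A_def)
qed

text \<open>The derivative is the limit of difference quotients, whose integrals vanish by
  translation invariance of Lebesgue measure; dominated convergence passes to the limit.\<close>

lemma integral_pd_compact_support:
  assumes F: "Ck_on 1 UNIV F" and K: "compact K" and F0: "\<And>z. z \<notin> K \<Longrightarrow> F z = 0"
    and v: "v = 1 \<or> v = \<i>"
  shows "integrable lborel (pd v F)" "(\<integral>z. pd v F z \<partial>lborel) = 0"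
proof -
  have diff: "F differentiable at z" for z using F by simp
  have contp: "continuous_on UNIV (pd v F)" using F v by auto
  have pd0: "pd v F z = 0" if "z \<notin> K" for z
    using pd_cong_open[of "- K" z F "\<lambda>_. 0" v] K F0 that by (simp add: compact_imp_closed open_Compl)
  obtain B where B: "\<And>z. z \<in> K \<Longrightarrow> \<bar>pd v F z\<bar> \<le> B" "B > 0"
    using compact_imp_bounded[OF compact_continuous_image[OF continuous_on_subset[OF contp subset_UNIV] K]]
    unfolding bounded_pos by auto
  have B': "\<bar>pd v F z\<bar> \<le> B" for z
    using B pd0 by (cases "z \<in> K") auto
  have der: "((\<lambda>t. F (z + of_real t * v)) has_real_derivative pd v F (z + of_real t * v)) (at t)" for z t
  proof -
    have "(F has_derivative frechet_derivative F (at (z + of_real t * v))) (at (z + of_real t * v))"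
      using diff frechet_derivative_works by blast
    then have "((\<lambda>t. F (z + of_real t * v)) has_derivative (\<lambda>h. frechet_derivative F (at (z + of_real t * v)) (of_real h * v))) (at t)"
      by (rule has_derivative_compose[rotated]) (auto intro!: derivative_eq_intros)
    moreover have "frechet_derivative F (at y) (of_real h * v) = pd v F y * h" for y h
      using linear_frechet_derivative[OF diff[of y]] linear_scale[of "frechet_derivative F (at y)" h v]
      by (simp add: pd_def scaleR_conv_of_real)
    ultimately show ?thesis by (simp add: has_field_derivative_def)
  qed
  \<comment> \<open>The difference quotients below have step at most 1, so they all vanish off the
    closed 1-neighbourhood of K, and the mean value theorem bounds them by B there.\<close>
  define K' where "K' = {x + y | x y. x \<in> K \<and> y \<in> cball 0 (1::real)}"
  have K': "compact K'" unfolding K'_def by (rule compact_sums[OF K compact_cball])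
  define s where "s n z = (F (z + of_real (1 / Suc n) * v) - F z) * Suc n" for n z
  have nv: "norm v = 1" using v by auto
  have bound: "\<bar>s n z\<bar> \<le> B * indicator K' z" for n z
  proof (cases "F (z + of_real (1 / Suc n) * v) = 0 \<and> F z = 0")
    case True then show ?thesis using \<open>B > 0\<close> by (simp add: s_def)
  next
    case False
    have "z \<in> K'"
    proof (cases "z \<in> K")
      case True then show ?thesis unfolding K'_def by force
    next
      case f: False
      then have "z + of_real (1 / Suc n) * v \<in> K" using False F0 by blast
      moreover have "z = (z + of_real (1 / Suc n) * v) + (- of_real (1 / Suc n) * v)" by simp
      moreover have "- of_real (1 / Suc n) * v \<in> cball 0 1" using nv by (simp add: norm_mult norm_divide del: of_nat_Suc)
      ultimately show ?thesis unfolding K'_def by blast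
    qed
    obtain t where t: "F (z + of_real (1 / Suc n) * v) - F (z + of_real 0 * v) = (1 / Suc n - 0) * pd v F (z + of_real t * v)"
      using MVT2[of 0 "1 / Suc n", OF _ der[of z]] by auto
    then have "s n z = pd v F (z + of_real t * v)" by (simp add: s_def field_simps del: of_nat_Suc)
    then show ?thesis using B' \<open>z \<in> K'\<close> by simp
  qed
  have lim: "(\<lambda>n. s n z) \<longlonglongrightarrow> pd v F z" for z
  proof -
    have "((\<lambda>h. (F (z + of_real (0 + h) * v) - F (z + of_real 0 * v)) / h) \<longlongrightarrow> pd v F z) (at 0)"
      using der[of z 0] unfolding DERIV_def by simp
    moreover have "filterlim (\<lambda>n. 1 / real (Suc n)) (at 0) sequentially"
      using LIMSEQ_inverse_real_of_nat
      by (simp add: filterlim_at inverse_eq_divide del: of_nat_Suc)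
    ultimately have "(\<lambda>n. (F (z + of_real (0 + 1 / real (Suc n)) * v) - F (z + of_real 0 * v)) / (1 / real (Suc n))) \<longlonglongrightarrow> pd v F z"
      by (rule filterlim_compose)
    then show ?thesis by (simp add: s_def del: of_nat_Suc)
  qed
  have Fc: "continuous_on UNIV F"
    using diff by (simp add: continuous_at_imp_continuous_on differentiable_imp_continuous_within)
  have Fm [measurable]: "F \<in> borel_measurable borel" using Fc by (rule borel_measurable_continuous_onI)
  have [measurable]: "pd v F \<in> borel_measurable borel" using contp by (rule borel_measurable_continuous_onI)
  obtain BF where BF: "\<And>z. z \<in> K \<Longrightarrow> \<bar>F z\<bar> \<le> BF"
    using compact_imp_bounded[OF compact_continuous_image[OF continuous_on_subset[OF Fc subset_UNIV] K]]
    unfolding bounded_pos by auto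
  have Fint: "integrable lborel F"
  proof (rule Bochner_Integration.integrable_bound)
    show "integrable lborel (\<lambda>z. BF * indicator K z)"
      using emeasure_compact_finite[OF K] K by (auto intro!: integrable_mult_right simp: borel_compact)
    show "AE z in lborel. norm (F z) \<le> norm (BF * indicator K z)"
      using BF F0 by (intro AE_I2) (auto simp: indicator_def intro: order_trans[OF _ abs_ge_self])
  qed auto
  have shift: "integrable lborel (\<lambda>z. F (z + c))" "(\<integral>z. F (z + c) \<partial>lborel) = (\<integral>z. F z \<partial>lborel)" for c
  proof -
    have "integrable (distr lborel borel ((+) c)) F" using Fint by (simp add: lborel_distr_plus)
    then show "integrable lborel (\<lambda>z. F (z + c))" by (subst (asm) integrable_distr_eq) (auto simp: add.commute)
    have "(\<integral>z. F z \<partial>lborel) = (\<integral>z. F z \<partial>distr lborel borel ((+) c))" by (simp add: lborel_distr_plus)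
    then show "(\<integral>z. F (z + c) \<partial>lborel) = (\<integral>z. F z \<partial>lborel)"
      by (subst (asm) integral_distr) (auto simp: add.commute)
  qed
  have s0: "(\<integral>z. s n z \<partial>lborel) = 0" for n
    unfolding s_def using shift Fint by simp
  have sm: "s n \<in> borel_measurable lborel" for n unfolding s_def by measurable
  have dom: "integrable lborel (\<lambda>z. B * indicator K' z)"
    using emeasure_compact_finite[OF K'] K' by (auto intro!: integrable_mult_right simp: borel_compact)
  have bd: "AE z in lborel. norm (s n z) \<le> B * indicator K' z" for n using bound by simp
  have lm: "AE z in lborel. (\<lambda>n. s n z) \<longlonglongrightarrow> pd v F z" using lim by simp
  show "integrable lborel (pd v F)"
    by (rule integrable_dominated_convergence[OF _ sm dom lm bd]) simp
  have "(\<lambda>n. \<integral>z. s n z \<partial>lborel) \<longlonglongrightarrow> (\<integral>z. pd v F z \<partial>lborel)"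
    by (rule integral_dominated_convergence[OF _ sm dom lm bd]) simp
  then show "(\<integral>z. pd v F z \<partial>lborel) = 0" unfolding s0 by (simp add: LIMSEQ_const_iff)
qed

section \<open>Integrals of Laplacians over the twice punctured plane\<close>

text \<open>Minus the logarithm of |z|^2 |z - 1|^2 / (1 + |z|^2)^3. The first two terms are harmonic
  off 0 and 1 and blow up there; the exponent 3 outweighs them at infinity, where the function grows
  like ln |z|^2. Its Laplacian is therefore that of the last term alone, which is bounded and
  integrable.\<close>

definition exhaustion :: "complex \<Rightarrow> real" where
  "exhaustion z = - ln ((norm z)\<^sup>2) - ln ((norm (z - 1))\<^sup>2) + 3 * ln (1 + (norm z)\<^sup>2)"

lemma open_twice_punctured: "open (UNIV - {0, 1 :: complex})"
  by (intro open_Diff) auto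

lemma Ck_on_uminus: "open S \<Longrightarrow> Ck_on k S f \<Longrightarrow> Ck_on k S (\<lambda>z. - f z)"
  using Ck_on_mult[of S k "\<lambda>_. -1" f] by simp

lemma Ck_on_diff: "open S \<Longrightarrow> Ck_on k S f \<Longrightarrow> Ck_on k S h \<Longrightarrow> Ck_on k S (\<lambda>z. f z - h z)"
  using Ck_on_add[of S k f "\<lambda>z. - h z"] Ck_on_uminus[of S k h] by simp

lemma flat_laplacian_cmult:
  assumes "open S" "z \<in> S" "Ck_on 2 S f"
  shows "flat_laplacian (\<lambda>z. c * f z) z = c * flat_laplacian f z"
  using flat_laplacian_compose[of S z f "\<lambda>x. c * x" "\<lambda>_. c" 0, OF assms]
  by (auto intro!: derivative_eq_intros)

lemma exhaustion_eq: "exhaustion = (\<lambda>z. (-1) * ln ((norm z)\<^sup>2) + ((-1) * ln ((norm (z - 1))\<^sup>2) + 3 * ln (1 + (norm z)\<^sup>2)))"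
  by (auto simp: exhaustion_def)

lemma exhaustion_parts:
  defines "M \<equiv> UNIV - {0, 1 :: complex}"
  shows "Ck_on k M (\<lambda>z. ln ((norm z)\<^sup>2))" "Ck_on k M (\<lambda>z. ln ((norm (z - 1))\<^sup>2))"
    "Ck_on k M (\<lambda>z. ln (1 + (norm z)\<^sup>2))"
    "z \<in> M \<Longrightarrow> flat_laplacian (\<lambda>z. ln ((norm z)\<^sup>2)) z = 0"
    "z \<in> M \<Longrightarrow> flat_laplacian (\<lambda>z. ln ((norm (z - 1))\<^sup>2)) z = 0"
    "flat_laplacian (\<lambda>z. ln (1 + (norm z)\<^sup>2)) z = 4 / (1 + (norm z)\<^sup>2)\<^sup>2"
    "grad_sq (\<lambda>z. ln (1 + (norm z)\<^sup>2)) z = 4 * (norm z)\<^sup>2 / (1 + (norm z)\<^sup>2)\<^sup>2"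
proof -
  have M: "open M" unfolding M_def by (rule open_twice_punctured)
  show "Ck_on k M (\<lambda>z. ln ((norm z)\<^sup>2))"
    by (rule Ck_on_ln_norm_sq[OF M, of "\<lambda>z. z"]) (auto simp: M_def)
  show "Ck_on k M (\<lambda>z. ln ((norm (z - 1))\<^sup>2))"
    by (rule Ck_on_ln_norm_sq[OF M, of "\<lambda>z. z - 1"]) (auto simp: M_def intro!: holomorphic_intros)
  show "Ck_on k M (\<lambda>z. ln (1 + (norm z)\<^sup>2))"
    by (rule Ck_on_ln_norm_sq_add1[OF M, of "\<lambda>z. z"]) (auto intro!: holomorphic_intros)
  show "z \<in> M \<Longrightarrow> flat_laplacian (\<lambda>z. ln ((norm z)\<^sup>2)) z = 0"
    by (rule flat_laplacian_ln_norm_sq[OF M, of "\<lambda>z. z"]) (auto simp: M_def)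
  show "z \<in> M \<Longrightarrow> flat_laplacian (\<lambda>z. ln ((norm (z - 1))\<^sup>2)) z = 0"
    by (rule flat_laplacian_ln_norm_sq[OF M, of "\<lambda>z. z - 1"]) (auto simp: M_def intro!: holomorphic_intros)
  show "flat_laplacian (\<lambda>z. ln (1 + (norm z)\<^sup>2)) z = 4 / (1 + (norm z)\<^sup>2)\<^sup>2"
    "grad_sq (\<lambda>z. ln (1 + (norm z)\<^sup>2)) z = 4 * (norm z)\<^sup>2 / (1 + (norm z)\<^sup>2)\<^sup>2"
    using flat_laplacian_ln_norm_sq_add1[of UNIV "\<lambda>z. z" z] grad_sq_ln_norm_sq_add1[of UNIV "\<lambda>z. z" z] by auto
qed

lemma grad_sq_ln_norm_sq:
  assumes "open S" "z \<in> S" "G holomorphic_on S" "G z \<noteq> 0"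
  shows "grad_sq (\<lambda>z. ln ((norm (G z))\<^sup>2)) z = 4 * (norm (deriv G z))\<^sup>2 / (norm (G z))\<^sup>2"
proof -
  have d: "(ln has_real_derivative inverse ((norm (G z))\<^sup>2)) (at ((norm (G z))\<^sup>2))"
    using assms(4) by (intro DERIV_ln) simp
  have "(\<lambda>z. (norm (G z))\<^sup>2) differentiable at z"
    using Ck_on_norm_sq[OF assms(1,3), of 1] assms(2) by simp
  from grad_sq_compose[where e = ln, OF this d] show ?thesis
    using assms(4) by (simp add: grad_sq_norm_sq[OF assms(1-3)]) (simp add: field_simps power2_eq_square)
qed

lemma Ck_on_exhaustion: "Ck_on k (UNIV - {0, 1}) exhaustion"
  unfolding exhaustion_eq
  by (intro Ck_on_add Ck_on_mult Ck_on_const exhaustion_parts open_twice_punctured)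

lemma flat_laplacian_exhaustion:
  assumes z: "z \<in> UNIV - {0, 1}"
  shows "flat_laplacian exhaustion z = 12 / (1 + (norm z)\<^sup>2)\<^sup>2"
proof -
  note M = open_twice_punctured and E = exhaustion_parts[unfolded]
  have C: "Ck_on 2 (UNIV - {0, 1}) (\<lambda>z. (-1) * ln ((norm z)\<^sup>2))"
    "Ck_on 2 (UNIV - {0, 1}) (\<lambda>z. (-1) * ln ((norm (z - 1))\<^sup>2))"
    "Ck_on 2 (UNIV - {0, 1}) (\<lambda>z. 3 * ln (1 + (norm z)\<^sup>2))"
    by (intro Ck_on_mult Ck_on_const E M)+
  show ?thesis
    unfolding exhaustion_eq flat_laplacian_add[OF M z C(1) Ck_on_add[OF M C(2,3)]]
      flat_laplacian_add[OF M z C(2,3)] flat_laplacian_cmult[OF M z E(1)]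
      flat_laplacian_cmult[OF M z E(2)] flat_laplacian_cmult[OF M z E(3)]
    using E(4,5,6) z by simp
qed

lemma grad_sq_exhaustion_le:
  assumes z: "z \<in> UNIV - {0, 1}"
  shows "grad_sq exhaustion z \<le> 120 / (norm z)\<^sup>2 + 12 / (norm (z - 1))\<^sup>2"
proof -
  define f1 f2 f3 :: "complex \<Rightarrow> real" where "f1 = (\<lambda>z. ln ((norm z)\<^sup>2))" and "f2 = (\<lambda>z. ln ((norm (z - 1))\<^sup>2))"
    and "f3 = (\<lambda>z. ln (1 + (norm z)\<^sup>2))"
  have d: "f1 differentiable at z" "f2 differentiable at z" "f3 differentiable at z"
    using exhaustion_parts(1,2,3)[of 1] z by (auto simp: f1_def f2_def f3_def)
  have e: "exhaustion = (\<lambda>z. (-1) * f1 z + ((-1) * f2 z + 3 * f3 z))"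
    by (simp add: exhaustion_eq f1_def f2_def f3_def)
  have pd: "pd v exhaustion z = - pd v f1 z - pd v f2 z + 3 * pd v f3 z" for v
    unfolding e by (subst pd_add | subst pd_mult | (rule differentiable_add differentiable_mult differentiable_const d) | simp add: d)+
  \<comment> \<open>Cauchy--Schwarz for the three terms a, b, 3 c. Each squared gradient is at most
    4 over a squared distance, whence 120 = 3 * 4 + 27 * 4 and 12 = 3 * 4.\<close>
  have sq: "(- a - b + 3 * c)\<^sup>2 \<le> 3 * a\<^sup>2 + 3 * b\<^sup>2 + 27 * c\<^sup>2" for a b c :: real
    using zero_le_power2[of "a - b"] zero_le_power2[of "a + 3 * c"] zero_le_power2[of "b + 3 * c"]
    by (simp add: power2_eq_square algebra_simps)
  have "grad_sq exhaustion z \<le> 3 * grad_sq f1 z + 3 * grad_sq f2 z + 27 * grad_sq f3 z"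
    using sq[of "pd 1 f1 z" "pd 1 f2 z" "pd 1 f3 z"] sq[of "pd \<i> f1 z" "pd \<i> f2 z" "pd \<i> f3 z"]
    by (simp add: grad_sq_def pd)
  also have "grad_sq f1 z = 4 / (norm z)\<^sup>2"
    using grad_sq_ln_norm_sq[of UNIV z "\<lambda>z. z"] z by (simp add: f1_def)
  also have "grad_sq f2 z = 4 / (norm (z - 1))\<^sup>2"
    using grad_sq_ln_norm_sq[of UNIV z "\<lambda>z. z - 1"] z by (simp add: f2_def holomorphic_intros)
  also have "grad_sq f3 z = 4 * (norm z)\<^sup>2 / (1 + (norm z)\<^sup>2)\<^sup>2"
    by (simp add: f3_def exhaustion_parts)
  also have "\<dots> \<le> 4 / (norm z)\<^sup>2"
  proof -
    have "(norm z)\<^sup>2 * (norm z)\<^sup>2 \<le> (1 + (norm z)\<^sup>2)\<^sup>2"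
      by (simp add: power2_eq_square algebra_simps)
    then show ?thesis using z
      by (simp add: divide_simps add_nonneg_eq_0_iff)
  qed
  finally show ?thesis by simp
qed

text \<open>The sublevel set at L lies in an annulus about 0 and in one about 1, each with ratio of
  radii 4 exp L. The integral of an inverse squared distance over such an annulus grows only
  linearly in L.\<close>

lemma exhaustion_bounds:
  assumes z: "z \<in> UNIV - {0, 1}"
  shows "exhaustion z \<ge> 0"
    and "exhaustion z < L \<Longrightarrow> exp (- L / 2) / 2 < norm z \<and> norm z < 2 * exp (L / 2)"
    and "exhaustion z < L \<Longrightarrow> exp (- L / 2) / 2 < norm (z - 1) \<and> norm (z - 1) < 2 * exp (L / 2)"
proof -
  define a b where "a = (norm z)\<^sup>2" and "b = (norm (z - 1))\<^sup>2"
  have ab: "a > 0" "b > 0" using z by (auto simp: a_def b_def)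
  have ba: "b \<le> 2 * (1 + a)"
  proof -
    have "norm (z - 1) \<le> norm z + 1" using norm_triangle_ineq4[of z 1] by simp
    then have "b \<le> (norm z + 1)\<^sup>2" unfolding b_def by (simp add: power_mono)
    also have "\<dots> \<le> 2 * (1 + a)" using zero_le_power2[of "norm z - 1"]
      by (simp add: a_def power2_eq_square algebra_simps)
    finally show ?thesis .
  qed
  define w where "w = a * b / (1 + a) ^ 3"
  have w0: "w > 0" using ab by (simp add: w_def)
  have Y: "exhaustion z = - ln w"
    using ab by (simp add: exhaustion_def w_def a_def[symmetric] b_def[symmetric] ln_mult ln_div ln_realpow)
  have w1: "w \<le> 2 * a / (1 + a)\<^sup>2"
  proof -
    have "w = a * (b / (1 + a)) / (1 + a)\<^sup>2" by (simp add: w_def power2_eq_square power3_eq_cube)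
    also have "\<dots> \<le> a * 2 / (1 + a)\<^sup>2"
      using ab ba by (intro divide_right_mono mult_left_mono) (auto simp: divide_simps)
    finally show ?thesis by (simp add: mult.commute)
  qed
  have wb: "w \<le> b"
  proof -
    have "a \<le> (1 + a) ^ 3"
      using ab self_le_power[of "1 + a" 3] by linarith
    then have "a / (1 + a) ^ 3 \<le> 1" using ab by (simp add: divide_simps)
    then have "a / (1 + a) ^ 3 * b \<le> 1 * b" using ab by (intro mult_right_mono) auto
    then show ?thesis by (simp add: w_def)
  qed
  have sq: "(1 + a)\<^sup>2 = 1 + 2 * a + a * a" by (simp add: power2_eq_square algebra_simps)
  have "2 * a / (1 + a)\<^sup>2 \<le> 1" using ab by (simp add: sq divide_simps)
  then have "w \<le> 1" using w1 by linarith
  then show "exhaustion z \<ge> 0" unfolding Y using w0 by (simp add: ln_le_zero_iff)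
  assume L: "exhaustion z < L"
  define e where "e = exp (L / 2)"
  have e0: "e > 0" by (simp add: e_def)
  have em: "exp (- L / 2) = 1 / e" by (simp add: e_def exp_minus inverse_eq_divide)
  have "w > exp (- L)" using L unfolding Y
    by (metis exp_less_mono exp_ln minus_less_iff w0)
  also have "exp (- L) = 1 / e\<^sup>2" by (simp add: e_def exp_minus inverse_eq_divide flip: exp_double)
  finally have w2: "1 / e\<^sup>2 < w" .
  have wa: "w \<le> 2 * a"
  proof -
    have "2 * a / (1 + a)\<^sup>2 \<le> 2 * a / 1"
      using ab by (intro divide_left_mono) (auto simp: sq intro!: add_pos_pos)
    then show ?thesis using w1 by simp
  qed
  have wc: "w * (1 + a) \<le> 2"
  proof -
    have "w * (1 + a) \<le> 2 * a / (1 + a)\<^sup>2 * (1 + a)" using w1 ab by (intro mult_right_mono) auto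
    also have "\<dots> = 2 * a / (1 + a)" using ab by (simp add: power2_eq_square)
    also have "\<dots> \<le> 2" using ab by (simp add: divide_simps)
    finally show ?thesis .
  qed
  have c: "1 + a < 2 * e\<^sup>2"
  proof -
    have "(1 + a) * (1 / e\<^sup>2) < (1 + a) * w" using w2 ab by (intro mult_strict_left_mono) auto
    also have "\<dots> \<le> 2" using wc by (simp add: mult.commute)
    finally show ?thesis using e0 by (simp add: field_simps)
  qed
  have lt: "x < y" if "x\<^sup>2 < y\<^sup>2" "y \<ge> 0" for x y :: real using power_less_imp_less_base[OF that] .
  have e2: "(1 / e / 2)\<^sup>2 = 1 / e\<^sup>2 / 4" "(2 * e)\<^sup>2 = 4 * e\<^sup>2" by (simp_all add: power_divide power_mult_distrib)
  have e3: "1 / e\<^sup>2 > 0" using e0 by simp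
  define q where "q = 1 / e\<^sup>2"
  have q: "q < w" "q > 0" using w2 e3 by (auto simp: q_def)
  have "q / 4 < a" "q / 4 < b" using q wa wb ab by linarith+
  have "2 * (1 + a) < 4 * e\<^sup>2" using c by simp
  moreover have "a < 2 * (1 + a)" using ab by simp
  ultimately have "a < 4 * e\<^sup>2" "b < 4 * e\<^sup>2"
    using order.strict_trans order.strict_trans1[OF ba] by blast+
  then have "q / 4 < a \<and> a < 4 * e\<^sup>2 \<and> q / 4 < b \<and> b < 4 * e\<^sup>2"
    using \<open>q / 4 < a\<close> \<open>q / 4 < b\<close> by blast
  then have "(1 / e / 2)\<^sup>2 < (norm z)\<^sup>2" "(norm z)\<^sup>2 < (2 * e)\<^sup>2"
    "(1 / e / 2)\<^sup>2 < (norm (z - 1))\<^sup>2" "(norm (z - 1))\<^sup>2 < (2 * e)\<^sup>2"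
    unfolding e2 a_def[symmetric] b_def[symmetric] q_def by blast+
  note F = this
  have "1 / e / 2 < norm z" "1 / e / 2 < norm (z - 1)"
    by (rule lt[OF F(1)], simp, rule lt[OF F(3)], simp)
  moreover have "norm z < 2 * e" "norm (z - 1) < 2 * e"
    by (rule lt[OF F(2)], use e0 in simp, rule lt[OF F(4)], use e0 in simp)
  ultimately show "exp (- L / 2) / 2 < norm z \<and> norm z < 2 * exp (L / 2)"
    "exp (- L / 2) / 2 < norm (z - 1) \<and> norm (z - 1) < 2 * exp (L / 2)"
    unfolding em e_def[symmetric] by blast+
qed

text \<open>The function w = exp (- exhaustion) extends continuously to the plane with value 0 at
  the punctures, so the condition w \<ge> exp (- L) is closed in the whole plane and excludes
  them.\<close>

lemma compact_exhaustion: "compact {z \<in> UNIV - {0, 1}. exhaustion z \<le> L}"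
proof -
  define w where "w z = (norm z)\<^sup>2 * (norm (z - 1))\<^sup>2 / (1 + (norm z)\<^sup>2) ^ 3" for z :: complex
  have nz: "1 + (norm z)\<^sup>2 \<noteq> 0" for z :: complex using zero_le_power2[of "norm z"] by linarith
  have "exhaustion z = - ln (w z)" if "z \<in> UNIV - {0, 1}" for z
  proof -
    define a b where "a = (norm z)\<^sup>2" and "b = (norm (z - 1))\<^sup>2"
    have ab: "a > 0" "b > 0" using that by (auto simp: a_def b_def)
    show ?thesis
      using ab by (simp add: exhaustion_def w_def a_def[symmetric] b_def[symmetric] ln_mult ln_div ln_realpow)
  qed
  moreover have "w z > 0" if "z \<in> UNIV - {0, 1}" for z
    using that by (auto simp: w_def add_pos_nonneg intro!: divide_pos_pos mult_pos_pos zero_less_power)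
  ultimately have "exhaustion z \<le> L \<longleftrightarrow> w z \<ge> exp (- L)" if "z \<in> UNIV - {0, 1}" for z
    using that by (metis exp_le_cancel_iff exp_ln minus_le_iff)
  moreover have "z \<in> UNIV - {0, 1}" if "exp (- L) \<le> w z" for z
    using that exp_gt_zero[of "- L"] by (auto simp: w_def not_le[symmetric] simp del: exp_gt_zero)
  ultimately have eq: "{z \<in> UNIV - {0, 1}. exhaustion z \<le> L} = {z. exp (- L) \<le> w z}"
    by blast
  have "closed {z. exp (- L) \<le> w z}"
    unfolding w_def using nz by (intro closed_Collect_le continuous_intros) auto
  moreover have "norm z \<le> 2 * exp ((L + 1) / 2)" if "z \<in> {z \<in> UNIV - {0, 1}. exhaustion z \<le> L}" for z
    using exhaustion_bounds(2)[of z "L + 1"] that by auto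
  ultimately show ?thesis
    unfolding compact_eq_bounded_closed eq bounded_iff by (metis eq)
qed

lemma has_integral_indicator_UNIV:
  fixes f :: "'a::euclidean_space \<Rightarrow> real"
  assumes "(f has_integral i) S"
  shows "((\<lambda>z. indicator S z * f z) has_integral i) UNIV"
proof -
  have "(\<lambda>z. indicator S z * f z) = (\<lambda>z. if z \<in> S then f z else 0)"
    by (auto simp: indicator_def)
  then show ?thesis using assms by (simp only: has_integral_restrict_UNIV)
qed

text \<open>Parabolicity of the twice punctured plane. With a cutoff that is a function of
  \<open>exhaustion\<close> / L, Green's formula moves the Laplacian from \<phi> to the cutoff. The
  squared gradient of \<open>exhaustion\<close> has integral of order L over the sublevel set, while
  differentiating the cutoff twice brings 1 / L^2; as \<phi> is bounded, the result is of order 1 /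
  L.\<close>

theorem integral_flat_laplacian_eq_0:
  fixes \<phi> :: "complex \<Rightarrow> real"
  defines "M \<equiv> UNIV - {0, 1 :: complex}"
  assumes \<phi>: "Ck_on 2 M \<phi>" and bdd: "\<And>z. z \<in> M \<Longrightarrow> \<bar>\<phi> z\<bar> \<le> B"
    and ai: "flat_laplacian \<phi> absolutely_integrable_on M"
  shows "integral M (flat_laplacian \<phi>) = 0"
proof -
  have M: "open M" unfolding M_def by (rule open_twice_punctured)
  have B: "B \<ge> 0" using bdd[of 2] by (simp add: M_def)
  have \<phi>1: "Ck_on 1 M \<phi>" using Ck_on_Suc_imp[of 1 M \<phi>] \<phi> M by (simp add: numeral_2_eq_2)
  have \<phi>1': "Ck_on 1 M (pd 1 \<phi>)" "Ck_on 1 M (pd \<i> \<phi>)" using \<phi> by (auto simp: numeral_2_eq_2)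
  note Y = Ck_on_exhaustion[folded M_def]
  define A where "A c L = {z. exp (- L / 2) / 2 < dist c z \<and> dist c z < 2 * exp (L / 2)}" for c :: complex and L
  define c where "c L z = max 0 (1 - exhaustion z / L)" for L z
  \<comment> \<open>The cube makes the cutoff twice continuously differentiable at the boundary of
    its support.\<close>
  define ct where "ct L z = c L z ^ 3" for L z
  \<comment> \<open>The coefficients come from the chain rule for y -> (1 - y / L)^3: the second
    derivative brings 6 / L^2, with 132 = 120 + 12 from \<open>grad_sq_exhaustion_le\<close> and 2
    pi (L + ln 4) from the annuli; the first derivative brings 3 / L, with 12 from the Laplacian of
    \<open>exhaustion\<close>; pi is the integral of 1 / (1 + |z|^2)^2 over the plane.\<close>
  define bnd where "bnd L = B * (6 / L\<^sup>2 * (132 * (2 * pi * (L + ln 4))) + 36 / L * pi)" for L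
  have main: "(\<lambda>z. ct L z * flat_laplacian \<phi> z) integrable_on M
      \<and> \<bar>integral M (\<lambda>z. ct L z * flat_laplacian \<phi> z)\<bar> \<le> bnd L"
    and chi01: "z \<in> M \<Longrightarrow> 0 \<le> ct L z \<and> ct L z \<le> 1" if L: "L > 0" for L z
  proof -
    have c01: "0 \<le> c L z \<and> c L z \<le> 1" if "z \<in> M" for z
      using exhaustion_bounds(1)[of z] that L by (auto simp: c_def M_def)
    then show "z \<in> M \<Longrightarrow> 0 \<le> ct L z \<and> ct L z \<le> 1"
      by (auto simp: ct_def power_le_one)
    have g: "Ck_on k M (\<lambda>z. 1 - exhaustion z / L)" for k
      using Ck_on_diff[OF M Ck_on_const Ck_on_mult[OF M Y Ck_on_const], of k 1 "1 / L"] by simp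
    have ct2: "Ck_on 2 M (ct L)"
      using Ck_on_pos_part_power[OF M g[of 2]] by (simp add: ct_def[abs_def] c_def numeral_3_eq_3 numeral_2_eq_2)
    have ct1: "Ck_on 1 M (ct L)" using Ck_on_Suc_imp[of 1 M "ct L"] ct2 M by (simp add: numeral_2_eq_2)
    have ct1': "Ck_on 1 M (pd 1 (ct L))" "Ck_on 1 M (pd \<i> (ct L))" using ct2 by (auto simp: numeral_2_eq_2)
    define K where "K = {z \<in> M. exhaustion z \<le> L}"
    have K: "compact K" "K \<subseteq> M" using compact_exhaustion[of L] by (auto simp: K_def M_def)
    have oK: "open (- K)" using K by (simp add: compact_imp_closed open_Compl)
    have c0: "c L z = 0" if "z \<in> M" "z \<notin> K" for z
      using that L by (auto simp: c_def K_def max_def field_simps)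
    have ct0: "ct L z = 0" if "z \<in> M" "z \<notin> K" for z using c0[OF that] by (simp add: ct_def)
    have pdct0: "pd v (ct L) z = 0" if "z \<in> M" "z \<notin> K" for z v
      using pd_cong_open[of "M \<inter> - K" z "ct L" "\<lambda>_. 0" v] ct0 that M oK by auto
    \<comment> \<open>The components of Green's vector field, extended by 0. Its divergence has
      integral 0 and equals the cutoff times the Laplacian of \<phi> minus \<phi> times the
      Laplacian of the cutoff.\<close>
    define F where "F v z = (if z \<in> M then ct L z * pd v \<phi> z - \<phi> z * pd v (ct L) z else 0)" for v z
    have F0: "F v z = 0" if "z \<notin> K" for v z using that ct0 pdct0 by (auto simp: F_def)
    have FC: "Ck_on 1 UNIV (F v)" if v: "v = 1 \<or> v = \<i>" for v
    proof (rule Ck_on_local)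
      fix z :: complex
      show "\<exists>T. open T \<and> z \<in> T \<and> Ck_on 1 T (F v)"
      proof (cases "z \<in> M")
        case True
        have C: "Ck_on 1 M (\<lambda>z. ct L z * pd v \<phi> z - \<phi> z * pd v (ct L) z)"
          using v by (intro Ck_on_diff Ck_on_mult M ct1 \<phi>1) (use \<phi>1' ct1' in auto)
        have "Ck_on 1 M (F v)" by (rule Ck_on_cong[OF M _ C]) (simp add: F_def)
        then show ?thesis using True M by blast
      next
        case False
        have "Ck_on 1 (- K) (F v)" by (rule Ck_on_cong[OF oK _ Ck_on_const[of 1 _ 0]]) (simp add: F0)
        then show ?thesis using False K oK by blast
      qed
    qed
    have Fpd: "pd v (F v) z = ct L z * pd v (pd v \<phi>) z - \<phi> z * pd v (pd v (ct L)) z"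
      if v: "v = 1 \<or> v = \<i>" and z: "z \<in> M" for v z
    proof -
      have d: "ct L differentiable at z" "\<phi> differentiable at z" "pd v \<phi> differentiable at z" "pd v (ct L) differentiable at z"
        using ct1 \<phi>1 \<phi>1' ct1' v z by auto
      have "pd v (F v) z = pd v (\<lambda>z. ct L z * pd v \<phi> z + (-1) * (\<phi> z * pd v (ct L) z)) z"
        by (rule pd_cong_open[OF M z]) (simp add: F_def)
      also have "\<dots> = pd v (\<lambda>z. ct L z * pd v \<phi> z) z + pd v (\<lambda>z. (-1) * (\<phi> z * pd v (ct L) z)) z"
        by (rule pd_add) (intro differentiable_mult differentiable_const d)+
      also have "pd v (\<lambda>z. (-1) * (\<phi> z * pd v (ct L) z)) z = - pd v (\<lambda>z. \<phi> z * pd v (ct L) z) z"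
        by (subst pd_mult) (auto intro!: differentiable_mult d)
      finally show ?thesis by (simp add: pd_mult d)
    qed
    have lap: "pd 1 (F 1) z + pd \<i> (F \<i>) z = (if z \<in> M then ct L z * flat_laplacian \<phi> z - \<phi> z * flat_laplacian (ct L) z else 0)" for z
    proof (cases "z \<in> M")
      case False
      then have "pd v (F v) z = 0" for v
        using pd_cong_open[OF oK, of z "F v" "\<lambda>_. 0" v] F0 K by auto
      then show ?thesis using False by simp
    qed (simp add: Fpd flat_laplacian_def algebra_simps)
    have "((\<lambda>z. pd 1 (F 1) z + pd \<i> (F \<i>) z) has_integral 0) UNIV"
    proof -
      have "(pd v (F v) has_integral 0) UNIV" if "v = 1 \<or> v = \<i>" for v
        using has_integral_integral_lborel[OF integral_pd_compact_support(1)[OF FC[OF that] K(1) F0 that]]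
          integral_pd_compact_support(2)[OF FC[OF that] K(1) F0 that] by simp
      from has_integral_add[OF this[of 1] this[of \<i>]] show ?thesis by simp
    qed
    then have int0: "((\<lambda>z. ct L z * flat_laplacian \<phi> z - \<phi> z * flat_laplacian (ct L) z) has_integral 0) M"
      unfolding lap has_integral_restrict_UNIV .
    have lapct: "flat_laplacian (ct L) z = 6 / L\<^sup>2 * c L z * grad_sq exhaustion z - 3 / L * (c L z)\<^sup>2 * (12 / (1 + (norm z)\<^sup>2)\<^sup>2)"
      if z: "z \<in> M" for z
    proof -
      have cub: "((\<lambda>y. max 0 (1 - y / L) ^ (n + 2)) has_real_derivative (real (n + 2) * max 0 (1 - y / L) ^ (n + 1)) * (- (1 / L))) (at y)" for y n
        by (rule DERIV_chain2[of "\<lambda>x. max 0 x ^ (n + 2)", OF DERIV_pos_part_power])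
           (use L in \<open>auto intro!: derivative_eq_intros\<close>)
      have 1: "((\<lambda>y. max 0 (1 - y / L) ^ 3) has_real_derivative - 3 / L * max 0 (1 - y / L) ^ 2) (at y)" for y
        using cub[of 1 y] by (simp add: numeral_3_eq_3 numeral_2_eq_2)
      have 2: "((\<lambda>y. - 3 / L * max 0 (1 - y / L) ^ 2) has_real_derivative 6 / L\<^sup>2 * max 0 (1 - y / L)) (at y)" for y
        using DERIV_cmult[OF cub[of 0 y], of "- 3 / L"] L by (simp add: power2_eq_square numeral_2_eq_2)
      show ?thesis
        unfolding ct_def[abs_def] c_def
        using flat_laplacian_compose[OF M z Y 1 2] flat_laplacian_exhaustion[OF z[unfolded M_def]] by simp
    qed
    \<comment> \<open>A majorant that is explicitly integrable: the support of the cutoff is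
      replaced by the two annuli that contain it.\<close>
    define dom where "dom z = B * (6 / L\<^sup>2 * (120 * (indicator (A 0 L) z * (1 / (dist 0 z)\<^sup>2)) + 12 * (indicator (A 1 L) z * (1 / (dist 1 z)\<^sup>2)))
       + 36 / L * (indicator (A 0 L) z * (1 / (1 + (dist 0 z)\<^sup>2)\<^sup>2)))" for z
    have dombound: "norm (\<phi> z * flat_laplacian (ct L) z) \<le> dom z" if z: "z \<in> M" for z
    proof (cases "exhaustion z < L")
      case True
      have inA: "z \<in> A 0 L" "z \<in> A 1 L"
        using exhaustion_bounds(2,3)[OF z[unfolded M_def] True] by (auto simp: A_def dist_norm norm_minus_commute)
      have g0: "grad_sq exhaustion z \<ge> 0" by (simp add: grad_sq_def)
      have g1: "c L z * grad_sq exhaustion z \<le> 120 / (norm z)\<^sup>2 + 12 / (norm (z - 1))\<^sup>2"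
        using mult_right_mono[of "c L z" 1, OF _ g0] c01[OF z] grad_sq_exhaustion_le[OF z[unfolded M_def]] by linarith
      have c2: "(c L z)\<^sup>2 \<le> 1" using c01[OF z] by (simp add: power_le_one)
      have "\<bar>flat_laplacian (ct L) z\<bar> \<le> 6 / L\<^sup>2 * (c L z * grad_sq exhaustion z) + 36 / L * ((c L z)\<^sup>2 * (1 / (1 + (norm z)\<^sup>2)\<^sup>2))"
        unfolding lapct[OF z] using L c01[OF z] g0
        by (intro order_trans[OF abs_triangle_ineq4]) (simp add: abs_mult)
      also have "\<dots> \<le> 6 / L\<^sup>2 * (120 / (norm z)\<^sup>2 + 12 / (norm (z - 1))\<^sup>2) + 36 / L * (1 * (1 / (1 + (norm z)\<^sup>2)\<^sup>2))"
        using L g1 c2 by (intro add_mono mult_left_mono mult_right_mono) auto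
      finally have "\<bar>flat_laplacian (ct L) z\<bar> \<le> \<dots>" .
      then have "\<bar>\<phi> z\<bar> * \<bar>flat_laplacian (ct L) z\<bar> \<le> B * (6 / L\<^sup>2 * (120 / (norm z)\<^sup>2 + 12 / (norm (z - 1))\<^sup>2) + 36 / L * (1 * (1 / (1 + (norm z)\<^sup>2)\<^sup>2)))"
        using bdd[OF z] B by (intro mult_mono) auto
      then show ?thesis using inA by (simp add: dom_def abs_mult dist_norm norm_minus_commute)
    next
      case False
      then have "c L z = 0" using L by (auto simp: c_def max_def field_simps)
      then have "flat_laplacian (ct L) z = 0" by (simp add: lapct[OF z])
      moreover have "dom z \<ge> 0" using B L by (auto simp: dom_def intro!: mult_nonneg_nonneg add_nonneg_nonneg)
      ultimately show ?thesis by simp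
    qed
    have ab: "0 < exp (- L / 2) / 2" "exp (- L / 2) / 2 < 2 * exp (L / 2)"
    proof -
      have "exp (- L / 2) < exp (L / 2)" using L by simp
      then show "exp (- L / 2) / 2 < 2 * exp (L / 2)" using exp_gt_zero[of "L / 2"] by linarith
    qed simp
    have ln4: "ln (2 * exp (L / 2)) - ln (exp (- L / 2) / 2) = L + ln 4"
      by (simp add: ln_mult ln_div ln_realpow[of 2 2, simplified])
    have I1: "((\<lambda>z. indicator (A c L) z * (1 / (dist c z)\<^sup>2)) has_integral 2 * pi * (L + ln 4)) UNIV" for c
    proof -
      have c: "continuous_on {0<..} (\<lambda>r::real. 1 / r\<^sup>2)" by (auto intro!: continuous_intros)
      have d: "(ln has_real_derivative r * (1 / r\<^sup>2)) (at r)" if "r > 0" for r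
        using DERIV_ln_divide[OF that] that by (simp add: power2_eq_square)
      have "((\<lambda>z. 1 / (dist c z)\<^sup>2) has_integral 2 * pi * (L + ln 4)) (A c L)"
        using polar_integral[OF ab c d, of c] ln4
        by (metis (mono_tags, lifting) A_def integrable_integral set_lebesgue_integral_eq_integral(1))
      then show ?thesis by (rule has_integral_indicator_UNIV)
    qed
    obtain i2 where I2: "((\<lambda>z. indicator (A 0 L) z * (1 / (1 + (dist 0 z)\<^sup>2)\<^sup>2)) has_integral i2) UNIV" "i2 \<le> pi"
    proof -
      have nz: "1 + r\<^sup>2 \<noteq> (0::real)" for r using zero_le_power2[of r] by linarith
      have c: "continuous_on {0<..} (\<lambda>r::real. 1 / (1 + r\<^sup>2)\<^sup>2)" using nz by (auto intro!: continuous_intros)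
      have d: "((\<lambda>r. - 1 / (2 * (1 + r\<^sup>2))) has_real_derivative r * (1 / (1 + r\<^sup>2)\<^sup>2)) (at r)" if "r > 0" for r
      proof (rule DERIV_cong)
        show "((\<lambda>r. - 1 / (2 * (1 + r\<^sup>2))) has_real_derivative (2 * (2 * r)) / (2 * (1 + r\<^sup>2))\<^sup>2) (at r)"
          using nz[of r] by (auto intro!: derivative_eq_intros simp: power2_eq_square)
      qed (simp only: power_mult_distrib, simp)
      define a b where "a = exp (- L / 2) / 2" and "b = 2 * exp (L / 2)"
      have "((\<lambda>z. 1 / (1 + (dist 0 z)\<^sup>2)\<^sup>2) has_integral 2 * pi * (- 1 / (2 * (1 + b\<^sup>2)) - (- 1 / (2 * (1 + a\<^sup>2))))) (A 0 L)"
        using polar_integral[OF ab c d, of 0, folded a_def b_def]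
        by (simp add: A_def a_def b_def has_integral_iff set_lebesgue_integral_eq_integral(1))
      then have h: "((\<lambda>z. indicator (A 0 L) z * (1 / (1 + (dist 0 z)\<^sup>2)\<^sup>2)) has_integral 2 * pi * (- 1 / (2 * (1 + b\<^sup>2)) - (- 1 / (2 * (1 + a\<^sup>2))))) UNIV"
        by (rule has_integral_indicator_UNIV)
      have "1 / (2 * (1 + a\<^sup>2)) \<le> 1 / 2" by (simp add: divide_simps add_pos_nonneg)
      moreover have "1 / (2 * (1 + b\<^sup>2)) \<ge> 0" by simp
      ultimately have "- 1 / (2 * (1 + b\<^sup>2)) - (- 1 / (2 * (1 + a\<^sup>2))) \<le> 1 / 2" by linarith
      then have "2 * pi * (- 1 / (2 * (1 + b\<^sup>2)) - (- 1 / (2 * (1 + a\<^sup>2)))) \<le> 2 * pi * (1 / 2)"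
        by (intro mult_left_mono) auto
      then show thesis using that h by simp
    qed
    have domint: "(dom has_integral B * (6 / L\<^sup>2 * (120 * (2 * pi * (L + ln 4)) + 12 * (2 * pi * (L + ln 4))) + 36 / L * i2)) UNIV"
      unfolding dom_def[abs_def]
      by (intro has_integral_mult_right has_integral_add I1 I2)
    have "dom z \<ge> 0" for z using B L by (auto simp: dom_def intro!: mult_nonneg_nonneg add_nonneg_nonneg)
    then have domM: "dom integrable_on M" "integral M dom \<le> bnd L"
    proof -
      have negl: "negligible (UNIV - M)" by (simp add: M_def Diff_Diff_Int)
      have "(dom has_integral B * (6 / L\<^sup>2 * (120 * (2 * pi * (L + ln 4)) + 12 * (2 * pi * (L + ln 4))) + 36 / L * i2)) M"
        by (rule has_integral_spike_set_eq[THEN iffD1, OF _ _ domint])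
           (auto intro: negligible_subset[OF negl])
      moreover have "B * (6 / L\<^sup>2 * (120 * (2 * pi * (L + ln 4)) + 12 * (2 * pi * (L + ln 4))) + 36 / L * i2) \<le> bnd L"
        unfolding bnd_def using I2(2) B L by (intro mult_left_mono add_mono) auto
      ultimately show "dom integrable_on M" "integral M dom \<le> bnd L"
        by (auto simp: has_integral_integrable_integral)
    qed
    have lapc: "continuous_on M (flat_laplacian h)" if "Ck_on 2 M h" for h
      using that unfolding flat_laplacian_def by (auto simp: numeral_2_eq_2 intro!: continuous_intros)
    have cphi: "continuous_on M \<phi>" "continuous_on M (ct L)"
      using Ck_on_continuous[OF \<phi> M] Ck_on_continuous[OF ct2 M] .
    have meas: "(\<lambda>z. \<phi> z * flat_laplacian (ct L) z) \<in> borel_measurable (lebesgue_on M)"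
      using M by (intro continuous_imp_measurable_on_sets_lebesgue continuous_intros cphi lapc ct2) auto
    have ai2: "(\<lambda>z. \<phi> z * flat_laplacian (ct L) z) absolutely_integrable_on M"
      by (rule measurable_bounded_by_integrable_imp_absolutely_integrable[OF meas _ domM(1)])
         (use M dombound in auto)
    then have i2: "(\<lambda>z. \<phi> z * flat_laplacian (ct L) z) integrable_on M"
      by (rule set_lebesgue_integral_eq_integral(1))
    have eq: "((\<lambda>z. ct L z * flat_laplacian \<phi> z) has_integral integral M (\<lambda>z. \<phi> z * flat_laplacian (ct L) z)) M"
      using has_integral_add[OF int0 integrable_integral[OF i2]] by simp
    have "norm (integral M (\<lambda>z. \<phi> z * flat_laplacian (ct L) z)) \<le> integral M dom"
      by (rule integral_norm_bound_integral[OF i2 domM(1) dombound])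
    then show "(\<lambda>z. ct L z * flat_laplacian \<phi> z) integrable_on M
      \<and> \<bar>integral M (\<lambda>z. ct L z * flat_laplacian \<phi> z)\<bar> \<le> bnd L"
      using eq domM(2) by (auto simp: has_integral_integrable_integral)
  qed
  define I where "I n = integral M (\<lambda>z. ct (real (Suc n)) z * flat_laplacian \<phi> z)" for n
  have "(I \<longlonglongrightarrow> integral M (flat_laplacian \<phi>))"
    unfolding I_def
  proof (rule dominated_convergence(2))
    show "(\<lambda>z. ct (real (Suc n)) z * flat_laplacian \<phi> z) integrable_on M" for n
      using main by simp
    show "(\<lambda>z. \<bar>flat_laplacian \<phi> z\<bar>) integrable_on M"
      using ai absolutely_integrable_on_def by (auto simp: absolutely_integrable_on_def)
    show "norm (ct (real (Suc n)) z * flat_laplacian \<phi> z) \<le> \<bar>flat_laplacian \<phi> z\<bar>" if "z \<in> M" for n z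
      using chi01[of "real (Suc n)" z] that by (simp add: abs_mult mult_left_le_one_le)
    show "(\<lambda>n. ct (real (Suc n)) z * flat_laplacian \<phi> z) \<longlonglongrightarrow> flat_laplacian \<phi> z" if "z \<in> M" for z
    proof -
      have "(\<lambda>n. exhaustion z * (1 / real (Suc n))) \<longlonglongrightarrow> exhaustion z * 0"
        using LIMSEQ_inverse_real_of_nat by (intro tendsto_intros) (simp add: inverse_eq_divide)
      then have "(\<lambda>n. max 0 (1 - exhaustion z * (1 / real (Suc n))) ^ 3 * flat_laplacian \<phi> z) \<longlonglongrightarrow> max 0 (1 - exhaustion z * 0) ^ 3 * flat_laplacian \<phi> z"
        by - (assumption | rule tendsto_mult tendsto_power tendsto_max tendsto_diff tendsto_const)+
      then show ?thesis by (simp add: ct_def c_def del: of_nat_Suc)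
    qed
  qed
  moreover have "I \<longlonglongrightarrow> 0"
  proof (rule Lim_null_comparison)
    show "\<forall>\<^sub>F n in sequentially. norm (I n) \<le> bnd (real (Suc n))"
      using main by (auto simp: I_def)
    have "(bnd \<longlongrightarrow> 0) at_top" unfolding bnd_def by real_asymp
    then show "(\<lambda>n. bnd (real (Suc n))) \<longlonglongrightarrow> 0"
      by (rule filterlim_compose) (simp add: filterlim_Suc filterlim_compose[OF filterlim_real_sequentially] del: of_nat_Suc)
  qed
  ultimately show ?thesis using LIMSEQ_unique by blast
qed

section \<open>The height function on the sphere\<close>

text \<open>The third coordinate of the point of the unit sphere that stereographic projection sends
  to w; it is -1 over 0 and tends to 1 at infinity.\<close>

definition height :: "complex \<Rightarrow> real" where
  "height w = ((norm w)\<^sup>2 - 1) / ((norm w)\<^sup>2 + 1)"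

text \<open>The density of the pullback by G of the area of the unit sphere, whose metric is 4
  |dw|^2 / (1 + |w|^2)^2.\<close>

definition sph_density :: "(complex \<Rightarrow> complex) \<Rightarrow> complex \<Rightarrow> real" where
  "sph_density G z = 4 * (norm (deriv G z))\<^sup>2 / (1 + (norm (G z))\<^sup>2)\<^sup>2"

lemma norm_sq_add1_pos: "1 + (norm (w :: complex))\<^sup>2 > 0"
  by (simp add: add_pos_nonneg)

lemma height_eq_exp: "height w = 1 - 2 * exp (- ln (1 + (norm w)\<^sup>2))"
  using norm_sq_add1_pos[of w]
  by (simp add: height_def exp_minus inverse_eq_divide field_simps)

lemma abs_height_le_1: "\<bar>height w\<bar> \<le> 1"
  using norm_sq_add1_pos[of w] by (simp add: height_def abs_le_iff divide_simps)

lemma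
  assumes S: "open S" and G: "G holomorphic_on S"
  shows Ck_on_height: "Ck_on 2 S (\<lambda>z. height (G z))"
    and continuous_on_sph_density: "continuous_on S (sph_density G)"
proof -
  have "Ck_on 2 S (\<lambda>z. 1 + (-2) * inverse (1 + (norm (G z))\<^sup>2))"
    using norm_sq_add1_pos
    by (intro Ck_on_add Ck_on_mult Ck_on_inverse Ck_on_norm_sq Ck_on_const S G) (auto simp: less_le)
  then show "Ck_on 2 S (\<lambda>z. height (G z))"
  proof (rule Ck_on_cong[OF S, rotated])
    show "1 + (-2) * inverse (1 + (norm (G z))\<^sup>2) = height (G z)" for z
      using norm_sq_add1_pos[of "G z"] by (simp add: height_def field_simps)
  qed
  have "(1 + (norm (G z))\<^sup>2)\<^sup>2 \<noteq> 0" for z using norm_sq_add1_pos[of "G z"] by simp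
  then show "continuous_on S (sph_density G)"
    unfolding sph_density_def using G holomorphic_deriv[OF G S]
    by (intro continuous_intros holomorphic_on_imp_continuous_on) auto
qed

text \<open>A coordinate function x on the unit sphere is an eigenfunction of the Laplacian with
  eigenvalue 2, and its squared gradient is 1 - x^2. Since G is conformal, both identities pull back
  with the factor \<open>sph_density G\<close>.\<close>

lemma
  assumes S: "open S" and z: "z \<in> S" and G: "G holomorphic_on S"
  shows flat_laplacian_height: "flat_laplacian (\<lambda>z. height (G z)) z = - 2 * height (G z) * sph_density G z"
    and grad_sq_height: "grad_sq (\<lambda>z. height (G z)) z = (1 - (height (G z))\<^sup>2) * sph_density G z"
proof -
  define m where "m = (\<lambda>z. ln (1 + (norm (G z))\<^sup>2))"
  have m2: "Ck_on 2 S m" unfolding m_def by (rule Ck_on_ln_norm_sq_add1[OF S G])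
  have e: "(\<lambda>z. height (G z)) = (\<lambda>z. 1 - 2 * exp (- m z))"
    by (simp add: m_def height_eq_exp)
  define s where "s = 1 + (norm (G z))\<^sup>2"
  have s: "s > 0" unfolding s_def by (rule norm_sq_add1_pos)
  have em: "exp (- m z) = 1 / s"
    using s by (simp add: m_def s_def exp_minus inverse_eq_divide)
  have d1: "((\<lambda>x. 1 - 2 * exp (- x)) has_real_derivative 2 * exp (- x)) (at x)" for x :: real
    by (auto intro!: derivative_eq_intros)
  have d2: "((\<lambda>x. 2 * exp (- x)) has_real_derivative - 2 * exp (- x)) (at x)" for x :: real
    by (auto intro!: derivative_eq_intros)
  have g2: "(norm (G z))\<^sup>2 = s - 1" by (simp add: s_def)
  have h: "height (G z) = (s - 2) / s" using s by (simp add: height_def g2)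
  have "flat_laplacian (\<lambda>z. height (G z)) z = - 2 / s * grad_sq m z + 2 / s * flat_laplacian m z"
    unfolding e using flat_laplacian_compose[where f = m, OF S z m2 d1 d2] by (simp add: em)
  also have "\<dots> = - 2 / s * (4 * (s - 1) * (norm (deriv G z))\<^sup>2 / s\<^sup>2) + 2 / s * (4 * (norm (deriv G z))\<^sup>2 / s\<^sup>2)"
    unfolding m_def flat_laplacian_ln_norm_sq_add1[OF S G z] grad_sq_ln_norm_sq_add1[OF S G z] g2[symmetric] s_def[symmetric] ..
  also have "\<dots> = - 2 * height (G z) * sph_density G z"
    unfolding h sph_density_def s_def[symmetric] using s by (simp add: field_simps power2_eq_square)
  finally show "flat_laplacian (\<lambda>z. height (G z)) z = - 2 * height (G z) * sph_density G z" .
  have "m differentiable at z" using m2 z by (auto simp: numeral_2_eq_2)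
  from grad_sq_compose[OF this d1]
  have "grad_sq (\<lambda>z. height (G z)) z = (2 / s)\<^sup>2 * grad_sq m z" unfolding e by (simp add: em)
  also have "\<dots> = (2 / s)\<^sup>2 * (4 * (s - 1) * (norm (deriv G z))\<^sup>2 / s\<^sup>2)"
    unfolding m_def grad_sq_ln_norm_sq_add1[OF S G z] g2[symmetric] s_def[symmetric] ..
  also have "\<dots> = (1 - (height (G z))\<^sup>2) * sph_density G z"
    unfolding h sph_density_def s_def[symmetric] using s by (simp add: field_simps power2_eq_square)
  finally show "grad_sq (\<lambda>z. height (G z)) z = (1 - (height (G z))\<^sup>2) * sph_density G z" .
qed

text \<open>The combination of h^n and h^(n + 2) is, up to a factor, the derivative of h^(n + 1) -
  h^(n + 3), whose integral over [-1, 1] is 0; this is the recursion satisfied by the moments of a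
  uniform distribution of heights.\<close>

lemma flat_laplacian_height_power:
  assumes S: "open S" and z: "z \<in> S" and G: "G holomorphic_on S"
  shows "flat_laplacian (\<lambda>z. height (G z) ^ (n + 2)) z =
    real (n + 2) * (real (n + 1) * height (G z) ^ n - real (n + 3) * height (G z) ^ (n + 2)) * sph_density G z"
proof -
  have d1: "((\<lambda>x. x ^ (n + 2)) has_real_derivative real (n + 2) * x ^ (n + 1)) (at x)" for x :: real
    by (rule derivative_eq_intros | simp)+
  have d2: "((\<lambda>x. real (n + 2) * x ^ (n + 1)) has_real_derivative real (n + 2) * (real (n + 1) * x ^ n)) (at x)" for x :: real
    by (rule derivative_eq_intros | simp)+
  show ?thesis
    using flat_laplacian_compose[OF S z Ck_on_height[OF S G] d1 d2]
    unfolding flat_laplacian_height[OF S z G] grad_sq_height[OF S z G]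
    by (simp add: power2_eq_square algebra_simps)
qed

text \<open>Archimedes: the area form pushed forward by the height function is uniform, here in terms of moments.\<close>

lemma moment_step:
  fixes D \<phi> \<psi> :: "complex \<Rightarrow> real"
  defines "M \<equiv> UNIV - {0, 1 :: complex}"
  assumes D: "D absolutely_integrable_on M"
    and loc: "\<And>z. z \<in> M \<Longrightarrow> \<exists>r G. 0 < r \<and> ball z r \<subseteq> M \<and> G holomorphic_on ball z r \<and>
       (\<forall>w\<in>ball z r. D w = sph_density G w \<and> \<phi> w = height (G w) ^ (n + 2) \<and> \<psi> w = height (G w) ^ n)"
  shows "(\<lambda>z. \<psi> z * D z) absolutely_integrable_on M" "(\<lambda>z. \<phi> z * D z) absolutely_integrable_on M"
    and "real (n + 1) * integral M (\<lambda>z. \<psi> z * D z) = real (n + 3) * integral M (\<lambda>z. \<phi> z * D z)"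
proof -
  have M: "open M" unfolding M_def by (rule open_twice_punctured)
  have Ms: "M \<in> sets lebesgue" using M by auto
  \<comment> \<open>The functions \<phi>, \<psi> and D are global while G is not, so regularity is
    checked on discs and no compatibility between the maps G of different discs enters.\<close>
  have C: "Ck_on 2 M \<phi>" "Ck_on 0 M (\<lambda>z. \<phi> z * D z)" "Ck_on 0 M (\<lambda>z. \<psi> z * D z)"
  proof (rule_tac [!] Ck_on_local)
    fix z assume "z \<in> M"
    then obtain r G where G: "0 < r" "ball z r \<subseteq> M" "G holomorphic_on ball z r"
      "\<And>w. w \<in> ball z r \<Longrightarrow> D w = sph_density G w \<and> \<phi> w = height (G w) ^ (n + 2) \<and> \<psi> w = height (G w) ^ n"
      using loc by blast
    note H = Ck_on_height[OF open_ball G(3)] and S = continuous_on_sph_density[OF open_ball G(3)]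
    have Hc: "continuous_on (ball z r) (\<lambda>z. height (G z))" using Ck_on_continuous[OF H] by simp
    have "Ck_on 2 (ball z r) (\<lambda>w. height (G w) ^ (n + 2))" by (rule Ck_on_power[OF open_ball H])
    then have "Ck_on 2 (ball z r) \<phi>" by (rule Ck_on_cong[OF open_ball, rotated]) (simp add: G(4))
    then show "\<exists>T. open T \<and> z \<in> T \<and> Ck_on 2 T \<phi>" using G(1) by (metis centre_in_ball open_ball)
    have c: "Ck_on 0 (ball z r) (\<lambda>w. height (G w) ^ j * sph_density G w)" for j
      unfolding Ck_on.simps by (intro continuous_intros Hc S)
    have "Ck_on 0 (ball z r) (\<lambda>z. \<phi> z * D z)" "Ck_on 0 (ball z r) (\<lambda>z. \<psi> z * D z)"
      by (rule Ck_on_cong[OF open_ball _ c[of "n + 2"]], simp add: G(4),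
          rule Ck_on_cong[OF open_ball _ c[of n]], simp add: G(4))
    then show "\<exists>T. open T \<and> z \<in> T \<and> Ck_on 0 T (\<lambda>z. \<phi> z * D z)" "\<exists>T. open T \<and> z \<in> T \<and> Ck_on 0 T (\<lambda>z. \<psi> z * D z)"
      using G(1) by (metis centre_in_ball open_ball)+
  qed
  have b: "\<bar>\<phi> z\<bar> \<le> 1 \<and> \<bar>\<psi> z\<bar> \<le> 1 \<and> D z \<ge> 0 \<and> flat_laplacian \<phi> z = real (n + 2) * (real (n + 1) * (\<psi> z * D z) - real (n + 3) * (\<phi> z * D z))"
    if "z \<in> M" for z
  proof -
    obtain r G where G: "0 < r" "ball z r \<subseteq> M" "G holomorphic_on ball z r"
      "\<And>w. w \<in> ball z r \<Longrightarrow> D w = sph_density G w \<and> \<phi> w = height (G w) ^ (n + 2) \<and> \<psi> w = height (G w) ^ n"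
      using loc \<open>z \<in> M\<close> by blast
    have z: "z \<in> ball z r" using G(1) by simp
    have "flat_laplacian \<phi> z = flat_laplacian (\<lambda>w. height (G w) ^ (n + 2)) z"
      by (rule flat_laplacian_cong[OF open_ball z]) (use G(4) in blast)
    then have "flat_laplacian \<phi> z = real (n + 2) * (real (n + 1) * (\<psi> z * D z) - real (n + 3) * (\<phi> z * D z))"
      unfolding flat_laplacian_height_power[OF open_ball z G(3)] using G(4)[OF z] by (simp add: algebra_simps)
    moreover have hb: "\<bar>height (G z) ^ j\<bar> \<le> 1" for j
      using abs_height_le_1[of "G z"] by (simp add: power_abs power_le_one)
    moreover have "D z \<ge> 0" using G(4)[OF z] by (simp add: sph_density_def)
    ultimately show ?thesis using G(4)[OF z] hb[of n] hb[of "n + 2"] by simp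
  qed
  have bnd: "(\<lambda>z. h z * D z) absolutely_integrable_on M"
    if "continuous_on M (\<lambda>z. h z * D z)" "\<And>z. z \<in> M \<Longrightarrow> \<bar>h z\<bar> \<le> 1" for h
  proof (rule measurable_bounded_by_integrable_imp_absolutely_integrable[OF _ Ms])
    show "(\<lambda>z. h z * D z) \<in> borel_measurable (lebesgue_on M)"
      by (rule continuous_imp_measurable_on_sets_lebesgue[OF that(1) Ms])
    show "D integrable_on M" using D by (rule set_lebesgue_integral_eq_integral(1))
    show "norm (h z * D z) \<le> D z" if "z \<in> M" for z
      using mult_right_mono[of "\<bar>h z\<bar>" 1 "D z"] b[OF \<open>z \<in> M\<close>] \<open>\<And>z. z \<in> M \<Longrightarrow> \<bar>h z\<bar> \<le> 1\<close>[OF \<open>z \<in> M\<close>] by (simp add: abs_mult)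
  qed
  show 1: "(\<lambda>z. \<psi> z * D z) absolutely_integrable_on M" and 2: "(\<lambda>z. \<phi> z * D z) absolutely_integrable_on M"
    using bnd C b by auto
  have ai: "flat_laplacian \<phi> absolutely_integrable_on M"
  proof -
    have a: "(\<lambda>z. real (n + 2) * (real (n + 1) * (\<psi> z * D z) - real (n + 3) * (\<phi> z * D z))) absolutely_integrable_on M"
      by (intro set_integrable_mult_right set_integral_diff(1) 1 2)
    show ?thesis by (rule absolutely_integrable_spike[OF a negligible_empty]) (use b in auto)
  qed
  have "0 = integral M (flat_laplacian \<phi>)"
    using integral_flat_laplacian_eq_0[of \<phi> 1] C(1) b ai unfolding M_def by simp
  also have "\<dots> = integral M (\<lambda>z. real (n + 2) * (real (n + 1) * (\<psi> z * D z) - real (n + 3) * (\<phi> z * D z)))"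
    by (rule integral_cong) (use b in blast)
  also have "\<dots> = real (n + 2) * (real (n + 1) * integral M (\<lambda>z. \<psi> z * D z) - real (n + 3) * integral M (\<lambda>z. \<phi> z * D z))"
  proof -
    have "(\<lambda>z. real (n + 1) * (\<psi> z * D z)) integrable_on M" "(\<lambda>z. real (n + 3) * (\<phi> z * D z)) integrable_on M"
      using 1 2 set_lebesgue_integral_eq_integral(1) by (auto intro!: integrable_on_cmult_left simp del: of_nat_add)
    then show ?thesis by (simp only: integral_mult_right integral_diff)
  qed
  finally show "real (n + 1) * integral M (\<lambda>z. \<psi> z * D z) = real (n + 3) * integral M (\<lambda>z. \<phi> z * D z)"
    by simp
qed

text \<open>The start of the recursion for odd moments: the height itself is -1/2 times its
  Laplacian divided by the area density, so its integral against D vanishes.\<close>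

lemma moment_height:
  fixes D h :: "complex \<Rightarrow> real"
  defines "M \<equiv> UNIV - {0, 1 :: complex}"
  assumes D: "D absolutely_integrable_on M"
    and loc: "\<And>z. z \<in> M \<Longrightarrow> \<exists>r G. 0 < r \<and> ball z r \<subseteq> M \<and> G holomorphic_on ball z r \<and>
       (\<forall>w\<in>ball z r. D w = sph_density G w \<and> h w = height (G w))"
  shows "integral M (\<lambda>z. h z * D z) = 0"
proof -
  have M: "open M" unfolding M_def by (rule open_twice_punctured)
  have Ms: "M \<in> sets lebesgue" using M by auto
  have C: "Ck_on 2 M h" "Ck_on 0 M (\<lambda>z. h z * D z)"
  proof (rule_tac [!] Ck_on_local)
    fix z assume "z \<in> M"
    then obtain r G where G: "0 < r" "ball z r \<subseteq> M" "G holomorphic_on ball z r"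
      "\<And>w. w \<in> ball z r \<Longrightarrow> D w = sph_density G w \<and> h w = height (G w)"
      using loc by blast
    note H = Ck_on_height[OF open_ball G(3)] and S = continuous_on_sph_density[OF open_ball G(3)]
    have Hc: "continuous_on (ball z r) (\<lambda>z. height (G z))" using Ck_on_continuous[OF H] by simp
    have "Ck_on 2 (ball z r) h" by (rule Ck_on_cong[OF open_ball _ H]) (simp add: G(4))
    then show "\<exists>T. open T \<and> z \<in> T \<and> Ck_on 2 T h" using G(1) by (metis centre_in_ball open_ball)
    have c: "Ck_on 0 (ball z r) (\<lambda>w. height (G w) * sph_density G w)"
      unfolding Ck_on.simps by (intro continuous_intros Hc S)
    have "Ck_on 0 (ball z r) (\<lambda>z. h z * D z)"
      by (rule Ck_on_cong[OF open_ball _ c]) (simp add: G(4))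
    then show "\<exists>T. open T \<and> z \<in> T \<and> Ck_on 0 T (\<lambda>z. h z * D z)"
      using G(1) by (metis centre_in_ball open_ball)
  qed
  have b: "\<bar>h z\<bar> \<le> 1 \<and> D z \<ge> 0 \<and> flat_laplacian h z = - 2 * (h z * D z)"
    if "z \<in> M" for z
  proof -
    obtain r G where G: "0 < r" "ball z r \<subseteq> M" "G holomorphic_on ball z r"
      "\<And>w. w \<in> ball z r \<Longrightarrow> D w = sph_density G w \<and> h w = height (G w)"
      using loc \<open>z \<in> M\<close> by blast
    have z: "z \<in> ball z r" using G(1) by simp
    have "flat_laplacian h z = flat_laplacian (\<lambda>w. height (G w)) z"
      by (rule flat_laplacian_cong[OF open_ball z]) (use G(4) in blast)
    then have "flat_laplacian h z = - 2 * (h z * D z)"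
      unfolding flat_laplacian_height[OF open_ball z G(3)] using G(4)[OF z] by simp
    then show ?thesis using abs_height_le_1[of "G z"] G(4)[OF z] by (auto simp: sph_density_def)
  qed
  have 1: "(\<lambda>z. h z * D z) absolutely_integrable_on M"
  proof (rule measurable_bounded_by_integrable_imp_absolutely_integrable[OF _ Ms])
    show "(\<lambda>z. h z * D z) \<in> borel_measurable (lebesgue_on M)"
      using C(2) by (intro continuous_imp_measurable_on_sets_lebesgue[OF _ Ms]) simp
    show "D integrable_on M" using D by (rule set_lebesgue_integral_eq_integral(1))
    show "norm (h z * D z) \<le> D z" if "z \<in> M" for z
      using mult_right_mono[of "\<bar>h z\<bar>" 1 "D z"] b[OF \<open>z \<in> M\<close>] by (simp add: abs_mult)
  qed
  have ai: "flat_laplacian h absolutely_integrable_on M"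
  proof -
    have a: "(\<lambda>z. - 2 * (h z * D z)) absolutely_integrable_on M"
      by (intro set_integrable_mult_right 1)
    show ?thesis by (rule absolutely_integrable_spike[OF a negligible_empty]) (use b in auto)
  qed
  have "0 = integral M (flat_laplacian h)"
    using integral_flat_laplacian_eq_0[of h 1] C(1) b ai unfolding M_def by simp
  also have "\<dots> = integral M (\<lambda>z. - 2 * (h z * D z))"
    by (rule integral_cong) (use b in blast)
  also have "\<dots> = - 2 * integral M (\<lambda>z. h z * D z)" by simp
  finally show "integral M (\<lambda>z. h z * D z) = 0"
    by simp
qed

text \<open>In a coordinate \<zeta> with \<zeta>^m = G, a small disc covers a cap around the pole of
  height -1 exactly m times. By Archimedes the annulus b < |\<zeta>| < e contributes 2 pi m
  (H(e^m)^n - H(b^m)^n) / n with n = 2 k + 1, where the first power tends to 0 for large k and the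
  second is close to -1 for small b. An annulus avoids the centre, where polar coordinates
  degenerate; it depends on k through b. The factorisation of G is part of the conclusion so that
  the same m can be compared with the order of E.\<close>

lemma spherical_area_near_zero:
  assumes G: "G holomorphic_on ball a r" "0 < r" "G a = 0" "\<not> G constant_on ball a r"
  obtains m g \<rho> where "m \<ge> (1::nat)" "0 < \<rho>" "ball a \<rho> \<subseteq> ball a r" "g holomorphic_on ball a \<rho>"
    "\<And>w. w \<in> ball a \<rho> \<Longrightarrow> G w = (w - a) ^ m * g w" "\<And>w. w \<in> ball a \<rho> \<Longrightarrow> g w \<noteq> 0"
    "\<And>N \<delta>. open N \<Longrightarrow> a \<in> N \<Longrightarrow> 0 < \<delta> \<Longrightarrow>
      \<exists>k0. \<forall>k\<ge>k0. \<exists>W. open W \<and> W \<subseteq> N \<inter> ball a r \<and> (\<lambda>z. height (G z) ^ (2 * k) * sph_density G z) absolutely_integrable_on W \<and>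
        real (2 * k + 1) * integral W (\<lambda>z. height (G z) ^ (2 * k) * sph_density G z) \<ge> 2 * pi * m - \<delta>"
proof -
  obtain g r1 m where m: "0 < m" and r1: "0 < r1" "ball a r1 \<subseteq> ball a r" and g: "g holomorphic_on ball a r1"
    and Gg: "\<And>w. w \<in> ball a r1 \<Longrightarrow> G w = (w - a) ^ m * g w" and g0: "\<And>w. w \<in> ball a r1 \<Longrightarrow> g w \<noteq> 0"
    by (rule holomorphic_factor_zero_nonconstant[OF G(1) open_ball connected_ball
      centre_in_ball[THEN iffD2, OF G(2)] G(3,4)]) (rule that, assumption+)

  obtain L where L: "L holomorphic_on ball a r1" "\<And>w. w \<in> ball a r1 \<Longrightarrow> g w = exp (L w)"
    using contractible_imp_holomorphic_log[OF g convex_imp_contractible[OF convex_ball]] g0 by metis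
  \<comment> \<open>An m-th root of G, taken through a logarithm of the nonvanishing factor g; it is
    a local coordinate because its derivative at a is exp (L a / m).\<close>
  define \<zeta> where "\<zeta> = (\<lambda>w. (w - a) * exp (L w / m))"
  have \<zeta>: "\<zeta> holomorphic_on ball a r1" unfolding \<zeta>_def using m by (intro holomorphic_intros L) auto
  have \<zeta>m: "\<zeta> w ^ m = G w" if "w \<in> ball a r1" for w
    using that m Gg L(2) by (simp add: \<zeta>_def power_mult_distrib flip: exp_of_nat_mult)
  have d\<zeta>: "deriv \<zeta> a \<noteq> 0"
  proof -
    have "(\<zeta> has_field_derivative exp (L a / m)) (at a)"
      unfolding \<zeta>_def using m holomorphic_derivI[OF L(1) open_ball, of a] r1 by (auto intro!: derivative_eq_intros)
    then show ?thesis using DERIV_imp_deriv by force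
  qed
  have main: "\<exists>k0. \<forall>k\<ge>k0. \<exists>W. open W \<and> W \<subseteq> N \<inter> ball a r \<and> (\<lambda>z. height (G z) ^ (2 * k) * sph_density G z) absolutely_integrable_on W \<and>
        real (2 * k + 1) * integral W (\<lambda>z. height (G z) ^ (2 * k) * sph_density G z) \<ge> 2 * pi * m - \<delta>"
    if N: "open N" "a \<in> N" and \<delta>: "0 < \<delta>" for N \<delta>
  proof -
    define S where "S = ball a r1 \<inter> N"
    have S: "open S" "a \<in> S" using N r1 by (auto simp: S_def)
    have \<zeta>S: "\<zeta> holomorphic_on S" by (rule holomorphic_on_subset[OF \<zeta>]) (auto simp: S_def)
    obtain r2 where r2: "0 < r2" "ball a r2 \<subseteq> S" "inj_on \<zeta> (ball a r2)"
      using has_complex_derivative_locally_injective[OF \<zeta>S S(2,1) d\<zeta>] by metis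
    have \<zeta>2: "\<zeta> holomorphic_on ball a r2" using holomorphic_on_subset[OF \<zeta>S r2(2)] .
    obtain s where s: "s holomorphic_on \<zeta> ` ball a r2" "\<And>z. z \<in> ball a r2 \<Longrightarrow> deriv \<zeta> z * deriv s (\<zeta> z) = 1"
      "\<And>z. z \<in> ball a r2 \<Longrightarrow> s (\<zeta> z) = z"
      using holomorphic_has_inverse[OF \<zeta>2 open_ball r2(3)] by metis
    have o: "open (\<zeta> ` ball a r2)" by (rule open_mapping_thm3[OF \<zeta>2 open_ball r2(3)])
    moreover have "0 \<in> \<zeta> ` ball a r2" using r2(1) by (auto simp: \<zeta>_def image_iff intro!: bexI[of _ a])
    ultimately obtain d where d: "0 < d" "ball 0 d \<subseteq> \<zeta> ` ball a r2" using open_contains_ball by blast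
    have sS: "s w \<in> S \<and> G (s w) = w ^ m \<and> \<zeta> (s w) = w" if w: "w \<in> ball 0 d" for w
    proof -
      have "w \<in> \<zeta> ` ball a r2" using d(2) w by blast
      then obtain z where z: "z \<in> ball a r2" "w = \<zeta> z" by blast
      then show ?thesis using s(3)[OF z(1)] r2(2) \<zeta>m[of z] by (auto simp: S_def)
    qed
    have sh: "s holomorphic_on ball 0 d" using holomorphic_on_subset[OF s(1) d(2)] .
    have injs: "inj_on s (ball 0 d)" using sS by (metis inj_onI)
    have dGs: "deriv G (s w) * deriv s w = of_nat m * w ^ (m - 1)" if w: "w \<in> ball 0 d" for w
    proof -
      have "s w \<in> ball a r" using sS[OF w] r1 by (auto simp: S_def)
      then have "((\<lambda>w. G (s w)) has_field_derivative deriv G (s w) * deriv s w) (at w)"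
        using DERIV_chain2 holomorphic_derivI[OF G(1) open_ball] holomorphic_derivI[OF sh open_ball w] by blast
      then have "((\<lambda>w. w ^ m) has_field_derivative deriv G (s w) * deriv s w) (at w)"
        by (rule has_field_derivative_transform_within_open[OF _ open_ball w]) (use sS in blast)
      moreover have "((\<lambda>w. w ^ m) has_field_derivative of_nat m * w ^ (m - 1)) (at w)"
        by (rule derivative_eq_intros | simp)+
      ultimately show ?thesis by (rule DERIV_unique)
    qed
    define H where "H x = (x\<^sup>2 - 1) / (x\<^sup>2 + 1)" for x :: real
    have Hpos: "x\<^sup>2 + 1 > 0" for x :: real by (simp add: add_nonneg_pos)
    have HH: "height w = H (norm w)" for w by (simp add: height_def H_def)
    \<comment> \<open>A fixed outer radius: it only has to keep the height strictly inside (-1, 1),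
      so that its powers tend to 0.\<close>
    define e where "e = d / 2"
    have e: "0 < e" "e < d" using d by (auto simp: e_def)
    have He: "\<bar>H (e ^ m)\<bar> < 1"
      using Hpos[of "e ^ m"] e by (simp add: H_def abs_less_iff divide_simps)
    have "(\<lambda>k. 2 * pi * m * \<bar>H (e ^ m)\<bar> ^ (2 * k + 1)) \<longlonglongrightarrow> 2 * pi * m * 0"
    proof (intro tendsto_mult tendsto_const)
      have "(\<lambda>k. \<bar>H (e ^ m)\<bar> ^ k) \<longlonglongrightarrow> 0" using He by (intro LIMSEQ_realpow_zero) auto
      then show "(\<lambda>k. \<bar>H (e ^ m)\<bar> ^ (2 * k + 1)) \<longlonglongrightarrow> 0"
        by (rule filterlim_compose) (auto intro!: filterlim_subseq simp: strict_mono_def)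
    qed
    then have "\<forall>\<^sub>F k in sequentially. 2 * pi * m * \<bar>H (e ^ m)\<bar> ^ (2 * k + 1) < \<delta> / 2"
      using \<delta> by (intro order_tendstoD) auto
    then obtain k0 where k0: "\<And>k. k \<ge> k0 \<Longrightarrow> 2 * pi * m * \<bar>H (e ^ m)\<bar> ^ (2 * k + 1) < \<delta> / 2"
      unfolding eventually_sequentially by blast
    show ?thesis
    proof (intro exI[of _ k0] allI impI)
      fix k assume k: "k0 \<le> k"
      define n where "n = 2 * k + 1"
      \<comment> \<open>For fixed k the inner radius b is now taken small; as n is odd, the n-th
        power of the limiting height -1 is -1.\<close>
      have "((\<lambda>x. 2 * pi * m * H (x ^ m) ^ n) \<longlongrightarrow> 2 * pi * m * H (0 ^ m) ^ n) (at_right 0)"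
        using Hpos unfolding H_def by (intro tendsto_intros) (simp add: less_imp_neq[symmetric])
      moreover have "H (0 ^ m) = - 1" using m by (simp add: H_def zero_power)
      then have "2 * pi * m * H (0 ^ m) ^ n = - (2 * pi * m)" by (simp add: n_def)
      ultimately have "\<forall>\<^sub>F x in at_right 0. 2 * pi * m * H (x ^ m) ^ n < - (2 * pi * m) + \<delta> / 2"
        using \<delta> by (intro order_tendstoD) auto
      moreover have "\<forall>\<^sub>F x in at_right 0. x \<in> {0<..<e}" using e by (intro eventually_at_right_real)
      ultimately have "\<forall>\<^sub>F x in at_right 0. 0 < x \<and> x < e \<and> 2 * pi * m * H (x ^ m) ^ n < - (2 * pi * m) + \<delta> / 2"
        by eventually_elim auto
      then obtain b where b: "0 < b" "b < e" "2 * pi * m * H (b ^ m) ^ n < - (2 * pi * m) + \<delta> / 2"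
        using eventually_happens by force
      define f where "f x = H (x ^ m) ^ (2 * k) * (4 * (m * x ^ (m - 1))\<^sup>2 / (1 + (x ^ m)\<^sup>2)\<^sup>2)" for x :: real
      \<comment> \<open>Archimedes in polar coordinates: the primitive of H^(2 k) dH, multiplied by
        the number m of sheets.\<close>
      define \<Psi> where "\<Psi> x = m / n * H (x ^ m) ^ n" for x :: real
      have p2: "(1 + y\<^sup>2)\<^sup>2 \<noteq> 0" "y\<^sup>2 + 1 \<noteq> 0" for y :: real using Hpos[of y] by (auto simp: add.commute)
      have cf: "continuous_on {0<..} f"
        unfolding f_def H_def using p2 by (intro continuous_intros) auto
      have d\<Psi>: "(\<Psi> has_real_derivative x * f x) (at x)" if x: "0 < x" for x
      proof -
        have dH: "(H has_real_derivative 4 * y / (1 + y\<^sup>2)\<^sup>2) (at y)" for y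
          unfolding H_def using p2(2)[of y]
          by (auto intro!: derivative_eq_intros simp: power2_eq_square algebra_simps)
        have dp: "((\<lambda>x. x ^ m) has_real_derivative m * x ^ (m - 1)) (at x)"
          by (rule derivative_eq_intros | simp)+
        have "((\<lambda>x. H (x ^ m)) has_real_derivative 4 * x ^ m / (1 + (x ^ m)\<^sup>2)\<^sup>2 * (m * x ^ (m - 1))) (at x)"
          by (rule DERIV_chain2[OF dH dp])
        from DERIV_cmult[OF DERIV_power[OF this, of n], of "m / n"]
        have "(\<Psi> has_real_derivative m / n * (n * (4 * x ^ m / (1 + (x ^ m)\<^sup>2)\<^sup>2 * (m * x ^ (m - 1)) * H (x ^ m) ^ (n - Suc 0)))) (at x)"
          unfolding \<Psi>_def by simp
        moreover have "x ^ m = x * x ^ (m - 1)" using m by (simp add: power_eq_if)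
        then have "m / n * (n * (4 * x ^ m / (1 + (x ^ m)\<^sup>2)\<^sup>2 * (m * x ^ (m - 1)) * H (x ^ m) ^ (n - Suc 0))) = x * f x"
          by (simp add: f_def n_def power2_eq_square)
        ultimately show ?thesis by simp
      qed
      define An where "An = {z :: complex. b < dist 0 z \<and> dist 0 z < e}"
      have pol: "(\<lambda>z. f (dist 0 z)) absolutely_integrable_on An"
        "integral An (\<lambda>z. f (dist 0 z)) = 2 * pi * (\<Psi> e - \<Psi> b)"
        using polar_integral[OF b(1,2) cf d\<Psi>, of "0::complex"] unfolding An_def by blast+
      have An: "open An" "An \<subseteq> ball 0 d"
        using e b by (auto simp: An_def intro!: open_Collect_conj open_Collect_less continuous_intros)
      have shA: "s holomorphic_on An" "inj_on s An"
        using holomorphic_on_subset[OF sh An(2)] inj_on_subset[OF injs An(2)] .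
      have sub: "s ` An \<subseteq> N \<inter> ball a r" using sS An(2) r1 by (fastforce simp: S_def)
      have Gsub: "G holomorphic_on s ` An" by (rule holomorphic_on_subset[OF G(1)]) (use sub in auto)
      have oW: "open (s ` An)" by (rule open_mapping_thm3[OF shA(1) An(1) shA(2)])
      have cd: "continuous_on (s ` An) (\<lambda>z. height (G z) ^ (2 * k) * sph_density G z)"
        by (intro continuous_intros Ck_on_continuous[OF Ck_on_height[OF oW Gsub] oW] continuous_on_sph_density[OF oW Gsub])
      have eq: "(norm (deriv s w))\<^sup>2 * (height (G (s w)) ^ (2 * k) * sph_density G (s w)) = f (dist 0 w)" if "w \<in> An" for w
      proof -
        have w: "w \<in> ball 0 d" using that An by blast
        have "(norm (deriv s w))\<^sup>2 * (norm (deriv G (s w)))\<^sup>2 = (m * norm w ^ (m - 1))\<^sup>2"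
          using arg_cong[OF dGs[OF w], of norm] by (metis mult.commute norm_mult norm_of_nat norm_power power_mult_distrib)
        then show ?thesis using sS[OF w]
          by (simp add: sph_density_def f_def HH norm_power mult_ac)
      qed
      have "(\<lambda>w. (norm (deriv s w))\<^sup>2 * (height (G (s w)) ^ (2 * k) * sph_density G (s w))) absolutely_integrable_on An"
        by (rule absolutely_integrable_spike[OF pol(1) negligible_empty]) (use eq in auto)
      moreover have "integral An (\<lambda>w. (norm (deriv s w))\<^sup>2 * (height (G (s w)) ^ (2 * k) * sph_density G (s w))) = 2 * pi * (\<Psi> e - \<Psi> b)"
        unfolding pol(2)[symmetric] by (rule integral_cong) (use eq in auto)
      ultimately have W: "(\<lambda>z. height (G z) ^ (2 * k) * sph_density G z) absolutely_integrable_on s ` An"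
        "integral (s ` An) (\<lambda>z. height (G z) ^ (2 * k) * sph_density G z) = 2 * pi * (\<Psi> e - \<Psi> b)"
        using holomorphic_change_of_variables[OF An(1) shA cd] by blast+
      have "real (2 * k + 1) * (2 * pi * (\<Psi> e - \<Psi> b)) = 2 * pi * m * H (e ^ m) ^ n - 2 * pi * m * H (b ^ m) ^ n"
        by (simp add: \<Psi>_def n_def field_simps del: of_nat_Suc)
      moreover have "2 * pi * m * H (e ^ m) ^ n \<ge> - (\<delta> / 2)"
      proof -
        have "\<bar>2 * pi * m * H (e ^ m) ^ n\<bar> = 2 * pi * m * \<bar>H (e ^ m)\<bar> ^ (2 * k + 1)"
          by (simp add: abs_mult power_abs n_def)
        then show ?thesis using k0[OF k] by linarith
      qed
      ultimately have "real (2 * k + 1) * (2 * pi * (\<Psi> e - \<Psi> b)) \<ge> 2 * pi * m - \<delta>"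
        using b(3) by linarith
      then show "\<exists>W. open W \<and> W \<subseteq> N \<inter> ball a r \<and> (\<lambda>z. height (G z) ^ (2 * k) * sph_density G z) absolutely_integrable_on W \<and>
        real (2 * k + 1) * integral W (\<lambda>z. height (G z) ^ (2 * k) * sph_density G z) \<ge> 2 * pi * m - \<delta>"
        using oW sub W by (intro exI[of _ "s ` An"]) simp
    qed
  qed
  show thesis by (rule that[OF _ r1 g Gg g0 main]) (use m in auto)
qed

section \<open>Zeros of the axis form\<close>

text \<open>
  \<open>Q dz\<^sup>2\<close> is the Hopf differential of the Weierstrass data \<open>(G, A dz)\<close> and \<open>E dz\<^sup>2\<close> is the square
  of the 1-form \<open>G A dz\<close>, which up to sign is unchanged under rotations about the axis through
  \<open>0\<close> and \<open>\<infinity>\<close> and under half-turns that exchange these two points.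
\<close>

definition local_data ::
  "(complex \<Rightarrow> real) \<Rightarrow> (complex \<Rightarrow> complex) \<Rightarrow> (complex \<Rightarrow> complex) \<Rightarrow> complex \<Rightarrow> real \<Rightarrow>
   (complex \<Rightarrow> complex) \<Rightarrow> (complex \<Rightarrow> complex) \<Rightarrow> bool" where
  "local_data lam Q E c r G A \<longleftrightarrow> 0 < r \<and> G holomorphic_on ball c r \<and> A holomorphic_on ball c r \<and>
     (\<forall>z\<in>ball c r. A z \<noteq> 0 \<and> deriv G z * A z = Q z \<and> (A z * G z)\<^sup>2 = E z \<and>
        lam z = 1 / 4 * (norm (A z))\<^sup>2 * (1 + (norm (G z))\<^sup>2)\<^sup>2)"

lemma local_data_subball:
  assumes "local_data lam Q E c r G A" "z \<in> ball c r"
  obtains \<rho> where "0 < \<rho>" "ball z \<rho> \<subseteq> ball c r" "\<And>\<rho>'. 0 < \<rho>' \<Longrightarrow> \<rho>' \<le> \<rho> \<Longrightarrow> local_data lam Q E z \<rho>' G A"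
proof -
  obtain \<rho> where \<rho>: "0 < \<rho>" "ball z \<rho> \<subseteq> ball c r"
    using assms(2) openE open_ball by blast
  show thesis
  proof (rule that[OF \<rho>])
    fix \<rho>' assume r: "0 < \<rho>'" "\<rho>' \<le> \<rho>"
    then have s: "ball z \<rho>' \<subseteq> ball c r" using \<rho> by (meson subset_ball subset_trans)
    show "local_data lam Q E z \<rho>' G A"
      using assms(1) s r(1) unfolding local_data_def by (meson holomorphic_on_subset subsetD)
  qed
qed

text \<open>The half-turn w -> -1/w belongs to PSU(2), hence preserves the metric. The minus sign
  keeps the Hopf differential, and A G only changes sign, so its square E is kept.\<close>

lemma local_data_swap:
  assumes "local_data lam Q E c r G A" "\<And>z. z \<in> ball c r \<Longrightarrow> G z \<noteq> 0"
  shows "local_data lam Q E c r (\<lambda>z. - (1 / G z)) (\<lambda>z. A z * (G z)\<^sup>2)"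
proof -
  have G: "G holomorphic_on ball c r" "A holomorphic_on ball c r" "0 < r" using assms by (auto simp: local_data_def)
  have "deriv (\<lambda>z. - (1 / G z)) z = deriv G z / (G z)\<^sup>2" if "z \<in> ball c r" for z
  proof (rule DERIV_imp_deriv)
    show "((\<lambda>z. - (1 / G z)) has_field_derivative deriv G z / (G z)\<^sup>2) (at z)"
      using holomorphic_derivI[OF G(1) open_ball that] assms(2)[OF that]
      by (auto intro!: derivative_eq_intros simp: power2_eq_square)
  qed
  moreover have "1 / 4 * (norm (A z * (G z)\<^sup>2))\<^sup>2 * (1 + (norm (- (1 / G z)))\<^sup>2)\<^sup>2 = 1 / 4 * (norm (A z))\<^sup>2 * (1 + (norm (G z))\<^sup>2)\<^sup>2"
    if "z \<in> ball c r" for z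
  proof -
    have "norm (G z) \<noteq> 0" using assms(2)[OF that] by simp
    then show ?thesis by (simp add: norm_mult norm_power norm_divide field_simps power2_eq_square)
  qed
  ultimately show ?thesis
    using assms G unfolding local_data_def
    by (auto intro!: holomorphic_intros simp: power_mult_distrib power2_eq_square)
qed

text \<open>The second identity is the fact that (-K) g_M is the spherical metric pulled back by G.
  The third expresses the square of the height through lam and E alone, with no choice of G.\<close>

lemma local_data_facts:
  assumes "local_data lam Q E c r G A" "z \<in> ball c r"
  shows "lam z > 0" "(norm (Q z))\<^sup>2 / lam z = sph_density G z" "1 - norm (E z) / lam z = (height (G z))\<^sup>2"
proof -
  have A: "A z \<noteq> 0" "Q z = deriv G z * A z" "E z = (A z * G z)\<^sup>2"
    and l: "lam z = 1 / 4 * (norm (A z))\<^sup>2 * (1 + (norm (G z))\<^sup>2)\<^sup>2"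
    using assms unfolding local_data_def by auto
  define s where "s = 1 + (norm (G z))\<^sup>2"
  have s: "s > 0" unfolding s_def by (rule norm_sq_add1_pos)
  have g: "(norm (G z))\<^sup>2 = s - 1" by (simp add: s_def)
  have a: "norm (A z) > 0" using A by simp
  show "lam z > 0" using a s by (simp add: l s_def[symmetric])
  show "(norm (Q z))\<^sup>2 / lam z = sph_density G z"
    using a s by (simp add: A(2) l sph_density_def s_def[symmetric] norm_mult power_mult_distrib)
  show "1 - norm (E z) / lam z = (height (G z))\<^sup>2"
    using a s by (simp add: A(3) l height_def norm_mult norm_power power_mult_distrib g add.commute)
       (simp add: field_simps power2_eq_square)
qed

text \<open>What remains of the surface once the universal cover is forgotten: Q and E are
  single-valued on M, whereas G and A exist only on discs and their choices on different discs are
  not coordinated. The number l is the area of (-K) g_M in units of the area of the sphere.\<close>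

locale reduced_surface =
  fixes lam :: "complex \<Rightarrow> real" and Q E :: "complex \<Rightarrow> complex" and l :: real and M :: "complex set"
  assumes M_def: "M = UNIV - {0, 1}"
    and ld: "\<And>z. z \<in> M \<Longrightarrow> \<exists>r G A. ball z r \<subseteq> M \<and> local_data lam Q E z r G A"
    and Q: "Q holomorphic_on M" and Q_nz: "\<exists>z\<in>M. Q z \<noteq> 0"
    and E: "E holomorphic_on M"
    and area_ai: "(\<lambda>z. (norm (Q z))\<^sup>2 / lam z) absolutely_integrable_on M"
    and area: "integral M (\<lambda>z. (norm (Q z))\<^sup>2 / lam z) = 4 * pi * l"
begin

abbreviation "D \<equiv> \<lambda>z. (norm (Q z))\<^sup>2 / lam z"
abbreviation "T \<equiv> \<lambda>z. 1 - norm (E z) / lam z"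

lemma open_M: "open M" unfolding M_def by (rule open_twice_punctured)

lemma connected_M: "connected M"
  unfolding M_def by (rule connected_open_delete_finite) auto

text \<open>Locally T is the square of a height, so its k-th moment I_k is a moment of order 2 k and
  \<open>moment_step\<close> gives (2 k + 1) I_k = (2 k + 3) I_(k + 1); the product is constant in
  k.\<close>

lemma moments_T:
  "(\<lambda>z. T z ^ k * D z) absolutely_integrable_on M \<and> real (2 * k + 1) * integral M (\<lambda>z. T z ^ k * D z) = 4 * pi * l"
proof (induction k)
  case 0 then show ?case using area_ai area by simp
next
  case (Suc k)
  have loc: "\<exists>r G. 0 < r \<and> ball z r \<subseteq> M \<and> G holomorphic_on ball z r \<and>
       (\<forall>w\<in>ball z r. D w = sph_density G w \<and> T w ^ Suc k = height (G w) ^ (2 * k + 2) \<and> T w ^ k = height (G w) ^ (2 * k))"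
    if z: "z \<in> M" for z
  proof -
    obtain r G A where ld: "ball z r \<subseteq> M" "local_data lam Q E z r G A" using ld[OF z] by blast
    then have "0 < r" "G holomorphic_on ball z r" by (auto simp: local_data_def)
    moreover have "T w ^ j = height (G w) ^ (2 * j)" if "w \<in> ball z r" for w j
      unfolding local_data_facts(3)[OF ld(2) that] by (simp add: power_mult)
    from this[of _ "Suc k"] this[of _ k]
    have "\<forall>w\<in>ball z r. D w = sph_density G w \<and> T w ^ Suc k = height (G w) ^ (2 * k + 2) \<and> T w ^ k = height (G w) ^ (2 * k)"
      using local_data_facts(2)[OF ld(2)] by simp
    ultimately show ?thesis using ld(1) by blast
  qed
  note ms = moment_step[OF area_ai[unfolded M_def] loc[unfolded M_def], folded M_def]
  have "(\<lambda>z. T z ^ Suc k * D z) absolutely_integrable_on M"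
    using ms(2) by blast
  moreover have "real (2 * k + 1) * integral M (\<lambda>z. T z ^ k * D z) = real (2 * k + 3) * integral M (\<lambda>z. T z ^ Suc k * D z)"
    using ms(3) by blast
  ultimately show ?case using Suc by (simp add: algebra_simps)
qed

lemma D_nonneg: "z \<in> M \<Longrightarrow> D z \<ge> 0"
proof -
  assume z: "z \<in> M"
  obtain r G A where g: "local_data lam Q E z r G A" using ld[OF z] by blast
  have "z \<in> ball z r" using g by (simp add: local_data_def)
  from local_data_facts(1)[OF g this] show ?thesis by simp
qed

lemma T_bounds: "z \<in> M \<Longrightarrow> 0 \<le> T z \<and> T z \<le> 1"
proof -
  assume z: "z \<in> M"
  obtain r G A where g: "local_data lam Q E z r G A" using ld[OF z] by blast
  have "z \<in> ball z r" using g by (simp add: local_data_def)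
  from local_data_facts(3)[OF g this] show ?thesis
    using abs_height_le_1[of "G z"] by (simp add: abs_square_le_1)
qed

lemma G_nonconstant:
  assumes "local_data lam Q E z r G A" "ball z r \<subseteq> M"
  shows "\<not> G constant_on ball z r"
proof
  assume c: "G constant_on ball z r"
  have r: "0 < r" using assms by (simp add: local_data_def)
  have Q0: "Q w = 0" if "w \<in> ball z r" for w
  proof -
    obtain c where c: "\<And>w. w \<in> ball z r \<Longrightarrow> G w = c" using c by (auto simp: constant_on_def)
    have "(G has_field_derivative 0) (at w)"
      using has_field_derivative_transform_within_open[OF DERIV_const open_ball that] c by metis
    then show ?thesis using assms(1) that DERIV_imp_deriv unfolding local_data_def by force
  qed
  have "Q w = 0" if "w \<in> M" for w
    by (rule analytic_continuation_open[of "ball z r" M Q "\<lambda>_. 0"])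
       (use r assms(2) Q0 Q open_M connected_M that in \<open>auto intro: ball_eq_empty\<close>)
  then show False using Q_nz by blast
qed

text \<open>The moments concentrate at the zeros of \<open>E\<close>, where the sphere is covered near the poles of the axis.\<close>

lemma zero_of_E:
  assumes a: "a \<in> M" "E a = 0"
  obtains m u \<rho> where "m \<ge> (1::nat)" "0 < \<rho>" "ball a \<rho> \<subseteq> M" "u holomorphic_on ball a \<rho>"
    "\<And>z. z \<in> ball a \<rho> \<Longrightarrow> E z = (z - a) ^ (2 * m) * u z" "\<And>z. z \<in> ball a \<rho> \<Longrightarrow> u z \<noteq> 0"
    "\<And>N \<delta>. open N \<Longrightarrow> a \<in> N \<Longrightarrow> 0 < \<delta> \<Longrightarrow>
      \<exists>k0. \<forall>k\<ge>k0. \<exists>W. open W \<and> W \<subseteq> N \<inter> M \<and> (\<lambda>z. T z ^ k * D z) absolutely_integrable_on W \<and>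
        real (2 * k + 1) * integral W (\<lambda>z. T z ^ k * D z) \<ge> 2 * pi * m - \<delta>"
proof -
  obtain r G A where ball: "ball a r \<subseteq> M" and g: "local_data lam Q E a r G A" using ld[OF a(1)] by blast
  have r: "0 < r" and G: "G holomorphic_on ball a r" and A: "A holomorphic_on ball a r" using g by (auto simp: local_data_def)
  have ar: "a \<in> ball a r" using r by simp
  \<comment> \<open>In \<open>local_data\<close> G is holomorphic, points over \<infinity> having
    been turned to 0, and A has no zeros. So zeros of E are zeros of G, of twice the order.\<close>
  have Ga: "G a = 0" using g ar a(2) unfolding local_data_def by fastforce
  obtain m g' \<rho> where m: "m \<ge> (1::nat)" and \<rho>: "0 < \<rho>" "ball a \<rho> \<subseteq> ball a r" and g': "g' holomorphic_on ball a \<rho>"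
    and Gg: "\<And>w. w \<in> ball a \<rho> \<Longrightarrow> G w = (w - a) ^ m * g' w" and g0: "\<And>w. w \<in> ball a \<rho> \<Longrightarrow> g' w \<noteq> 0"
    and area: "\<And>N \<delta>. open N \<Longrightarrow> a \<in> N \<Longrightarrow> 0 < \<delta> \<Longrightarrow>
      \<exists>k0. \<forall>k\<ge>k0. \<exists>W. open W \<and> W \<subseteq> N \<inter> ball a r \<and> (\<lambda>z. height (G z) ^ (2 * k) * sph_density G z) absolutely_integrable_on W \<and>
        real (2 * k + 1) * integral W (\<lambda>z. height (G z) ^ (2 * k) * sph_density G z) \<ge> 2 * pi * m - \<delta>"
    by (rule spherical_area_near_zero[OF G r Ga G_nonconstant[OF g ball]]) (rule that)
  show thesis
  proof (rule that[of m \<rho> "\<lambda>z. (A z * g' z)\<^sup>2"])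
    show "m \<ge> 1" "0 < \<rho>" "ball a \<rho> \<subseteq> M" using m \<rho> ball by auto
    show "(\<lambda>z. (A z * g' z)\<^sup>2) holomorphic_on ball a \<rho>"
      by (intro holomorphic_intros g' holomorphic_on_subset[OF A \<rho>(2)])
    show "E z = (z - a) ^ (2 * m) * (A z * g' z)\<^sup>2" "(A z * g' z)\<^sup>2 \<noteq> 0" if z: "z \<in> ball a \<rho>" for z
    proof -
      have "E z = (A z * G z)\<^sup>2" "A z \<noteq> 0" using g z \<rho>(2) unfolding local_data_def by auto
      then show "E z = (z - a) ^ (2 * m) * (A z * g' z)\<^sup>2" "(A z * g' z)\<^sup>2 \<noteq> 0"
        using Gg[OF z] g0[OF z] by (auto simp: power_mult_distrib power_mult[symmetric] mult_ac)
    qed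
    fix N \<delta> assume N: "open N" "a \<in> N" "0 < (\<delta>::real)"
    obtain k0 where k0: "\<And>k. k \<ge> k0 \<Longrightarrow> \<exists>W. open W \<and> W \<subseteq> N \<inter> ball a r \<and> (\<lambda>z. height (G z) ^ (2 * k) * sph_density G z) absolutely_integrable_on W \<and>
        real (2 * k + 1) * integral W (\<lambda>z. height (G z) ^ (2 * k) * sph_density G z) \<ge> 2 * pi * m - \<delta>"
      using area[OF N] by blast
    show "\<exists>k0. \<forall>k\<ge>k0. \<exists>W. open W \<and> W \<subseteq> N \<inter> M \<and> (\<lambda>z. T z ^ k * D z) absolutely_integrable_on W \<and>
        real (2 * k + 1) * integral W (\<lambda>z. T z ^ k * D z) \<ge> 2 * pi * m - \<delta>"
    proof (intro exI[of _ k0] allI impI)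
      fix k assume "k0 \<le> k"
      then obtain W where W: "open W" "W \<subseteq> N \<inter> ball a r" "(\<lambda>z. height (G z) ^ (2 * k) * sph_density G z) absolutely_integrable_on W"
        "real (2 * k + 1) * integral W (\<lambda>z. height (G z) ^ (2 * k) * sph_density G z) \<ge> 2 * pi * m - \<delta>"
        using k0 by blast
      have eq: "T z ^ k * D z = height (G z) ^ (2 * k) * sph_density G z" if "z \<in> W" for z
      proof -
        have z: "z \<in> ball a r" using W(2) that by blast
        show ?thesis unfolding local_data_facts(2,3)[OF g z] by (simp add: power_mult)
      qed
      have ai: "(\<lambda>z. T z ^ k * D z) absolutely_integrable_on W"
        by (rule absolutely_integrable_spike[OF W(3) negligible_empty]) (use eq in auto)
      have "integral W (\<lambda>z. T z ^ k * D z) = integral W (\<lambda>z. height (G z) ^ (2 * k) * sph_density G z)"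
        by (rule integral_cong) (rule eq)
      then show "\<exists>W. open W \<and> W \<subseteq> N \<inter> M \<and> (\<lambda>z. T z ^ k * D z) absolutely_integrable_on W \<and>
          real (2 * k + 1) * integral W (\<lambda>z. T z ^ k * D z) \<ge> 2 * pi * m - \<delta>"
        using W ai ball by (intro exI[of _ W]) auto
    qed
  qed
qed

lemma integral_le_total:
  assumes "W \<subseteq> M" "(\<lambda>z. T z ^ k * D z) absolutely_integrable_on W"
  shows "real (2 * k + 1) * integral W (\<lambda>z. T z ^ k * D z) \<le> 4 * pi * l"
proof -
  have "integral W (\<lambda>z. T z ^ k * D z) \<le> integral M (\<lambda>z. T z ^ k * D z)"
  proof (rule integral_subset_le[OF assms(1)])
    show "(\<lambda>z. T z ^ k * D z) integrable_on W" "(\<lambda>z. T z ^ k * D z) integrable_on M"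
      using assms(2) moments_T[of k] by (auto intro: set_lebesgue_integral_eq_integral(1))
    show "\<forall>z\<in>M. 0 \<le> T z ^ k * D z"
      using T_bounds D_nonneg by (intro ballI mult_nonneg_nonneg zero_le_power) auto
  qed
  then have "real (2 * k + 1) * integral W (\<lambda>z. T z ^ k * D z) \<le> real (2 * k + 1) * integral M (\<lambda>z. T z ^ k * D z)"
    by (intro mult_left_mono) auto
  then show ?thesis using moments_T[of k] by linarith
qed

text \<open>The contribution 2 pi m of the zero is at most 4 pi l < 4 pi, which leaves only m =
  1.\<close>

lemma zero_of_E_simple:
  assumes l: "l < 1" and a: "a \<in> M" "E a = 0"
  obtains u \<rho> where "0 < \<rho>" "ball a \<rho> \<subseteq> M" "u holomorphic_on ball a \<rho>"
    "\<And>z. z \<in> ball a \<rho> \<Longrightarrow> E z = (z - a)\<^sup>2 * u z" "\<And>z. z \<in> ball a \<rho> \<Longrightarrow> u z \<noteq> 0"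
proof (rule zero_of_E[OF a])
  fix m u \<rho>
  assume *: "m \<ge> (1::nat)" "0 < \<rho>" "ball a \<rho> \<subseteq> M" "u holomorphic_on ball a \<rho>"
    "\<And>z. z \<in> ball a \<rho> \<Longrightarrow> E z = (z - a) ^ (2 * m) * u z" "\<And>z. z \<in> ball a \<rho> \<Longrightarrow> u z \<noteq> 0"
    and area: "\<And>N \<delta>. open N \<Longrightarrow> a \<in> N \<Longrightarrow> 0 < \<delta> \<Longrightarrow>
      \<exists>k0. \<forall>k\<ge>k0. \<exists>W. open W \<and> W \<subseteq> N \<inter> M \<and> (\<lambda>z. T z ^ k * D z) absolutely_integrable_on W \<and>
        real (2 * k + 1) * integral W (\<lambda>z. T z ^ k * D z) \<ge> 2 * pi * m - \<delta>"
  have "2 * pi * m - \<delta> \<le> 4 * pi * l" if "\<delta> > 0" for \<delta>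
  proof -
    obtain k0 where "\<forall>k\<ge>k0. \<exists>W. open W \<and> W \<subseteq> UNIV \<inter> M \<and> (\<lambda>z. T z ^ k * D z) absolutely_integrable_on W \<and>
        real (2 * k + 1) * integral W (\<lambda>z. T z ^ k * D z) \<ge> 2 * pi * m - \<delta>" using area[OF open_UNIV UNIV_I \<open>\<delta> > 0\<close>] by blast
    then obtain W where "W \<subseteq> M" "(\<lambda>z. T z ^ k0 * D z) absolutely_integrable_on W"
        "real (2 * k0 + 1) * integral W (\<lambda>z. T z ^ k0 * D z) \<ge> 2 * pi * m - \<delta>" by auto
    then show ?thesis using integral_le_total[of W k0] by linarith
  qed
  then have "2 * pi * m \<le> 4 * pi * l"
    by (meson diff_le_eq field_le_epsilon)
  also have "4 * pi * l < 2 * pi * 2" using l by simp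
  finally have "m < 2" by simp
  then have "m = 1" using *(1) by simp
  then show thesis using that[OF *(2,3,4)] *(5,6) by (simp add: power2_eq_square)
qed

text \<open>Two zeros would contribute 2 pi each on disjoint neighbourhoods, for all large k and so
  for a common one, and 4 pi exceeds 4 pi l.\<close>

lemma zero_of_E_unique:
  assumes l: "l < 1" and a: "a \<in> M" "E a = 0" and b: "b \<in> M" "E b = 0"
  shows "a = b"
proof (rule ccontr)
  assume "a \<noteq> b"
  then obtain Na Nb where N: "open Na" "open Nb" "a \<in> Na" "b \<in> Nb" "Na \<inter> Nb = {}"
    using hausdorff[of a b] by blast
  have area: "\<exists>k0. \<forall>k\<ge>k0. \<exists>W. open W \<and> W \<subseteq> N \<inter> M \<and> (\<lambda>z. T z ^ k * D z) absolutely_integrable_on W \<and>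
        real (2 * k + 1) * integral W (\<lambda>z. T z ^ k * D z) \<ge> 2 * pi - \<delta>"
    if "c \<in> M" "E c = 0" "open N" "c \<in> N" "\<delta> > 0" for c N \<delta>
  proof (rule zero_of_E[OF that(1,2)])
    fix m :: nat assume m: "m \<ge> 1"
      and area: "\<And>N \<delta>. open N \<Longrightarrow> c \<in> N \<Longrightarrow> 0 < \<delta> \<Longrightarrow>
      \<exists>k0. \<forall>k\<ge>k0. \<exists>W. open W \<and> W \<subseteq> N \<inter> M \<and> (\<lambda>z. T z ^ k * D z) absolutely_integrable_on W \<and>
        real (2 * k + 1) * integral W (\<lambda>z. T z ^ k * D z) \<ge> 2 * pi * m - \<delta>"
    have "2 * pi * m - \<delta> \<ge> 2 * pi - \<delta>" using m by simp
    then show ?thesis using area[OF that(3,4,5)] by (meson order_trans)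
  qed
  have "4 * pi - \<delta> \<le> 4 * pi * l" if "\<delta> > 0" for \<delta>
  proof -
    obtain ka kb where k: "\<And>k. k \<ge> ka \<Longrightarrow> \<exists>W. open W \<and> W \<subseteq> Na \<inter> M \<and> (\<lambda>z. T z ^ k * D z) absolutely_integrable_on W \<and>
        real (2 * k + 1) * integral W (\<lambda>z. T z ^ k * D z) \<ge> 2 * pi - \<delta> / 2"
      "\<And>k. k \<ge> kb \<Longrightarrow> \<exists>W. open W \<and> W \<subseteq> Nb \<inter> M \<and> (\<lambda>z. T z ^ k * D z) absolutely_integrable_on W \<and>
        real (2 * k + 1) * integral W (\<lambda>z. T z ^ k * D z) \<ge> 2 * pi - \<delta> / 2"
      using area[OF a N(1,3), of "\<delta> / 2"] area[OF b N(2,4), of "\<delta> / 2"] \<open>\<delta> > 0\<close> by auto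
    define k where "k = max ka kb"
    have kk: "k \<ge> ka" "k \<ge> kb" by (simp_all add: k_def)
    obtain Wa where Wa: "open Wa" "Wa \<subseteq> Na \<inter> M" "(\<lambda>z. T z ^ k * D z) absolutely_integrable_on Wa"
        "real (2 * k + 1) * integral Wa (\<lambda>z. T z ^ k * D z) \<ge> 2 * pi - \<delta> / 2"
      using k(1)[OF kk(1)] by (elim exE conjE) (rule that)
    obtain Wb where Wb: "open Wb" "Wb \<subseteq> Nb \<inter> M" "(\<lambda>z. T z ^ k * D z) absolutely_integrable_on Wb"
        "real (2 * k + 1) * integral Wb (\<lambda>z. T z ^ k * D z) \<ge> 2 * pi - \<delta> / 2"
      using k(2)[OF kk(2)] by (elim exE conjE) (rule that)
    note W = Wa Wb
    have d: "Wa \<inter> Wb = {}" using W N by blast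
    have i: "((\<lambda>z. T z ^ k * D z) has_integral integral Wa (\<lambda>z. T z ^ k * D z) + integral Wb (\<lambda>z. T z ^ k * D z)) (Wa \<union> Wb)"
      by (rule has_integral_Un) (use W d in \<open>auto intro: integrable_integral set_lebesgue_integral_eq_integral(1)\<close>)
    have "(\<lambda>z. T z ^ k * D z) absolutely_integrable_on (Wa \<union> Wb)"
      using W by (intro absolutely_integrable_Un) auto
    moreover have "Wa \<union> Wb \<subseteq> M" using W by blast
    ultimately have "real (2 * k + 1) * (integral Wa (\<lambda>z. T z ^ k * D z) + integral Wb (\<lambda>z. T z ^ k * D z)) \<le> 4 * pi * l"
      using integral_le_total[of "Wa \<union> Wb" k] unfolding integral_unique[OF i] by blast
    moreover have "real (2 * k + 1) * (integral Wa (\<lambda>z. T z ^ k * D z) + integral Wb (\<lambda>z. T z ^ k * D z))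
      = real (2 * k + 1) * integral Wa (\<lambda>z. T z ^ k * D z) + real (2 * k + 1) * integral Wb (\<lambda>z. T z ^ k * D z)"
      by (rule distrib_left)
    ultimately show ?thesis using W(4,8) by linarith
  qed
  then have "4 * pi \<le> 4 * pi * l"
    by (meson diff_le_eq field_le_epsilon)
  then show False using l by simp
qed

end

section \<open>Growth at an end\<close>

text \<open>The Cayley transform N maps the right half-plane to the unit disc and F c to 0. Cauchy's
  inequality on the disc of half the radius bounds its derivative by 2 / R, and the derivative of N
  at c is that of F divided by 2 Re (F c).\<close>

lemma norm_deriv_le_Re:
  assumes F: "F holomorphic_on ball c R" and R: "0 < R" and pos: "\<And>w. w \<in> ball c R \<Longrightarrow> 0 < Re (F w)"
  shows "norm (deriv F c) \<le> 4 * Re (F c) / R"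
proof -
  define N where "N w = (F w - F c) / (F w + cnj (F c))" for w
  have c: "c \<in> ball c R" using R by simp
  have nz: "F w + cnj (F c) \<noteq> 0" if "w \<in> ball c R" for w
    using pos[OF that] pos[OF c] by (auto simp: complex_eq_iff)
  have le: "norm (N w) \<le> 1" if w: "w \<in> ball c R" for w
  proof -
    have "(norm (F w - F c))\<^sup>2 \<le> (norm (F w + cnj (F c)))\<^sup>2"
      using mult_pos_pos[OF pos[OF w] pos[OF c]]
      unfolding cmod_power2 by (simp add: power2_eq_square algebra_simps)
    then have "norm (F w - F c) \<le> norm (F w + cnj (F c))" using power2_le_imp_le norm_ge_zero by blast
    then show ?thesis using nz[OF w] by (simp add: N_def norm_divide divide_simps)
  qed
  have hol: "N holomorphic_on ball c R" unfolding N_def using nz by (intro holomorphic_intros F) auto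
  have sub: "cball c (R / 2) \<subseteq> ball c R" using R by (auto simp: subset_iff)
  have "norm ((deriv ^^ 1) N c) \<le> fact 1 * 1 / (R / 2) ^ 1"
  proof (rule Cauchy_inequality)
    show "N holomorphic_on ball c (R / 2)" "continuous_on (cball c (R / 2)) N"
      using holomorphic_on_subset[OF hol] sub by (auto intro!: holomorphic_on_imp_continuous_on ball_subset_cball[THEN subset_trans])
    show "norm (N x) \<le> 1" if "norm (c - x) = R / 2" for x
      using that R by (intro le) (simp add: dist_norm)
  qed (use R in auto)
  then have dN: "norm (deriv N c) \<le> 2 / R" by simp
  have "deriv N c = deriv F c / (2 * Re (F c))"
  proof (rule DERIV_imp_deriv)
    have "F c + cnj (F c) = 2 * Re (F c)" by (simp add: complex_add_cnj)
    then show "(N has_field_derivative deriv F c / (2 * Re (F c))) (at c)"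
      unfolding N_def using holomorphic_derivI[OF F open_ball c] nz[OF c]
      by (auto intro!: derivative_eq_intros)
  qed
  then have "norm (deriv F c) = norm (deriv N c) * (2 * Re (F c))"
    using pos[OF c] by (simp add: norm_divide norm_mult)
  also have "\<dots> \<le> 2 / R * (2 * Re (F c))" using dN pos[OF c] by (intro mult_right_mono) auto
  finally show ?thesis by simp
qed

text \<open>The Gudermannian function. In the logarithmic coordinate x + \<i> y on the sphere the
  round metric has conformal factor 1 / cosh x, and \<open>arctan (sinh x)\<close> is the
  latitude.\<close>

lemma arctan_sinh_deriv: "((\<lambda>x. arctan (sinh x)) has_real_derivative 1 / cosh x) (at x)"
proof -
  have "1 + (sinh x)\<^sup>2 = (cosh x)\<^sup>2" by (simp add: cosh_square_eq)
  then show ?thesis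
    by (auto intro!: derivative_eq_intros simp: power2_eq_square inverse_eq_divide)
qed

text \<open>Courant--Lebesgue: a vertical segment of small energy carries a small oscillation.\<close>

lemma oscillation_on_segment:
  fixes f :: "complex \<Rightarrow> complex"
  assumes f: "f holomorphic_on S" "open S" and seg: "\<And>t. 0 \<le> t \<Longrightarrow> t \<le> 2 * pi \<Longrightarrow> Complex s t \<in> S"
    and J: "integral {0..2 * pi} (\<lambda>t. (norm (deriv f (Complex s t)))\<^sup>2 / (cosh (Re (f (Complex s t))))\<^sup>2) \<le> 1 / (8 * pi)"
    and t: "0 \<le> t1" "t1 \<le> 2 * pi" "0 \<le> t2" "t2 \<le> 2 * pi" and neg: "Re (f (Complex s t1)) \<le> 0"
  shows "Re (f (Complex s t2)) \<le> arsinh (tan (1 / 2))"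
proof -
  \<comment> \<open>The latitude of the point with logarithmic coordinate f; \<rho> is the spherical
    speed along the segment and bounds its rate of change.\<close>
  define \<theta> where "\<theta> t = arctan (sinh (Re (f (Complex s t))))" for t
  define \<rho> where "\<rho> t = norm (deriv f (Complex s t)) / cosh (Re (f (Complex s t)))" for t
  define \<theta>' where "\<theta>' t = 1 / cosh (Re (f (Complex s t))) * Re (deriv f (Complex s t) * \<i>)" for t
  have cosh0: "cosh x > 0" for x :: real by simp
  have der: "(\<theta> has_real_derivative \<theta>' t) (at t)" if "0 \<le> t" "t \<le> 2 * pi" for t
  proof -
    have "((\<lambda>t. Complex s t) has_vector_derivative \<i>) (at t)"
      unfolding Complex_eq by (auto intro!: derivative_eq_intros)
    moreover have "(f has_field_derivative deriv f (Complex s t)) (at (Complex s t))"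
      by (rule holomorphic_derivI[OF f seg[OF that]])
    ultimately have "((\<lambda>t. f (Complex s t)) has_vector_derivative \<i> * deriv f (Complex s t)) (at t)"
      using field_vector_diff_chain_at[of "\<lambda>t. Complex s t" \<i> t f] by (simp add: o_def)
    then have "((\<lambda>t. Re (f (Complex s t))) has_real_derivative Re (deriv f (Complex s t) * \<i>)) (at t)"
      using bounded_linear.has_vector_derivative[OF bounded_linear_Re, of "\<lambda>t. f (Complex s t)"]
      by (metis has_real_derivative_iff_has_vector_derivative mult.commute)
    then show ?thesis unfolding \<theta>_def \<theta>'_def by (rule DERIV_chain2[OF arctan_sinh_deriv])
  qed
  have le: "\<bar>\<theta>' t\<bar> \<le> \<rho> t" for t
    using abs_Re_le_cmod[of "deriv f (Complex s t) * \<i>"]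
    by (simp add: \<theta>'_def \<rho>_def abs_mult norm_mult divide_right_mono)
  \<comment> \<open>The arithmetic-geometric mean inequality \<rho> \<le> (4 pi \<rho>^2 + 1 / (4
    pi)) / 2. With the weight 4 pi, energy at most 1 / (8 pi) and length 2 pi, both terms integrate
    to at most 1/2, so the latitude varies by at most 1/2 < pi / 2 and cannot reach the
    pole.\<close>
  define e where "e t = (4 * pi * ((norm (deriv f (Complex s t)))\<^sup>2 / (cosh (Re (f (Complex s t))))\<^sup>2) + 1 / (4 * pi)) / 2" for t
  have le2: "\<bar>\<theta>' t\<bar> \<le> e t" for t
  proof -
    have "0 \<le> (4 * pi * \<rho> t - 1)\<^sup>2 / (8 * pi)" by simp
    also have "\<dots> = (4 * pi * (\<rho> t)\<^sup>2 + 1 / (4 * pi)) / 2 - \<rho> t"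
      by (simp add: power2_eq_square field_simps)
    finally show ?thesis using le[of t] by (simp add: e_def \<rho>_def power_divide)
  qed
  have cs: "continuous_on {0..2 * pi} (\<lambda>t. Complex s t)" unfolding Complex_eq by (intro continuous_intros)
  have c1: "continuous_on {0..2 * pi} (\<lambda>t. f (Complex s t))"
    by (rule continuous_on_compose2[OF holomorphic_on_imp_continuous_on[OF f(1)] cs]) (use seg in auto)
  have c2: "continuous_on {0..2 * pi} (\<lambda>t. deriv f (Complex s t))"
    by (rule continuous_on_compose2[OF holomorphic_on_imp_continuous_on[OF holomorphic_deriv[OF f]] cs]) (use seg in auto)
  have cosh_cont: "continuous_on {0..2 * pi} (\<lambda>t. cosh (Re (f (Complex s t))))"
    by (intro continuous_on_cosh continuous_intros c1)
  have ce: "continuous_on {0..2 * pi} (\<lambda>t. (norm (deriv f (Complex s t)))\<^sup>2 / (cosh (Re (f (Complex s t))))\<^sup>2)"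
    using cosh0 by (intro continuous_intros cosh_cont c2) (auto simp: less_imp_neq[symmetric])
  have ie: "e integrable_on {0..2 * pi}" unfolding e_def[abs_def]
    by (intro integrable_continuous_interval continuous_intros ce) auto
  have inte: "integral {0..2 * pi} e \<le> 1 / 2"
  proof -
    define W where "W t = (norm (deriv f (Complex s t)))\<^sup>2 / (cosh (Re (f (Complex s t))))\<^sup>2" for t
    have i: "W integrable_on {0..2 * pi}"
      unfolding W_def by (rule integrable_continuous_interval[OF ce])
    have k: "((\<lambda>x. 1 / (4 * pi)) has_integral 1 / 2) {0..2 * pi}"
      using has_integral_const_real[of "1 / (4 * pi)" 0 "2 * pi"] by simp
    have "((\<lambda>t. (4 * pi * W t + 1 / (4 * pi)) / 2) has_integral (4 * pi * integral {0..2 * pi} W + 1 / 2) / 2) {0..2 * pi}"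
      by (intro has_integral_divide has_integral_add has_integral_mult_right integrable_integral[OF i] k)
    then have "integral {0..2 * pi} e = (4 * pi * integral {0..2 * pi} W + 1 / 2) / 2"
      unfolding e_def[abs_def] W_def[abs_def] by (rule integral_unique)
    also have "\<dots> \<le> (4 * pi * (1 / (8 * pi)) + 1 / 2) / 2"
      using J unfolding W_def by (intro divide_right_mono add_mono mult_left_mono) auto
    finally show ?thesis by simp
  qed
  have e0: "e t \<ge> 0" for t using le2[of t] by linarith
  have key: "\<theta> t2 - \<theta> t1 \<le> 1 / 2"
  proof -
    have bd: "\<bar>\<theta> b - \<theta> a\<bar> \<le> 1 / 2" if ab: "0 \<le> a" "a \<le> b" "b \<le> 2 * pi" for a b
    proof -
      have fi: "(\<theta>' has_integral (\<theta> b - \<theta> a)) {a..b}"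
        using ab by (intro fundamental_theorem_of_calculus)
          (use der in \<open>auto simp: has_real_derivative_iff_has_vector_derivative[symmetric] intro: has_field_derivative_at_within\<close>)
      have ie': "e integrable_on {a..b}" using integrable_on_subinterval[OF ie] ab by auto
      have "norm (integral {a..b} \<theta>') \<le> integral {a..b} e"
        using fi le2 by (intro integral_norm_bound_integral ie') (auto simp: has_integral_iff)
      also have "\<dots> \<le> integral {0..2 * pi} e"
        using ab e0 by (intro integral_subset_le ie ie') auto
      finally show ?thesis using inte fi by (simp add: has_integral_iff)
    qed
    show ?thesis
    proof (cases "t1 \<le> t2")
      case True then show ?thesis using bd[OF t(1) True t(4)] by linarith
    next
      case False
      then have "t2 \<le> t1" by simp
      from bd[OF t(3) this t(2)] show ?thesis by linarith
    qed
  qed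
  have "\<theta> t1 \<le> 0" using neg by (simp add: \<theta>_def)
  then have "arctan (sinh (Re (f (Complex s t2)))) \<le> 1 / 2" using key unfolding \<theta>_def by linarith
  then have "tan (arctan (sinh (Re (f (Complex s t2))))) \<le> tan (1 / 2)"
  proof -
    have "- (pi / 2) < 1 / 2" "1 / 2 < pi / 2" using pi_gt3 by linarith+
    from tan_monotone'[OF this arctan_lbound arctan_ubound, of "sinh (Re (f (Complex s t2)))"]
    show ?thesis using \<open>arctan (sinh (Re (f (Complex s t2)))) \<le> 1 / 2\<close> by linarith
  qed
  then have "sinh (Re (f (Complex s t2))) \<le> tan (1 / 2)" by (simp add: tan_arctan)
  also have "\<dots> = sinh (arsinh (tan (1 / 2)))" by simp
  finally show ?thesis unfolding sinh_real_le_iff .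
qed

text \<open>Fubini on a half-strip of infinite length: if every segment to the left of s1 carried
  more than \<eta>, the total could not be finite.\<close>

lemma small_energy_segment:
  fixes D :: "complex \<Rightarrow> real" and s0 :: real
  defines "R \<equiv> {w. Re w < s0 \<and> 0 < Im w \<and> Im w < 2 * pi}"
  assumes cont: "continuous_on {w. Re w < s0} D" and ai: "D absolutely_integrable_on R"
    and nonneg: "\<And>w. Re w < s0 \<Longrightarrow> D w \<ge> 0" and \<eta>: "\<eta> > 0" and s1: "s1 \<le> s0"
  shows "\<exists>s<s1. integral {0..2 * pi} (\<lambda>t. D (Complex s t)) \<le> \<eta>"
proof (rule ccontr)
  assume "\<not> ?thesis"
  then have big: "integral {0..2 * pi} (\<lambda>t. D (Complex s t)) > \<eta>" if "s < s1" for s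
    using that by force
  have oR: "open R" unfolding R_def by (intro open_Collect_conj open_Collect_less continuous_intros)
  have cR: "continuous_on R D" by (rule continuous_on_subset[OF cont]) (auto simp: R_def)
  define h where "h z = indicator R z * D z" for z
  have ih: "integrable lborel h"
    using absolutely_integrable_on_lborel(1)[OF cR] ai oR by (simp add: h_def[abs_def])
  define F where "F x = (\<integral>y. h (Complex x y) \<partial>lborel)" for x
  have iF: "integrable lborel F" using integral_complex_iterated(1)[OF ih] by (simp add: F_def[abs_def])
  have h0: "h z \<ge> 0" for z using nonneg by (auto simp: h_def R_def indicator_def)
  have F0: "F x \<ge> 0" for x unfolding F_def using h0 by (intro integral_nonneg_AE) auto
  have Fbig: "F x > \<eta>" if x: "x < s1" for x
  proof -
    have c: "continuous_on {0..2 * pi} (\<lambda>t. D (Complex x t))"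
      using x s1 by (intro continuous_on_compose2[OF cont]) (auto simp: Complex_eq intro!: continuous_intros)
    have "F x = (\<integral>y. indicator {0..2 * pi} y * D (Complex x y) \<partial>lborel)"
      unfolding F_def
    proof (rule integral_cong_AE)
      have "AE y in lborel. y \<noteq> 0 \<and> y \<noteq> 2 * pi" by (intro AE_conjI AE_lborel_singleton)
      then show "AE y in lborel. h (Complex x y) = indicator {0..2 * pi} y * D (Complex x y)"
        by eventually_elim (use x s1 in \<open>auto simp: h_def R_def indicator_def\<close>)
      have [measurable]: "h \<in> borel_measurable borel" using ih by auto
      have [measurable]: "(\<lambda>y. Complex x y) \<in> borel_measurable borel"
        by (intro borel_measurable_continuous_onI) (auto simp: Complex_eq intro!: continuous_intros)
      show "(\<lambda>y. h (Complex x y)) \<in> borel_measurable lborel" by measurable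
      show "(\<lambda>y. indicator {0..2 * pi} y * D (Complex x y)) \<in> borel_measurable lborel"
        using borel_measurable_continuous_on_indicator[OF _ c] by simp
    qed
    also have "\<dots> = integral {0..2 * pi} (\<lambda>t. D (Complex x t))"
    proof -
      have "set_integrable lborel {0..2 * pi} (\<lambda>t. D (Complex x t))"
        by (rule borel_integrable_atLeastAtMost') (rule c)
      from set_borel_integral_eq_integral(2)[OF this] show ?thesis
        by (simp add: set_lebesgue_integral_def)
    qed
    finally show ?thesis using big[OF x] by simp
  qed
  define I where "I = (\<integral>x. F x \<partial>lborel)"
  \<comment> \<open>The n unit intervals to the left of s1 contribute at least \<eta> each.\<close>
  have "real n * \<eta> \<le> I" for n
  proof -
    have i: "integrable lborel (\<lambda>x. indicator {s1 - n..<s1} x * \<eta>)"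
      by (intro integrable_mult_left integrable_real_indicator) auto
    have "(\<integral>x. indicator {s1 - n..<s1} x * \<eta> \<partial>lborel) \<le> I"
      unfolding I_def
      by (rule integral_mono[OF i iF]) (use Fbig F0 \<eta> in \<open>auto simp: indicator_def intro: less_imp_le\<close>)
    then show ?thesis by simp
  qed
  then show False using reals_Archimedean3[OF \<eta>] by (metis not_less)
qed

section \<open>Harmonic functions on a half-plane, periodic up to sign\<close>

lemma periodic_reduce:
  fixes u :: "complex \<Rightarrow> real"
  assumes per: "\<And>w. Re w < s0 \<Longrightarrow> u (w + of_real c * \<i>) = u w" and c: "c > 0" and w: "Re w < s0"
  obtains t where "0 \<le> t" "t \<le> c" "u (Complex (Re w) t) = u w"
proof -
  have nat: "u (w + of_real (real n * c) * \<i>) = u w" if "Re w < s0" for n w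
    using that
  proof (induction n)
    case (Suc n)
    have "u (w + of_real (real (Suc n) * c) * \<i>) = u ((w + of_real (real n * c) * \<i>) + of_real c * \<i>)"
      by (simp add: algebra_simps)
    also have "\<dots> = u w" using per[of "w + of_real (real n * c) * \<i>"] Suc by simp
    finally show ?case .
  qed simp
  have int: "u (w + of_real (of_int n * c) * \<i>) = u w" for n :: int
  proof (cases "n \<ge> 0")
    case True
    then show ?thesis using nat[OF w, of "nat n"] by simp
  next
    case False
    have "Re (w + of_real (of_int n * c) * \<i>) < s0" using w by simp
    from nat[OF this, of "nat (- n)"] show ?thesis using False by (simp add: algebra_simps)
  qed
  define n where "n = \<lfloor>Im w / c\<rfloor>"
  define t where "t = Im w - of_int n * c"
  have "of_int n \<le> Im w / c" "Im w / c < of_int n + 1" unfolding n_def by linarith+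
  then have "0 \<le> t" "t \<le> c" using c by (auto simp: t_def field_simps)
  moreover have "Complex (Re w) t = w + of_real (of_int (- n) * c) * \<i>"
    by (simp add: complex_eq_iff t_def)
  then have "u (Complex (Re w) t) = u w" by (simp only: int)
  ultimately show thesis by (rule that)
qed

lemma Re_zero_imp_constant:
  assumes g: "g holomorphic_on S" "open S" "connected S" and "\<And>w. w \<in> S \<Longrightarrow> Re (g w) = 0"
  shows "g constant_on S"
proof (rule ccontr)
  assume nc: "\<not> g constant_on S"
  then obtain w where w: "w \<in> S" by (auto simp: constant_on_def)
  have "open (g ` S)" by (rule open_mapping_thm[OF g g(2) order_refl nc])
  then obtain e where e: "e > 0" "ball (g w) e \<subseteq> g ` S" using w open_contains_ball by blast
  have "g w + of_real (e / 2) \<in> ball (g w) e" using e(1) by (simp add: dist_norm)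
  then have "g w + of_real (e / 2) \<in> g ` S" using e(2) by blast
  then obtain y where "y \<in> S" "g y = g w + of_real (e / 2)" by auto
  then show False using assms(4)[OF w] assms(4)[of y] e(1) by simp
qed

lemma cosh_sq_eq_imp:
  fixes x y :: real
  assumes "(cosh x)\<^sup>2 = (cosh y)\<^sup>2"
  shows "x = y \<or> x = - y"
proof -
  have "cosh x = cosh y" using assms by (simp add: power2_eq_iff_nonneg)
  then have "cosh \<bar>x\<bar> = cosh \<bar>y\<bar>" by (simp add: abs_if)
  then have "\<bar>x\<bar> = \<bar>y\<bar>"
    by (metis abs_ge_zero cosh_real_nonneg_less_iff less_irrefl linorder_neqE_linordered_idom)
  then show ?thesis by linarith
qed

lemma open_half_plane: "open {w. Re w < s}" "connected {w. Re w < s}" "convex {w. Re w < s}"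
  using convex_halfspace_Re_lt[of s] by (auto intro: convex_connected open_halfspace_Re_lt)

text \<open>Since cosh is even, it determines Re f only up to sign at each point. If the plus sign
  fails somewhere, the minus sign holds on a disc; there the sum of f and its translate has real
  part 0, so it is constant, and continuation spreads this to the half-plane. The minus sign is the
  case of a monodromy that exchanges the poles of the axis.\<close>

lemma Re_translate_dichotomy:
  assumes f: "f holomorphic_on {w. Re w < s0}"
    and per: "\<And>w. Re w < s0 \<Longrightarrow> (cosh (Re (f (w + of_real c * \<i>))))\<^sup>2 = (cosh (Re (f w)))\<^sup>2"
  shows "(\<forall>w. Re w < s0 \<longrightarrow> Re (f (w + of_real c * \<i>)) = Re (f w)) \<or>
    (\<forall>w. Re w < s0 \<longrightarrow> Re (f (w + of_real c * \<i>)) = - Re (f w))"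
proof -
  define \<Omega> where "\<Omega> = {w. Re w < s0}"
  note O = open_half_plane(1,2)[of s0, folded \<Omega>_def]
  define f1 where "f1 w = f (w + of_real c * \<i>)" for w
  have f: "f holomorphic_on \<Omega>" using f by (simp add: \<Omega>_def)
  have f1: "f1 holomorphic_on \<Omega>"
    unfolding f1_def by (rule holomorphic_on_compose_gen[OF _ f, unfolded o_def]) (auto simp: \<Omega>_def intro!: holomorphic_intros)
  have pm: "Re (f1 w) = Re (f w) \<or> Re (f1 w) = - Re (f w)" if "w \<in> \<Omega>" for w
    using cosh_sq_eq_imp[OF per, of w] that by (simp add: f1_def \<Omega>_def)
  have "\<forall>w\<in>\<Omega>. Re (f1 w) = - Re (f w)" if w1: "w1 \<in> \<Omega>" "Re (f1 w1) \<noteq> Re (f w1)" for w1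
  proof -
    define V where "V = {w \<in> \<Omega>. Re (f1 w) - Re (f w) \<in> - {0}}"
    have V: "open V" unfolding V_def
      by (rule continuous_open_preimage[OF _ O(1), unfolded vimage_def Int_def mem_Collect_eq])
         (auto intro!: continuous_intros holomorphic_on_imp_continuous_on f f1)
    have "w1 \<in> V" using w1 by (simp add: V_def)
    then obtain e where e: "e > 0" "ball w1 e \<subseteq> V" using V open_contains_ball by blast
    have sub: "ball w1 e \<subseteq> \<Omega>" using e by (auto simp: V_def)
    have h: "(\<lambda>w. f1 w + f w) holomorphic_on \<Omega>" by (intro holomorphic_intros f f1)
    have z: "Re (f1 w + f w) = 0" if "w \<in> ball w1 e" for w
    proof -
      have "w \<in> \<Omega>" "Re (f1 w) \<noteq> Re (f w)" using that e(2) by (auto simp: V_def)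
      then show ?thesis using pm by fastforce
    qed
    have "(\<lambda>w. f1 w + f w) constant_on ball w1 e"
      by (rule Re_zero_imp_constant[OF holomorphic_on_subset[OF h sub] open_ball connected_ball z])
    then obtain k where k: "\<And>w. w \<in> ball w1 e \<Longrightarrow> f1 w + f w = k" by (auto simp: constant_on_def)
    have all: "f1 w + f w = k" if "w \<in> \<Omega>" for w
      by (rule analytic_continuation_open[of "ball w1 e" \<Omega> "\<lambda>w. f1 w + f w" "\<lambda>_. k"])
         (use e sub O h k that in \<open>auto simp: ball_eq_empty\<close>)
    have "Re k = 0" using z[of w1] k[of w1] e(1) by simp
    then show ?thesis using all by (metis add_eq_0_iff2 plus_complex.simps(1))
  qed
  then show ?thesis unfolding f1_def \<Omega>_def by blast
qed

lemma Re_bounded_on_line: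
  assumes f: "f holomorphic_on {w. Re w < s0}" and s: "s < s0" and c: "c > 0"
    and per: "\<And>w. Re w < s0 \<Longrightarrow> Re (f (w + of_real c * \<i>)) = Re (f w)"
  obtains C where "\<And>t. \<bar>Re (f (Complex s t))\<bar> \<le> C"
proof -
  have "continuous_on {0..c} (\<lambda>t. Re (f (Complex s t)))"
    by (intro continuous_intros continuous_on_compose2[OF holomorphic_on_imp_continuous_on[OF f]])
       (use s in \<open>auto simp: Complex_eq intro!: continuous_intros\<close>)
  from compact_imp_bounded[OF compact_continuous_image[OF this compact_Icc]]
  obtain C where "\<forall>x\<in>(\<lambda>t. Re (f (Complex s t))) ` {0..c}. norm x \<le> C"
    unfolding bounded_iff by blast
  then have C: "\<bar>Re (f (Complex s t))\<bar> \<le> C" if "t \<in> {0..c}" for t using that by auto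
  show thesis
  proof (rule that[of C])
    fix t
    obtain t' where "0 \<le> t'" "t' \<le> c" "Re (f (Complex (Re (Complex s t)) t')) = Re (f (Complex s t))"
      by (rule periodic_reduce[where u = "\<lambda>w. Re (f w)" and w = "Complex s t", OF per c]) (use s in auto)
    then show "\<bar>Re (f (Complex s t))\<bar> \<le> C" using C[of t'] by simp
  qed
qed

text \<open>The maximum principle on an unbounded strip, where periodicity replaces compactness: the
  supremum is a maximum over one period rectangle.\<close>

lemma Re_bounded_above_between_lines:
  assumes f: "f holomorphic_on {w. Re w < s0}" and c: "c > 0"
    and per: "\<And>w. Re w < s0 \<Longrightarrow> Re (f (w + of_real c * \<i>)) = Re (f w)"
    and s: "s' < s" "s < s0"
    and b: "\<And>t. Re (f (Complex s' t)) \<le> C" "\<And>t. Re (f (Complex s t)) \<le> C"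
    and w: "s' \<le> Re w" "Re w \<le> s"
  shows "Re (f w) \<le> C"
proof -
  define V where "V = cbox (Complex s' 0) (Complex s c)"
  have V: "x \<in> V \<longleftrightarrow> s' \<le> Re x \<and> Re x \<le> s \<and> 0 \<le> Im x \<and> Im x \<le> c" for x
    by (auto simp: V_def in_cbox_complex_iff)
  have "continuous_on V (\<lambda>w. Re (f w))"
    by (intro continuous_intros holomorphic_on_imp_continuous_on holomorphic_on_subset[OF f]) (use s V in auto)
  moreover have "compact V" "V \<noteq> {}" using V[of "Complex s 0"] s c by (auto simp: V_def)
  ultimately have "\<exists>x\<in>V. \<forall>y\<in>V. Re (f y) \<le> Re (f x)"
    by (intro continuous_attains_sup)
  then obtain x where x: "x \<in> V" "\<And>y. y \<in> V \<Longrightarrow> Re (f y) \<le> Re (f x)" by blast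
  have all: "Re (f y) \<le> Re (f x)" if y: "s' \<le> Re y" "Re y \<le> s" for y
  proof -
    obtain t where "0 \<le> t" "t \<le> c" "Re (f (Complex (Re y) t)) = Re (f y)"
      by (rule periodic_reduce[where u = "\<lambda>w. Re (f w)" and w = y, OF per c]) (use s y in auto)
    then show ?thesis using x(2)[of "Complex (Re y) t"] y by (simp add: V)
  qed
  have line: "Re (f y) \<le> C" if "Re y = s' \<or> Re y = s" for y
    using that b[of "Im y"] by (metis complex_surj)
  have "Re (f x) \<le> C"
  proof (cases "Re x = s' \<or> Re x = s")
    case False
    define S where "S = {w. s' < Re w \<and> Re w < s}"
    have S: "open S" "connected S"
    proof -
      have eq: "S = {w. s' < Re w} \<inter> {w. Re w < s}" by (auto simp: S_def)
      show "open S" unfolding S_def by (intro open_Collect_conj open_Collect_less continuous_intros)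
      show "connected S" unfolding eq by (intro convex_connected convex_Int convex_halfspace_Re_lt convex_halfspace_Re_gt)
    qed
    have xS: "x \<in> S" using False x(1) by (auto simp: S_def V)
    have fS: "f holomorphic_on S"
      by (rule holomorphic_on_subset[OF f]) (use s in \<open>auto simp: S_def\<close>)
    \<comment> \<open>An interior maximum of Re f is one of |exp f|, so exp f is constant on the
      strip; by continuity the maximum is then also attained on the boundary line Re w = s, where C
      is a bound.\<close>
    have "(\<lambda>w. exp (f w)) constant_on S"
    proof (rule maximum_modulus_principle[OF _ S S(1) order_refl xS])
      show "(\<lambda>w. exp (f w)) holomorphic_on S" by (intro holomorphic_intros fS)
      show "norm (exp (f z)) \<le> norm (exp (f x))" if "z \<in> S" for z using all[of z] that by (simp add: S_def)
    qed
    then have const: "exp (f y) = exp (f x)" if "y \<in> S" for y using that xS by (auto simp: constant_on_def)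
    have "((\<lambda>r. Re (f (Complex r 0))) \<longlongrightarrow> Re (f (Complex s 0))) (at_left s)"
    proof -
      have "isCont f (Complex s 0)"
        using holomorphic_on_imp_continuous_on[OF f] open_half_plane(1)[of s0] s
        by (simp add: continuous_on_eq_continuous_at)
      then show ?thesis
        by (intro tendsto_Re isCont_tendsto_compose[of _ f]) (auto simp: Complex_eq intro!: tendsto_eq_intros)
    qed
    moreover have "\<forall>\<^sub>F r in at_left s. Re (f (Complex r 0)) = Re (f x)"
    proof -
      have "\<forall>\<^sub>F r in at_left s. r \<in> {s'<..<s}" using s by (intro eventually_at_left_real)
      then show ?thesis
      proof eventually_elim
        case (elim r)
        then have "exp (f (Complex r 0)) = exp (f x)" by (intro const) (simp add: S_def)
        then have "norm (exp (f (Complex r 0))) = norm (exp (f x))" by simp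
        then show ?case by simp
      qed
    qed
    ultimately have "((\<lambda>r. Re (f x)) \<longlongrightarrow> Re (f (Complex s 0))) (at_left s)"
      by (rule Lim_transform_eventually)
    then have "Re (f (Complex s 0)) = Re (f x)" by (simp add: tendsto_const_iff)
    then show ?thesis using b(2)[of 0] by simp
  qed (use line in blast)
  then show ?thesis using all[OF w] by linarith
qed

text \<open>Lines with Re f \<le> C0 recur arbitrarily far left, so the maximum principle between
  lines bounds Re f above on a half-plane. Then F = C + 1 - f has positive real part, and
  \<open>norm_deriv_le_Re\<close> on discs reaching to the line Re w = s1 is a Harnack inequality:
  its constant 4 makes Re F grow at most like the fourth power of the distance, and hence the
  derivative like the third.\<close>

lemma deriv_growth_one_sided:
  assumes f: "f holomorphic_on {w. Re w < s0}" and c: "c > 0"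
    and per: "\<And>w. Re w < s0 \<Longrightarrow> Re (f (w + of_real c * \<i>)) = Re (f w)"
    and seq: "\<And>s. s < s0 \<Longrightarrow> \<exists>s'<s. \<forall>t. Re (f (Complex s' t)) \<le> C0"
  obtains K where "K \<ge> 0" "\<And>w. Re w < s0 - 2 \<Longrightarrow> norm (deriv f w) \<le> K * (s0 - Re w) ^ 3"
proof -
  define s1 s2 where "s1 = s0 - 1" and "s2 = s0 - 2"
  obtain C1 where C1: "\<And>t. \<bar>Re (f (Complex s1 t))\<bar> \<le> C1"
    by (rule Re_bounded_on_line[OF f _ c per, of s1]) (auto simp: s1_def)
  obtain C2 where C2: "\<And>t. \<bar>Re (f (Complex s2 t))\<bar> \<le> C2"
    by (rule Re_bounded_on_line[OF f _ c per, of s2]) (auto simp: s2_def)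
  define C where "C = max C0 C1"
  have up: "Re (f w) \<le> C" if w: "Re w \<le> s1" for w
  proof -
    obtain s' where s': "s' < Re w" "\<And>t. Re (f (Complex s' t)) \<le> C0" using seq[of "Re w"] w by (auto simp: s1_def)
    show ?thesis
    proof (rule Re_bounded_above_between_lines[OF f c per, of s' s1])
      show "Re (f (Complex s' t)) \<le> C" for t using s'(2)[of t] by (simp add: C_def)
      show "Re (f (Complex s1 t)) \<le> C" for t using C1[of t] by (simp add: C_def)
    qed (use s' w in \<open>auto simp: s1_def\<close>)
  qed
  define F where "F w = C + 1 - f w" for w
  have F1: "Re (F w) \<ge> 1" if "Re w < s1" for w using up[of w] that by (simp add: F_def)
  have hF: "F holomorphic_on {w. Re w < s0}" unfolding F_def by (intro holomorphic_intros f)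
  have dF: "norm (deriv f w) = norm (deriv F w)" if "Re w < s0" for w
  proof -
    have "(F has_field_derivative - deriv f w) (at w)"
      unfolding F_def using holomorphic_derivI[OF f open_half_plane(1), of w] that by (auto intro!: derivative_eq_intros)
    then show ?thesis using DERIV_imp_deriv by fastforce
  qed
  have dle: "norm (deriv F w) \<le> 4 * Re (F w) / (s1 - Re w)" if w: "Re w < s1" for w
  proof -
    have Re: "Re x < s1" if "x \<in> ball w (s1 - Re w)" for x
      using that abs_Re_le_cmod[of "x - w"] by (simp add: dist_norm norm_minus_commute)
    show ?thesis
    proof (rule norm_deriv_le_Re)
      show "F holomorphic_on ball w (s1 - Re w)"
        by (rule holomorphic_on_subset[OF hF]) (use Re in \<open>force simp: s1_def\<close>)
      show "0 < Re (F x)" if "x \<in> ball w (s1 - Re w)" for x using F1[OF Re[OF that]] by simp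
    qed (use w in simp)
  qed
  \<comment> \<open>A bound for Re F on the line Re w = s2, whose distance from Re w = s1 is 1, so
    that the comparison with the fourth power of the distance starts with the factor 1.\<close>
  define B where "B = C + 1 + C2"
  have FB: "Re (F (Complex s2 t)) \<le> B" for t using C2[of t] by (simp add: F_def B_def abs_le_iff)
  have B1: "B \<ge> 1" using FB[of 0] F1[of "Complex s2 0"] by (simp add: s1_def s2_def)
  have growth: "Re (F (Complex s t)) \<le> B * (s1 - s) ^ 4" if s: "s < s2" for s t
  proof -
    define Y where "Y x = Re (F (Complex x t))" for x
    have dY: "(Y has_real_derivative Re (deriv F (Complex x t))) (at x)" if "x < s1" for x
    proof -
      have "((\<lambda>x. Complex x t) has_vector_derivative 1) (at x)"
        unfolding Complex_eq by (auto intro!: derivative_eq_intros)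
      moreover have "(F has_field_derivative deriv F (Complex x t)) (at (Complex x t))"
        by (rule holomorphic_derivI[OF hF open_half_plane(1)]) (use that in \<open>simp add: s1_def\<close>)
      ultimately have "((\<lambda>x. F (Complex x t)) has_vector_derivative 1 * deriv F (Complex x t)) (at x)"
        using field_vector_diff_chain_at[of "\<lambda>x. Complex x t" 1 x F] by (simp add: o_def)
      then show ?thesis unfolding Y_def
        using bounded_linear.has_vector_derivative[OF bounded_linear_Re]
        by (simp add: has_real_derivative_iff_has_vector_derivative)
    qed
    \<comment> \<open>The differential inequality that minus the derivative of Y is at most 4 Y /
      (s1 - x) says precisely that Y / (s1 - x)^4 is nondecreasing.\<close>
    have "Y s / (s1 - s) ^ 4 \<le> Y s2 / (s1 - s2) ^ 4"
    proof (rule DERIV_nonneg_imp_nondecreasing[where f = "\<lambda>x. Y x / (s1 - x) ^ 4"])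
      fix x assume x: "s \<le> x" "x \<le> s2"
      then have x1: "x < s1" by (simp add: s1_def s2_def)
      define d where "d = s1 - x"
      have d: "d > 0" using x1 by (simp add: d_def)
      have D: "((\<lambda>x. Y x / (s1 - x) ^ 4) has_real_derivative
         (Re (deriv F (Complex x t)) * (s1 - x) ^ 4 - Y x * (- (4 * (s1 - x) ^ 3))) / ((s1 - x) ^ 4 * (s1 - x) ^ 4)) (at x)"
        by (rule DERIV_divide[OF dY[OF x1]]) (use x1 in \<open>auto intro!: derivative_eq_intros\<close>)
      have "- Re (deriv F (Complex x t)) \<le> 4 * Y x / d"
        using dle[of "Complex x t"] x1 abs_Re_le_cmod[of "deriv F (Complex x t)"] by (simp add: Y_def d_def)
      then have "- Re (deriv F (Complex x t)) * d ^ 4 \<le> 4 * Y x / d * d ^ 4"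
        using d by (intro mult_right_mono) auto
      also have "\<dots> = 4 * Y x * d ^ 3" using d by (simp add: power_eq_if)
      finally have "0 \<le> (Re (deriv F (Complex x t)) * d ^ 4 - Y x * (- (4 * d ^ 3))) / (d ^ 4 * d ^ 4)"
        using d by (intro divide_nonneg_nonneg) (auto simp: algebra_simps)
      then show "\<exists>y. ((\<lambda>x. Y x / (s1 - x) ^ 4) has_real_derivative y) (at x) \<and> y \<ge> 0"
        using D unfolding d_def by blast
    qed (use s in auto)
    also have "\<dots> \<le> B" using FB[of t] by (simp add: Y_def s1_def s2_def)
    finally have "Y s / (s1 - s) ^ 4 \<le> B" .
    moreover have "(s1 - s) ^ 4 > 0" using s by (simp add: s1_def s2_def)
    ultimately show ?thesis by (simp add: Y_def divide_le_eq)
  qed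
  show thesis
  proof (rule that[of "4 * B"])
    fix w assume "Re w < s0 - 2"
    then have w: "Re w < s2" "Re w < s1" by (auto simp: s1_def s2_def)
    define d where "d = s1 - Re w"
    have d: "d > 0" "d \<le> s0 - Re w" using w by (auto simp: d_def s1_def)
    have "norm (deriv f w) \<le> 4 * Re (F w) / d" using dle[OF w(2)] dF[of w] w by (simp add: d_def s1_def)
    also have "\<dots> \<le> 4 * (B * d ^ 4) / d"
      using growth[OF w(1), of "Im w"] d by (intro divide_right_mono mult_left_mono) (auto simp: d_def)
    also have "\<dots> = 4 * B * d ^ 3" using d by (simp add: power_eq_if)
    also have "\<dots> \<le> 4 * B * (s0 - Re w) ^ 3" using B1 d by (intro mult_left_mono power_mono) auto
    finally show "norm (deriv f w) \<le> 4 * B * (s0 - Re w) ^ 3" .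
  qed (use B1 in simp)
qed

text \<open>Finite area gives vertical lines of small energy arbitrarily far left, and on each of
  them Re f is bounded by C0 from above or by - C0 from below. One of the two alternatives recurs
  arbitrarily far left; after replacing f by - f if necessary, \<open>deriv_growth_one_sided\<close>
  applies.\<close>

theorem deriv_growth_finite_area:
  assumes f: "f holomorphic_on {w. Re w < s0}"
    and per: "\<And>w. Re w < s0 \<Longrightarrow> (cosh (Re (f (w + of_real (2 * pi) * \<i>))))\<^sup>2 = (cosh (Re (f w)))\<^sup>2"
    and ai: "(\<lambda>w. (norm (deriv f w))\<^sup>2 / (cosh (Re (f w)))\<^sup>2) absolutely_integrable_on {w. Re w < s0 \<and> 0 < Im w \<and> Im w < 2 * pi}"
  obtains K where "K \<ge> 0" "\<And>w. Re w < s0 - 2 \<Longrightarrow> norm (deriv f w) \<le> K * (s0 - Re w) ^ 3"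
proof -
  define C0 where "C0 = arsinh (tan (1 / 2 :: real))"
  define u where "u w = Re (f w)" for w
  have C0: "C0 \<ge> 0" unfolding C0_def using tan_gt_zero[of "1/2"] pi_gt3 by (simp add: less_imp_le)
  have cosh0: "cosh x > 0" for x :: real by simp
  note dich = Re_translate_dichotomy[OF f per, folded u_def]
  have abs_per: "\<bar>u (w + of_real (2 * pi) * \<i>)\<bar> = \<bar>u w\<bar>" if "Re w < s0" for w using dich that by fastforce
  \<comment> \<open>Two turns around the puncture restore the sign, so the period 4 pi serves both
    cases of the dichotomy.\<close>
  have per4: "u (w + of_real (4 * pi) * \<i>) = u w" if w: "Re w < s0" for w
  proof -
    have "w + of_real (4 * pi) * \<i> = (w + of_real (2 * pi) * \<i>) + of_real (2 * pi) * \<i>"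
      by (simp add: algebra_simps)
    moreover have "Re (w + of_real (2 * pi) * \<i>) < s0" using w by simp
    ultimately show ?thesis using dich w by (metis minus_minus)
  qed
  have cont: "continuous_on {w. Re w < s0} (\<lambda>w. (norm (deriv f w))\<^sup>2 / (cosh (Re (f w)))\<^sup>2)"
    using cosh0 holomorphic_deriv[OF f open_half_plane(1)] f
    by (intro continuous_intros continuous_on_cosh holomorphic_on_imp_continuous_on) (auto simp: less_imp_neq[symmetric])
  have osc: "u (Complex s t2) \<le> C0 \<and> (- u (Complex s t1) \<le> 0 \<longrightarrow> True)"
    if "s < s0" "integral {0..2 * pi} (\<lambda>t. (norm (deriv f (Complex s t)))\<^sup>2 / (cosh (Re (f (Complex s t))))\<^sup>2) \<le> 1 / (8 * pi)"
      "0 \<le> t1" "t1 \<le> 2 * pi" "0 \<le> t2" "t2 \<le> 2 * pi" "u (Complex s t1) \<le> 0" for s t1 t2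
    using oscillation_on_segment[OF f open_half_plane(1) _ that(2-6)] that(1,7) by (simp add: u_def C0_def)
  have osc': "- u (Complex s t2) \<le> C0"
    if "s < s0" "integral {0..2 * pi} (\<lambda>t. (norm (deriv f (Complex s t)))\<^sup>2 / (cosh (Re (f (Complex s t))))\<^sup>2) \<le> 1 / (8 * pi)"
      "0 \<le> t1" "t1 \<le> 2 * pi" "0 \<le> t2" "t2 \<le> 2 * pi" "u (Complex s t1) \<ge> 0" for s t1 t2
  proof -
    have h: "(\<lambda>w. - f w) holomorphic_on {w. Re w < s0}" by (intro holomorphic_intros f)
    have d: "deriv (\<lambda>w. - f w) w = - deriv f w" if "Re w < s0" for w
      by (rule DERIV_imp_deriv) (use holomorphic_derivI[OF f open_half_plane(1), of w] that in \<open>auto intro!: derivative_eq_intros\<close>)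
    show ?thesis
      using oscillation_on_segment[OF h open_half_plane(1) _ _ that(3-6)] that(1,2,7) by (simp add: u_def C0_def d)
  qed
  have line: "(\<forall>t. u (Complex s t) \<le> C0) \<or> (\<forall>t. - u (Complex s t) \<le> C0)"
    if s: "s < s0" "integral {0..2 * pi} (\<lambda>t. (norm (deriv f (Complex s t)))\<^sup>2 / (cosh (Re (f (Complex s t))))\<^sup>2) \<le> 1 / (8 * pi)" for s
  proof -
    have p0: "(0::real) \<le> 2 * pi" "(0::real) \<le> 0" "2 * pi \<le> 2 * pi" by auto
    show ?thesis
      using dich
    proof
      assume P: "\<forall>w. Re w < s0 \<longrightarrow> u (w + of_real (2 * pi) * \<i>) = u w"
      have red: "\<exists>t'. 0 \<le> t' \<and> t' \<le> 2 * pi \<and> u (Complex s t') = u (Complex s t)" for t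
        using periodic_reduce[of s0 u "2 * pi" "Complex s t"] P s(1) by (metis complex.sel(1) pi_gt_zero zero_less_mult_iff zero_less_numeral)
      show ?thesis
      proof (cases "u (Complex s 0) \<le> 0")
        case True
        then show ?thesis using osc[OF s p0(2,1) _ _ ] red by metis
      next
        case False
        then show ?thesis using osc'[OF s p0(2,1)] red by (metis linear)
      qed
    next
      assume N: "\<forall>w. Re w < s0 \<longrightarrow> u (w + of_real (2 * pi) * \<i>) = - u w"
      have red: "\<exists>t'. 0 \<le> t' \<and> t' \<le> 2 * pi \<and> \<bar>u (Complex s t')\<bar> = \<bar>u (Complex s t)\<bar>" for t
        using periodic_reduce[of s0 "\<lambda>w. \<bar>u w\<bar>" "2 * pi" "Complex s t"] abs_per s(1) by (metis complex.sel(1) pi_gt_zero zero_less_mult_iff zero_less_numeral)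
      \<comment> \<open>When one turn changes the sign of u, the values at the two ends of the
        segment are opposite, so both one-sided bounds hold on this segment.\<close>
      have eq: "u (Complex s (2 * pi)) = - u (Complex s 0)"
      proof -
        have "Complex s (2 * pi) = Complex s 0 + of_real (2 * pi) * \<i>" by (simp add: complex_eq_iff)
        then show ?thesis using N s(1) by (metis complex.sel(1))
      qed
      have "u (Complex s t) \<le> C0 \<and> - u (Complex s t) \<le> C0" if "0 \<le> t" "t \<le> 2 * pi" for t
        using osc[OF s p0(2,1) that] osc[OF s p0(1,3) that] osc'[OF s p0(2,1) that] osc'[OF s p0(1,3) that] eq
        by linarith
      then have "\<bar>u (Complex s t)\<bar> \<le> C0" for t using red[of t] by (metis abs_le_iff)
      then show ?thesis by (metis abs_le_iff)
    qed
  qed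
  have ex: "\<exists>s<s1. (\<forall>t. u (Complex s t) \<le> C0) \<or> (\<forall>t. - u (Complex s t) \<le> C0)" if "s1 \<le> s0" for s1
    using small_energy_segment[OF cont ai _ _ that, of "1 / (8 * pi)"] line that by (auto simp: ) (meson less_le_trans)
  \<comment> \<open>Otherwise each alternative stops to the left of some abscissa, and
    \<open>ex\<close> to the left of both gives a contradiction.\<close>
  have "(\<forall>s<s0. \<exists>s'<s. \<forall>t. u (Complex s' t) \<le> C0) \<or> (\<forall>s<s0. \<exists>s'<s. \<forall>t. - u (Complex s' t) \<le> C0)"
  proof (rule ccontr)
    assume "\<not> ?thesis"
    then obtain a b where ab: "a < s0" "b < s0" "\<forall>s'<a. \<not> (\<forall>t. u (Complex s' t) \<le> C0)" "\<forall>s'<b. \<not> (\<forall>t. - u (Complex s' t) \<le> C0)"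
      by blast
    obtain s where "s < min a b" "(\<forall>t. u (Complex s t) \<le> C0) \<or> (\<forall>t. - u (Complex s t) \<le> C0)"
      using ex[of "min a b"] ab(1) by (auto simp: min_le_iff_disj)
    then show False using ab(3,4) by auto
  qed
  then show thesis
  proof
    assume "\<forall>s<s0. \<exists>s'<s. \<forall>t. u (Complex s' t) \<le> C0"
    then show thesis using deriv_growth_one_sided[OF f, of "4 * pi" C0] per4 that unfolding u_def by auto
  next
    assume a: "\<forall>s<s0. \<exists>s'<s. \<forall>t. - u (Complex s' t) \<le> C0"
    have h: "(\<lambda>w. - f w) holomorphic_on {w. Re w < s0}" by (intro holomorphic_intros f)
    have d: "deriv (\<lambda>w. - f w) w = - deriv f w" if "Re w < s0" for w
      by (rule DERIV_imp_deriv) (use holomorphic_derivI[OF f open_half_plane(1), of w] that in \<open>auto intro!: derivative_eq_intros\<close>)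
    obtain K where "K \<ge> 0" "\<And>w. Re w < s0 - 2 \<Longrightarrow> norm (deriv (\<lambda>w. - f w) w) \<le> K * (s0 - Re w) ^ 3"
      using deriv_growth_one_sided[OF h, of "4 * pi" C0] per4 a unfolding u_def by auto
    then show thesis using that[of K] d by simp
  qed
qed

section \<open>The logarithm of the developing map as a potential of the metric\<close>

lemma exp_ln_quotient_eq_cosh:
  assumes "x > (0::real)"
  shows "(1 + x\<^sup>2)\<^sup>2 / (4 * x\<^sup>2) = (cosh (ln x))\<^sup>2"
  using assms by (simp add: cosh_ln_real power2_eq_square field_simps)

lemma holomorphic_mult_eq_0:
  assumes f: "f holomorphic_on S" and g: "g holomorphic_on S" and S: "open S" "connected S"
    and fg: "\<And>z. z \<in> S \<Longrightarrow> f z * g z = 0"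
  shows "(\<forall>z\<in>S. f z = 0) \<or> (\<forall>z\<in>S. g z = 0)"
proof (rule disjCI)
  assume "\<not> (\<forall>z\<in>S. g z = 0)"
  then obtain w where w: "w \<in> S" "g w \<noteq> 0" by blast
  define V where "V = {z \<in> S. g z \<in> - {0}}"
  have "open V" unfolding V_def
    by (rule continuous_open_preimage[OF holomorphic_on_imp_continuous_on[OF g] S(1), unfolded vimage_def Int_def mem_Collect_eq]) auto
  then show "\<forall>z\<in>S. f z = 0"
    using analytic_continuation_open[of V S f "\<lambda>_. 0"] w S f fg by (auto simp: V_def)
qed

text \<open>Where E has no zeros, f is locally a logarithm of G up to sign and an additive constant:
  its derivative is q = Q / sqrt E, and lam = |E| (1 + |G|^2)^2 / (4 |G|^2) turns into |E| times the
  square of cosh (Re f). Convexity of \<Omega> provides the root and the primitive; what needs proof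
  is that one real constant of integration fits all discs.\<close>

lemma potential:
  fixes lam :: "complex \<Rightarrow> real" and Q E :: "complex \<Rightarrow> complex"
  assumes \<Omega>: "open \<Omega>" "convex \<Omega>" and Q: "Q holomorphic_on \<Omega>" and E: "E holomorphic_on \<Omega>"
    and E0: "\<And>w. w \<in> \<Omega> \<Longrightarrow> E w \<noteq> 0" and Q0: "\<exists>w\<in>\<Omega>. Q w \<noteq> 0"
    and ld: "\<And>w. w \<in> \<Omega> \<Longrightarrow> \<exists>r G A. ball w r \<subseteq> \<Omega> \<and> local_data lam Q E w r G A"
  obtains f where "f holomorphic_on \<Omega>" "\<And>w. w \<in> \<Omega> \<Longrightarrow> (deriv f w)\<^sup>2 * E w = (Q w)\<^sup>2"
    "\<And>w. w \<in> \<Omega> \<Longrightarrow> lam w = norm (E w) * (cosh (Re (f w)))\<^sup>2"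
proof -
  have conn: "connected \<Omega>" using \<Omega>(2) by (rule convex_connected)
  obtain L where L: "L holomorphic_on \<Omega>" "\<And>w. w \<in> \<Omega> \<Longrightarrow> E w = exp (L w)"
    using contractible_imp_holomorphic_log[OF E convex_imp_contractible[OF \<Omega>(2)]] E0 by metis
  define q where "q w = Q w / exp (L w / 2)" for w
  have q: "q holomorphic_on \<Omega>" unfolding q_def by (intro holomorphic_intros Q L) auto
  have q2: "(q w)\<^sup>2 * E w = (Q w)\<^sup>2" if "w \<in> \<Omega>" for w
    using L(2)[OF that] by (simp add: q_def power_divide flip: exp_double)
  obtain f0 where f0': "\<And>x. x \<in> \<Omega> \<Longrightarrow> (f0 has_field_derivative q x) (at x within \<Omega>)"
    using holomorphic_convex_primitive'[OF \<Omega>(2,1) q] by metis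
  have f0: "(f0 has_field_derivative q x) (at x)" if "x \<in> \<Omega>" for x
    using f0'[OF that] at_within_open[OF that \<Omega>(1)] by simp
  have f0h: "f0 holomorphic_on \<Omega>" using f0 by (auto simp: holomorphic_on_open[OF \<Omega>(1)])
  \<comment> \<open>A local logarithm g1 of G has derivative q or - q, hence is f0 or - f0 plus a
    constant. As cosh is even, the sign disappears and only the real part of the constant, with a
    sign, remains.\<close>
  have loc: "\<exists>r c. 0 < r \<and> ball w r \<subseteq> \<Omega> \<and> (\<forall>z\<in>ball w r. lam z = norm (E z) * (cosh (Re (f0 z) + c))\<^sup>2)"
    if w: "w \<in> \<Omega>" for w
  proof -
    obtain r G A where sub: "ball w r \<subseteq> \<Omega>" and g: "local_data lam Q E w r G A" using ld[OF w] by blast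
    have r: "0 < r" and G: "G holomorphic_on ball w r" and A: "A holomorphic_on ball w r" using g by (auto simp: local_data_def)
    have GA: "A z \<noteq> 0" "deriv G z * A z = Q z" "(A z * G z)\<^sup>2 = E z" "lam z = 1 / 4 * (norm (A z))\<^sup>2 * (1 + (norm (G z))\<^sup>2)\<^sup>2"
      if "z \<in> ball w r" for z using g that by (auto simp: local_data_def)
    have G0: "G z \<noteq> 0" if "z \<in> ball w r" for z using GA(3)[OF that] E0[of z] sub that by auto
    obtain g1 where g1: "g1 holomorphic_on ball w r" "\<And>z. z \<in> ball w r \<Longrightarrow> G z = exp (g1 z)"
      using contractible_imp_holomorphic_log[OF G convex_imp_contractible[OF convex_ball]] G0 by metis
    have dG: "deriv G z = deriv g1 z * G z" if z: "z \<in> ball w r" for z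
    proof -
      have "((\<lambda>z. exp (g1 z)) has_field_derivative exp (g1 z) * deriv g1 z) (at z)"
        using holomorphic_derivI[OF g1(1) open_ball z] by (auto intro!: derivative_eq_intros)
      then have "(G has_field_derivative exp (g1 z) * deriv g1 z) (at z)"
        by (rule has_field_derivative_transform_within_open[OF _ open_ball z]) (use g1(2) in auto)
      then show ?thesis using DERIV_imp_deriv g1(2)[OF z] by fastforce
    qed
    have sq: "(deriv g1 z - q z) * (deriv g1 z + q z) = 0" if z: "z \<in> ball w r" for z
    proof -
      have zO: "z \<in> \<Omega>" using z sub by blast
      have "(deriv g1 z)\<^sup>2 * E z = (Q z)\<^sup>2"
        using GA(2,3)[OF z] dG[OF z] by (metis mult.assoc mult.commute power_mult_distrib)
      then have "(deriv g1 z)\<^sup>2 = (q z)\<^sup>2" using q2[OF zO] E0[OF zO] by (metis mult_right_cancel)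
      then show ?thesis by (simp add: power2_eq_square algebra_simps)
    qed
    have hq: "q holomorphic_on ball w r" by (rule holomorphic_on_subset[OF q sub])
    have "\<exists>\<epsilon> c. (\<epsilon> = 1 \<or> \<epsilon> = - 1) \<and> (\<forall>z\<in>ball w r. g1 z = of_real \<epsilon> * f0 z + c)"
    proof -
      have "(\<forall>z\<in>ball w r. deriv g1 z - q z = 0) \<or> (\<forall>z\<in>ball w r. deriv g1 z + q z = 0)"
        by (rule holomorphic_mult_eq_0[OF _ _ open_ball connected_ball sq])
           (intro holomorphic_intros holomorphic_deriv[OF g1(1) open_ball] hq)+
      then obtain \<epsilon> :: real where \<epsilon>: "\<epsilon> = 1 \<or> \<epsilon> = - 1" "\<And>z. z \<in> ball w r \<Longrightarrow> deriv g1 z = of_real \<epsilon> * q z"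
        by (metis (no_types, opaque_lifting) add_eq_0_iff2 eq_iff_diff_eq_0 mult_1 mult_minus_left of_real_1 of_real_minus)
      have "\<exists>c. \<forall>z\<in>ball w r. g1 z - of_real \<epsilon> * f0 z = c"
      proof (rule has_field_derivative_zero_constant[OF convex_ball])
        fix z assume z: "z \<in> ball w r"
        have "((\<lambda>z. g1 z - of_real \<epsilon> * f0 z) has_field_derivative deriv g1 z - of_real \<epsilon> * q z) (at z)"
          using holomorphic_derivI[OF g1(1) open_ball z] f0[of z] sub z by (auto intro!: derivative_eq_intros)
        then show "((\<lambda>z. g1 z - of_real \<epsilon> * f0 z) has_field_derivative 0) (at z within ball w r)"
          using \<epsilon>(2)[OF z] by (simp add: has_field_derivative_at_within)
      qed
      then show ?thesis using \<epsilon>(1) by (metis diff_add_cancel add.commute)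
    qed
    then obtain \<epsilon> c where \<epsilon>: "\<epsilon> = 1 \<or> \<epsilon> = - (1::real)" and g1c: "\<And>z. z \<in> ball w r \<Longrightarrow> g1 z = of_real \<epsilon> * f0 z + c"
      by blast
    have "lam z = norm (E z) * (cosh (Re (f0 z) + \<epsilon> * Re c))\<^sup>2" if z: "z \<in> ball w r" for z
    proof -
      define x where "x = norm (G z)"
      have x: "x > 0" using G0[OF z] by (simp add: x_def)
      have lnx: "ln x = Re (g1 z)" using g1(2)[OF z] by (simp add: x_def)
      have a: "norm (A z) > 0" using GA(1)[OF z] by simp
      have "norm (E z) = (norm (A z))\<^sup>2 * x\<^sup>2" unfolding GA(3)[OF z, symmetric] by (simp add: norm_mult norm_power power_mult_distrib x_def)
      then have "lam z = norm (E z) * ((1 + x\<^sup>2)\<^sup>2 / (4 * x\<^sup>2))"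
        using GA(4)[OF z] x a by (simp add: x_def[symmetric])
      also have "\<dots> = norm (E z) * (cosh (Re (g1 z)))\<^sup>2" unfolding exp_ln_quotient_eq_cosh[OF x] lnx ..
      also have "cosh (Re (g1 z)) = cosh (Re (f0 z) + \<epsilon> * Re c)"
        using g1c[OF z] \<epsilon> cosh_minus[of "Re (f0 z) - Re c"] by auto
      finally show ?thesis .
    qed
    then show ?thesis using r sub by blast
  qed
  obtain w0 where w0: "w0 \<in> \<Omega>" using Q0 by blast
  obtain r0 c0 where r0: "0 < r0" "ball w0 r0 \<subseteq> \<Omega>" "\<And>z. z \<in> ball w0 r0 \<Longrightarrow> lam z = norm (E z) * (cosh (Re (f0 z) + c0))\<^sup>2"
    using loc[OF w0] by blast
  define good where "good c r w \<longleftrightarrow> 0 < r \<and> ball w r \<subseteq> \<Omega> \<and> (\<forall>z\<in>ball w r. lam z = norm (E z) * (cosh (Re (f0 z) + c))\<^sup>2)" for c r w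
  have ex: "\<exists>r c. good c r w" if "w \<in> \<Omega>" for w using loc[OF that] by (auto simp: good_def)
  \<comment> \<open>Two different constants on a common disc would force Re f0 + c = - (Re f0 + c');
    then Re f0 and so f0 would be constant there, and Q would vanish.\<close>
  have same: "c = c'" if g: "good c r w" "good c' r' w'" and meet: "ball w r \<inter> ball w' r' \<noteq> {}" for c c' r r' w w'
  proof (rule ccontr)
    assume ne: "c \<noteq> c'"
    obtain x where "x \<in> ball w r \<inter> ball w' r'" using meet by blast
    then obtain e where e: "e > 0" "ball x e \<subseteq> ball w r \<inter> ball w' r'"
      using open_contains_ball[of "ball w r \<inter> ball w' r'"] by blast
    have sub: "ball x e \<subseteq> \<Omega>" using e g by (auto simp: good_def)
    have Re: "Re (f0 z + of_real ((c + c') / 2)) = 0" if z: "z \<in> ball x e" for z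
    proof -
      have "norm (E z) * (cosh (Re (f0 z) + c))\<^sup>2 = norm (E z) * (cosh (Re (f0 z) + c'))\<^sup>2"
        using g e(2) z unfolding good_def by (metis IntD1 IntD2 subsetD)
      moreover have "norm (E z) \<noteq> 0" using E0 sub z by auto
      ultimately have "(cosh (Re (f0 z) + c))\<^sup>2 = (cosh (Re (f0 z) + c'))\<^sup>2" by simp
      from cosh_sq_eq_imp[OF this] ne have "Re (f0 z) + c = - (Re (f0 z) + c')" by auto
      then have "Re (f0 z) = - ((c + c') / 2)" by (simp add: field_simps)
      then show ?thesis by simp
    qed
    have h: "(\<lambda>z. f0 z + of_real ((c + c') / 2)) holomorphic_on ball x e"
      by (intro holomorphic_intros holomorphic_on_subset[OF f0h sub])
    obtain k where k: "\<And>z. z \<in> ball x e \<Longrightarrow> f0 z + of_real ((c + c') / 2) = k"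
      using Re_zero_imp_constant[OF h open_ball connected_ball Re] by (auto simp: constant_on_def)
    have "Q z = 0" if z: "z \<in> ball x e" for z
    proof -
      have zO: "z \<in> \<Omega>" using sub z by blast
      have "((\<lambda>z. k - of_real ((c + c') / 2)) has_field_derivative q z) (at z)"
        by (rule has_field_derivative_transform_within_open[OF f0[OF zO] open_ball z]) (use k in \<open>auto simp: algebra_simps\<close>)
      then have "q z = 0" using DERIV_unique DERIV_const by blast
      then show ?thesis by (simp add: q_def)
    qed
    then have "Q z = 0" if "z \<in> \<Omega>" for z
      using analytic_continuation_open[of "ball x e" \<Omega> Q "\<lambda>_. 0"] e(1) sub \<Omega>(1) conn Q that by auto
    then show False using Q0 by blast
  qed
  \<comment> \<open>The discs that belong to c0 and those that belong to other constants form
    disjoint open sets, so connectedness leaves only c0.\<close>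
  have all: "good c r w \<Longrightarrow> c = c0" if w: "w \<in> \<Omega>" for c r w
  proof -
    define U V where "U = \<Union>{ball w r | w r. good c0 r w}" and "V = \<Union>{ball w r | w r. \<exists>c. c \<noteq> c0 \<and> good c r w}"
    have "open U" "open V" by (auto simp: U_def V_def)
    moreover have "U \<inter> V \<inter> \<Omega> = {}" unfolding U_def V_def using same by fastforce
    moreover have "\<Omega> \<subseteq> U \<union> V"
    proof
      fix x assume "x \<in> \<Omega>"
      then obtain r c where "good c r x" using ex by blast
      moreover from this have "x \<in> ball x r" by (simp add: good_def)
      ultimately show "x \<in> U \<union> V" unfolding U_def V_def by (cases "c = c0") blast+
    qed
    moreover have "w0 \<in> U \<inter> \<Omega>"
    proof -
      have "good c0 r0 w0" using r0 by (simp add: good_def)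
      then show ?thesis using r0(1) w0 unfolding U_def by force
    qed
    ultimately have "V \<inter> \<Omega> = {}" using connectedD[OF conn, of U V] by blast
    assume g: "good c r w"
    then have "w \<in> ball w r" by (simp add: good_def)
    then show "c = c0" using g w \<open>V \<inter> \<Omega> = {}\<close> unfolding V_def by blast
  qed
  show thesis
  proof (rule that[of "\<lambda>w. f0 w + of_real c0"])
    show "(\<lambda>w. f0 w + of_real c0) holomorphic_on \<Omega>" by (intro holomorphic_intros f0h)
    fix w assume w: "w \<in> \<Omega>"
    have "deriv (\<lambda>w. f0 w + of_real c0) w = q w"
      by (rule DERIV_imp_deriv) (use f0[OF w] in \<open>auto intro!: derivative_eq_intros\<close>)
    then show "(deriv (\<lambda>w. f0 w + of_real c0) w)\<^sup>2 * E w = (Q w)\<^sup>2" using q2[OF w] by simp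
    obtain r c where "good c r w" using ex[OF w] by blast
    then have "good c0 r w" using all[OF w] by blast
    then show "lam w = norm (E w) * (cosh (Re (f0 w + of_real c0)))\<^sup>2" unfolding good_def by simp
  qed
qed

text \<open>Under a change of coordinate G is a function, A a 1-form, Q and E are quadratic
  differentials and lam is a metric, which accounts for the powers of
  \<open>deriv P\<close>.\<close>

lemma local_data_pullback:
  assumes g: "local_data lam Q E (P w) r G A" and S: "open S" "w \<in> S" and P: "P holomorphic_on S"
    and P': "\<And>z. z \<in> S \<Longrightarrow> deriv P z \<noteq> 0"
  obtains r' where "ball w r' \<subseteq> S" "local_data (\<lambda>z. lam (P z) * (norm (deriv P z))\<^sup>2) (\<lambda>z. Q (P z) * (deriv P z)\<^sup>2)
    (\<lambda>z. E (P z) * (deriv P z)\<^sup>2) w r' (\<lambda>z. G (P z)) (\<lambda>z. A (P z) * deriv P z)"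
proof -
  have r: "0 < r" and G: "G holomorphic_on ball (P w) r" and A: "A holomorphic_on ball (P w) r" using g by (auto simp: local_data_def)
  define V where "V = {z \<in> S. P z \<in> ball (P w) r}"
  have "open V" unfolding V_def
    by (rule continuous_open_preimage[OF holomorphic_on_imp_continuous_on[OF P] S(1) open_ball, unfolded vimage_def Int_def mem_Collect_eq])
  moreover have "w \<in> V" using S r by (simp add: V_def)
  ultimately obtain r' where r': "0 < r'" "ball w r' \<subseteq> V" using open_contains_ball by blast
  have sub: "ball w r' \<subseteq> S" using r' by (auto simp: V_def)
  have Pb: "P holomorphic_on ball w r'" by (rule holomorphic_on_subset[OF P sub])
  have im: "P ` ball w r' \<subseteq> ball (P w) r" using r' by (auto simp: V_def)
  show thesis
  proof (rule that[OF sub])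
    have "(\<lambda>z. G (P z)) holomorphic_on ball w r'" "(\<lambda>z. A (P z)) holomorphic_on ball w r'"
      using holomorphic_on_compose_gen[OF Pb G im] holomorphic_on_compose_gen[OF Pb A im] by (auto simp: o_def)
    moreover have "deriv (\<lambda>z. G (P z)) z = deriv G (P z) * deriv P z" if z: "z \<in> ball w r'" for z
      by (rule DERIV_imp_deriv[OF DERIV_chain2[OF holomorphic_derivI[OF G open_ball] holomorphic_derivI[OF Pb open_ball z]]])
         (use im z in blast)
    moreover have "deriv P holomorphic_on ball w r'" using holomorphic_deriv[OF Pb open_ball] .
    ultimately show "local_data (\<lambda>z. lam (P z) * (norm (deriv P z))\<^sup>2) (\<lambda>z. Q (P z) * (deriv P z)\<^sup>2)
      (\<lambda>z. E (P z) * (deriv P z)\<^sup>2) w r' (\<lambda>z. G (P z)) (\<lambda>z. A (P z) * deriv P z)"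
      using g r'(1) sub P' im unfolding local_data_def
      by (auto intro!: holomorphic_intros simp: image_subset_iff norm_mult power_mult_distrib power2_eq_square[of "deriv P _"] mult_ac)
  qed
qed

section \<open>From finite area to a bound at an end\<close>

context reduced_surface
begin

lemma continuous_on_D: "continuous_on M D"
proof -
  have "Ck_on 0 M D"
  proof (rule Ck_on_local)
    fix z assume z: "z \<in> M"
    obtain r G A where g: "ball z r \<subseteq> M" "local_data lam Q E z r G A" using ld[OF z] by blast
    then have r: "0 < r" and G: "G holomorphic_on ball z r" by (auto simp: local_data_def)
    have "Ck_on 0 (ball z r) (sph_density G)" using continuous_on_sph_density[OF open_ball G] by simp
    then have "Ck_on 0 (ball z r) D" by (rule Ck_on_cong[OF open_ball, rotated]) (use local_data_facts(2)[OF g(2)] in auto)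
    then show "\<exists>T. open T \<and> z \<in> T \<and> Ck_on 0 T D" using r by (metis centre_in_ball open_ball)
  qed
  then show ?thesis by simp
qed

text \<open>In the coordinate w = ln \<xi> the end is a half-plane, and \<open>potential\<close>
  gives f such that the square of its derivative is \<phi> (exp w), where \<phi> is single-valued in
  \<xi> although f is not. The bound for the derivative of f is a power of ln |\<xi>|, so \<xi>
  \<phi> tends to 0 and the singularity of \<phi> is removable. The conclusion says that \<phi> is
  bounded.\<close>

theorem end_growth:
  assumes r: "0 < r" and \<psi>: "\<psi> holomorphic_on ball 0 r - {0}" "inj_on \<psi> (ball 0 r - {0})" "\<psi> ` (ball 0 r - {0}) \<subseteq> M"
    and E0: "\<And>\<xi>. \<xi> \<in> ball 0 r - {0} \<Longrightarrow> E (\<psi> \<xi>) \<noteq> 0"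
  obtains K \<rho> where "0 < \<rho>" "\<rho> \<le> r"
    "\<And>\<xi>. \<xi> \<in> ball 0 \<rho> - {0} \<Longrightarrow> (norm \<xi>)\<^sup>2 * (norm (Q (\<psi> \<xi>)))\<^sup>2 * (norm (deriv \<psi> \<xi>))\<^sup>2 \<le> K * norm (E (\<psi> \<xi>))"
proof -
  define B where "B = ball 0 r - {0 :: complex}"
  have B: "open B" unfolding B_def by (intro open_Diff) auto
  note \<psi> = \<psi>[folded B_def] and E0 = E0[folded B_def]
  define s0 where "s0 = ln r"
  define \<Omega> where "\<Omega> = {w. Re w < s0}"
  note O = open_half_plane[of s0, folded \<Omega>_def]
  have expB: "exp w \<in> B" if "w \<in> \<Omega>" for w
  proof -
    have "exp (Re w) < exp (ln r)" using that by (simp add: \<Omega>_def s0_def)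
    then show ?thesis using r by (simp add: B_def dist_norm)
  qed
  have Bexp: "\<exists>w\<in>\<Omega>. exp w = \<xi>" if "\<xi> \<in> B" for \<xi>
  proof (rule bexI[of _ "Ln \<xi>"])
    show "exp (Ln \<xi>) = \<xi>" using that by (simp add: B_def)
    show "Ln \<xi> \<in> \<Omega>" using that r by (simp add: B_def \<Omega>_def s0_def dist_norm)
  qed
  define P where "P w = \<psi> (exp w)" for w
  have PM: "P w \<in> M" if "w \<in> \<Omega>" for w using \<psi>(3) expB[OF that] by (auto simp: P_def)
  have dP: "(P has_field_derivative deriv \<psi> (exp w) * exp w) (at w)" if "w \<in> \<Omega>" for w
    unfolding P_def by (rule DERIV_chain2[OF holomorphic_derivI[OF \<psi>(1) B expB[OF that]] DERIV_exp])
  have Ph: "P holomorphic_on \<Omega>" using dP by (auto simp: holomorphic_on_open[OF O(1)])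
  have P': "deriv P w = deriv \<psi> (exp w) * exp w" if "w \<in> \<Omega>" for w
    by (rule DERIV_imp_deriv[OF dP[OF that]])
  have \<psi>': "deriv \<psi> \<xi> \<noteq> 0" if "\<xi> \<in> B" for \<xi>
    by (rule holomorphic_injective_imp_regular[OF \<psi>(1) B \<psi>(2) that])
  have P'0: "deriv P w \<noteq> 0" if "w \<in> \<Omega>" for w using \<psi>'[OF expB[OF that]] by (simp add: P'[OF that])
  define Qh where "Qh w = Q (P w) * (deriv P w)\<^sup>2" for w
  define Eh where "Eh w = E (P w) * (deriv P w)\<^sup>2" for w
  define lamh where "lamh w = lam (P w) * (norm (deriv P w))\<^sup>2" for w
  have hol: "Qh holomorphic_on \<Omega>" "Eh holomorphic_on \<Omega>"
    unfolding Qh_def Eh_def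
    by (intro holomorphic_intros holomorphic_deriv[OF Ph O(1)]
        holomorphic_on_compose_gen[OF Ph Q, unfolded o_def] holomorphic_on_compose_gen[OF Ph E, unfolded o_def]; use PM in auto)+
  have Eh0: "Eh w \<noteq> 0" if "w \<in> \<Omega>" for w
    using E0[OF expB[OF that]] P'0[OF that] by (simp add: Eh_def P_def)
  have Qh0: "\<exists>w\<in>\<Omega>. Qh w \<noteq> 0"
  proof (rule ccontr)
    assume "\<not> ?thesis"
    then have "Q (P w) = 0" if "w \<in> \<Omega>" for w using P'0[OF that] that by (auto simp: Qh_def)
    then have Q0: "Q z = 0" if "z \<in> \<psi> ` B" for z using that Bexp by (force simp: P_def)
    have "open (\<psi> ` B)" by (rule open_mapping_thm3[OF \<psi>(1) B \<psi>(2)])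
      moreover have "of_real (r / 2) \<in> B" using r by (simp add: B_def dist_norm)
      then have "\<psi> ` B \<noteq> {}" by blast
    ultimately have "Q z = 0" if "z \<in> M" for z
      using analytic_continuation_open[of "\<psi> ` B" M Q "\<lambda>_. 0"] open_M connected_M Q \<psi>(3) Q0 that by auto
    then show False using Q_nz by blast
  qed
  have ldh: "\<exists>r G A. ball w r \<subseteq> \<Omega> \<and> local_data lamh Qh Eh w r G A" if w: "w \<in> \<Omega>" for w
  proof -
    obtain r1 G A where g: "local_data lam Q E (P w) r1 G A" using ld[OF PM[OF w]] by blast
    show ?thesis
      by (rule local_data_pullback[OF g O(1) w Ph P'0]) (auto simp: lamh_def[abs_def] Qh_def[abs_def] Eh_def[abs_def])
  qed
  obtain f where f: "f holomorphic_on \<Omega>" "\<And>w. w \<in> \<Omega> \<Longrightarrow> (deriv f w)\<^sup>2 * Eh w = (Qh w)\<^sup>2"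
    "\<And>w. w \<in> \<Omega> \<Longrightarrow> lamh w = norm (Eh w) * (cosh (Re (f w)))\<^sup>2"
    by (rule potential[OF O(1,3) hol Eh0 Qh0 ldh]) (assumption, assumption, rule that, assumption+)
  have cosh_eq: "(cosh (Re (f w)))\<^sup>2 = lamh w / norm (Eh w)" if "w \<in> \<Omega>" for w
    using f(3)[OF that] Eh0[OF that] by simp
  have per: "(cosh (Re (f (w + of_real (2 * pi) * \<i>))))\<^sup>2 = (cosh (Re (f w)))\<^sup>2" if w: "w \<in> \<Omega>" for w
  proof -
    have w': "w + of_real (2 * pi) * \<i> \<in> \<Omega>" using w by (simp add: \<Omega>_def)
    have ex: "exp (w + of_real (2 * pi) * \<i>) = exp w" by (simp add: exp_add exp_two_pi_i mult_ac)
    have "deriv P (w + of_real (2 * pi) * \<i>) = deriv P w" "P (w + of_real (2 * pi) * \<i>) = P w"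
      using P'[OF w] P'[OF w'] ex by (auto simp: P_def)
    then show ?thesis unfolding cosh_eq[OF w] cosh_eq[OF w'] by (simp add: lamh_def Eh_def)
  qed
  \<comment> \<open>This is the density of the spherical area in logarithmic coordinates, so its
    integral over a strip of height 2 pi, on which P is injective, is part of the finite area of
    (-K) g_M.\<close>
  have dens: "(norm (deriv f w))\<^sup>2 / (cosh (Re (f w)))\<^sup>2 = (norm (deriv P w))\<^sup>2 * D (P w)" if w: "w \<in> \<Omega>" for w
  proof -
    have "(norm (deriv f w))\<^sup>2 * norm (Eh w) = (norm (Qh w))\<^sup>2"
      using arg_cong[OF f(2)[OF w], of norm] by (simp add: norm_mult norm_power)
    then have "(norm (deriv f w))\<^sup>2 = (norm (Qh w))\<^sup>2 / norm (Eh w)" using Eh0[OF w] by (simp add: field_simps)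
    then have "(norm (deriv f w))\<^sup>2 / (cosh (Re (f w)))\<^sup>2 = (norm (Qh w))\<^sup>2 / lamh w"
      unfolding cosh_eq[OF w] using Eh0[OF w] by simp
    also have "\<dots> = (norm (deriv P w))\<^sup>2 * D (P w)"
      using P'0[OF w] by (simp add: Qh_def lamh_def norm_mult norm_power power_mult_distrib power2_eq_square)
    finally show ?thesis .
  qed
  define R where "R = {w. Re w < s0 \<and> 0 < Im w \<and> Im w < 2 * pi}"
  have RO: "R \<subseteq> \<Omega>" by (auto simp: R_def \<Omega>_def)
  have oR: "open R" unfolding R_def by (intro open_Collect_conj open_Collect_less continuous_intros)
  have PhR: "P holomorphic_on R" by (rule holomorphic_on_subset[OF Ph RO])
  have injP: "inj_on P R"
  proof (rule inj_onI)
    fix x y assume xy: "x \<in> R" "y \<in> R" "P x = P y"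
    then have "exp x = exp y" using \<psi>(2) expB RO by (auto simp: P_def dest: inj_onD)
    then obtain n :: int where n: "x = y + of_real (2 * n * pi) * \<i>" by (auto simp: exp_eq)
    then have "\<bar>2 * of_int n * pi\<bar> < 2 * pi" using xy(1,2) by (auto simp: R_def)
    then have "\<bar>real_of_int n\<bar> < 1" by (simp add: abs_mult)
    then have "n = 0" by linarith
    then show "x = y" using n by simp
  qed
  have subM: "P ` R \<subseteq> M" using PM RO by auto
  have "D absolutely_integrable_on P ` R"
    by (rule set_integrable_subset[OF area_ai]) (use subM open_mapping_thm3[OF PhR oR injP] in auto)
  then have "(\<lambda>w. (norm (deriv P w))\<^sup>2 * D (P w)) absolutely_integrable_on R"
    using holomorphic_change_of_variables[OF oR PhR injP continuous_on_subset[OF continuous_on_D subM]] by blast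
  then have ai: "(\<lambda>w. (norm (deriv f w))\<^sup>2 / (cosh (Re (f w)))\<^sup>2) absolutely_integrable_on R"
    by (rule absolutely_integrable_spike[OF _ negligible_empty]) (use dens RO in auto)
  obtain K where K: "K \<ge> 0" "\<And>w. Re w < s0 - 2 \<Longrightarrow> norm (deriv f w) \<le> K * (s0 - Re w) ^ 3"
    by (rule deriv_growth_finite_area[of f s0]) (use f(1) per ai in \<open>auto simp: \<Omega>_def R_def\<close>)
  \<comment> \<open>Squaring removes the sign ambiguity of the derivative of f, and the factor
    \<xi>^2 comes from d w = d \<xi> / \<xi>.\<close>
  define \<phi> where "\<phi> \<xi> = \<xi>\<^sup>2 * (Q (\<psi> \<xi>))\<^sup>2 * (deriv \<psi> \<xi>)\<^sup>2 / E (\<psi> \<xi>)" for \<xi>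
  have \<phi>h: "\<phi> holomorphic_on ball 0 r - {0}"
    unfolding \<phi>_def B_def[symmetric]
    by (intro holomorphic_intros holomorphic_deriv[OF \<psi>(1) B]
        holomorphic_on_compose_gen[OF \<psi>(1) Q, unfolded o_def] holomorphic_on_compose_gen[OF \<psi>(1) E, unfolded o_def]; use \<psi>(3) E0 in auto)
  have \<phi>f: "\<phi> (exp w) = (deriv f w)\<^sup>2" if w: "w \<in> \<Omega>" for w
  proof -
    have "(deriv f w)\<^sup>2 = (Qh w)\<^sup>2 / Eh w" using f(2)[OF w] Eh0[OF w] by (simp add: field_simps)
    also have "\<dots> = \<phi> (exp w)"
      using P'0[OF w] \<psi>'[OF expB[OF w]] by (simp add: Qh_def Eh_def \<phi>_def P_def P'[OF w] power2_eq_square)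
    finally show ?thesis ..
  qed
  have "((\<lambda>z. (z - 0) * \<phi> z) \<longlongrightarrow> 0) (at 0)"
  proof (rule Lim_null_comparison)
    have "norm ((\<xi> - 0) * \<phi> \<xi>) \<le> norm \<xi> * (K * (s0 - ln (norm \<xi>)) ^ 3)\<^sup>2"
      if "\<xi> \<noteq> 0" "dist \<xi> 0 < r * exp (- 2)" for \<xi>
    proof -
      have n0: "norm \<xi> > 0" using that by simp
      have "ln (norm \<xi>) < ln (r * exp (-2))" using that n0 r by (subst ln_less_cancel_iff) (auto simp: dist_norm)
      also have "\<dots> = s0 - 2" using r by (simp add: ln_mult s0_def)
      finally have l: "ln (norm \<xi>) < s0 - 2" .
      then have w: "Ln \<xi> \<in> \<Omega>" "Re (Ln \<xi>) < s0 - 2" using that(1) by (auto simp: \<Omega>_def)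
      have "norm (\<phi> \<xi>) = (norm (deriv f (Ln \<xi>)))\<^sup>2" using \<phi>f[OF w(1)] that(1) by (simp add: norm_power)
      also have "\<dots> \<le> (K * (s0 - ln (norm \<xi>)) ^ 3)\<^sup>2"
        using K(2)[OF w(2)] that(1) by (intro power_mono) auto
      finally show ?thesis by (simp add: norm_mult mult_left_mono)
    qed
    then show "\<forall>\<^sub>F \<xi> in at 0. norm ((\<xi> - 0) * \<phi> \<xi>) \<le> norm \<xi> * (K * (s0 - ln (norm \<xi>)) ^ 3)\<^sup>2"
      unfolding eventually_at using r by (intro exI[of _ "r * exp (- 2)"]) auto
    have "((\<lambda>x. x * (s0 - ln x) ^ 6) \<longlongrightarrow> 0) (at_right 0)" by real_asymp
    then have "((\<lambda>x. K\<^sup>2 * (x * (s0 - ln x) ^ 6)) \<longlongrightarrow> 0) (at_right 0)"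
      by (rule tendsto_mult_right_zero)
    then have "((\<lambda>x. x * (K * (s0 - ln x) ^ 3)\<^sup>2) \<longlongrightarrow> 0) (at_right 0)"
      by (simp add: power_mult_distrib mult_ac flip: power_mult)
    moreover have "filterlim (norm :: complex \<Rightarrow> real) (at_right 0) (at 0)"
      unfolding filterlim_at by (auto intro!: tendsto_eq_intros simp: eventually_at intro: exI[of _ 1])
    ultimately show "((\<lambda>\<xi> :: complex. norm \<xi> * (K * (s0 - ln (norm \<xi>)) ^ 3)\<^sup>2) \<longlongrightarrow> 0) (at 0)"
      by (rule filterlim_compose)
  qed
  then obtain g where g: "g holomorphic_on ball 0 r" "\<And>z. z \<in> ball 0 r - {0} \<Longrightarrow> g z = \<phi> z"
    using holomorphic_on_extend_lim[OF \<phi>h, THEN iffD2] r by (auto simp: interior_open)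
  have "compact (g ` cball 0 (r / 2))"
    by (intro compact_continuous_image holomorphic_on_imp_continuous_on holomorphic_on_subset[OF g(1)]) (use r in auto)
  then have "bounded (g ` cball 0 (r / 2))" by (rule compact_imp_bounded)
  then obtain K' where "\<forall>x\<in>g ` cball 0 (r / 2). norm x \<le> K'" unfolding bounded_iff by blast
  then have K': "norm (g z) \<le> K'" if "z \<in> cball 0 (r / 2)" for z using that by auto
  show thesis
  proof (rule that[of "r / 2" K'])
    fix \<xi> assume x: "\<xi> \<in> ball 0 (r / 2) - {0 :: complex}"
    then have xB: "\<xi> \<in> B" using r by (auto simp: B_def)
    have "norm (\<phi> \<xi>) \<le> K'" using K'[of \<xi>] g(2)[of \<xi>] x xB by (auto simp: B_def)
    then show "(norm \<xi>)\<^sup>2 * (norm (Q (\<psi> \<xi>)))\<^sup>2 * (norm (deriv \<psi> \<xi>))\<^sup>2 \<le> K' * norm (E (\<psi> \<xi>))"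
      using E0[OF xB] by (simp add: \<phi>_def norm_mult norm_divide norm_power divide_le_eq)
  qed (use r in auto)
qed

end

section \<open>Total area at least that of the sphere\<close>

lemma holomorphic_extend_finite:
  assumes "finite S" "F holomorphic_on UNIV - S" "\<And>s. s \<in> S \<Longrightarrow> \<exists>B. \<forall>\<^sub>F z in at s. norm (F z) \<le> B"
  shows "\<exists>g. g holomorphic_on UNIV \<and> (\<forall>z\<in>UNIV - S. g z = (F z :: complex))"
  using assms
proof (induction S arbitrary: F rule: finite_induct)
  case (insert s S)
  have o: "open (UNIV - S)" using insert.hyps(1) by (intro open_Diff) (auto intro: finite_imp_closed)
  have "UNIV - insert s S = UNIV - S - {s}" by auto
  then have h: "F holomorphic_on UNIV - S - {s}" using insert.prems(1) by simp
  have "s \<in> interior (UNIV - S)" using o insert.hyps(2) by (simp add: interior_open)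
  from holomorphic_on_extend_bounded[OF h this] insert.prems(2)[of s]
  obtain g where g: "g holomorphic_on UNIV - S" "\<forall>z\<in>UNIV - S - {s}. g z = F z" by blast
  have "\<exists>B. \<forall>\<^sub>F z in at t. norm (g z) \<le> B" if t: "t \<in> S" for t
  proof -
    obtain B where B: "\<forall>\<^sub>F z in at t. norm (F z) \<le> B" using insert.prems(2)[of t] t by blast
    have "open (UNIV - (insert s S - {t}))" using insert.hyps(1) by (intro open_Diff) (auto intro: finite_imp_closed)
    then have "\<forall>\<^sub>F z in at t. z \<in> UNIV - (insert s S - {t}) - {t}"
      using eventually_at_in_open[of "UNIV - (insert s S - {t})" t] by auto
    with B have "\<forall>\<^sub>F z in at t. norm (g z) \<le> B"
      by eventually_elim (use g(2) in auto)
    then show ?thesis by blast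
  qed
  from insert.IH[OF g(1) this] obtain g' where g': "g' holomorphic_on UNIV" "\<forall>z\<in>UNIV - S. g' z = g z" by blast
  show ?case by (rule exI[of _ g']) (use g g' in auto)
qed auto

lemma Liouville_finite_singularities:
  assumes S: "finite S" and F: "F holomorphic_on UNIV - S"
    and b: "\<And>s. s \<in> S \<Longrightarrow> \<exists>B. \<forall>\<^sub>F z in at s. norm (F z) \<le> B"
    and inf: "\<And>z. norm z \<ge> R \<Longrightarrow> norm (F z) \<le> C"
  obtains k where "\<And>z. z \<notin> S \<Longrightarrow> F z = k"
proof -
  obtain g where g: "g holomorphic_on UNIV" "\<And>z. z \<notin> S \<Longrightarrow> g z = F z"
    using holomorphic_extend_finite[OF S F b] by auto
  have "bounded S" using S by (rule finite_imp_bounded)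
  then obtain R1 where R1: "\<And>z. z \<in> S \<Longrightarrow> norm z \<le> R1" unfolding bounded_iff by blast
  define R2 where "R2 = max R (R1 + 1)"
  have out: "norm (g z) \<le> C" if "norm z \<ge> R2" for z
    using that R1[of z] g(2)[of z] inf[of z] by (force simp: R2_def)
  have "compact (g ` cball 0 R2)"
    by (intro compact_continuous_image holomorphic_on_imp_continuous_on holomorphic_on_subset[OF g(1)]) auto
  then have "bounded (g ` cball 0 R2)" by (rule compact_imp_bounded)
  then obtain B where "\<forall>x\<in>g ` cball 0 R2. norm x \<le> B" unfolding bounded_iff by blast
  then have "norm (g z) \<le> max B C" for z using out[of z] by (cases "norm z \<le> R2") (auto simp: le_max_iff_disj)
  then have "bounded (range g)" unfolding bounded_iff by blast
  from Liouville_theorem[OF g(1) this] obtain k where "\<And>z. g z = k" by (auto simp: constant_on_def)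
  then show thesis using g(2) that by metis
qed

text \<open>In the coordinate at a puncture, \<open>F dz\<^sup>2\<close> has modulus at least \<open>c / |\<xi>|\<^sup>2\<close>.\<close>

definition end_lower_bound :: "(complex \<Rightarrow> complex) \<Rightarrow> (complex \<Rightarrow> complex) \<Rightarrow> bool" where
  "end_lower_bound F \<psi> \<longleftrightarrow> (\<exists>r>0. \<exists>c>0. \<forall>\<xi>\<in>ball 0 r - {0}. c \<le> (norm \<xi>)\<^sup>2 * norm (F (\<psi> \<xi>)) * (norm (deriv \<psi> \<xi>))\<^sup>2)"

section \<open>Determination of E and the contradiction\<close>

context reduced_surface
begin

text \<open>With n = |\<xi>|^2, p the squared modulus of the derivative of \<psi>, q = |Q| and e =
  |E|, the hypothesis is c \<le> n q p and \<open>end_growth\<close> gives n q^2 p \<le> K e.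
  Squaring the first and inserting the second yields c^2 \<le> K n e p.\<close>

lemma end_lower_bound_E:
  assumes l: "l < 1" and Qb: "end_lower_bound Q \<psi>"
    and \<psi>: "\<psi> holomorphic_on ball 0 1 - {0}" "inj_on \<psi> (ball 0 1 - {0})" "\<psi> ` (ball 0 1 - {0}) \<subseteq> M"
  shows "end_lower_bound E \<psi>"
proof -
  obtain r c where r: "r > 0" and c: "c > 0" and Qc: "\<And>\<xi>. \<xi> \<in> ball 0 r - {0} \<Longrightarrow> c \<le> (norm \<xi>)\<^sup>2 * norm (Q (\<psi> \<xi>)) * (norm (deriv \<psi> \<xi>))\<^sup>2"
    using Qb unfolding end_lower_bound_def by blast
  \<comment> \<open>E has at most one zero in M; if it lies in this end, the radius is reduced to
    exclude it, as \<open>end_growth\<close> requires.\<close>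
  have "\<exists>r1>0. r1 \<le> 1 \<and> (\<forall>\<xi>\<in>ball 0 r1 - {0}. E (\<psi> \<xi>) \<noteq> 0)"
  proof (cases "\<exists>\<xi>0\<in>ball 0 1 - {0}. E (\<psi> \<xi>0) = 0")
    case True
    then obtain \<xi>0 where x0: "\<xi>0 \<in> ball 0 1 - {0}" "E (\<psi> \<xi>0) = 0" by blast
    show ?thesis
    proof (intro exI[of _ "norm \<xi>0"] conjI ballI notI)
      fix \<xi> assume x: "\<xi> \<in> ball 0 (norm \<xi>0) - {0}" "E (\<psi> \<xi>) = 0"
      then have x1: "\<xi> \<in> ball 0 1 - {0}" using x0(1) by auto
      have "\<psi> \<xi> = \<psi> \<xi>0" using zero_of_E_unique[OF l] x x0 x1 \<psi>(3) by blast
      then have "\<xi> = \<xi>0" using inj_onD[OF \<psi>(2) _ x1 x0(1)] by blast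
      then show False using x(1) by simp
    qed (use x0 in auto)
  qed (auto intro!: exI[of _ 1])
  then obtain r1 where r1: "r1 > 0" "r1 \<le> 1" "\<And>\<xi>. \<xi> \<in> ball 0 r1 - {0} \<Longrightarrow> E (\<psi> \<xi>) \<noteq> 0" by blast
  have sub: "ball 0 r1 - {0} \<subseteq> ball 0 1 - {0 :: complex}" using r1 by auto
  obtain K \<rho> where K: "0 < \<rho>" "\<rho> \<le> r1"
    "\<And>\<xi>. \<xi> \<in> ball 0 \<rho> - {0} \<Longrightarrow> (norm \<xi>)\<^sup>2 * (norm (Q (\<psi> \<xi>)))\<^sup>2 * (norm (deriv \<psi> \<xi>))\<^sup>2 \<le> K * norm (E (\<psi> \<xi>))"
    by (rule end_growth[OF r1(1) holomorphic_on_subset[OF \<psi>(1) sub] inj_on_subset[OF \<psi>(2) sub] subset_trans[OF image_mono[OF sub] \<psi>(3)] r1(3)])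
       (assumption, rule that, assumption+)
  show ?thesis
    unfolding end_lower_bound_def
  proof (intro exI conjI ballI)
    show "min r \<rho> > 0" "c\<^sup>2 / (\<bar>K\<bar> + 1) > 0" using r K(1) c by (auto intro!: divide_pos_pos)
    fix \<xi> :: complex assume x: "\<xi> \<in> ball 0 (min r \<rho>) - {0}"
    define n q p e where "n = (norm \<xi>)\<^sup>2" and "q = norm (Q (\<psi> \<xi>))" and "p = (norm (deriv \<psi> \<xi>))\<^sup>2" and "e = norm (E (\<psi> \<xi>))"
    have 1: "c \<le> n * q * p" using Qc[of \<xi>] x by (simp add: n_def q_def p_def)
    have 2: "n * q\<^sup>2 * p \<le> K * e" using K(3)[of \<xi>] x by (simp add: n_def q_def p_def e_def)
    have nn: "n \<ge> 0" "p \<ge> 0" "e \<ge> 0" by (auto simp: n_def p_def e_def)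
    have "c\<^sup>2 \<le> (n * q * p)\<^sup>2" using 1 c by (intro power_mono) auto
    also have "\<dots> = (n * q\<^sup>2 * p) * (n * p)" by (simp add: power2_eq_square)
    also have "\<dots> \<le> (K * e) * (n * p)" using 2 nn by (intro mult_right_mono) auto
    also have "\<dots> \<le> ((\<bar>K\<bar> + 1) * e) * (n * p)" using nn by (intro mult_right_mono) auto
    finally have "c\<^sup>2 \<le> (n * e * p) * (\<bar>K\<bar> + 1)" by (simp add: mult_ac)
    then show "c\<^sup>2 / (\<bar>K\<bar> + 1) \<le> (norm \<xi>)\<^sup>2 * norm (E (\<psi> \<xi>)) * (norm (deriv \<psi> \<xi>))\<^sup>2"
      unfolding n_def[symmetric] p_def[symmetric] e_def[symmetric] by (simp add: divide_le_eq)
  qed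
qed

text \<open>Liouville for the quotient of p by E z^2 (z - 1)^2. By the end bounds the denominator is
  bounded away from 0 near 0 and 1 and at least a multiple of |z|^2 at infinity, so a quadratic
  bound on p suffices; p has to cancel the zeros of E in Z. It is used with p = 1 and with p = (z -
  a)^2.\<close>

lemma E_rational:
  assumes e0: "end_lower_bound E (\<lambda>w. w)" and e1: "end_lower_bound E (\<lambda>w. 1 + w)" and einf: "end_lower_bound E (\<lambda>w. inverse w)"
    and Z: "finite Z" "Z \<subseteq> M" and nz: "\<And>z. z \<in> M - Z \<Longrightarrow> E z \<noteq> 0"
    and p: "p holomorphic_on UNIV" "\<And>z. norm (p z) \<le> C * (1 + norm z)\<^sup>2"
    and pZ: "\<And>z. z \<in> Z \<Longrightarrow> \<exists>B. \<forall>\<^sub>F w in at z. norm (p w / E w) \<le> B"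
  obtains k where "\<And>z. z \<in> M - Z \<Longrightarrow> p z = k * (E z * z\<^sup>2 * (z - 1)\<^sup>2)"
    and "\<exists>R c. c > 0 \<and> (\<forall>z. norm z \<ge> R \<longrightarrow> norm (E z) * (norm z)\<^sup>2 \<ge> c)"
proof -
  define F where "F z = p z / (E z * z\<^sup>2 * (z - 1)\<^sup>2)" for z
  have U: "UNIV - ({0, 1} \<union> Z) = M - Z" by (auto simp: M_def)
  have Fh: "F holomorphic_on UNIV - ({0, 1} \<union> Z)"
    unfolding F_def U using nz
    by (intro holomorphic_intros holomorphic_on_subset[OF p(1)] holomorphic_on_subset[OF E]) (auto simp: M_def)
  obtain r0 c0 where r0: "r0 > 0" "c0 > 0" "\<And>z. z \<in> ball 0 r0 - {0} \<Longrightarrow> c0 \<le> (norm z)\<^sup>2 * norm (E z)"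
    using e0 by (auto simp: end_lower_bound_def)
  have d1: "deriv (\<lambda>w. 1 + w) z = 1" for z :: complex
    by (rule DERIV_imp_deriv) (auto intro!: derivative_eq_intros)
  obtain r1 c1 where r1: "r1 > 0" "c1 > 0" "\<And>z. z \<in> ball 0 r1 - {0} \<Longrightarrow> c1 \<le> (norm z)\<^sup>2 * norm (E (1 + z))"
    using e1 by (auto simp: end_lower_bound_def d1)
  obtain r2 c2 where r2: "r2 > 0" "c2 > 0" "\<And>z. z \<in> ball 0 r2 - {0} \<Longrightarrow> c2 \<le> (norm z)\<^sup>2 * norm (E (inverse z)) * (norm (deriv inverse z))\<^sup>2"
    using einf by (auto simp: end_lower_bound_def)
  define R where "R = 2 / r2 + 2"
  have R: "R \<ge> 2" using r2 by (simp add: R_def)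
  \<comment> \<open>For \<xi> = 1 / z the factors |\<xi>|^2 and |z|^4, the latter from the
    derivative of the inverse, combine to |z|^2.\<close>
  have big: "c2 \<le> norm (E z) * (norm z)\<^sup>2" if z: "norm z \<ge> R" for z
  proof -
    have nz0: "norm z > 0" using z R by linarith
    have "1 / r2 < norm z" using z r2(1) by (simp add: R_def add_pos_pos field_simps)
    then have "inverse (norm z) < r2" using nz0 r2(1) by (simp add: field_simps)
    then have "inverse z \<in> ball 0 r2 - {0}"
      using nz0 by (simp add: norm_inverse)
    have di: "deriv inverse (inverse z) = - (z\<^sup>2)"
      using DERIV_imp_deriv[OF DERIV_inverse[of "inverse z"]] nz0 by (simp add: numeral_2_eq_2)
    from r2(3)[OF \<open>inverse z \<in> ball 0 r2 - {0}\<close>, unfolded di]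
    have "c2 \<le> (norm (inverse z))\<^sup>2 * norm (E z) * (norm (z\<^sup>2))\<^sup>2" by simp
    also have "\<dots> = norm (E z) * (norm z)\<^sup>2"
    proof -
      define n where "n = norm z"
      have "(inverse n)\<^sup>2 * x * (n\<^sup>2)\<^sup>2 = x * n\<^sup>2" for x
        using nz0 by (simp add: n_def[symmetric] power2_eq_square field_simps)
      then show ?thesis unfolding norm_inverse norm_power n_def[symmetric] .
    qed
    finally show ?thesis .
  qed
  have pcont: "continuous_on UNIV p" using p(1) by (rule holomorphic_on_imp_continuous_on)
  \<comment> \<open>Here h is the factor of z^2 (z - 1)^2 that does not vanish at the puncture
    s.\<close>
  have bdd: "\<exists>B. \<forall>\<^sub>F z in at s. norm (F z) \<le> B" if "continuous_on UNIV h" "h s \<noteq> 0" "0 < r" "0 < c"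
    "\<And>z. dist s z < r \<Longrightarrow> z \<noteq> s \<Longrightarrow> c * norm (h z) \<le> norm (E z * z\<^sup>2 * (z - 1)\<^sup>2)" for s c r and h :: "complex \<Rightarrow> complex"
  proof -
    have "isCont h s" using that(1) by (simp add: continuous_on_eq_continuous_at)
    then have "((\<lambda>z. norm (p z) / (c * norm (h z))) \<longlongrightarrow> norm (p s) / (c * norm (h s))) (at s)"
      using that(2,4) pcont by (intro tendsto_intros) (auto simp: continuous_on_eq_continuous_at isCont_def)
    then have ev: "\<forall>\<^sub>F z in at s. norm (p z) / (c * norm (h z)) < norm (p s) / (c * norm (h s)) + 1"
      by (rule order_tendstoD) simp
    have "\<forall>\<^sub>F z in at s. h z \<noteq> 0"
      using \<open>isCont h s\<close> that(2) by (intro tendsto_imp_eventually_ne) (auto simp: isCont_def)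
    moreover have "\<forall>\<^sub>F z in at s. dist s z < r \<and> z \<noteq> s"
      using that(3) by (auto simp: eventually_at dist_commute)
    ultimately have "\<forall>\<^sub>F z in at s. norm (F z) \<le> norm (p s) / (c * norm (h s)) + 1"
      using ev
    proof eventually_elim
      case (elim z)
      have ch: "0 < c * norm (h z)" using that(4) elim by simp
      have le: "c * norm (h z) \<le> norm (E z * z\<^sup>2 * (z - 1)\<^sup>2)" using that(5)[of z] elim by simp
      have "norm (F z) \<le> norm (p z) / (c * norm (h z))"
        unfolding F_def norm_divide using ch le
        by (intro divide_left_mono[OF le norm_ge_zero] mult_pos_pos[of "norm (E z * z\<^sup>2 * (z - 1)\<^sup>2)"]) linarith+
      then show ?case using elim by linarith
    qed
    then show ?thesis by blast
  qed
  have bnd: "\<exists>B. \<forall>\<^sub>F z in at s. norm (F z) \<le> B" if s: "s \<in> {0, 1} \<union> Z" for s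
  proof -
    consider "s = 0" | "s = 1" | "s \<in> Z" using s by blast
    then show ?thesis
    proof cases
      case 1
      show ?thesis
      proof (rule bdd[of "\<lambda>z. (z - 1)\<^sup>2" s r0 c0])
        fix z assume z: "dist s z < r0" "z \<noteq> s"
        have "c0 * (norm (z - 1))\<^sup>2 \<le> (norm z)\<^sup>2 * norm (E z) * (norm (z - 1))\<^sup>2"
          using r0(3)[of z] z 1 by (intro mult_right_mono) auto
        then show "c0 * norm ((z - 1)\<^sup>2) \<le> norm (E z * z\<^sup>2 * (z - 1)\<^sup>2)"
          by (simp add: norm_mult norm_power mult_ac)
      qed (use r0 1 in \<open>auto intro!: continuous_intros\<close>)
    next
      case 2
      show ?thesis
      proof (rule bdd[of "\<lambda>z. z\<^sup>2" s r1 c1])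
        fix z assume z: "dist s z < r1" "z \<noteq> s"
        have "c1 * (norm z)\<^sup>2 \<le> (norm (z - 1))\<^sup>2 * norm (E z) * (norm z)\<^sup>2"
          using r1(3)[of "z - 1"] z 2 by (intro mult_right_mono) (auto simp: dist_norm norm_minus_commute)
        then show "c1 * norm (z\<^sup>2) \<le> norm (E z * z\<^sup>2 * (z - 1)\<^sup>2)"
          by (simp add: norm_mult norm_power mult_ac)
      qed (use r1 2 in \<open>auto intro!: continuous_intros\<close>)
    next
      case 3
      obtain B where B: "\<forall>\<^sub>F w in at s. norm (p w / E w) \<le> B" using pZ[OF 3] by blast
      have s01: "s \<noteq> 0" "s \<noteq> 1" using 3 Z(2) by (auto simp: M_def)
      have "((\<lambda>w. norm (inverse (w\<^sup>2 * (w - 1)\<^sup>2))) \<longlongrightarrow> norm (inverse (s\<^sup>2 * (s - 1)\<^sup>2))) (at s)"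
        using s01 by (intro tendsto_intros) auto
      then have "\<forall>\<^sub>F w in at s. norm (inverse (w\<^sup>2 * (w - 1)\<^sup>2)) < norm (inverse (s\<^sup>2 * (s - 1)\<^sup>2)) + 1"
        by (rule order_tendstoD) simp
      with B have "\<forall>\<^sub>F w in at s. norm (F w) \<le> B * (norm (inverse (s\<^sup>2 * (s - 1)\<^sup>2)) + 1)"
      proof eventually_elim
        case (elim w)
        have "F w = (p w / E w) * inverse (w\<^sup>2 * (w - 1)\<^sup>2)" by (simp add: F_def divide_inverse mult_ac)
        then have "norm (F w) = norm (p w / E w) * norm (inverse (w\<^sup>2 * (w - 1)\<^sup>2))" by (metis norm_mult)
        also have "\<dots> \<le> B * (norm (inverse (s\<^sup>2 * (s - 1)\<^sup>2)) + 1)"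
          using elim by (intro mult_mono) (auto intro: order_trans[OF norm_ge_zero])
        finally show ?case .
      qed
      then show ?thesis by blast
    qed
  qed
  have inf: "norm (F z) \<le> \<bar>C\<bar> * 9 / c2" if z: "norm z \<ge> R" for z
  proof -
    define n where "n = norm z"
    have n: "n \<ge> 2" using z R by (simp add: n_def)
    have n1: "norm (z - 1) \<ge> n / 2"
      using norm_triangle_ineq2[of z 1] n by (simp add: n_def)
    have up: "norm (p z) \<le> \<bar>C\<bar> * (9 / 4 * n\<^sup>2)"
    proof -
      have "(1 + n)\<^sup>2 \<le> (3 / 2 * n)\<^sup>2" using n by (intro power_mono) auto
      then have "\<bar>C\<bar> * (1 + n)\<^sup>2 \<le> \<bar>C\<bar> * (9 / 4 * n\<^sup>2)" by (intro mult_left_mono) (auto simp: power2_eq_square)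
      moreover have "norm (p z) \<le> \<bar>C\<bar> * (1 + n)\<^sup>2"
        using order_trans[OF p(2)[of z] mult_right_mono[OF abs_ge_self[of C]]] by (simp add: n_def)
      ultimately show ?thesis by linarith
    qed
    have "(norm (E z) * n\<^sup>2) * (norm (z - 1))\<^sup>2 \<ge> c2 * (n / 2)\<^sup>2"
      using big[OF z] n1 n r2(2) by (intro mult_mono power_mono) (auto simp: n_def)
    then have low: "norm (E z * z\<^sup>2 * (z - 1)\<^sup>2) \<ge> c2 * n\<^sup>2 / 4"
      by (simp add: norm_mult norm_power n_def power_divide)
    have pos: "c2 * n\<^sup>2 / 4 > 0" using n r2(2) by auto
    have "norm (F z) \<le> (\<bar>C\<bar> * (9 / 4 * n\<^sup>2)) / (c2 * n\<^sup>2 / 4)"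
      unfolding F_def norm_divide using up low pos by (intro frac_le) auto
    also have "\<dots> = \<bar>C\<bar> * 9 / c2" using n r2(2) by (simp add: field_simps)
    finally show ?thesis .
  qed
  obtain k where k: "\<And>z. z \<notin> {0, 1} \<union> Z \<Longrightarrow> F z = k"
    by (rule Liouville_finite_singularities[OF _ Fh bnd inf]) (use Z(1) in auto)
  show thesis
  proof (rule that[of k])
    fix z assume z: "z \<in> M - Z"
    then have "F z = k" "E z \<noteq> 0" "z \<noteq> 0" "z \<noteq> 1" using k[of z] nz[OF z] by (auto simp: M_def)
    then show "p z = k * (E z * z\<^sup>2 * (z - 1)\<^sup>2)" by (auto simp: F_def)
  qed (use big r2(2) in blast)
qed

text \<open>With \<open>E = e\<^sup>2\<close>, local data normalised by \<open>A G = e\<close> have a globally defined height of \<open>G\<close>.\<close>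

definition signed_data :: "(complex \<Rightarrow> complex) \<Rightarrow> complex \<Rightarrow> real \<Rightarrow> (complex \<Rightarrow> complex) \<Rightarrow> (complex \<Rightarrow> complex) \<Rightarrow> bool" where
  "signed_data e c r G A \<longleftrightarrow> ball c r \<subseteq> M \<and> local_data lam Q E c r G A \<and> (\<forall>z\<in>ball c r. A z * G z = e z)"

lemma signed_data_sign:
  assumes "ball c r \<subseteq> M" "local_data lam Q E c r G A" "e holomorphic_on M" "\<And>z. z \<in> M \<Longrightarrow> (e z)\<^sup>2 = E z"
  shows "(\<forall>z\<in>ball c r. A z * G z = e z) \<or> (\<forall>z\<in>ball c r. A z * G z = - e z)"
proof -
  have "(\<forall>z\<in>ball c r. A z * G z - e z = 0) \<or> (\<forall>z\<in>ball c r. A z * G z + e z = 0)"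
  proof (rule holomorphic_mult_eq_0)
    show "(\<lambda>z. A z * G z - e z) holomorphic_on ball c r" "(\<lambda>z. A z * G z + e z) holomorphic_on ball c r"
      using assms(2) holomorphic_on_subset[OF assms(3,1)] by (auto simp: local_data_def intro!: holomorphic_intros)
    fix z assume z: "z \<in> ball c r"
    have "(A z * G z)\<^sup>2 = (e z)\<^sup>2" using z assms by (auto simp: local_data_def)
    then show "(A z * G z - e z) * (A z * G z + e z) = 0" by (simp add: power2_eq_square algebra_simps)
  qed auto
  then show ?thesis by (auto simp: add_eq_0_iff2)
qed

text \<open>Both maps have logarithmic derivative Q / e, so near w they differ by a constant factor
  k. Comparing the two expressions for lam leaves |k| = 1 or |k| |G1|^2 = 1, and the latter on a
  disc would make G1 constant. Where e vanishes, both maps are 0.\<close>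

lemma signed_data_height_unique:
  assumes 1: "signed_data e c1 r1 G1 A1" and 2: "signed_data e c2 r2 G2 A2"
    and w: "w \<in> ball c1 r1" "w \<in> ball c2 r2"
  shows "height (G1 w) = height (G2 w)"
proof (cases "e w = 0")
  case True
  then show ?thesis using 1 2 w unfolding signed_data_def local_data_def by (metis mult_eq_0_iff)
next
  case False
  define B where "B = ball c1 r1 \<inter> ball c2 r2"
  have L1: "local_data lam Q E c1 r1 G1 A1" "ball c1 r1 \<subseteq> M" and L2: "local_data lam Q E c2 r2 G2 A2" "ball c2 r2 \<subseteq> M"
    using 1 2 by (auto simp: signed_data_def)
  have G: "G1 holomorphic_on B" "G2 holomorphic_on B"
    using L1 L2 by (auto simp: local_data_def B_def elim!: holomorphic_on_subset)
  have f: "A1 z \<noteq> 0" "A2 z \<noteq> 0" "A1 z * G1 z = e z" "A2 z * G2 z = e z" "deriv G1 z * A1 z = Q z" "deriv G2 z * A2 z = Q z"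
    if "z \<in> B" for z
    using 1 2 that unfolding signed_data_def local_data_def B_def by auto
  have f7: "(norm (A1 z))\<^sup>2 * (1 + (norm (G1 z))\<^sup>2)\<^sup>2 = (norm (A2 z))\<^sup>2 * (1 + (norm (G2 z))\<^sup>2)\<^sup>2"
    if "z \<in> B" for z
  proof -
    have "lam z = 1 / 4 * (norm (A1 z))\<^sup>2 * (1 + (norm (G1 z))\<^sup>2)\<^sup>2"
      "lam z = 1 / 4 * (norm (A2 z))\<^sup>2 * (1 + (norm (G2 z))\<^sup>2)\<^sup>2"
      using L1(1) L2(1) that unfolding local_data_def B_def by blast+
    then show ?thesis by simp
  qed
  define V where "V = {z \<in> B. G1 z \<in> - {0}}"
  have oV: "open V" unfolding V_def
    by (rule continuous_open_preimage[OF holomorphic_on_imp_continuous_on[OF G(1)], unfolded vimage_def Int_def mem_Collect_eq]) (auto simp: B_def)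
  have wB: "w \<in> B" using w by (simp add: B_def)
  have "w \<in> V" using f(3)[OF wB] False wB by (auto simp: V_def)
  then obtain s where s: "s > 0" "ball w s \<subseteq> V" using oV open_contains_ball by blast
  have sB: "ball w s \<subseteq> B" using s by (auto simp: V_def)
  have G10: "G1 z \<noteq> 0" if "z \<in> ball w s" for z using that s by (auto simp: V_def)
  have "\<exists>k. \<forall>z\<in>ball w s. G2 z / G1 z = k"
  proof (rule has_field_derivative_zero_constant[OF convex_ball])
    fix z assume z: "z \<in> ball w s"
    then have zB: "z \<in> B" using sB by blast
    have d: "(G1 has_field_derivative deriv G1 z) (at z)" "(G2 has_field_derivative deriv G2 z) (at z)"
      using holomorphic_derivI[OF G(1) _ zB] holomorphic_derivI[OF G(2) _ zB] by (auto simp: B_def)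
    have "(deriv G2 z * G1 z) * (A1 z * A2 z) = (G2 z * deriv G1 z) * (A1 z * A2 z)"
      using f(3-6)[OF zB] by (metis mult.assoc mult.commute)
    then have "deriv G2 z * G1 z = G2 z * deriv G1 z" using f(1,2)[OF zB] by simp
    then have "((\<lambda>z. G2 z / G1 z) has_field_derivative 0) (at z)"
      using DERIV_divide[OF d(2,1) G10[OF z]] by simp
    then show "((\<lambda>z. G2 z / G1 z) has_field_derivative 0) (at z within ball w s)"
      by (rule has_field_derivative_at_within)
  qed
  then obtain k where k: "\<And>z. z \<in> ball w s \<Longrightarrow> G2 z = k * G1 z" using G10 by (metis nonzero_divide_eq_eq)
  have ws: "w \<in> ball w s" using s by simp
  have k0: "norm k > 0" using k[OF ws] f(4)[OF wB] False by auto
  \<comment> \<open>Equality of the two metrics factors as (|k| - 1) (1 - |k| |G1|^2) = 0.\<close>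
  have alt: "norm k = 1 \<or> norm k * (norm (G1 z))\<^sup>2 = 1" if z: "z \<in> ball w s" for z
  proof -
    have zB: "z \<in> B" using sB z by blast
    define x where "x = norm (G1 z)"
    have "A1 z * G1 z = (A2 z * k) * G1 z" using f(3,4)[OF zB] k[OF z] by (simp add: mult.assoc)
    then have "A1 z = A2 z * k" using G10[OF z] by simp
    then have "(norm (A2 z))\<^sup>2 * ((norm k)\<^sup>2 * (1 + x\<^sup>2)\<^sup>2) = (norm (A2 z))\<^sup>2 * (1 + (norm k * x)\<^sup>2)\<^sup>2"
      using f7[OF zB] k[OF z] by (simp add: norm_mult power_mult_distrib x_def mult_ac)
    then have "(norm k * (1 + x\<^sup>2))\<^sup>2 = (1 + (norm k * x)\<^sup>2)\<^sup>2" using f(2)[OF zB] by (simp add: power_mult_distrib)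
    then have "norm k * (1 + x\<^sup>2) = 1 + (norm k * x)\<^sup>2"
      using k0 by (simp add: power2_eq_iff_nonneg add_nonneg_nonneg)
    then have "(norm k - 1) * (1 - norm k * x\<^sup>2) = 0" by (simp add: power2_eq_square algebra_simps)
    then show ?thesis by (simp add: x_def)
  qed
  have "norm k = 1"
  proof (rule ccontr)
    assume nk: "norm k \<noteq> 1"
    have eq: "norm (G1 z) = norm (G1 w)" if z: "z \<in> ball w s" for z
    proof -
      have "norm k * (norm (G1 z))\<^sup>2 = norm k * (norm (G1 w))\<^sup>2" using alt[OF z] alt[OF ws] nk by simp
      then have "(norm (G1 z))\<^sup>2 = (norm (G1 w))\<^sup>2" using k0 by simp
      then show ?thesis by (simp add: power2_eq_iff_nonneg)
    qed
    have c: "G1 constant_on ball w s"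
      by (rule maximum_modulus_principle[OF holomorphic_on_subset[OF G(1) sB] open_ball connected_ball open_ball order_refl ws])
         (use eq in auto)
    obtain \<rho> where \<rho>: "0 < \<rho>" "\<And>\<rho>'. 0 < \<rho>' \<Longrightarrow> \<rho>' \<le> \<rho> \<Longrightarrow> local_data lam Q E w \<rho>' G1 A1"
      by (rule local_data_subball[OF L1(1) w(1)]) (rule that, assumption+)
    define \<rho>' where "\<rho>' = min \<rho> s"
    have "local_data lam Q E w \<rho>' G1 A1" using \<rho> s(1) by (intro \<rho>(2)) (auto simp: \<rho>'_def)
    moreover have "ball w \<rho>' \<subseteq> ball w s" by (auto simp: \<rho>'_def)
    moreover have "ball w s \<subseteq> M" using sB L1(2) by (auto simp: B_def)
    ultimately show False using G_nonconstant constant_on_subset[OF c] by (meson subset_trans)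
  qed
  then have "norm (G2 w) = norm (G1 w)" using k[OF ws] by (simp add: norm_mult)
  then show ?thesis by (simp add: height_def)
qed

text \<open>Even moments count both poles of the axis without distinguishing them. Since the odd
  moments of the signed height h vanish, the weight 1 - h leaves the total 4 pi l / (2 k + 1)
  unchanged but doubles the contribution of a point with h = -1.\<close>

theorem no_simple_zero:
  assumes l: "l < 1" and e: "e holomorphic_on M" "\<And>z. z \<in> M \<Longrightarrow> (e z)\<^sup>2 = E z"
    and a: "a \<in> M" "\<And>z. z \<in> M \<Longrightarrow> e z = 0 \<longleftrightarrow> z = a"
  shows False
proof -
  have Ea: "E a = 0" unfolding e(2)[OF a(1), symmetric] using a(2)[OF a(1)] by simp
  have "\<exists>\<epsilon>. (\<epsilon> = 1 \<or> \<epsilon> = - 1) \<and> (\<exists>r G A. signed_data (\<lambda>z. \<epsilon> * e z) a r G A)"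
  proof -
    obtain r G A where "ball a r \<subseteq> M" "local_data lam Q E a r G A" using ld[OF a(1)] by blast
    note rGA = this
    from signed_data_sign[OF rGA e] show ?thesis
    proof
      assume "\<forall>z\<in>ball a r. A z * G z = e z"
      then have "signed_data (\<lambda>z. 1 * e z) a r G A" using rGA by (simp add: signed_data_def)
      then show ?thesis by blast
    next
      assume "\<forall>z\<in>ball a r. A z * G z = - e z"
      then have "signed_data (\<lambda>z. - 1 * e z) a r G A" using rGA by (simp add: signed_data_def)
      then show ?thesis by blast
    qed
  qed
  then obtain \<epsilon> r0 G0 A0 where \<epsilon>: "\<epsilon> = 1 \<or> \<epsilon> = - 1" and sd0: "signed_data (\<lambda>z. \<epsilon> * e z) a r0 G0 A0" by blast
  define e' where "e' z = \<epsilon> * e z" for z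
  have e': "e' holomorphic_on M" "\<And>z. z \<in> M \<Longrightarrow> (e' z)\<^sup>2 = E z" "\<And>z. z \<in> M \<Longrightarrow> e' z = 0 \<longleftrightarrow> z = a"
    using e a(2) \<epsilon> by (auto simp: e'_def[abs_def] power_mult_distrib intro!: holomorphic_intros)
  note sd0 = sd0[folded e'_def[abs_def]]
  have ex: "\<exists>r G A. signed_data e' z r G A" if z: "z \<in> M" for z
  proof (cases "z = a")
    case True then show ?thesis using sd0 by blast
  next
    case False
    obtain r G A where g: "ball z r \<subseteq> M" "local_data lam Q E z r G A" using ld[OF z] by blast
    have zr: "z \<in> ball z r" using g(2) by (simp add: local_data_def)
    from signed_data_sign[OF g e'(1,2)] show ?thesis
    proof
      assume "\<forall>w\<in>ball z r. A w * G w = e' w" then show ?thesis using g unfolding signed_data_def by blast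
    next
      assume n: "\<forall>w\<in>ball z r. A w * G w = - e' w"
      obtain \<rho> where \<rho>: "0 < \<rho>" "ball z \<rho> \<subseteq> ball z r" "\<And>\<rho>'. 0 < \<rho>' \<Longrightarrow> \<rho>' \<le> \<rho> \<Longrightarrow> local_data lam Q E z \<rho>' G A"
        by (rule local_data_subball[OF g(2) zr]) (rule that, assumption+)
      \<comment> \<open>The disc stays away from a, the only zero of e, so that G has no zeros on it
        and the half-turn applies.\<close>
      define s where "s = min \<rho> (dist z a)"
      have s: "0 < s" "s \<le> \<rho>" using \<rho> False by (auto simp: s_def)
      have sub: "ball z s \<subseteq> ball z r" using \<rho>(2) s by auto
      have G0: "G w \<noteq> 0" if w: "w \<in> ball z s" for w
      proof -
        have "w \<noteq> a" using w by (auto simp: s_def)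
        moreover have "w \<in> M" using w sub g(1) by blast
        ultimately have "e' w \<noteq> 0" using e'(3) by blast
        then show ?thesis using n w sub by (metis mult_zero_right neg_equal_0_iff_equal subsetD)
      qed
      have "local_data lam Q E z s (\<lambda>w. - (1 / G w)) (\<lambda>w. A w * (G w)\<^sup>2)"
        by (rule local_data_swap[OF \<rho>(3)[OF s] G0])
      moreover have "(A w * (G w)\<^sup>2) * - (1 / G w) = e' w" if "w \<in> ball z s" for w
        using n sub that G0[OF that] by (auto simp: power2_eq_square)
      ultimately show ?thesis using sub g(1) unfolding signed_data_def by blast
    qed
  qed
  \<comment> \<open>By \<open>signed_data_height_unique\<close> the value does not depend on the
    choice.\<close>
  define h where "h w = (SOME x. \<exists>r G A. signed_data e' w r G A \<and> x = height (G w))" for w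
  have h: "h w = height (G w)" if g: "signed_data e' c r G A" and w: "w \<in> ball c r" for c r G A w
  proof -
    have "w \<in> M" using g w by (auto simp: signed_data_def)
    then have "\<exists>x r G A. signed_data e' w r G A \<and> x = height (G w)" using ex by blast
    from someI_ex[OF this] obtain r' G' A' where g': "signed_data e' w r' G' A'" "h w = height (G' w)"
      unfolding h_def by blast
    have "w \<in> ball w r'" using g'(1) by (simp add: signed_data_def local_data_def)
    then show ?thesis using signed_data_height_unique[OF g'(1) g _ w] g'(2) by simp
  qed
  have loc: "\<exists>r G. 0 < r \<and> ball z r \<subseteq> M \<and> G holomorphic_on ball z r \<and>
       (\<forall>w\<in>ball z r. D w = sph_density G w \<and> h w = height (G w) \<and> T w = (h w)\<^sup>2)" if z: "z \<in> M" for z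
  proof -
    obtain r G A where g: "signed_data e' z r G A" using ex[OF z] by blast
    have L: "local_data lam Q E z r G A" "ball z r \<subseteq> M" using g by (auto simp: signed_data_def)
    then have "0 < r" "G holomorphic_on ball z r" by (auto simp: local_data_def)
    moreover have "D w = sph_density G w \<and> h w = height (G w) \<and> T w = (h w)\<^sup>2" if w: "w \<in> ball z r" for w
      using local_data_facts(2,3)[OF L(1) w] h[OF g w] by simp
    ultimately show ?thesis using L(2) by blast
  qed
  have loc1: "\<exists>r G. 0 < r \<and> ball z r \<subseteq> M \<and> G holomorphic_on ball z r \<and>
       (\<forall>w\<in>ball z r. D w = sph_density G w \<and> h w = height (G w))" if "z \<in> M" for z using loc[OF that] by blast
  have loc2: "\<exists>r G. 0 < r \<and> ball z r \<subseteq> M \<and> G holomorphic_on ball z r \<and>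
       (\<forall>w\<in>ball z r. D w = sph_density G w \<and> h w ^ (n + 2) = height (G w) ^ (n + 2) \<and> h w ^ n = height (G w) ^ n)"
    if "z \<in> M" for z n using loc[OF that] by metis
  have T: "T z = (h z)\<^sup>2" if "z \<in> M" for z using loc[OF that] by (meson centre_in_ball)
  have step: "(\<lambda>z. h z ^ n * D z) absolutely_integrable_on M" "(\<lambda>z. h z ^ (n + 2) * D z) absolutely_integrable_on M"
    "real (n + 1) * integral M (\<lambda>z. h z ^ n * D z) = real (n + 3) * integral M (\<lambda>z. h z ^ (n + 2) * D z)" for n
    using moment_step[OF area_ai[unfolded M_def] loc2[unfolded M_def], of n, folded M_def] by blast+
  have odd: "(\<lambda>z. h z ^ (2 * k + 1) * D z) absolutely_integrable_on M \<and> integral M (\<lambda>z. h z ^ (2 * k + 1) * D z) = 0" for k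
  proof (induction k)
    case 0
    have "integral M (\<lambda>z. h z * D z) = 0"
      using moment_height[OF area_ai[unfolded M_def] loc1[unfolded M_def], folded M_def] by blast
    moreover have "(\<lambda>z. h z ^ 1 * D z) absolutely_integrable_on M" by (rule step(1))
    ultimately show ?case by simp
  next
    case (Suc k)
    have "(\<lambda>z. h z ^ (2 * k + 1 + 2) * D z) absolutely_integrable_on M" by (rule step(2))
    moreover have "real (2 * k + 1 + 1) * integral M (\<lambda>z. h z ^ (2 * k + 1) * D z) = real (2 * k + 1 + 3) * integral M (\<lambda>z. h z ^ (2 * k + 1 + 2) * D z)"
      by (rule step(3))
    ultimately show ?case using Suc by simp
  qed
  have h1: "\<bar>h z\<bar> \<le> 1" if "z \<in> M" for z
    using T[OF that] T_bounds[OF that] by (simp add: abs_square_le_1)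
  \<comment> \<open>The integrand with weight 1 - h, which is nonnegative because |h| \<le> 1, so
    that its integral over W is at most that over M.\<close>
  define I where "I k z = h z ^ (2 * k) * D z - h z ^ (2 * k + 1) * D z" for k z
  have even: "(\<lambda>z. h z ^ (2 * k) * D z) absolutely_integrable_on M"
      "real (2 * k + 1) * integral M (\<lambda>z. h z ^ (2 * k) * D z) = 4 * pi * l" for k
  proof -
    have eq: "T z ^ k * D z = h z ^ (2 * k) * D z" if "z \<in> M" for z by (simp add: T[OF that] power_mult)
    show "(\<lambda>z. h z ^ (2 * k) * D z) absolutely_integrable_on M"
      by (rule absolutely_integrable_spike[OF conjunct1[OF moments_T[of k]] negligible_empty])
         (rule eq[symmetric], blast)
    have "integral M (\<lambda>z. T z ^ k * D z) = integral M (\<lambda>z. h z ^ (2 * k) * D z)"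
      by (rule integral_cong[OF eq])
    then show "real (2 * k + 1) * integral M (\<lambda>z. h z ^ (2 * k) * D z) = 4 * pi * l"
      using conjunct2[OF moments_T[of k]] by simp
  qed
  have I: "I k integrable_on M" "real (2 * k + 1) * integral M (I k) = 4 * pi * l" for k
  proof -
    have i: "(\<lambda>z. h z ^ (2 * k) * D z) integrable_on M" "(\<lambda>z. h z ^ (2 * k + 1) * D z) integrable_on M"
      using even(1)[of k] odd[of k] set_lebesgue_integral_eq_integral(1) by blast+
    show "I k integrable_on M" unfolding I_def[abs_def] by (intro integrable_diff i)
    have "integral M (I k) = integral M (\<lambda>z. h z ^ (2 * k) * D z) - integral M (\<lambda>z. h z ^ (2 * k + 1) * D z)"
      unfolding I_def[abs_def] by (rule integral_diff[OF i])
    then show "real (2 * k + 1) * integral M (I k) = 4 * pi * l" using even(2)[of k] odd[of k] by simp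
  qed
  have Ik: "I k z = (1 - h z) * (T z ^ k * D z)" if "z \<in> M" for k z
  proof -
    have Tk: "T z ^ k = h z ^ (2 * k)" by (simp only: T[OF that] power_mult)
    have "x * d - y * x * d = (1 - y) * (x * d)" for x y d :: real by (simp add: algebra_simps)
    from this[of "h z ^ (2 * k)" "D z" "h z"] show ?thesis by (simp only: I_def Tk power_add power_one_right mult.commute)
  qed
  have ineq: "(2 - \<delta>) * (2 * pi - \<delta>) \<le> 4 * pi * l" if \<delta>: "0 < \<delta>" "\<delta> < 1" for \<delta>
  proof -
    have L0: "local_data lam Q E a r0 G0 A0" "ball a r0 \<subseteq> M" using sd0 by (auto simp: signed_data_def)
    then have r0: "0 < r0" and G0: "G0 holomorphic_on ball a r0" by (auto simp: local_data_def)
    have G0a: "G0 a = 0"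
    proof -
      have "a \<in> ball a r0" using r0 by simp
      then have "A0 a * G0 a = e' a" "A0 a \<noteq> 0" using sd0 unfolding signed_data_def local_data_def by blast+
      then show ?thesis using e'(3)[OF a(1)] by simp
    qed
    \<comment> \<open>On this neighbourhood of a the weight 1 - h exceeds 2 - \<delta>.\<close>
    define N where "N = {z \<in> ball a r0. height (G0 z) \<in> {..< - 1 + \<delta>}}"
    have "continuous_on (ball a r0) (\<lambda>z. height (G0 z))"
      using Ck_on_continuous[OF Ck_on_height[OF open_ball G0] open_ball] .
    then have N: "open N" unfolding N_def
      by (rule continuous_open_preimage[OF _ open_ball, unfolded vimage_def Int_def mem_Collect_eq]) auto
    have aN: "a \<in> N" using r0 \<delta> by (simp add: N_def G0a height_def)
    obtain m where m: "m \<ge> (1::nat)" and area: "\<exists>k0. \<forall>k\<ge>k0. \<exists>W. open W \<and> W \<subseteq> N \<inter> M \<and> (\<lambda>z. T z ^ k * D z) absolutely_integrable_on W \<and>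
        real (2 * k + 1) * integral W (\<lambda>z. T z ^ k * D z) \<ge> 2 * pi * m - \<delta>"
      by (rule zero_of_E[OF a(1) Ea], rule that, assumption, drule meta_spec[of _ N], drule meta_spec[of _ \<delta>]) (use N aN \<delta>(1) in simp)
    then obtain k W where W: "open W" "W \<subseteq> N \<inter> M" "(\<lambda>z. T z ^ k * D z) absolutely_integrable_on W"
      "real (2 * k + 1) * integral W (\<lambda>z. T z ^ k * D z) \<ge> 2 * pi * m - \<delta>" by blast
    have iW: "(\<lambda>z. T z ^ k * D z) integrable_on W" using W(3) set_lebesgue_integral_eq_integral(1) by blast
    have TD: "T z ^ k * D z \<ge> 0" if "z \<in> M" for z
      using T_bounds[OF that] D_nonneg[OF that] by (intro mult_nonneg_nonneg zero_le_power) auto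
    have IW: "I k integrable_on W"
    proof -
      have "I k absolutely_integrable_on M"
        unfolding I_def[abs_def] using even(1)[of k] odd[of k] by (intro set_integral_diff(1)) auto
      then have "I k absolutely_integrable_on W"
        by (rule set_integrable_subset) (use W in auto)
      then show ?thesis by (rule set_lebesgue_integral_eq_integral(1))
    qed
    have "(2 - \<delta>) * integral W (\<lambda>z. T z ^ k * D z) = integral W (\<lambda>z. (2 - \<delta>) * (T z ^ k * D z))"
      by (rule integral_mult_right[symmetric])
    also have "\<dots> \<le> integral W (I k)"
    proof (rule integral_le[OF has_integral_integrable[OF has_integral_mult_right[OF integrable_integral[OF iW]]] IW])
      fix z assume z: "z \<in> W"
      then have zM: "z \<in> M" and zN: "z \<in> N" using W by auto
      have "h z < - 1 + \<delta>" using zN h[OF sd0, of z] by (auto simp: N_def)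
      then show "(2 - \<delta>) * (T z ^ k * D z) \<le> I k z" unfolding Ik[OF zM] using TD[OF zM] by (intro mult_right_mono) auto
    qed
    also have "\<dots> \<le> integral M (I k)"
    proof (rule integral_subset_le[OF _ IW I(1)])
      show "\<forall>z\<in>M. 0 \<le> I k z"
      proof
        fix z assume z: "z \<in> M"
        have "0 \<le> 1 - h z" using h1[OF z] by (simp add: abs_le_iff)
        then show "0 \<le> I k z" unfolding Ik[OF z] using TD[OF z] by (rule mult_nonneg_nonneg)
      qed
    qed (use W in auto)
    finally have "(2 - \<delta>) * integral W (\<lambda>z. T z ^ k * D z) \<le> integral M (I k)" .
    then have "real (2 * k + 1) * ((2 - \<delta>) * integral W (\<lambda>z. T z ^ k * D z)) \<le> real (2 * k + 1) * integral M (I k)"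
      by (intro mult_left_mono) auto
    then have "(2 - \<delta>) * (real (2 * k + 1) * integral W (\<lambda>z. T z ^ k * D z)) \<le> 4 * pi * l"
      unfolding I(2) by (simp only: mult.left_commute)
    moreover have "2 * pi - \<delta> \<le> real (2 * k + 1) * integral W (\<lambda>z. T z ^ k * D z)"
    proof -
      have "2 * pi * 1 \<le> 2 * pi * real m" using m by (intro mult_left_mono) auto
      then show ?thesis using W(4) by linarith
    qed
    then have "(2 - \<delta>) * (2 * pi - \<delta>) \<le> (2 - \<delta>) * (real (2 * k + 1) * integral W (\<lambda>z. T z ^ k * D z))"
      using \<delta> by (intro mult_left_mono) auto
    ultimately show ?thesis by linarith
  qed
  \<comment> \<open>As \<delta> tends to 0 the inequality becomes 4 pi \<le> 4 pi l.\<close>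
  have "((\<lambda>\<delta>. (2 - \<delta>) * (2 * pi - \<delta>)) \<longlongrightarrow> (2 - 0) * (2 * pi - 0)) (at_right (0::real))"
    by (intro tendsto_intros)
  moreover have "\<forall>\<^sub>F \<delta> in at_right (0::real). (2 - \<delta>) * (2 * pi - \<delta>) \<le> 4 * pi * l"
    by (rule eventually_mono[OF eventually_at_right_real[OF zero_less_one]]) (use ineq in auto)
  ultimately have "(2 - 0) * (2 * pi - 0) \<le> 4 * pi * l"
    by (rule tendsto_upperbound) simp
  then show False using l by simp
qed

text \<open>Liouville leaves two candidates. Without zeros, E is a multiple of 1 / (z^2 (z - 1)^2)
  and decays like |z|^(-4), whereas the bound at infinity permits no faster decay than |z|^(-2).
  With a zero a, it is a multiple of (z - a)^2 / (z^2 (z - 1)^2), which is a square on M.\<close>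

theorem no_reduced_surface:
  assumes l: "l < 1" and Qb: "end_lower_bound Q (\<lambda>w. w)" "end_lower_bound Q (\<lambda>w. 1 + w)" "end_lower_bound Q (\<lambda>w. inverse w)"
  shows False
proof -
  have nb: "1 + w \<noteq> 0" "w \<noteq> 1" if "norm w < 1" for w :: complex
    using that by (auto simp: add_eq_0_iff)
  have e0: "end_lower_bound E (\<lambda>w. w)"
    by (rule end_lower_bound_E[OF l Qb(1)]) (use nb in \<open>auto simp: M_def\<close>)
  have e1: "end_lower_bound E (\<lambda>w. 1 + w)"
    by (rule end_lower_bound_E[OF l Qb(2)]) (use nb in \<open>auto simp: M_def inj_on_def intro!: holomorphic_intros\<close>)
  have einf: "end_lower_bound E (\<lambda>w. inverse w)"
    by (rule end_lower_bound_E[OF l Qb(3)]) (use nb in \<open>auto simp: M_def inj_on_def intro!: holomorphic_intros\<close>)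
  show False
  proof (cases "\<exists>a\<in>M. E a = 0")
    case False
    obtain k where k: "\<And>z. z \<in> M - {} \<Longrightarrow> (1 :: complex) = k * (E z * z\<^sup>2 * (z - 1)\<^sup>2)"
      and big: "\<exists>R c. c > 0 \<and> (\<forall>z. norm z \<ge> R \<longrightarrow> norm (E z) * (norm z)\<^sup>2 \<ge> c)"
      by (rule E_rational[OF e0 e1 einf, of "{}" "\<lambda>_. 1" 1])
         (use False in \<open>auto simp: one_le_power\<close>)
    obtain R c where c: "c > 0" "\<And>z. norm z \<ge> R \<Longrightarrow> norm (E z) * (norm z)\<^sup>2 \<ge> c" using big by blast
    have k0: "norm k > 0" using k[of 2] by (auto simp: M_def)
    \<comment> \<open>A real point so far out that |k| c (n - 1)^2 > 1, against the bound at
      infinity.\<close>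
    define n where "n = max R 2 + 1 / (norm k * c) + 1"
    have t: "1 / (norm k * c) > 0" using k0 c(1) by simp
    then have n: "n \<ge> R" "n \<ge> 2" "n - 1 \<ge> 1 / (norm k * c)" "n - 1 > 1" unfolding n_def by linarith+
    define z where "z = complex_of_real n"
    have "z - 1 = complex_of_real (n - 1)" by (simp add: z_def)
    then have "norm (z - 1) = \<bar>n - 1\<bar>" by (simp only: norm_of_real)
    then have z: "norm z = n" "norm (z - 1) = n - 1" "z \<in> M"
      using n by (auto simp: z_def M_def)
    have "1 = norm k * ((norm (E z) * (norm z)\<^sup>2) * (norm (z - 1))\<^sup>2)"
      using arg_cong[OF k[of z], of norm] z(3) by (simp add: norm_mult norm_power mult_ac)
    also have "\<dots> \<ge> norm k * (c * (n - 1)\<^sup>2)"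
      using c z n by (intro mult_left_mono mult_right_mono) auto
    finally have le: "norm k * c * (n - 1)\<^sup>2 \<le> 1" by (simp add: mult_ac)
    have "(n - 1) < (n - 1)\<^sup>2" using mult_strict_right_mono[of 1 "n - 1" "n - 1"] n(4) by (simp add: power2_eq_square)
    then have "norm k * c * (n - 1) < norm k * c * (n - 1)\<^sup>2" using k0 c by simp
    moreover have "norm k * c * (1 / (norm k * c)) \<le> norm k * c * (n - 1)" using n k0 c by (intro mult_left_mono) auto
    moreover have "norm k * c * (1 / (norm k * c)) = 1" using k0 c(1) by simp
    ultimately show False using le by linarith
  next
    case True
    then obtain a where a: "a \<in> M" "E a = 0" by blast
    have za: "E z = 0 \<longleftrightarrow> z = a" if "z \<in> M" for z using zero_of_E_unique[OF l that _ a] a by blast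
    obtain u \<rho> where u: "0 < \<rho>" "ball a \<rho> \<subseteq> M" "u holomorphic_on ball a \<rho>"
      "\<And>z. z \<in> ball a \<rho> \<Longrightarrow> E z = (z - a)\<^sup>2 * u z" "\<And>z. z \<in> ball a \<rho> \<Longrightarrow> u z \<noteq> 0"
      by (rule zero_of_E_simple[OF l a]) (rule that, assumption+)
    have bd: "\<exists>B. \<forall>\<^sub>F w in at z. norm ((w - a)\<^sup>2 / E w) \<le> B" if "z \<in> {a}" for z
    proof -
      have "isCont u a" using holomorphic_on_imp_continuous_on[OF u(3)] u(1) by (simp add: continuous_on_eq_continuous_at)
      then have "((\<lambda>w. norm (inverse (u w))) \<longlongrightarrow> norm (inverse (u a))) (at a)"
        using u(5)[of a] u(1) by (intro tendsto_intros) (auto simp: isCont_def)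
      then have "\<forall>\<^sub>F w in at a. norm (inverse (u w)) < norm (inverse (u a)) + 1"
        by (rule order_tendstoD) simp
      moreover have "\<forall>\<^sub>F w in at a. w \<in> ball a \<rho> - {a}"
        using eventually_at_in_open[of "ball a \<rho>" a] u(1) by simp
      ultimately have "\<forall>\<^sub>F w in at a. norm ((w - a)\<^sup>2 / E w) \<le> norm (inverse (u a)) + 1"
      proof eventually_elim
        case (elim w)
        then have "(w - a)\<^sup>2 / E w = inverse (u w)" using u(4)[of w] by (simp add: field_simps)
        then show ?case using elim by simp
      qed
      then show ?thesis using that by blast
    qed
    have pb: "norm ((z - a)\<^sup>2) \<le> (1 + norm a)\<^sup>2 * (1 + norm z)\<^sup>2" for z
    proof -
      have "norm (z - a) \<le> (1 + norm a) * (1 + norm z)"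
      proof -
        have "(1 + norm a) * (1 + norm z) = 1 + norm a + norm z + norm a * norm z" by (simp add: algebra_simps)
        moreover have "0 \<le> norm a * norm z" by simp
        ultimately show ?thesis using norm_triangle_ineq4[of z a] by linarith
      qed
      then show ?thesis unfolding norm_power power_mult_distrib[symmetric] by (intro power_mono) auto
    qed
    obtain k where k: "\<And>z. z \<in> M - {a} \<Longrightarrow> (z - a)\<^sup>2 = k * (E z * z\<^sup>2 * (z - 1)\<^sup>2)"
      by (rule E_rational[OF e0 e1 einf, of "{a}" "\<lambda>z. (z - a)\<^sup>2" "(1 + norm a)\<^sup>2"])
         (use a za bd pb in \<open>auto intro!: holomorphic_intros\<close>)
    have k0: "k \<noteq> 0"
    proof
      assume "k = 0"
      then have "M - {a} = {}" using k by auto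
      moreover have "2 \<in> M" "3 \<in> M" by (auto simp: M_def)
      ultimately have "(2::complex) = 3" by blast
      then show False by simp
    qed
    \<comment> \<open>The root of 1 / k makes the square of e equal to E, because k E z^2 (z - 1)^2
      = (z - a)^2.\<close>
    define \<kappa> where "\<kappa> = csqrt (1 / k)"
    have \<kappa>: "\<kappa>\<^sup>2 = 1 / k" "\<kappa> \<noteq> 0" using k0 by (auto simp: \<kappa>_def)
    define e where "e z = \<kappa> * (z - a) / (z * (z - 1))" for z
    show False
    proof (rule no_simple_zero[OF l _ _ a(1), of e])
      show "e holomorphic_on M" unfolding e_def by (intro holomorphic_intros) (auto simp: M_def)
      show "(e z)\<^sup>2 = E z" if z: "z \<in> M" for z
      proof (cases "z = a")
        case True then show ?thesis using a by (simp add: e_def)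
      next
        case False
        then show ?thesis using k[of z] z k0
          by (simp add: e_def power_divide power_mult_distrib \<kappa> M_def)
      qed
      show "e z = 0 \<longleftrightarrow> z = a" if "z \<in> M" for z using that \<kappa>(2) by (auto simp: e_def M_def)
    qed
  qed
qed

end

text \<open>A continuous function without zeros has modulus bounded below on the closed disc of half
  the radius.\<close>

lemma modulus_end_lower_bound:
  assumes Y: "Y holomorphic_on ball 0 r" and r: "0 < r" and nz: "\<And>\<xi>. \<xi> \<in> ball 0 r \<Longrightarrow> Y \<xi> \<noteq> 0"
    and eq: "\<And>\<xi>. \<xi> \<in> ball 0 r - {0} \<Longrightarrow> norm (F (\<psi> \<xi>)) * (norm (deriv \<psi> \<xi>))\<^sup>2 * (norm \<xi>)\<^sup>2 = norm (Y \<xi>)"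
  shows "end_lower_bound F \<psi>"
proof -
  have "continuous_on (cball 0 (r / 2)) (\<lambda>\<xi>. norm (Y \<xi>))"
    using holomorphic_on_imp_continuous_on[OF Y] r by (auto intro!: continuous_intros elim: continuous_on_subset)
  then obtain \<xi>0 where \<xi>0: "\<xi>0 \<in> cball 0 (r / 2)" "\<And>\<xi>. \<xi> \<in> cball 0 (r / 2) \<Longrightarrow> norm (Y \<xi>0) \<le> norm (Y \<xi>)"
    using continuous_attains_inf[OF compact_cball, of 0 "r / 2" "\<lambda>\<xi>. norm (Y \<xi>)"] r by auto
  have c: "0 < norm (Y \<xi>0)" using \<xi>0(1) nz[of \<xi>0] r by simp
  have b: "norm (Y \<xi>0) \<le> (norm \<xi>)\<^sup>2 * norm (F (\<psi> \<xi>)) * (norm (deriv \<psi> \<xi>))\<^sup>2" if "\<xi> \<in> ball 0 (r / 2) - {0}" for \<xi>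
    using \<xi>0(2)[of \<xi>] eq[of \<xi>] that r by (simp add: ac_simps)
  have "0 < r / 2" using r by simp
  then show ?thesis using c b unfolding end_lower_bound_def by blast
qed

section \<open>Global functions of prescribed modulus\<close>

text \<open>On a disc without zeros of h the quotient has modulus 1 and is constant by the maximum
  principle; continuation does the rest.\<close>

lemma eq_norm_imp_unit_multiple:
  assumes f: "f holomorphic_on S" and h: "h holomorphic_on S" and S: "open S" "connected S"
    and eq: "\<And>z. z \<in> S \<Longrightarrow> norm (f z) = norm (h z)"
  obtains c where "norm c = 1" "\<And>z. z \<in> S \<Longrightarrow> f z = c * h z"
proof (cases "\<forall>z\<in>S. h z = 0")
  case True
  show thesis by (rule that[of 1]) (use True eq in force)+
next
  case False
  then obtain x where x: "x \<in> S" "h x \<noteq> 0" by blast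
  define V where "V = {z \<in> S. h z \<in> - {0}}"
  have "open V" unfolding V_def
    by (rule continuous_open_preimage[OF holomorphic_on_imp_continuous_on[OF h] S(1), unfolded vimage_def Int_def mem_Collect_eq]) auto
  moreover have "x \<in> V" using x by (simp add: V_def)
  ultimately obtain e where e: "e > 0" "ball x e \<subseteq> V" using open_contains_ball by blast
  have sub: "ball x e \<subseteq> S" using e by (auto simp: V_def)
  have h0: "h z \<noteq> 0" if "z \<in> ball x e" for z using e that by (auto simp: V_def)
  have q: "(\<lambda>z. f z / h z) holomorphic_on ball x e"
    by (intro holomorphic_intros holomorphic_on_subset[OF f sub] holomorphic_on_subset[OF h sub] h0)
  have n1: "norm (f z / h z) = 1" if "z \<in> ball x e" for z
    using eq[of z] h0[OF that] sub that by (auto simp: norm_divide)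
  have "(\<lambda>z. f z / h z) constant_on ball x e"
    by (rule maximum_modulus_principle[OF q open_ball connected_ball open_ball order_refl, of x]) (use n1 e(1) in auto)
  then obtain c where c: "\<And>z. z \<in> ball x e \<Longrightarrow> f z / h z = c" by (auto simp: constant_on_def)
  show thesis
  proof (rule that[of c])
    show "norm c = 1" using n1[of x] c[of x] e(1) by simp
    show "f z = c * h z" if "z \<in> S" for z
    proof (rule analytic_continuation_open[of "ball x e" S f "\<lambda>z. c * h z"])
      show "f w = c * h w" if "w \<in> ball x e" for w using c[OF that] h0[OF that] by (simp add: field_simps)
    qed (use e sub S f h that in \<open>auto intro!: holomorphic_intros\<close>)
  qed
qed

text \<open>Equal moduli mean X = c Y with |c| = 1, and c drops out of the logarithmic derivative.
  The centres z and w are excluded in the hypothesis because the prescribed modulus is described by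
  the local functions only off their centres; continuity recovers them.\<close>

lemma local_log_derivatives_agree:
  assumes X: "X holomorphic_on ball z r" "\<And>u. u \<in> ball z r \<Longrightarrow> X u \<noteq> 0"
    and Y: "Y holomorphic_on ball w s" "\<And>u. u \<in> ball w s \<Longrightarrow> Y u \<noteq> 0" and s: "0 < s" and w: "w \<in> ball z r"
    and eq: "\<And>u. u \<in> ball z r \<inter> ball w s - {z, w} \<Longrightarrow> norm (X u) = norm (Y u)"
  shows "norm (X w) = norm (Y w)" "deriv X w / X w = deriv Y w / Y w"
proof -
  define B where "B = ball z r \<inter> ball w s"
  have B: "open B" "w \<in> B" using w s by (auto simp: B_def)
  have all: "norm (X u) = norm (Y u)" if u: "u \<in> B" for u
  proof (cases "u \<in> {z, w}")
    case False then show ?thesis using eq[of u] u by (simp add: B_def)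
  next
    case True
    have "isCont X u" "isCont Y u"
      using holomorphic_on_imp_continuous_on[OF X(1)] holomorphic_on_imp_continuous_on[OF Y(1)] u
      by (auto simp: B_def continuous_on_eq_continuous_at)
    then have l: "((\<lambda>v. norm (X v)) \<longlongrightarrow> norm (X u)) (at u)" "((\<lambda>v. norm (Y v)) \<longlongrightarrow> norm (Y u)) (at u)"
      by (auto intro!: tendsto_norm simp: isCont_def)
    have "open (B - ({z, w} - {u}))" using B(1) by (intro open_Diff finite_imp_closed) auto
    then have "\<forall>\<^sub>F v in at u. v \<in> B - ({z, w} - {u}) - {u}"
      using eventually_at_in_open[of "B - ({z, w} - {u})" u] u by auto
    then have "\<forall>\<^sub>F v in at u. norm (X v) = norm (Y v)"
      by eventually_elim (use eq in \<open>auto simp: B_def\<close>)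
    then have "((\<lambda>v. norm (Y v)) \<longlongrightarrow> norm (X u)) (at u)" using l(1) by (rule Lim_transform_eventually[rotated])
    then show ?thesis using l(2) tendsto_unique by (metis at_neq_bot)
  qed
  then show "norm (X w) = norm (Y w)" using B by blast
  obtain e where e: "e > 0" "ball w e \<subseteq> B" using B open_contains_ball by blast
  obtain c where c: "norm c = 1" "\<And>u. u \<in> ball w e \<Longrightarrow> X u = c * Y u"
  proof (rule eq_norm_imp_unit_multiple[of X "ball w e" Y])
    show "X holomorphic_on ball w e" "Y holomorphic_on ball w e"
      using e(2) X(1) Y(1) by (auto simp: B_def elim!: holomorphic_on_subset)
  qed (use all e in auto)
  have we: "w \<in> ball w e" using e by simp
  have "((\<lambda>u. c * Y u) has_field_derivative c * deriv Y w) (at w)"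
    using holomorphic_derivI[OF Y(1) open_ball, of w] s by (auto intro!: derivative_eq_intros)
  then have "(X has_field_derivative c * deriv Y w) (at w)"
    by (rule has_field_derivative_transform_within_open[OF _ open_ball we]) (use c(2) in auto)
  then have "deriv X w = c * deriv Y w" by (rule DERIV_imp_deriv)
  then show "deriv X w / X w = deriv Y w / Y w" using c(1) c(2)[OF we] by auto
qed

text \<open>Logarithmic derivatives do not see unimodular constants, so local functions of prescribed modulus glue.\<close>

lemma global_function_of_modulus:
  fixes \<Theta> :: "complex \<Rightarrow> real"
  assumes loc: "\<And>z. \<exists>r Y n. 0 < r \<and> Y holomorphic_on ball z r \<and> (\<forall>w\<in>ball z r. Y w \<noteq> 0) \<and>
      (\<forall>w\<in>ball z r - {z}. \<Theta> w = norm (Y w) * norm (w - z) ^ n)"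
    and inf: "\<And>w. norm w > R0 \<Longrightarrow> \<Theta> w \<noteq> 0" "continuous_on {w. norm w > R0} \<Theta>"
  obtains R where "R holomorphic_on UNIV" "\<And>w. (\<Theta> \<longlongrightarrow> norm (R w)) (at w)"
proof -
  obtain rr YY nn where P: "\<And>z. 0 < rr z" "\<And>z. YY z holomorphic_on ball z (rr z)" "\<And>z w. w \<in> ball z (rr z) \<Longrightarrow> YY z w \<noteq> 0"
      "\<And>z w. w \<in> ball z (rr z) - {z} \<Longrightarrow> \<Theta> w = norm (YY z w) * norm (w - z) ^ nn z"
    using loc by metis
  \<comment> \<open>As \<open>0 ^ 0 = 1\<close>, the limit vanishes exactly when the exponent at w
    is positive.\<close>
  have lim: "(\<Theta> \<longlongrightarrow> norm (YY w w) * 0 ^ nn w) (at w)" for w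
  proof -
    have "isCont (YY w) w"
      using holomorphic_on_imp_continuous_on[OF P(2)[of w]] P(1)[of w] by (simp add: continuous_on_eq_continuous_at)
    then have "((\<lambda>u. norm (YY w u) * norm (u - w) ^ nn w) \<longlongrightarrow> norm (YY w w) * norm (w - w) ^ nn w) (at w)"
      by (intro tendsto_intros) (auto simp: isCont_def)
    moreover have "\<forall>\<^sub>F u in at w. u \<in> ball w (rr w) - {w}"
      using eventually_at_in_open[of "ball w (rr w)" w] P(1)[of w] by simp
    then have "\<forall>\<^sub>F u in at w. norm (YY w u) * norm (u - w) ^ nn w = \<Theta> u"
      by eventually_elim (use P(4) in simp)
    ultimately show ?thesis by (simp add: Lim_transform_eventually)
  qed
  have nn0: "nn w = 0" if "(\<Theta> \<longlongrightarrow> c) (at w)" "c \<noteq> 0" for w c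
  proof (rule ccontr)
    assume "nn w \<noteq> 0"
    then have "(\<Theta> \<longlongrightarrow> 0) (at w)" using lim[of w] by (simp add: zero_power)
    then show False using that tendsto_unique by (metis at_neq_bot)
  qed
  have near: "nn w = 0" if w: "w \<in> ball z (rr z) - {z}" for z w
  proof (rule nn0)
    have "isCont (YY z) w"
      using holomorphic_on_imp_continuous_on[OF P(2)[of z]] w by (simp add: continuous_on_eq_continuous_at)
    then have "((\<lambda>u. norm (YY z u) * norm (u - z) ^ nn z) \<longlongrightarrow> norm (YY z w) * norm (w - z) ^ nn z) (at w)"
      by (intro tendsto_intros) (auto simp: isCont_def)
    moreover have "\<forall>\<^sub>F u in at w. u \<in> ball z (rr z) - {z} - {w}"
      using eventually_at_in_open[of "ball z (rr z) - {z}" w] w by (auto simp: open_Diff)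
    then have "\<forall>\<^sub>F u in at w. norm (YY z u) * norm (u - z) ^ nn z = \<Theta> u"
      by eventually_elim (use P(4)[of _ z] in simp)
    ultimately show "(\<Theta> \<longlongrightarrow> norm (YY z w) * norm (w - z) ^ nn z) (at w)" by (rule Lim_transform_eventually)
    show "norm (YY z w) * norm (w - z) ^ nn z \<noteq> 0" using P(3)[of w z] w by auto
  qed
  have far: "nn w = 0" if w: "norm w > R0" for w
  proof (rule nn0)
    have "open {w :: complex. norm w > R0}" by (intro open_Collect_less continuous_intros)
    then show "(\<Theta> \<longlongrightarrow> \<Theta> w) (at w)" using inf(2) w by (simp add: continuous_on_eq_continuous_at isCont_def)
  qed (use inf(1) w in blast)
  \<comment> \<open>The exponents vanish on punctured discs about every point and for large |w|, so
    only finitely many zeros have to be split off.\<close>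
  define S where "S = {z. nn z \<noteq> 0}"
  have Sb: "S \<subseteq> cball 0 R0"
  proof
    fix w assume "w \<in> S"
    then have "\<not> norm w > R0" using far[of w] by (auto simp: S_def)
    then show "w \<in> cball 0 R0" by simp
  qed
  have fS: "finite S"
  proof (rule ccontr)
    assume "infinite S"
    then obtain z where "z islimpt S"
      using Sb compact_cball compact_eq_Bolzano_Weierstrass by metis
    then obtain w where "w \<in> S" "w \<in> ball z (rr z)" "w \<noteq> z"
      using P(1)[of z] unfolding islimpt_approachable by (metis dist_commute mem_ball)
    then show False using near[of w z] by (simp add: S_def)
  qed
  define Pi where "Pi T w = (\<Prod>z\<in>T. (w - z) ^ nn z)" for T and w :: complex
  have Pih: "Pi T holomorphic_on A" for T A unfolding Pi_def[abs_def] by (intro holomorphic_intros)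
  have Pi_split: "Pi S w = (w - z) ^ nn z * Pi (S - {z}) w" for z w
  proof (cases "z \<in> S")
    case True then show ?thesis unfolding Pi_def by (rule prod.remove[OF fS])
  next
    case False then show ?thesis by (simp add: S_def)
  qed
  have Pi0: "Pi (S - {z}) w \<noteq> 0" if "w \<in> ball z (rr z)" for z w
  proof -
    have "w \<notin> S - {z}" using near[of w z] that by (auto simp: S_def)
    then show ?thesis using fS by (auto simp: Pi_def)
  qed
  \<comment> \<open>Dividing by the zeros at the other points leaves a function without zeros whose
    modulus off the centre is \<Theta> / |Pi S|, the same expression for every z.\<close>
  define X where "X z w = YY z w / Pi (S - {z}) w" for z w
  have X: "X z holomorphic_on ball z (rr z)" "\<And>w. w \<in> ball z (rr z) \<Longrightarrow> X z w \<noteq> 0" for z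
    unfolding X_def[abs_def] using P(3)[of _ z] Pi0[of _ z] by (auto intro!: holomorphic_intros P Pih)
  have XT: "norm (X z w) = \<Theta> w / norm (Pi S w)" if "w \<in> ball z (rr z) - {z}" for z w
    using P(4)[OF that] Pi0[of w z] that unfolding Pi_split[of w z] X_def
    by (simp add: norm_divide norm_mult norm_power)
  have agree: "norm (X z w) = norm (X w w)" "deriv (X z) w / X z w = deriv (X w) w / X w w" if w: "w \<in> ball z (rr z)" for z w
    using local_log_derivatives_agree[of "X z" z "rr z" "X w" w "rr w", OF X(1) _ X(1) _ P(1) w] X(2) XT[of _ z] XT[of _ w] by auto
  define L where "L w = deriv (X w) w / X w w" for w
  have L: "L holomorphic_on UNIV"
  proof -
    have "L field_differentiable at z" for z
    proof -
      have "(\<lambda>w. deriv (X z) w / X z w) holomorphic_on ball z (rr z)"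
        by (intro holomorphic_intros holomorphic_deriv[OF X(1)] X) auto
      then have "L holomorphic_on ball z (rr z)"
        by (rule holomorphic_transform) (use agree(2) in \<open>simp add: L_def\<close>)
      then show ?thesis using P(1)[of z] by (auto intro: holomorphic_on_imp_differentiable_at)
    qed
    then show ?thesis by (simp add: holomorphic_on_def field_differentiable_at_within)
  qed
  obtain f where f: "\<And>x. (f has_field_derivative L x) (at x)"
    using holomorphic_convex_primitive'[OF convex_UNIV open_UNIV L] by auto
  define F where "F w = exp (f w)" for w
  \<comment> \<open>F and the local functions have the same logarithmic derivative L, so this
    quotient of moduli is locally constant; its value c is divided out in the final
    function.\<close>
  define \<phi> where "\<phi> w = norm (F w) / norm (X w w)" for w
  have loc_const: "\<phi> w = \<phi> z" if w: "w \<in> ball z (rr z)" for z w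
  proof -
    have "\<exists>c. \<forall>u\<in>ball z (rr z). F u / X z u = c"
    proof (rule has_field_derivative_zero_constant[OF convex_ball])
      fix u assume u: "u \<in> ball z (rr z)"
      have "(F has_field_derivative F u * L u) (at u)" unfolding F_def using f[of u] by (auto intro!: derivative_eq_intros)
      from DERIV_divide[OF this holomorphic_derivI[OF X(1) open_ball u] X(2)[OF u]]
      have "((\<lambda>u. F u / X z u) has_field_derivative (F u * L u * X z u - F u * deriv (X z) u) / (X z u * X z u)) (at u)" .
      moreover have "L u * X z u = deriv (X z) u" using agree(2)[OF u] X(2)[OF u] by (simp add: L_def[of u] field_simps)
      ultimately show "((\<lambda>u. F u / X z u) has_field_derivative 0) (at u within ball z (rr z))"
        by (simp add: has_field_derivative_at_within mult.assoc)
    qed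
    then have "F w / X z w = F z / X z z" using w P(1)[of z] by (metis centre_in_ball)
    then have "norm (F w) / norm (X z w) = norm (F z) / norm (X z z)" by (metis norm_divide)
    then show ?thesis using agree(1)[OF w] by (simp add: \<phi>_def)
  qed
  have "\<exists>c. \<forall>x\<in>UNIV. \<phi> x = c"
  proof (rule has_derivative_zero_constant[OF convex_UNIV])
    fix z :: complex
    have "((\<lambda>_. \<phi> z) has_derivative (\<lambda>h. 0)) (at z)" by simp
    then show "(\<phi> has_derivative (\<lambda>h. 0)) (at z within UNIV)"
    proof (rule has_derivative_transform_within_open[OF _ open_ball])
      show "z \<in> ball z (rr z)" using P(1)[of z] by simp
      show "\<phi> z = \<phi> w" if "w \<in> ball z (rr z)" for w using loc_const[OF that] by (rule sym)
    qed
  qed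
  then obtain c where c: "\<And>z. \<phi> z = c" by blast
  have cpos: "c > 0" using c[of 0] X(2)[of 0 0] P(1)[of 0] by (auto simp: \<phi>_def F_def)
  show thesis
  proof (rule that[of "\<lambda>w. of_real (1 / c) * (F w * Pi S w)"])
    have "f holomorphic_on UNIV"
      unfolding holomorphic_on_def field_differentiable_def using f has_field_derivative_at_within by blast
    then have "F holomorphic_on UNIV" unfolding F_def[abs_def] by (intro holomorphic_intros)
    then show "(\<lambda>w. of_real (1 / c) * (F w * Pi S w)) holomorphic_on UNIV" by (intro holomorphic_intros Pih)
    fix w
    have w: "w \<in> ball w (rr w)" using P(1)[of w] by simp
    have "norm (F w) = c * norm (X w w)" using c[of w] X(2)[OF w] by (simp add: \<phi>_def field_simps)
    then have "norm (F w) * norm (Pi S w) = c * (norm (YY w w) * 0 ^ nn w)"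
      using Pi0[OF w] by (simp add: Pi_split[of w w] X_def norm_divide norm_mult norm_power)
    then have "norm (of_real (1 / c) * (F w * Pi S w)) = norm (YY w w) * 0 ^ nn w"
      using cpos by (simp add: norm_mult norm_divide)
    then show "(\<Theta> \<longlongrightarrow> norm (of_real (1 / c) * (F w * Pi S w))) (at w)" using lim[of w] by simp
  qed
qed

section \<open>Commuting rotations of the sphere\<close>

text \<open>Homogeneous coordinates, on which Moebius maps act linearly; meaningful when n and d are
  not both 0.\<close>

definition sphere_point :: "complex \<Rightarrow> complex \<Rightarrow> complex option" where
  "sphere_point n d = (if d = 0 then None else Some (n / d))"

text \<open>The action of the matrix with rows (a, b) and (- cnj b, cnj a), which lies in SU(2) when
  |a|^2 + |b|^2 = 1.\<close>

definition unitary_moebius :: "complex \<Rightarrow> complex \<Rightarrow> complex option \<Rightarrow> complex option" where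
  "unitary_moebius a b P = (case P of None \<Rightarrow> sphere_point a (- cnj b)
     | Some w \<Rightarrow> sphere_point (a * w + b) (- cnj b * w + cnj a))"

text \<open>Unitarity together with determinant 1 determines the second row of the matrix from the
  first.\<close>

lemma PSU2_cases:
  assumes "m \<in> PSU2"
  obtains a b where "(norm a)\<^sup>2 + (norm b)\<^sup>2 = 1" "m = unitary_moebius a b"
proof -
  obtain A where A: "A \<in> SU2" "m = moebius_action A" using assms by (auto simp: PSU2_def)
  define a b c d where "a = A $ 1 $ 1" and "b = A $ 1 $ 2" and "c = A $ 2 $ 1" and "d = A $ 2 $ 2"
  have U: "A ** (\<chi> i j. cnj (A $ j $ i)) = mat 1" and det: "det A = 1" using A(1) by (auto simp: SU2_def)
  have 1: "a * cnj a + b * cnj b = 1" and 2: "c * cnj a + d * cnj b = 0"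
    using arg_cong[OF U, of "\<lambda>B :: complex^2^2. B $ 1 $ 1"] arg_cong[OF U, of "\<lambda>B :: complex^2^2. B $ 2 $ 1"]
    by (auto simp: matrix_matrix_mult_def sum_2 mat_def a_def b_def c_def d_def)
  have 3: "a * d - b * c = 1" using det by (simp add: det_2 a_def b_def c_def d_def)
  have "d = d * (a * cnj a + b * cnj b)" using 1 by simp
  also have "\<dots> = cnj a * (a * d) + b * (d * cnj b)" by (simp add: algebra_simps)
  also have "d * cnj b = - (c * cnj a)" using 2 by (simp add: add_eq_0_iff)
  also have "cnj a * (a * d) + b * - (c * cnj a) = cnj a * (a * d - b * c)" by (simp add: algebra_simps)
  finally have d: "d = cnj a" using 3 by simp
  have "c = c * (a * cnj a + b * cnj b)" using 1 by simp
  also have "\<dots> = a * (c * cnj a) + cnj b * (b * c)" by (simp add: algebra_simps)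
  also have "c * cnj a = - (d * cnj b)" using 2 by (simp add: eq_neg_iff_add_eq_0)
  also have "a * - (d * cnj b) + cnj b * (b * c) = - cnj b * (a * d - b * c)" by (simp add: algebra_simps)
  finally have c: "c = - cnj b" using 3 by simp
  show thesis
  proof (rule that[of a b])
    have "complex_of_real ((norm a)\<^sup>2 + (norm b)\<^sup>2) = 1"
      using 1 by (simp only: of_real_add complex_norm_square)
    then show "(norm a)\<^sup>2 + (norm b)\<^sup>2 = 1" by (simp only: of_real_eq_1_iff)
    show "m = unitary_moebius a b"
    proof
      fix P show "m P = unitary_moebius a b P"
        using c d by (cases P) (auto simp: A(2) unitary_moebius_def sphere_point_def a_def b_def c_def d_def)
    qed
  qed
qed

lemma sphere_point_cases:
  obtains n d where "P = sphere_point n d" "n \<noteq> 0 \<or> d \<noteq> 0"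
  by (cases P) (auto simp: sphere_point_def intro: that[of 1 0] that[of "the P" 1])

lemma unitary_nonzero:
  assumes "(norm a)\<^sup>2 + (norm b)\<^sup>2 = 1" "n \<noteq> 0 \<or> d \<noteq> 0"
  shows "a * n + b * d \<noteq> 0 \<or> - cnj b * n + cnj a * d \<noteq> 0"
proof (rule ccontr)
  assume "\<not> ?thesis"
  then have 1: "a * n + b * d = 0" and 2: "- cnj b * n + cnj a * d = 0" by auto
  have u: "a * cnj a + b * cnj b = 1"
    using arg_cong[OF assms(1), of complex_of_real] by (simp only: of_real_add complex_norm_square of_real_1)
  have "n = n * (a * cnj a + b * cnj b)" using u by simp
  also have "\<dots> = cnj a * (a * n + b * d) - b * (- cnj b * n + cnj a * d)" by (simp add: algebra_simps)
  finally have "n = 0" by (simp only: 1 2) simp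
  have "d = d * (a * cnj a + b * cnj b)" using u by simp
  also have "\<dots> = cnj b * (a * n + b * d) + a * (- cnj b * n + cnj a * d)" by (simp add: algebra_simps)
  finally have "d = 0" by (simp only: 1 2) simp
  then show False using \<open>n = 0\<close> assms(2) by blast
qed

lemma unitary_moebius_sphere_point:
  assumes "n \<noteq> 0 \<or> d \<noteq> 0"
  shows "unitary_moebius a b (sphere_point n d) = sphere_point (a * n + b * d) (- cnj b * n + cnj a * d)"
proof (cases "d = 0")
  case True
  then show ?thesis using assms by (auto simp: sphere_point_def unitary_moebius_def)
next
  case False
  have 1: "a * (n / d) + b = (a * n + b * d) / d" and 2: "- cnj b * (n / d) + cnj a = (- cnj b * n + cnj a * d) / d"
    using False by (simp_all add: field_simps)
  show ?thesis using False unfolding sphere_point_def unitary_moebius_def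
    by (simp only: if_False option.case 1 2) simp
qed

lemma unitary_moebius_compose:
  assumes "(norm c)\<^sup>2 + (norm e)\<^sup>2 = 1"
  shows "unitary_moebius a b (unitary_moebius c e P) = unitary_moebius (a * c - b * cnj e) (a * e + b * cnj c) P"
proof -
  obtain n d where P: "P = sphere_point n d" "n \<noteq> 0 \<or> d \<noteq> 0" by (rule sphere_point_cases)
  show ?thesis
    unfolding P(1) unitary_moebius_sphere_point[OF P(2)] unitary_moebius_sphere_point[OF unitary_nonzero[OF assms P(2)]]
    by (intro arg_cong2[where f = sphere_point]) (simp_all add: algebra_simps)
qed

lemma unitary_compose_norm:
  assumes "(norm a)\<^sup>2 + (norm b)\<^sup>2 = 1" "(norm c)\<^sup>2 + (norm e)\<^sup>2 = 1"
  shows "(norm (a * c - b * cnj e))\<^sup>2 + (norm (a * e + b * cnj c))\<^sup>2 = 1"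
proof -
  have "complex_of_real ((norm (a * c - b * cnj e))\<^sup>2 + (norm (a * e + b * cnj c))\<^sup>2)
     = (a * cnj a + b * cnj b) * (c * cnj c + e * cnj e)"
    by (simp only: of_real_add complex_norm_square) (simp add: algebra_simps)
  also have "\<dots> = complex_of_real (((norm a)\<^sup>2 + (norm b)\<^sup>2) * ((norm c)\<^sup>2 + (norm e)\<^sup>2))"
    by (simp only: of_real_add of_real_mult complex_norm_square)
  also have "\<dots> = 1" using assms by simp
  finally show ?thesis by (simp only: of_real_eq_1_iff)
qed

text \<open>A finite fixed point solves cnj t w^2 + (s - cnj s) w + t = 0, which has a root if t
  \<noteq> 0; if t = 0, the point \<infinity> is fixed. At a root the denominator cannot vanish,
  since this would give |w|^2 + 1 = 0.\<close>

lemma unitary_moebius_fixed_point: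
  obtains n d where "n \<noteq> 0 \<or> d \<noteq> 0" "unitary_moebius s t (sphere_point n d) = sphere_point n d"
proof (cases "t = 0")
  case True
  show thesis by (rule that[of 1 0]) (auto simp: unitary_moebius_def True sphere_point_def)
next
  case False
  define \<Delta> where "\<Delta> = csqrt ((s - cnj s)\<^sup>2 - 4 * (cnj t * t))"
  define w where "w = (- (s - cnj s) + \<Delta>) / (2 * cnj t)"
  have "2 * cnj t * w + (s - cnj s) = \<Delta>" using False by (simp add: w_def)
  then have "(2 * cnj t * w + (s - cnj s))\<^sup>2 = (s - cnj s)\<^sup>2 - 4 * (cnj t * t)" by (simp add: \<Delta>_def)
  then have "4 * cnj t * (cnj t * w\<^sup>2 + (s - cnj s) * w + t) = 0" by (simp add: power2_eq_square algebra_simps)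
  then have "cnj t * w\<^sup>2 + (s - cnj s) * w + t = 0" using False by simp
  then have r: "s * w + t = w * (- cnj t * w + cnj s)" by (simp add: power2_eq_square algebra_simps)
  show thesis
  proof (rule that[of w 1])
    show "unitary_moebius s t (sphere_point w 1) = sphere_point w 1"
    proof (cases "- cnj t * w + cnj s = 0")
      case True
      then have z: "s * w + t = 0" using r by simp
      have "cnj s = cnj t * w" using True by (simp add: add_eq_0_iff2)
      then have "cnj (cnj s) = cnj (cnj t * w)" by (rule arg_cong)
      then have "s = t * cnj w" by simp
      then have "t * (w * cnj w + 1) = 0" using z by (simp add: algebra_simps)
      then have "w * cnj w + 1 = 0" using False by simp
      then have "complex_of_real ((norm w)\<^sup>2 + 1) = 0" by (simp only: of_real_add complex_norm_square of_real_1)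
      then have "(norm w)\<^sup>2 + 1 = 0" by (simp only: of_real_eq_0_iff)
      then show ?thesis using zero_le_power2[of "norm w"] by linarith
    next
      case nz: False
      have "(s * w + t) / (- cnj t * w + cnj s) = w" unfolding r using nz by (rule nonzero_mult_div_cancel_right)
      then show ?thesis using nz by (simp add: unitary_moebius_sphere_point) (simp add: sphere_point_def)
    qed
  qed auto
qed

fun rotate_sphere :: "complex \<Rightarrow> complex option \<Rightarrow> complex option" where
  "rotate_sphere k None = None"
| "rotate_sphere k (Some w) = Some (k * w)"

fun flip_sphere :: "complex \<Rightarrow> complex option \<Rightarrow> complex option" where
  "flip_sphere k None = Some 0"
| "flip_sphere k (Some w) = (if w = 0 then None else Some (k / w))"

text \<open>
  Elements commuting with a nontrivial rotation permute its two fixed points, which are moved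
  here to \<open>0\<close> and \<open>\<infinity>\<close>.
\<close>

lemma commuting_PSU2_normal_form:
  assumes F: "F \<subseteq> PSU2" and comm: "\<And>m m'. m \<in> F \<Longrightarrow> m' \<in> F \<Longrightarrow> m \<circ> m' = m' \<circ> m"
  obtains a b where "(norm a)\<^sup>2 + (norm b)\<^sup>2 = 1"
    "\<And>m. m \<in> F \<Longrightarrow> \<exists>k. norm k = 1 \<and> ((\<forall>P. unitary_moebius a b (m P) = rotate_sphere k (unitary_moebius a b P)) \<or>
        (\<forall>P. unitary_moebius a b (m P) = flip_sphere k (unitary_moebius a b P)))"
proof (cases "\<exists>m0\<in>F. \<exists>P. m0 P \<noteq> P")
  case False
  have r1: "rotate_sphere 1 P = P" for P by (cases P) auto
  show thesis by (rule that[of 1 0]) (use False in \<open>auto intro!: exI[of _ 1] simp: r1\<close>)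
next
  case True
  then obtain m0 P1 where m0: "m0 \<in> F" "m0 P1 \<noteq> P1" by blast
  obtain s t where st: "(norm s)\<^sup>2 + (norm t)\<^sup>2 = 1" "m0 = unitary_moebius s t"
    using PSU2_cases F m0(1) by blast
  obtain n0 d0 where nd: "n0 \<noteq> 0 \<or> d0 \<noteq> 0" "unitary_moebius s t (sphere_point n0 d0) = sphere_point n0 d0"
    by (rule unitary_moebius_fixed_point)
  define r where "r = sqrt ((norm n0)\<^sup>2 + (norm d0)\<^sup>2)"
  have r: "r > 0" using nd(1) by (auto simp: r_def sum_power2_gt_zero_iff)
  \<comment> \<open>The unit vector of the fixed point, conjugated: the rotation with this first row
    sends the fixed point to \<infinity>.\<close>
  define a b where "a = cnj n0 / of_real r" and "b = cnj d0 / of_real r"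
  have ab: "(norm a)\<^sup>2 + (norm b)\<^sup>2 = 1"
  proof -
    have "(norm a)\<^sup>2 + (norm b)\<^sup>2 = ((norm n0)\<^sup>2 + (norm d0)\<^sup>2) / r\<^sup>2"
      using r by (simp add: a_def b_def norm_divide power_divide add_divide_distrib)
    also have "r\<^sup>2 = (norm n0)\<^sup>2 + (norm d0)\<^sup>2" by (simp add: r_def)
    finally show ?thesis using nd(1) by (simp add: sum_power2_eq_zero_iff)
  qed
  define \<Phi> where "\<Phi> = unitary_moebius a b"
  define \<Psi> where "\<Psi> = unitary_moebius (cnj a) (- b)"
  have ab': "(norm (cnj a))\<^sup>2 + (norm (- b))\<^sup>2 = 1" using ab by simp
  have u: "a * cnj a + b * cnj b = 1"
    using arg_cong[OF ab, of complex_of_real] by (simp only: of_real_add complex_norm_square of_real_1)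
  have one: "unitary_moebius 1 0 P = P" for P by (cases P) (auto simp: unitary_moebius_def sphere_point_def)
  have \<Psi>\<Phi>: "\<Psi> (\<Phi> P) = P" "\<Phi> (\<Psi> P) = P" for P
  proof -
    have "cnj a * a - - b * cnj b = 1" "cnj a * b + - b * cnj a = 0" "a * cnj a - b * cnj (- b) = 1" "a * - b + b * cnj (cnj a) = 0"
      using u by (simp_all add: algebra_simps)
    then show "\<Psi> (\<Phi> P) = P" "\<Phi> (\<Psi> P) = P"
      unfolding \<Phi>_def \<Psi>_def unitary_moebius_compose[OF ab] unitary_moebius_compose[OF ab'] by (simp_all only: one)
  qed
  have conj: "\<exists>s t. (norm s)\<^sup>2 + (norm t)\<^sup>2 = 1 \<and> (\<forall>P. \<Phi> (m (\<Psi> P)) = unitary_moebius s t P)" if "m \<in> F" for m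
  proof -
    obtain c e where ce: "(norm c)\<^sup>2 + (norm e)\<^sup>2 = 1" "m = unitary_moebius c e"
      using PSU2_cases F \<open>m \<in> F\<close> by blast
    have n1: "(norm (c * cnj a - e * cnj (- b)))\<^sup>2 + (norm (c * (- b) + e * cnj (cnj a)))\<^sup>2 = 1"
      by (rule unitary_compose_norm[OF ce(1) ab'])
    note n2 = unitary_compose_norm[OF ab n1]
    have "\<Phi> (m (\<Psi> P)) = unitary_moebius (a * (c * cnj a - e * cnj (- b)) - b * cnj (c * (- b) + e * cnj (cnj a)))
       (a * (c * (- b) + e * cnj (cnj a)) + b * cnj (c * cnj a - e * cnj (- b))) P" for P
      unfolding \<Phi>_def \<Psi>_def ce(2) unitary_moebius_compose[OF ab'] unitary_moebius_compose[OF n1] ..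
    then show ?thesis using n2 by blast
  qed
  have PN: "\<Phi> (sphere_point n0 d0) = None"
    unfolding \<Phi>_def unitary_moebius_sphere_point[OF nd(1)] by (simp add: a_def b_def sphere_point_def mult.commute)
  then have PN': "\<Psi> None = sphere_point n0 d0" using \<Psi>\<Phi>(1) by metis
  have diag: "unitary_moebius s 0 P = rotate_sphere (s / cnj s) P" if "(norm s)\<^sup>2 + (norm (0::complex))\<^sup>2 = 1" for s P
    using that by (cases P) (auto simp: unitary_moebius_def sphere_point_def)
  obtain s0 t0 where s0: "(norm s0)\<^sup>2 + (norm t0)\<^sup>2 = 1" "\<forall>P. \<Phi> (m0 (\<Psi> P)) = unitary_moebius s0 t0 P"
    using conj[OF m0(1)] by blast
  have "unitary_moebius s0 t0 None = None" using s0(2)[rule_format, of None] PN PN' nd(2) st(2) by simp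
  then have t0: "t0 = 0" by (auto simp: unitary_moebius_def sphere_point_def split: if_splits)
  define k0 where "k0 = s0 / cnj s0"
  have rot0: "\<Phi> (m0 (\<Psi> P)) = rotate_sphere k0 P" for P using s0 diag[of s0 P] by (simp add: t0 k0_def)
  have k01: "k0 \<noteq> 1"
  proof
    assume "k0 = 1"
    then have "\<Phi> (m0 (\<Psi> (\<Phi> P1))) = \<Phi> P1" using rot0[of "\<Phi> P1"] by (cases "\<Phi> P1") auto
    then have "m0 P1 = P1" using \<Psi>\<Phi> by metis
    then show False using m0(2) by simp
  qed
  have main: "\<exists>k. norm k = 1 \<and> ((\<forall>P. \<Phi> (m P) = rotate_sphere k (\<Phi> P)) \<or> (\<forall>P. \<Phi> (m P) = flip_sphere k (\<Phi> P)))"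
    if m: "m \<in> F" for m
  proof -
    obtain s t where s: "(norm s)\<^sup>2 + (norm t)\<^sup>2 = 1" "\<forall>P. \<Phi> (m (\<Psi> P)) = unitary_moebius s t P"
      using conj[OF m] by blast
    \<comment> \<open>The image of \<infinity> under the conjugate of m. By commutation it is fixed
      by the rotation with factor k0 \<noteq> 1, so it is \<infinity> or 0, and these cases give a
      rotation and a half-turn.\<close>
    define P where "P = \<Phi> (m (\<Psi> None))"
    have "rotate_sphere k0 P = \<Phi> (m0 (m (\<Psi> None)))" using rot0[of P] \<Psi>\<Phi> by (simp add: P_def)
    also have "\<dots> = \<Phi> (m (m0 (\<Psi> None)))" using comm[OF m0(1) m] by (metis comp_apply)
    also have "m0 (\<Psi> None) = \<Psi> None" using rot0[of None] \<Psi>\<Phi> by (metis rotate_sphere.simps(1))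
    finally have fixed: "rotate_sphere k0 P = P" by (simp add: P_def)
    have P: "P = unitary_moebius s t None" using s(2)[rule_format, of None] by (simp add: P_def)
    have mP: "\<Phi> (m Q) = unitary_moebius s t (\<Phi> Q)" for Q using s(2)[rule_format, of "\<Phi> Q"] \<Psi>\<Phi> by simp
    show ?thesis
    proof (cases P)
      case None
      then have "t = 0" using P by (auto simp: unitary_moebius_def sphere_point_def split: if_splits)
      then have "norm (s / cnj s) = 1" "\<And>Q. \<Phi> (m Q) = rotate_sphere (s / cnj s) (\<Phi> Q)"
        using s(1) mP diag[of s] by (auto simp: norm_divide)
      then show ?thesis by blast
    next
      case (Some w)
      then have "w = 0" using fixed k01 by auto
      then have t: "t \<noteq> 0" "s = 0" using P Some by (auto simp: unitary_moebius_def sphere_point_def split: if_splits)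
      have "unitary_moebius 0 t Q = flip_sphere (- (t / cnj t)) Q" for Q
        using t(1) by (cases Q) (auto simp: unitary_moebius_def sphere_point_def divide_simps)
      then have "\<And>Q. \<Phi> (m Q) = flip_sphere (- (t / cnj t)) (\<Phi> Q)" using mP t(2) by simp
      moreover have "norm (- (t / cnj t)) = 1" using t by (simp add: norm_divide)
      ultimately show ?thesis by blast
    qed
  qed
  show thesis by (rule that[OF ab main[unfolded \<Phi>_def]])
qed

section \<open>Weierstrass data on the universal cover\<close>

text \<open>With g = n / d in lowest terms, the order 2 m of \<alpha> at a pole of order m is
  exactly what makes \<alpha> / d^2 extend to a function \<beta> without zeros. In terms of n, d and
  \<beta> the poles of g are no longer exceptional.\<close>

lemma meromorphic_quotient_form:
  assumes g: "g nicely_meromorphic_on U" and \<alpha>: "\<alpha> holomorphic_on U" and U: "open U" "x \<in> U"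
    and ord: "\<And>z. z \<in> U \<Longrightarrow> if is_pole g z then zorder \<alpha> z = 2 * (- zorder g z) else \<alpha> z \<noteq> 0"
  obtains \<rho> n d \<beta> where "0 < \<rho>" "ball x \<rho> \<subseteq> U" "n holomorphic_on ball x \<rho>" "d holomorphic_on ball x \<rho>" "\<beta> holomorphic_on ball x \<rho>"
    "\<And>z. z \<in> ball x \<rho> \<Longrightarrow> \<beta> z \<noteq> 0 \<and> (n z \<noteq> 0 \<or> d z \<noteq> 0) \<and> sphere_map g z = sphere_point (n z) (d z)"
    "\<And>z. z \<in> ball x \<rho> - {x} \<Longrightarrow> \<not> is_pole g z \<and> d z \<noteq> 0 \<and> g z = n z / d z \<and> \<alpha> z = \<beta> z * (d z)\<^sup>2"
proof (cases "is_pole g x")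
  case False
  then have "g analytic_on {x}" using g U(2) nicely_meromorphic_on_imp_analytic_at by blast
  then obtain S where S: "open S" "x \<in> S" "g holomorphic_on S" by (auto simp: analytic_at)
  have "open (S \<inter> U)" "x \<in> S \<inter> U" using S U by auto
  then obtain \<rho> where \<rho>: "0 < \<rho>" "ball x \<rho> \<subseteq> S \<inter> U" by (rule openE)
  have np: "\<not> is_pole g z" if "z \<in> ball x \<rho>" for z
    using not_is_pole_holomorphic[OF S(1) _ S(3)] that \<rho> by auto
  show thesis
    by (rule that[of \<rho> g "\<lambda>_. 1" \<alpha>])
      (use \<rho> S \<alpha> np ord in \<open>auto simp: sphere_map_def sphere_point_def intro: holomorphic_on_subset split: if_splits\<close>)
next
  case True
  have gm: "isolated_singularity_at g x" using g U(2) by (auto simp: nicely_meromorphic_on_def meromorphic_on_altdef)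
  then obtain r0 where r0: "0 < r0" "g analytic_on ball x r0 - {x}" by (auto simp: isolated_singularity_at_def)
  have "open (ball x r0 \<inter> U)" "x \<in> ball x r0 \<inter> U" using r0 U by auto
  then obtain r1 where r1: "0 < r1" "ball x r1 \<subseteq> ball x r0 \<inter> U" by (rule openE)
  have gh: "g holomorphic_on ball x r1 - {x}"
    using r0(2) r1(2) by (auto intro: holomorphic_on_subset dest: analytic_imp_holomorphic)
  have np: "\<not> is_pole g z" if "z \<in> ball x r1 - {x}" for z
    using not_is_pole_holomorphic[OF _ that gh] by (simp add: open_Diff)
  define m h k where "m = nat (- zorder g x)" and "h = zor_poly g x" and "k = zor_poly \<alpha> x"
  obtain r2 where r2: "zorder g x < 0" "h x \<noteq> 0" "0 < r2" "cball x r2 \<subseteq> ball x r1" "h holomorphic_on cball x r2"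
      "\<And>w. w \<in> cball x r2 - {x} \<Longrightarrow> g w = h w / (w - x) ^ m \<and> h w \<noteq> 0"
    using zorder_exist_pole[OF gh open_ball _ True] r1(1) unfolding m_def h_def by auto
  obtain w0 where w0: "w0 \<in> ball x r1" "w0 \<noteq> x"
    by (rule that[of "x + of_real (r1 / 2)"]) (use r1(1) in \<open>auto simp: dist_norm\<close>)
  have "\<alpha> w0 \<noteq> 0" using ord[of w0] np[of w0] w0 r1(2) by auto
  then have "\<exists>w\<in>ball x r1. \<alpha> w \<noteq> 0" using w0 by blast
  moreover have "\<alpha> holomorphic_on ball x r1" using \<alpha> r1(2) by (auto intro: holomorphic_on_subset)
  ultimately obtain r3 where r3: "0 < r3" "k holomorphic_on cball x r3"
      "\<And>w. w \<in> cball x r3 \<Longrightarrow> \<alpha> w = k w * (w - x) ^ nat (zorder \<alpha> x) \<and> k w \<noteq> 0"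
    using conjunct2[OF zorder_exist_zero[OF _ open_ball connected_ball, of \<alpha> x r1 x]] r1(1) unfolding k_def
    by (metis centre_in_ball)
  have "zorder \<alpha> x = 2 * (- zorder g x)" using ord[OF U(2)] True by simp
  then have z\<alpha>: "nat (zorder \<alpha> x) = m * 2" by (simp add: m_def)
  have m: "m > 0" using r2(1) by (simp add: m_def)
  define \<rho> where "\<rho> = min r2 r3"
  have \<rho>: "ball x \<rho> \<subseteq> cball x r2" "ball x \<rho> \<subseteq> cball x r3" by (auto simp: \<rho>_def)
  show thesis
  proof (rule that[of \<rho> h "\<lambda>w. (w - x) ^ m" k])
    show "0 < \<rho>" using r2 r3 by (simp add: \<rho>_def)
    show "ball x \<rho> \<subseteq> U" using \<rho> r2(4) r1(2) by blast
    show "h holomorphic_on ball x \<rho>" "k holomorphic_on ball x \<rho>"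
      using r2(5) r3(2) \<rho> by (auto intro: holomorphic_on_subset)
    show "(\<lambda>w. (w - x) ^ m) holomorphic_on ball x \<rho>" by (intro holomorphic_intros)
    have off: "\<not> is_pole g z \<and> (z - x) ^ m \<noteq> 0 \<and> g z = h z / (z - x) ^ m \<and> \<alpha> z = k z * ((z - x) ^ m)\<^sup>2"
      if "z \<in> ball x \<rho> - {x}" for z
    proof -
      have z: "z \<in> cball x r2 - {x}" "z \<in> cball x r3" using that \<rho> by auto
      have "z \<in> ball x r1 - {x}" using z(1) r2(4) by blast
      then show ?thesis using np r2(6)[OF z(1)] r3(3)[OF z(2)] z(1) by (simp add: z\<alpha> power_mult)
    qed
    show "\<not> is_pole g z \<and> (z - x) ^ m \<noteq> 0 \<and> g z = h z / (z - x) ^ m \<and> \<alpha> z = k z * ((z - x) ^ m)\<^sup>2"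
      if "z \<in> ball x \<rho> - {x}" for z using off[OF that] .
    show "k z \<noteq> 0 \<and> (h z \<noteq> 0 \<or> (z - x) ^ m \<noteq> 0) \<and> sphere_map g z = sphere_point (h z) ((z - x) ^ m)"
      if z: "z \<in> ball x \<rho>" for z
    proof (cases "z = x")
      case True
      then show ?thesis using r2(2) r3(1,3) m \<open>is_pole g x\<close> by (simp add: sphere_map_def sphere_point_def)
    next
      case False
      then show ?thesis using off[of z] z \<rho> r3(3)[of z] by (auto simp: sphere_map_def sphere_point_def)
    qed
  qed
qed

lemma unitary_norm_sq:
  assumes "(norm a)\<^sup>2 + (norm b)\<^sup>2 = 1"
  shows "(norm (a * n + b * d))\<^sup>2 + (norm (- cnj b * n + cnj a * d))\<^sup>2 = (norm n)\<^sup>2 + (norm d)\<^sup>2"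
proof -
  have u: "a * cnj a + b * cnj b = 1"
    using arg_cong[OF assms, of complex_of_real] by (simp only: of_real_add complex_norm_square of_real_1)
  have "complex_of_real ((norm (a * n + b * d))\<^sup>2 + (norm (- cnj b * n + cnj a * d))\<^sup>2)
     = (a * cnj a + b * cnj b) * (n * cnj n + d * cnj d)"
    by (simp only: of_real_add complex_norm_square) (simp add: algebra_simps)
  also have "\<dots> = complex_of_real ((norm n)\<^sup>2 + (norm d)\<^sup>2)"
    by (simp only: u of_real_add complex_norm_square mult_1)
  finally show ?thesis by (simp only: of_real_eq_iff)
qed

text \<open>Half the logarithm of lam is ln |A| + ln (1 + |G|^2) up to a constant; the first term is
  harmonic and the Laplacian of the second is \<open>sph_density G\<close>.\<close>

lemma gauss_curvature_local_data:
  assumes g: "local_data lam Q E c r G A" and z: "z \<in> ball c r"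
  shows "gauss_curvature lam z * lam z = - ((norm (Q z))\<^sup>2 / lam z)"
proof -
  have G: "G holomorphic_on ball c r" and A: "A holomorphic_on ball c r" and Anz: "\<And>w. w \<in> ball c r \<Longrightarrow> A w \<noteq> 0"
    and lam: "\<And>w. w \<in> ball c r \<Longrightarrow> lam w = 1 / 4 * (norm (A w))\<^sup>2 * (1 + (norm (G w))\<^sup>2)\<^sup>2"
    using g by (auto simp: local_data_def)
  define f where "f w = ln ((norm (A w))\<^sup>2)" for w
  define h where "h w = ln (1 + (norm (G w))\<^sup>2)" for w
  have fC: "Ck_on k (ball c r) f" for k unfolding f_def[abs_def] by (rule Ck_on_ln_norm_sq[OF open_ball A Anz])
  have hC: "Ck_on k (ball c r) h" for k unfolding h_def[abs_def] by (rule Ck_on_ln_norm_sq_add1[OF open_ball G])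
  have f2C: "Ck_on 2 (ball c r) (\<lambda>w. 1 / 2 * f w)" by (intro Ck_on_mult fC) auto
  have "flat_laplacian (\<lambda>w. ln (lam w) / 2) z = flat_laplacian (\<lambda>w. 1 / 2 * f w + (h w + ln (1 / 4) / 2)) z"
  proof (rule flat_laplacian_cong[OF open_ball z])
    fix w assume w: "w \<in> ball c r"
    have "0 < (norm (A w))\<^sup>2" "0 < 1 + (norm (G w))\<^sup>2" using Anz[OF w] by (auto simp: add_pos_nonneg)
    then show "ln (lam w) / 2 = 1 / 2 * f w + (h w + ln (1 / 4) / 2)"
      unfolding lam[OF w] f_def h_def by (simp add: ln_mult ln_div ln_realpow)
  qed
  also have "\<dots> = flat_laplacian (\<lambda>w. 1 / 2 * f w) z + flat_laplacian (\<lambda>w. h w + ln (1 / 4) / 2) z"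
    by (rule flat_laplacian_add[OF open_ball z f2C]) (intro Ck_on_add hC open_ball Ck_on_const)
  also have "flat_laplacian (\<lambda>w. h w + ln (1 / 4) / 2) z = 0 * grad_sq h z + 1 * flat_laplacian h z"
    by (rule flat_laplacian_compose[OF open_ball z hC, of "\<lambda>x. x + ln (1 / 4) / 2" "\<lambda>_. 1"]) (auto intro!: derivative_eq_intros)
  also have "flat_laplacian (\<lambda>w. 1 / 2 * f w) z = 0 * grad_sq f z + 1 / 2 * flat_laplacian f z"
    by (rule flat_laplacian_compose[OF open_ball z fC, of "\<lambda>x. 1 / 2 * x" "\<lambda>_. 1 / 2"]) (auto intro!: derivative_eq_intros)
  also have "flat_laplacian f z = 0" unfolding f_def[abs_def] by (rule flat_laplacian_ln_norm_sq[OF open_ball A Anz z])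
  also have "flat_laplacian h z = 4 * (norm (deriv G z))\<^sup>2 / (1 + (norm (G z))\<^sup>2)\<^sup>2"
    unfolding h_def[abs_def] by (rule flat_laplacian_ln_norm_sq_add1[OF open_ball G z])
  finally have "flat_laplacian (\<lambda>w. ln (lam w) / 2) z = sph_density G z" by (simp add: sph_density_def)
  moreover have "lam z > 0" by (rule local_data_facts(1)[OF g z])
  ultimately show ?thesis
    unfolding local_data_facts(2)[OF g z] by (simp add: gauss_curvature_def laplacian_def flat_laplacian_def)
qed

text \<open>A unitary change of (n, d) into (N, D) preserves the Wronskian and |n|^2 + |d|^2, hence
  the Hopf differential and the metric; so N / D and \<beta> D^2 are again Weierstrass data near x
  as long as D x \<noteq> 0.\<close>

lemma local_data_of_quotient_form:
  assumes "0 < \<rho>" and n: "n holomorphic_on ball x \<rho>" and d: "d holomorphic_on ball x \<rho>" and \<beta>: "\<beta> holomorphic_on ball x \<rho>"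
    and nz: "\<And>z. z \<in> ball x \<rho> \<Longrightarrow> \<beta> z \<noteq> 0 \<and> (n z \<noteq> 0 \<or> d z \<noteq> 0)"
    and ab: "(norm a)\<^sup>2 + (norm b)\<^sup>2 = 1" and D0: "- cnj b * n x + cnj a * d x \<noteq> 0"
    and L: "\<And>z. z \<in> ball x \<rho> \<Longrightarrow> L z = 1 / 4 * (norm (\<beta> z))\<^sup>2 * ((norm (n z))\<^sup>2 + (norm (d z))\<^sup>2)\<^sup>2"
    and Q: "\<And>z. z \<in> ball x \<rho> \<Longrightarrow> Q z = \<beta> z * (deriv n z * d z - n z * deriv d z)"
    and E: "\<And>z. z \<in> ball x \<rho> \<Longrightarrow> E z = (\<beta> z * (a * n z + b * d z) * (- cnj b * n z + cnj a * d z))\<^sup>2"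
  obtains r A where "0 < r" "r \<le> \<rho>" "local_data L Q E x r (\<lambda>z. (a * n z + b * d z) / (- cnj b * n z + cnj a * d z)) A"
    "\<And>z. z \<in> ball x r \<Longrightarrow> - cnj b * n z + cnj a * d z \<noteq> 0"
proof -
  define N D where "N z = a * n z + b * d z" and "D z = - cnj b * n z + cnj a * d z" for z
  have ND: "N holomorphic_on ball x \<rho>" "D holomorphic_on ball x \<rho>"
    unfolding N_def[abs_def] D_def[abs_def] by (intro holomorphic_intros n d)+
  have "open {z \<in> ball x \<rho>. D z \<in> - {0}}"
    by (rule continuous_open_preimage[OF holomorphic_on_imp_continuous_on[OF ND(2)] open_ball, unfolded vimage_def Int_def mem_Collect_eq]) auto
  moreover have "x \<in> {z \<in> ball x \<rho>. D z \<in> - {0}}" using D0 \<open>0 < \<rho>\<close> by (simp add: D_def)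
  ultimately obtain r' where r': "0 < r'" "ball x r' \<subseteq> {z \<in> ball x \<rho>. D z \<in> - {0}}" by (meson openE)
  define r where "r = min r' \<rho>"
  have r: "0 < r" "r \<le> \<rho>" "ball x r \<subseteq> ball x \<rho>" "ball x r \<subseteq> ball x r'" using r'(1) \<open>0 < \<rho>\<close> by (auto simp: r_def)
  have Dnz: "D z \<noteq> 0" if "z \<in> ball x r" for z using r'(2) r(4) that by blast
  have u: "a * cnj a + b * cnj b = 1"
    using arg_cong[OF ab, of complex_of_real] by (simp only: of_real_add complex_norm_square of_real_1)
  have ld: "local_data L Q E x r (\<lambda>z. N z / D z) (\<lambda>z. \<beta> z * (D z)\<^sup>2)"
    unfolding local_data_def
  proof (intro conjI ballI)
    show "0 < r" by (rule r)
    show "(\<lambda>z. N z / D z) holomorphic_on ball x r" "(\<lambda>z. \<beta> z * (D z)\<^sup>2) holomorphic_on ball x r"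
      using Dnz by (auto intro!: holomorphic_intros holomorphic_on_subset[OF ND(1) r(3)] holomorphic_on_subset[OF ND(2) r(3)] holomorphic_on_subset[OF \<beta> r(3)])
    fix z assume z: "z \<in> ball x r"
    then have z': "z \<in> ball x \<rho>" using r(3) by blast
    note D = Dnz[OF z]
    show "\<beta> z * (D z)\<^sup>2 \<noteq> 0" using D nz[OF z'] by simp
    have n': "(n has_field_derivative deriv n z) (at z)" "(d has_field_derivative deriv d z) (at z)"
      using holomorphic_derivI[OF n open_ball z'] holomorphic_derivI[OF d open_ball z'] .
    have N': "(N has_field_derivative a * deriv n z + b * deriv d z) (at z)"
      unfolding N_def[abs_def] by (auto intro!: derivative_eq_intros n')
    have D': "(D has_field_derivative - cnj b * deriv n z + cnj a * deriv d z) (at z)"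
      unfolding D_def[abs_def] by (auto intro!: derivative_eq_intros n')
    have "(a * deriv n z + b * deriv d z) * D z - N z * (- cnj b * deriv n z + cnj a * deriv d z)
        = (a * cnj a + b * cnj b) * (deriv n z * d z - n z * deriv d z)"
      by (simp add: N_def D_def algebra_simps)
    then have W: "(a * deriv n z + b * deriv d z) * D z - N z * (- cnj b * deriv n z + cnj a * deriv d z) = deriv n z * d z - n z * deriv d z"
      by (simp only: u mult_1)
    have "deriv (\<lambda>z. N z / D z) z = (deriv n z * d z - n z * deriv d z) / (D z * D z)"
      using DERIV_divide[OF N' D' D] unfolding W by (rule DERIV_imp_deriv)
    then show "deriv (\<lambda>z. N z / D z) z * (\<beta> z * (D z)\<^sup>2) = Q z"
      using D by (simp add: Q[OF z'] power2_eq_square)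
    show "(\<beta> z * (D z)\<^sup>2 * (N z / D z))\<^sup>2 = E z"
      using D unfolding E[OF z'] N_def[symmetric] D_def[symmetric] by (simp add: power2_eq_square)
    have nd: "(norm (N z))\<^sup>2 + (norm (D z))\<^sup>2 = (norm (n z))\<^sup>2 + (norm (d z))\<^sup>2"
      unfolding N_def D_def by (rule unitary_norm_sq[OF ab])
    have "(norm (D z))\<^sup>2 * (1 + (norm (N z / D z))\<^sup>2) = (norm (N z))\<^sup>2 + (norm (D z))\<^sup>2"
      using D by (simp add: norm_divide power_divide distrib_left)
    then have "L z = 1 / 4 * (norm (\<beta> z))\<^sup>2 * ((norm (D z))\<^sup>2 * (1 + (norm (N z / D z))\<^sup>2))\<^sup>2"
      unfolding L[OF z'] nd by simp
    then show "L z = 1 / 4 * (norm (\<beta> z * (D z)\<^sup>2))\<^sup>2 * (1 + (norm (N z / D z))\<^sup>2)\<^sup>2"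
      by (simp add: norm_mult norm_power power_mult_distrib)
  qed
  show thesis by (rule that[OF r(1,2) ld[unfolded N_def D_def] Dnz[unfolded D_def]])
qed

lemma local_data_cong:
  assumes "local_data lam Q E c r G A" "\<And>z. z \<in> ball c r \<Longrightarrow> lam' z = lam z \<and> Q' z = Q z \<and> E' z = E z"
  shows "local_data lam' Q' E' c r G A"
  using assms by (simp add: local_data_def)

locale weierstrass_cover =
  fixes M :: "complex set" and lam :: "complex \<Rightarrow> real" and U :: "complex set" and p g \<alpha> :: "complex \<Rightarrow> complex"
  assumes metric: "conformal_metric M lam" and data: "weierstrass_data M lam U p g \<alpha>"
begin

lemma open_M: "open M" and lam_pos: "z \<in> M \<Longrightarrow> lam z > 0" and continuous_lam: "continuous_on M lam" and M_ne: "M \<noteq> {}"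
  using metric by (auto simp: conformal_metric_def smooth_on_def dest: spec[of _ 0])

lemma open_U: "open U" and simply_connected_U: "simply_connected U" and p_hol: "p holomorphic_on U"
  and covering: "covering_space U p M" and g_mero: "g nicely_meromorphic_on U" and \<alpha>_hol: "\<alpha> holomorphic_on U"
  and zorder_\<alpha>: "z \<in> U \<Longrightarrow> if is_pole g z then zorder \<alpha> z = 2 * (- zorder g z) else \<alpha> z \<noteq> 0"
  and cover_metric: "z \<in> U \<Longrightarrow> \<not> is_pole g z \<Longrightarrow>
        lam (p z) * (norm (deriv p z))\<^sup>2 = 1 / 4 * (norm (\<alpha> z))\<^sup>2 * (1 + (norm (g z))\<^sup>2)\<^sup>2"
  using data by (auto simp: weierstrass_data_def universal_cover_def)

lemma connected_U: "connected U"
  by (rule simply_connected_imp_connected[OF simply_connected_U])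

lemma p_in: "z \<in> U \<Longrightarrow> p z \<in> M" and p_surj: "w \<in> M \<Longrightarrow> \<exists>z\<in>U. p z = w"
  using covering_space_imp_surjective[OF covering] by auto

text \<open>
  Limits are used because \<open>deriv g * \<alpha>\<close> and \<open>g * \<alpha>\<close> have removable singularities at the poles of \<open>g\<close>.
  The form \<open>axis_form\<close> is the square of \<open>g \<eta>\<close> for the data rotated by \<open>unitary_moebius a b\<close>.
\<close>

definition "hopf x = Lim (at x) (\<lambda>w. deriv g w * \<alpha> w)"
definition "axis_form a b x = Lim (at x) (\<lambda>w. (\<alpha> w * (a * g w + b) * (- cnj b * g w + cnj a))\<^sup>2)"
definition "lamU z = lam (p z) * (norm (deriv p z))\<^sup>2"

lemma continuous_lamU: "continuous_on U lamU"
proof -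
  have "continuous_on U (\<lambda>z. lam (p z))"
    by (rule continuous_on_compose2[OF continuous_lam holomorphic_on_imp_continuous_on[OF p_hol]]) (use p_in in auto)
  then show ?thesis unfolding lamU_def[abs_def]
    by (intro continuous_intros holomorphic_on_imp_continuous_on holomorphic_deriv p_hol open_U)
qed

text \<open>The centre x may be a pole of g, so f is controlled only off x; the limit still exists
  at every point of the disc.\<close>

lemma Lim_eq_off_point:
  assumes h: "continuous_on (ball x \<rho>) h" and eq: "\<And>w. w \<in> ball x \<rho> - {x} \<Longrightarrow> f w = h w" and z: "z \<in> ball x \<rho>"
  shows "(f \<longlongrightarrow> h z) (at z)"
proof -
  have "(h \<longlongrightarrow> h z) (at z)" using h z by (simp add: continuous_on_eq_continuous_at isCont_def)
  moreover have "\<forall>\<^sub>F w in at z. h w = f w"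
  proof (cases "z = x")
    case True
    have "\<forall>\<^sub>F w in at x. w \<in> ball x \<rho> - {x}" using eventually_at_in_open[of "ball x \<rho>" x] z True by simp
    then show ?thesis unfolding True by eventually_elim (use eq in simp)
  next
    case False
    have "\<forall>\<^sub>F w in at z. w \<in> ball x \<rho> - {x} - {z}" using eventually_at_in_open[of "ball x \<rho> - {x}" z] z False by (simp add: open_Diff)
    then show ?thesis by eventually_elim (use eq in simp)
  qed
  ultimately show ?thesis by (rule Lim_transform_eventually)
qed

text \<open>If the rotated g has a pole at x, a further half-turn moves the value \<infinity> to 0
  and changes neither the forms nor the metric. So local data with holomorphic G exist at every
  point, at the price of the second alternative in the conclusion.\<close>

lemma cover_local_data:
  assumes x: "x \<in> U" and ab: "(norm a)\<^sup>2 + (norm b)\<^sup>2 = 1"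
  obtains r G A where "ball x r \<subseteq> U" "local_data lamU hopf (axis_form a b) x r G A"
    "(\<forall>z\<in>ball x r. unitary_moebius a b (sphere_map g z) = Some (G z)) \<or>
     (\<forall>z\<in>ball x r. unitary_moebius a b (sphere_map g z) = (if G z = 0 then None else Some (- 1 / G z)))"
proof -
  obtain \<rho> n d \<beta> where \<rho>: "0 < \<rho>" "ball x \<rho> \<subseteq> U" and n: "n holomorphic_on ball x \<rho>" and d: "d holomorphic_on ball x \<rho>" and \<beta>: "\<beta> holomorphic_on ball x \<rho>"
    and nz: "\<And>z. z \<in> ball x \<rho> \<Longrightarrow> \<beta> z \<noteq> 0 \<and> (n z \<noteq> 0 \<or> d z \<noteq> 0) \<and> sphere_map g z = sphere_point (n z) (d z)"
    and off: "\<And>z. z \<in> ball x \<rho> - {x} \<Longrightarrow> \<not> is_pole g z \<and> d z \<noteq> 0 \<and> g z = n z / d z \<and> \<alpha> z = \<beta> z * (d z)\<^sup>2"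
    using meromorphic_quotient_form[OF g_mero \<alpha>_hol open_U x zorder_\<alpha>] by metis
  have c: "continuous_on (ball x \<rho>) n" "continuous_on (ball x \<rho>) d" "continuous_on (ball x \<rho>) \<beta>"
    "continuous_on (ball x \<rho>) (deriv n)" "continuous_on (ball x \<rho>) (deriv d)"
    using n d \<beta> by (auto intro: holomorphic_on_imp_continuous_on holomorphic_deriv)
  have Q: "hopf z = \<beta> z * (deriv n z * d z - n z * deriv d z)" if z: "z \<in> ball x \<rho>" for z
  proof -
    have "deriv g w * \<alpha> w = \<beta> w * (deriv n w * d w - n w * deriv d w)" if w: "w \<in> ball x \<rho> - {x}" for w
    proof -
      have w': "w \<in> ball x \<rho>" using w by blast
      have dw: "d w \<noteq> 0" using off[OF w] by blast
      have "((\<lambda>w. n w / d w) has_field_derivative (deriv n w * d w - n w * deriv d w) / (d w * d w)) (at w)"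
        by (rule DERIV_divide[OF holomorphic_derivI[OF n open_ball w'] holomorphic_derivI[OF d open_ball w'] dw])
      then have "(g has_field_derivative (deriv n w * d w - n w * deriv d w) / (d w * d w)) (at w)"
        by (rule has_field_derivative_transform_within_open[of _ _ _ "ball x \<rho> - {x}"]) (use w off in \<open>auto simp: open_Diff\<close>)
      then show ?thesis using off[OF w] by (simp add: DERIV_imp_deriv power2_eq_square)
    qed
    then show ?thesis unfolding hopf_def
      by (intro tendsto_Lim Lim_eq_off_point[OF _ _ z]) (auto intro!: continuous_intros c)
  qed
  have E: "axis_form a b z = (\<beta> z * (a * n z + b * d z) * (- cnj b * n z + cnj a * d z))\<^sup>2" if z: "z \<in> ball x \<rho>" for z
    unfolding axis_form_def
  proof (intro tendsto_Lim Lim_eq_off_point[OF _ _ z])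
    fix w assume w: "w \<in> ball x \<rho> - {x}"
    have "d w * (a * g w + b) = a * n w + b * d w" "d w * (- cnj b * g w + cnj a) = - cnj b * n w + cnj a * d w"
      using off[OF w] by (simp_all add: field_simps)
    moreover have "\<alpha> w * (a * g w + b) * (- cnj b * g w + cnj a) = \<beta> w * (d w * (a * g w + b)) * (d w * (- cnj b * g w + cnj a))"
      using off[OF w] by (simp add: power2_eq_square)
    ultimately show "(\<alpha> w * (a * g w + b) * (- cnj b * g w + cnj a))\<^sup>2 = (\<beta> w * (a * n w + b * d w) * (- cnj b * n w + cnj a * d w))\<^sup>2"
      by simp
  qed (auto intro!: continuous_intros c)
  have L: "lamU z = 1 / 4 * (norm (\<beta> z))\<^sup>2 * ((norm (n z))\<^sup>2 + (norm (d z))\<^sup>2)\<^sup>2" if z: "z \<in> ball x \<rho>" for z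
  proof (rule tendsto_unique)
    let ?h = "\<lambda>z. 1 / 4 * (norm (\<beta> z))\<^sup>2 * ((norm (n z))\<^sup>2 + (norm (d z))\<^sup>2)\<^sup>2"
    show "(lamU \<longlongrightarrow> lamU z) (at z)"
      using continuous_lamU z \<rho>(2) open_U by (auto simp: continuous_on_eq_continuous_at isCont_def)
    show "(lamU \<longlongrightarrow> ?h z) (at z)"
    proof (rule Lim_eq_off_point[OF _ _ z])
      show "continuous_on (ball x \<rho>) ?h" by (intro continuous_intros c)
      fix w assume w: "w \<in> ball x \<rho> - {x}"
      have "(norm (d w))\<^sup>2 * (1 + (norm (g w))\<^sup>2) = (norm (n w))\<^sup>2 + (norm (d w))\<^sup>2"
        using off[OF w] by (simp add: norm_divide power_divide distrib_left)
      then have "?h w = 1 / 4 * (norm (\<beta> w))\<^sup>2 * ((norm (d w))\<^sup>2 * (1 + (norm (g w))\<^sup>2))\<^sup>2" by simp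
      also have "\<dots> = 1 / 4 * (norm (\<alpha> w))\<^sup>2 * (1 + (norm (g w))\<^sup>2)\<^sup>2"
        using off[OF w] by (simp add: norm_mult norm_power power_mult_distrib)
      also have "\<dots> = lamU w" unfolding lamU_def by (rule cover_metric[symmetric]) (use w off \<rho>(2) in auto)
      finally show "lamU w = ?h w" by simp
    qed
  qed simp
  have \<Gamma>: "unitary_moebius a b (sphere_map g z) = sphere_point (a * n z + b * d z) (- cnj b * n z + cnj a * d z)"
    if "z \<in> ball x \<rho>" for z
    using nz[OF that] by (simp add: unitary_moebius_sphere_point)
  have nz': "\<beta> z \<noteq> 0 \<and> (n z \<noteq> 0 \<or> d z \<noteq> 0)" if "z \<in> ball x \<rho>" for z using nz[OF that] by blast
  show thesis
  proof (cases "- cnj b * n x + cnj a * d x = 0")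
    case False
    obtain r A where r: "0 < r" "r \<le> \<rho>" "local_data lamU hopf (axis_form a b) x r (\<lambda>z. (a * n z + b * d z) / (- cnj b * n z + cnj a * d z)) A"
      and D: "\<And>z. z \<in> ball x r \<Longrightarrow> - cnj b * n z + cnj a * d z \<noteq> 0"
      by (rule local_data_of_quotient_form[OF \<rho>(1) n d \<beta> nz' ab False L Q E]) (assumption | rule that)+
    show thesis
    proof (rule that[OF _ r(3) disjI1])
      show "ball x r \<subseteq> U" using r \<rho> by auto
      show "\<forall>z\<in>ball x r. unitary_moebius a b (sphere_map g z) = Some ((a * n z + b * d z) / (- cnj b * n z + cnj a * d z))"
        using D \<Gamma> r(2) by (auto simp: sphere_point_def)
    qed
  next
    case True
    have "0 < (norm (n x))\<^sup>2 + (norm (d x))\<^sup>2" using nz[of x] \<rho>(1) by (auto simp: sum_power2_gt_zero_iff)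
    then have Nx: "a * n x + b * d x \<noteq> 0" using unitary_norm_sq[OF ab, of "n x" "d x"] True by auto
    \<comment> \<open>The pair (cnj b, - cnj a) is the rotation with (a, b) followed by w ->
      -1/w.\<close>
    have ab': "(norm (cnj b))\<^sup>2 + (norm (- cnj a))\<^sup>2 = 1" using ab by simp
    have D0: "- cnj (- cnj a) * n x + cnj (cnj b) * d x \<noteq> 0" using Nx by simp
    have E': "axis_form a b z = (\<beta> z * (cnj b * n z + - cnj a * d z) * (- cnj (- cnj a) * n z + cnj (cnj b) * d z))\<^sup>2" if "z \<in> ball x \<rho>" for z
      unfolding E[OF that] by (simp add: power2_eq_square algebra_simps)
    obtain r A where r: "0 < r" "r \<le> \<rho>" "local_data lamU hopf (axis_form a b) x r (\<lambda>z. (cnj b * n z + - cnj a * d z) / (- cnj (- cnj a) * n z + cnj (cnj b) * d z)) A"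
      and D: "\<And>z. z \<in> ball x r \<Longrightarrow> - cnj (- cnj a) * n z + cnj (cnj b) * d z \<noteq> 0"
      by (rule local_data_of_quotient_form[OF \<rho>(1) n d \<beta> nz' ab' D0 L Q E']) (assumption | rule that)+
    show thesis
    proof (rule that[OF _ r(3) disjI2])
      show "ball x r \<subseteq> U" using r \<rho> by auto
      show "\<forall>z\<in>ball x r. unitary_moebius a b (sphere_map g z) =
         (if (cnj b * n z + - cnj a * d z) / (- cnj (- cnj a) * n z + cnj (cnj b) * d z) = 0 then None
          else Some (- 1 / ((cnj b * n z + - cnj a * d z) / (- cnj (- cnj a) * n z + cnj (cnj b) * d z))))"
      proof
        fix z assume z: "z \<in> ball x r"
        define N1 D1 where "N1 = a * n z + b * d z" and "D1 = cnj b * n z + - cnj a * d z"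
        have e: "- cnj (- cnj a) * n z + cnj (cnj b) * d z = N1" "- cnj b * n z + cnj a * d z = - D1" by (simp_all add: N1_def D1_def)
        have "N1 \<noteq> 0" using D[OF z] unfolding e .
        moreover have "unitary_moebius a b (sphere_map g z) = sphere_point N1 (- D1)"
          using \<Gamma>[of z] z r(2) unfolding e N1_def by auto
        ultimately show "unitary_moebius a b (sphere_map g z) =
         (if (cnj b * n z + - cnj a * d z) / (- cnj (- cnj a) * n z + cnj (cnj b) * d z) = 0 then None
          else Some (- 1 / ((cnj b * n z + - cnj a * d z) / (- cnj (- cnj a) * n z + cnj (cnj b) * d z))))"
          unfolding e D1_def[symmetric] by (simp add: sphere_point_def)
      qed
    qed
  qed
qed

lemma hopf_holomorphic: "hopf holomorphic_on U"
  and axis_form_holomorphic: "(norm a)\<^sup>2 + (norm b)\<^sup>2 = 1 \<Longrightarrow> axis_form a b holomorphic_on U"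
proof -
  have *: "hopf field_differentiable at x \<and> axis_form a b field_differentiable at x" if x: "x \<in> U" and ab: "(norm a)\<^sup>2 + (norm b)\<^sup>2 = 1" for a b x
  proof -
    obtain r G A where "local_data lamU hopf (axis_form a b) x r G A" by (rule cover_local_data[OF x ab])
    then have r: "0 < r" and G: "G holomorphic_on ball x r" and A: "A holomorphic_on ball x r"
      and eq: "\<And>z. z \<in> ball x r \<Longrightarrow> deriv G z * A z = hopf z" "\<And>z. z \<in> ball x r \<Longrightarrow> (A z * G z)\<^sup>2 = axis_form a b z"
      by (auto simp: local_data_def)
    have "(\<lambda>z. deriv G z * A z) holomorphic_on ball x r" "(\<lambda>z. (A z * G z)\<^sup>2) holomorphic_on ball x r"
      by (intro holomorphic_intros holomorphic_deriv G A open_ball)+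
    then have "hopf holomorphic_on ball x r" "axis_form a b holomorphic_on ball x r"
      using eq by (auto elim: holomorphic_transform)
    then show ?thesis using r by (auto intro: holomorphic_on_imp_differentiable_at)
  qed
  show "hopf holomorphic_on U" using *[of _ 1 0] by (simp add: holomorphic_on_def field_differentiable_at_within)
  show "axis_form a b holomorphic_on U" if "(norm a)\<^sup>2 + (norm b)\<^sup>2 = 1"
    using *[OF _ that] by (simp add: holomorphic_on_def field_differentiable_at_within)
qed

lemma hopf_eq:
  assumes x: "x \<in> U" "\<not> is_pole g x"
  shows "hopf x = deriv g x * \<alpha> x"
proof -
  have "g analytic_on {x}" using g_mero x nicely_meromorphic_on_imp_analytic_at by blast
  then obtain S where S: "open S" "x \<in> S" "g holomorphic_on S" by (auto simp: analytic_at)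
  have "(\<lambda>w. deriv g w * \<alpha> w) holomorphic_on S \<inter> U"
    using S open_U by (intro holomorphic_intros holomorphic_deriv) (auto intro: holomorphic_on_subset \<alpha>_hol)
  then have "isCont (\<lambda>w. deriv g w * \<alpha> w) x"
    using S open_U x by (auto dest!: holomorphic_on_imp_continuous_on simp: continuous_on_eq_continuous_at open_Int)
  then show ?thesis unfolding hopf_def isCont_def by (rule tendsto_Lim[rotated]) simp
qed

lemma eventually_not_pole: "x \<in> U \<Longrightarrow> \<forall>\<^sub>F z in at x. \<not> is_pole g z"
  using meromorphic_quotient_form[OF g_mero \<alpha>_hol open_U _ zorder_\<alpha>, of x]
  by (metis (no_types, lifting) centre_in_ball eventually_at_in_open eventually_mono open_ball)

lemma local_section:
  assumes x: "x \<in> U"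
  obtains \<rho> s where "0 < \<rho>" "ball (p x) \<rho> \<subseteq> M" "s holomorphic_on ball (p x) \<rho>" "s (p x) = x"
    "\<And>w. w \<in> ball (p x) \<rho> \<Longrightarrow> s w \<in> U \<and> p (s w) = w \<and> deriv p (s w) * deriv s w = 1"
proof -
  obtain T u q where T: "x \<in> T" "openin (top_of_set U) T" "homeomorphism T u p q"
    by (rule covering_space_local_homeomorphism[OF covering x]) (rule that, assumption+)
  have oT: "open T" "T \<subseteq> U" using T(2) open_U openin_open_eq by auto
  have inj: "inj_on p T" using T(3) by (metis homeomorphism_def inj_on_inverseI)
  have pT: "p holomorphic_on T" using p_hol oT holomorphic_on_subset by blast
  obtain s where s: "s holomorphic_on p ` T" "\<And>z. z \<in> T \<Longrightarrow> deriv p z * deriv s (p z) = 1" "\<And>z. z \<in> T \<Longrightarrow> s (p z) = z"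
    by (rule holomorphic_has_inverse[OF pT oT(1) inj]) (rule that, assumption+)
  have "open (p ` T)" by (rule open_mapping_thm3[OF pT oT(1) inj])
  then obtain \<rho> where \<rho>: "0 < \<rho>" "ball (p x) \<rho> \<subseteq> p ` T" using T(1) by (meson imageI openE)
  show thesis
  proof (rule that[of \<rho> s])
    show "ball (p x) \<rho> \<subseteq> M" using \<rho>(2) oT(2) p_in by blast
    show "s holomorphic_on ball (p x) \<rho>" using s(1) \<rho>(2) holomorphic_on_subset by blast
    show "s w \<in> U \<and> p (s w) = w \<and> deriv p (s w) * deriv s w = 1" if w: "w \<in> ball (p x) \<rho>" for w
    proof -
      obtain z where "z \<in> T" "w = p z" using w \<rho>(2) by blast
      then show ?thesis using s(2,3)[of z] oT(2) by auto
    qed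
  qed (use \<rho> T s in auto)
qed

lemma deriv_p_nonzero: "x \<in> U \<Longrightarrow> deriv p x \<noteq> 0"
  by (metis centre_in_ball local_section mult_zero_left zero_neq_one)

text \<open>Local data on U are pulled back by a section s of p; the factors of
  \<open>deriv p\<close> and \<open>deriv s\<close> in the metric cancel, so lam itself
  reappears.\<close>

lemma base_local_data:
  assumes x: "x \<in> U" and ab: "(norm a)\<^sup>2 + (norm b)\<^sup>2 = 1"
    and s: "0 < \<rho>" "s holomorphic_on ball (p x) \<rho>" "s (p x) = x"
    "\<And>w. w \<in> ball (p x) \<rho> \<Longrightarrow> s w \<in> U \<and> p (s w) = w \<and> deriv p (s w) * deriv s w = 1"
  obtains r G A where "ball (p x) r \<subseteq> ball (p x) \<rho>"
    "local_data lam (\<lambda>w. hopf (s w) * (deriv s w)\<^sup>2) (\<lambda>w. axis_form a b (s w) * (deriv s w)\<^sup>2) (p x) r G A"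
proof -
  obtain r0 G A where ld: "local_data lamU hopf (axis_form a b) x r0 G A" by (rule cover_local_data[OF x ab])
  have nz: "deriv s w \<noteq> 0" if "w \<in> ball (p x) \<rho>" for w using s(4)[OF that] by auto
  obtain r where r: "ball (p x) r \<subseteq> ball (p x) \<rho>" "local_data (\<lambda>w. lamU (s w) * (norm (deriv s w))\<^sup>2) (\<lambda>w. hopf (s w) * (deriv s w)\<^sup>2)
      (\<lambda>w. axis_form a b (s w) * (deriv s w)\<^sup>2) (p x) r (\<lambda>w. G (s w)) (\<lambda>w. A (s w) * deriv s w)"
    by (rule local_data_pullback[where P = s and w = "p x" and S = "ball (p x) \<rho>", unfolded s(3), OF ld open_ball _ s(2) nz])
       (use s(1) in \<open>auto intro: that\<close>)
  have "lam w = lamU (s w) * (norm (deriv s w))\<^sup>2" if "w \<in> ball (p x) r" for w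
  proof -
    have w: "w \<in> ball (p x) \<rho>" using that r(1) by blast
    have "norm (deriv p (s w) * deriv s w) = 1" using s(4)[OF w] by simp
    then have "(norm (deriv p (s w)))\<^sup>2 * (norm (deriv s w))\<^sup>2 = 1" by (simp add: norm_mult flip: power_mult_distrib)
    then show ?thesis using s(4)[OF w] by (simp add: lamU_def mult.assoc)
  qed
  then show thesis using that[OF r(1) local_data_cong[OF r(2)]] by simp
qed

text \<open>The modulus of the coefficient of the Hopf differential, from K lam = - |Q|^2 / lam.
  Written through the metric it is a function on M before Q is known to descend.\<close>

definition "hopf_norm w = sqrt (- gauss_curvature lam w) * lam w"

lemma hopf_norm_section:
  assumes x: "x \<in> U"
    and s: "0 < \<rho>" "s holomorphic_on ball (p x) \<rho>" "s (p x) = x"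
    "\<And>w. w \<in> ball (p x) \<rho> \<Longrightarrow> s w \<in> U \<and> p (s w) = w \<and> deriv p (s w) * deriv s w = 1"
  shows "hopf_norm (p x) = norm (hopf x * (deriv s (p x))\<^sup>2)"
    "gauss_curvature lam (p x) * lam (p x) = - ((norm (hopf x * (deriv s (p x))\<^sup>2))\<^sup>2 / lam (p x))"
proof -
  have ab: "(norm (1::complex))\<^sup>2 + (norm (0::complex))\<^sup>2 = 1" by simp
  obtain r G A where ld: "local_data lam (\<lambda>w. hopf (s w) * (deriv s w)\<^sup>2) (\<lambda>w. axis_form 1 0 (s w) * (deriv s w)\<^sup>2) (p x) r G A"
    by (rule base_local_data[OF x ab s])
  have r: "p x \<in> ball (p x) r" using ld by (simp add: local_data_def)
  show K: "gauss_curvature lam (p x) * lam (p x) = - ((norm (hopf x * (deriv s (p x))\<^sup>2))\<^sup>2 / lam (p x))"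
    using gauss_curvature_local_data[OF ld r] unfolding s(3) .
  have l: "lam (p x) > 0" by (rule lam_pos[OF p_in[OF x]])
  have "- gauss_curvature lam (p x) = (norm (hopf x * (deriv s (p x))\<^sup>2) / lam (p x))\<^sup>2"
    using K l by (simp add: field_simps power2_eq_square)
  then show "hopf_norm (p x) = norm (hopf x * (deriv s (p x))\<^sup>2)"
    using l by (simp add: hopf_norm_def)
qed

lemma hopf_norm_eq:
  assumes x: "x \<in> U"
  shows "hopf_norm (p x) * (norm (deriv p x))\<^sup>2 = norm (hopf x)"
    "gauss_curvature lam (p x) * lam (p x) = - ((hopf_norm (p x))\<^sup>2 / lam (p x))"
proof -
  obtain \<rho> s where s: "0 < \<rho>" "ball (p x) \<rho> \<subseteq> M" "s holomorphic_on ball (p x) \<rho>" "s (p x) = x"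
    "\<And>w. w \<in> ball (p x) \<rho> \<Longrightarrow> s w \<in> U \<and> p (s w) = w \<and> deriv p (s w) * deriv s w = 1"
    by (rule local_section[OF x]) (rule that, assumption+)
  note h = hopf_norm_section[OF x s(1,3,4,5)]
  show "gauss_curvature lam (p x) * lam (p x) = - ((hopf_norm (p x))\<^sup>2 / lam (p x))" using h by simp
  have "norm (deriv p x * deriv s (p x)) = 1" using s(5)[of "p x"] s(1,4) by simp
  then have "(norm (deriv s (p x)))\<^sup>2 * (norm (deriv p x))\<^sup>2 = 1" by (simp add: norm_mult mult.commute flip: power_mult_distrib)
  then show "hopf_norm (p x) * (norm (deriv p x))\<^sup>2 = norm (hopf x)" using h(1) by (simp add: norm_mult norm_power mult.assoc)
qed

lemma hopf_norm_via_section: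
  assumes y: "y \<in> U" and c: "deriv p y * c = 1"
  shows "hopf_norm (p y) = norm (hopf y * c\<^sup>2)"
proof -
  have "norm (deriv p y * c) = 1" using c by simp
  then have "(norm (deriv p y))\<^sup>2 * (norm c)\<^sup>2 = 1" by (simp add: norm_mult flip: power_mult_distrib)
  then show ?thesis by (simp add: norm_mult norm_power flip: hopf_norm_eq(1)[OF y])
qed

lemma continuous_hopf_norm: "continuous_on M hopf_norm"
proof -
  have "isCont hopf_norm w" if w: "w \<in> M" for w
  proof -
    obtain x where x: "x \<in> U" "p x = w" using p_surj[OF w] by blast
    obtain \<rho> s where s: "0 < \<rho>" "s holomorphic_on ball (p x) \<rho>" "s (p x) = x"
      "\<And>w. w \<in> ball (p x) \<rho> \<Longrightarrow> s w \<in> U \<and> p (s w) = w \<and> deriv p (s w) * deriv s w = 1"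
      by (rule local_section[OF x(1)]) (rule that, assumption+)
    have eq: "norm (hopf (s v)) * (norm (deriv s v))\<^sup>2 = hopf_norm v" if v: "v \<in> ball (p x) \<rho>" for v
      using hopf_norm_via_section[of "s v" "deriv s v"] s(4)[OF v] by (simp add: norm_mult norm_power)
    have "s ` ball (p x) \<rho> \<subseteq> U" using s(4) by blast
    then have "(\<lambda>v. hopf (s v)) holomorphic_on ball (p x) \<rho>"
      using holomorphic_on_compose_gen[OF s(2) hopf_holomorphic] by (simp add: o_def)
    then have "continuous_on (ball (p x) \<rho>) (\<lambda>v. norm (hopf (s v)) * (norm (deriv s v))\<^sup>2)"
      by (intro continuous_intros holomorphic_on_imp_continuous_on holomorphic_deriv s(2) open_ball)
    then have "continuous_on (ball (p x) \<rho>) hopf_norm"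
      by (rule continuous_on_eq) (rule eq)
    then show ?thesis using x(2) s(1) by (simp add: continuous_on_eq_continuous_at)
  qed
  then show ?thesis by (simp add: continuous_at_imp_continuous_on)
qed

text \<open>A simply connected cover is regular: p lifts through itself in both directions, and
  uniqueness of lifts makes the two lifts inverse to each other. The deck transformation \<delta> is
  the inverse of \<tau>, since the monodromy representation is formulated with
  \<open>inv_into\<close>, and it is a restriction because \<open>deck\<close> consists of
  extensional functions.\<close>

lemma deck_transitive:
  assumes x: "x \<in> U" "x' \<in> U" "p x = p x'"
  obtains \<tau> \<delta> where "\<tau> holomorphic_on U" "\<And>z. z \<in> U \<Longrightarrow> \<tau> z \<in> U \<and> p (\<tau> z) = p z" "\<tau> x = x'"
    "\<delta> \<in> deck U p" "\<And>z. z \<in> U \<Longrightarrow> inv_into U \<delta> z = \<tau> z"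
proof -
  have lp: "locally path_connected U" using open_U by (rule open_imp_locally_path_connected)
  have pM: "p \<in> U \<rightarrow> M" using p_in by blast
  have cp: "continuous_on U p" by (rule holomorphic_on_imp_continuous_on[OF p_hol])
  obtain \<tau> where \<tau>: "continuous_on U \<tau>" "\<tau> \<in> U \<rightarrow> U" "\<tau> x = x'" "\<And>y. y \<in> U \<Longrightarrow> p (\<tau> y) = p y"
    by (rule covering_space_lift_strong[OF covering x(2,1) simply_connected_U lp cp pM x(3)]) (rule that, assumption+)
  obtain \<sigma> where \<sigma>: "continuous_on U \<sigma>" "\<sigma> \<in> U \<rightarrow> U" "\<sigma> x' = x" "\<And>y. y \<in> U \<Longrightarrow> p (\<sigma> y) = p y"
    by (rule covering_space_lift_strong[OF covering x(1,2) simply_connected_U lp cp pM x(3)[symmetric]]) (rule that, assumption+)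
  have id: "f (h z) = z" if f: "continuous_on U f" "f \<in> U \<rightarrow> U" "\<And>y. y \<in> U \<Longrightarrow> p (f y) = p y"
      and h: "continuous_on U h" "h \<in> U \<rightarrow> U" "\<And>y. y \<in> U \<Longrightarrow> p (h y) = p y"
      and a: "a \<in> U" "f (h a) = a" and z: "z \<in> U" for f h a z
  proof (rule covering_space_lift_unique[OF covering, of "\<lambda>z. f (h z)" a "\<lambda>z. z" U p])
    show "continuous_on U (\<lambda>z. f (h z))"
      by (rule continuous_on_compose2[OF f(1) h(1)]) (use h(2) in auto)
    show "(\<lambda>z. f (h z)) \<in> U \<rightarrow> U" using f(2) h(2) by blast
    show "p y = p (f (h y))" if "y \<in> U" for y using f(3)[of "h y"] h(2) h(3)[OF that] that by (auto simp: Pi_iff)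
  qed (use a z cp pM connected_U in \<open>auto intro: continuous_intros\<close>)
  have st: "\<sigma> (\<tau> z) = z" "\<tau> (\<sigma> z) = z" if "z \<in> U" for z
    using id[OF \<sigma>(1,2,4) \<tau>(1,2,4) x(1) _ that] id[OF \<tau>(1,2,4) \<sigma>(1,2,4) x(2) _ that] \<sigma>(3) \<tau>(3) by simp_all
  show thesis
  proof (rule that[of \<tau> "restrict \<sigma> U"])
    show "\<tau> holomorphic_on U"
      by (rule covering_space_lift_is_holomorphic[OF covering open_U p_hol p_hol pM \<tau>(2,1,4)])
    show "\<tau> z \<in> U \<and> p (\<tau> z) = p z" if "z \<in> U" for z using \<tau> that by blast
    show "\<tau> x = x'" by (rule \<tau>(3))
    have "homeomorphism U U (restrict \<sigma> U) \<tau>"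
      using \<sigma>(1,2) \<tau>(1,2) st by (intro homeomorphismI) (auto simp: Pi_iff)
    then show "restrict \<sigma> U \<in> deck U p" using \<sigma>(4) by (auto simp: deck_def)
    show "inv_into U (restrict \<sigma> U) z = \<tau> z" if "z \<in> U" for z
    proof (rule inv_into_f_eq)
      show "inj_on (restrict \<sigma> U) U" using st(2) by (auto simp: inj_on_def) metis
      show "\<tau> z \<in> U" using \<tau>(2) that by blast
      then show "restrict \<sigma> U (\<tau> z) = z" using st(1)[OF that] by simp
    qed
  qed
qed

text \<open>\<open>catenoidal_end\<close> provides a q for each component of the preimage, possibly
  different ones. Their modulus is governed by \<open>hopf_norm\<close>, which lives on M, so a
  single component C is enough: it covers the whole punctured disc. Y is q freed of its double
  pole.\<close>

lemma catenoid_modulus: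
  assumes cat: "catenoidal_end M U p g \<alpha> \<psi>" and \<psi>: "\<psi> holomorphic_on UNIV - {0}" "inj_on \<psi> (UNIV - {0})"
  obtains r Y where "0 < r" "r \<le> 1" "\<psi> ` (ball 0 r - {0}) \<subseteq> M" "Y holomorphic_on ball 0 r" "\<And>\<xi>. \<xi> \<in> ball 0 r \<Longrightarrow> Y \<xi> \<noteq> 0"
    "\<And>\<xi>. \<xi> \<in> ball 0 r - {0} \<Longrightarrow> hopf_norm (\<psi> \<xi>) * (norm (deriv \<psi> \<xi>))\<^sup>2 * (norm \<xi>)\<^sup>2 = norm (Y \<xi>)"
proof -
  obtain r0 where r0: "r0 > 0" "\<psi> ` (ball 0 r0 - {0}) \<subseteq> M"
    and comp: "\<And>C. C \<in> components {z\<in>U. p z \<in> \<psi> ` (ball 0 r0 - {0})} \<Longrightarrow>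
          \<exists>q. q meromorphic_on ball 0 r0 \<and> is_pole q 0 \<and> zorder q 0 = -2 \<and>
            (\<forall>z\<in>C. \<forall>w \<in> ball 0 r0 - {0}. \<psi> w = p z \<and> \<not> is_pole g z \<longrightarrow>
               deriv g z * \<alpha> z = q w * (deriv p z / deriv \<psi> w)\<^sup>2)"
    using cat unfolding catenoidal_end_def by blast
  define B where "B = ball (0::complex) r0 - {0}"
  have B: "open B" "B \<subseteq> UNIV - {0}" by (auto simp: B_def open_Diff)
  have \<psi>B: "\<psi> holomorphic_on B" "inj_on \<psi> B" using \<psi> B(2) by (auto intro: holomorphic_on_subset inj_on_subset)
  define W where "W = {z\<in>U. p z \<in> \<psi> ` B}"
  have oN: "open (\<psi> ` B)" by (rule open_mapping_thm3[OF \<psi>B(1) B(1) \<psi>B(2)])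
  have oW: "open W" unfolding W_def
    by (rule continuous_open_preimage[OF holomorphic_on_imp_continuous_on[OF p_hol] open_U oN, unfolded vimage_def Int_def mem_Collect_eq])
  have \<psi>': "deriv \<psi> \<xi> \<noteq> 0" if "\<xi> \<in> B" for \<xi> by (rule holomorphic_injective_imp_regular[OF \<psi>B(1) B(1) \<psi>B(2) that])
  define \<xi>0 :: complex where "\<xi>0 = of_real (r0 / 2)"
  have \<xi>0: "\<xi>0 \<in> B" using r0(1) by (simp add: \<xi>0_def B_def)
  then obtain z0 where z0: "z0 \<in> U" "p z0 = \<psi> \<xi>0" using p_surj r0(2) unfolding B_def[symmetric] by blast
  then have z0W: "z0 \<in> W" using \<xi>0 by (simp add: W_def)
  define C where "C = connected_component_set W z0"
  have "C \<in> components W" using z0W by (auto simp: components_def C_def)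
  then obtain q where q: "q meromorphic_on ball 0 r0" "is_pole q 0" "zorder q 0 = -2"
    and qC: "\<And>z w. z \<in> C \<Longrightarrow> w \<in> B \<Longrightarrow> \<psi> w = p z \<Longrightarrow> \<not> is_pole g z \<Longrightarrow>
               deriv g z * \<alpha> z = q w * (deriv p z / deriv \<psi> w)\<^sup>2"
    using comp[of C] unfolding W_def B_def by blast
  have oC: "open C" unfolding C_def by (rule open_connected_component[OF oW])
  have CU: "C \<subseteq> U" using connected_component_subset[of W z0] by (auto simp: C_def W_def)
  have "isolated_singularity_at q 0" using q(1) r0(1) by (auto simp: meromorphic_on_altdef)
  then obtain r1 where r1: "0 < r1" "q analytic_on ball 0 r1 - {0}" by (auto simp: isolated_singularity_at_def)
  have qh: "q holomorphic_on ball 0 r1 - {0}" by (rule analytic_imp_holomorphic[OF r1(2)])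
  define Y where "Y = zor_poly q 0"
  have "0 \<in> ball 0 r1" using r1(1) by simp
  note zz = zorder_exist_pole[OF qh open_ball this q(2), folded Y_def]
  have Y0: "Y 0 \<noteq> 0" using zz by blast
  obtain r2 where r2: "0 < r2" "Y holomorphic_on cball 0 r2" "\<And>w. w \<in> cball 0 r2 - {0} \<Longrightarrow> q w = Y w / w\<^sup>2 \<and> Y w \<noteq> 0"
    using zz[THEN conjunct2, THEN conjunct2] unfolding q(3) by auto
  define r where "r = min (min r0 r2) 1"
  have r: "0 < r" "r \<le> 1" "ball 0 r - {0} \<subseteq> B" "ball (0::complex) r \<subseteq> cball 0 r2" using r0(1) r2(1) by (auto simp: r_def B_def)
  have Yh: "Y holomorphic_on ball 0 r" using r2(2) r(4) by (rule holomorphic_on_subset)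
  have main: "hopf_norm (\<psi> \<xi>) * (norm (deriv \<psi> \<xi>))\<^sup>2 * (norm \<xi>)\<^sup>2 = norm (Y \<xi>)" if \<xi>: "\<xi> \<in> ball 0 r - {0}" for \<xi>
  proof -
    have \<xi>B: "\<xi> \<in> B" using \<xi> r(3) by blast
    \<comment> \<open>Lifting a path from \<xi>0 to \<xi>, started at z0, ends at a point of C over
      \<psi> \<xi>.\<close>
    have "path_connected B" unfolding B_def by (rule path_connected_punctured_ball) simp
    then obtain \<gamma> where \<gamma>: "path \<gamma>" "path_image \<gamma> \<subseteq> B" "pathstart \<gamma> = \<xi>0" "pathfinish \<gamma> = \<xi>"
      using \<xi>0 \<xi>B unfolding path_connected_def by blast
    have p1: "path (\<psi> \<circ> \<gamma>)"
      by (rule path_continuous_image[OF \<gamma>(1) continuous_on_subset[OF holomorphic_on_imp_continuous_on[OF \<psi>B(1)] \<gamma>(2)]])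
    have p2: "path_image (\<psi> \<circ> \<gamma>) \<subseteq> M" "pathstart (\<psi> \<circ> \<gamma>) = p z0"
      using \<gamma>(2,3) r0(2) z0(2) by (auto simp: path_image_compose pathstart_compose B_def[symmetric])
    obtain h where h: "path h" "path_image h \<subseteq> U" "pathstart h = z0" "\<And>t. t \<in> {0..1} \<Longrightarrow> p (h t) = (\<psi> \<circ> \<gamma>) t"
      by (rule covering_space_lift_path_strong[OF covering z0(1) p1 p2]) (rule that, assumption+)
    have "path_image h \<subseteq> W"
    proof
      fix y assume "y \<in> path_image h"
      then obtain t where t: "t \<in> {0..1}" "y = h t" by (auto simp: path_image_def)
      have "\<gamma> t \<in> B" using t(1) \<gamma>(2) by (auto simp: path_image_def)
      then show "y \<in> W" using h(2,4) t by (auto simp: W_def path_image_def)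
    qed
    then have hC: "path_image h \<subseteq> C" unfolding C_def
      using connected_component_maximal[of z0 "path_image h" W] connected_path_image[OF h(1)] h(3) pathstart_in_path_image[of h] by blast
    define z where "z = pathfinish h"
    have z: "z \<in> C" "z \<in> U" "p z = \<psi> \<xi>"
      using hC CU h(4)[of 1] \<gamma>(4) pathfinish_in_path_image[of h] by (auto simp: z_def pathfinish_def)
    obtain \<rho> s where s: "0 < \<rho>" "ball (p z) \<rho> \<subseteq> M" "s holomorphic_on ball (p z) \<rho>" "s (p z) = z"
      "\<And>w. w \<in> ball (p z) \<rho> \<Longrightarrow> s w \<in> U \<and> p (s w) = w \<and> deriv p (s w) * deriv s w = 1"
      by (rule local_section[OF z(2)]) (rule that, assumption+)
    have "isCont s (p z)" using holomorphic_on_imp_continuous_on[OF s(3)] s(1) by (simp add: continuous_on_eq_continuous_at)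
    moreover have c\<psi>: "isCont \<psi> \<xi>" using holomorphic_on_imp_continuous_on[OF \<psi>B(1)] \<xi>B B(1) by (simp add: continuous_on_eq_continuous_at)
    ultimately have "isCont (\<lambda>\<xi>. s (\<psi> \<xi>)) \<xi>" unfolding z(3) using isCont_o2 by blast
    then have lim: "((\<lambda>\<xi>'. s (\<psi> \<xi>')) \<longlongrightarrow> z) (at \<xi>)" using s(4) z(3) by (simp add: isCont_def)
    have e1: "\<forall>\<^sub>F \<xi>' in at \<xi>. \<psi> \<xi>' \<in> ball (p z) \<rho>"
      using c\<psi>[unfolded isCont_def, THEN topological_tendstoD, of "ball (p z) \<rho>"] s(1) z(3) by simp
    have e2: "\<forall>\<^sub>F \<xi>' in at \<xi>. \<xi>' \<in> ball 0 r - {0} - {\<xi>}"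
      using eventually_at_in_open[of "ball 0 r - {0}" \<xi>] \<xi> by (simp add: open_Diff)
    have e3: "\<forall>\<^sub>F \<xi>' in at \<xi>. s (\<psi> \<xi>') \<noteq> z"
      using e1 e2
    proof eventually_elim
      case (elim \<xi>')
      then have "p (s (\<psi> \<xi>')) = \<psi> \<xi>'" "\<xi>' \<in> B" "\<xi>' \<noteq> \<xi>" using s(5) r(3) by auto
      then show ?case using z(3) \<xi>B \<psi>B(2) by (metis inj_onD)
    qed
    \<comment> \<open>Poles of g are isolated, so points of C near z but different from z are not
      poles. The formula holds at the corresponding \<xi>' near \<xi>, and continuity carries it to
      \<xi> even if z is a pole.\<close>
    have "filterlim (\<lambda>\<xi>'. s (\<psi> \<xi>')) (at z) (at \<xi>)" using lim e3 by (simp add: filterlim_at)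
    moreover have "\<forall>\<^sub>F y in at z. y \<in> C \<and> \<not> is_pole g y"
      using eventually_at_in_open'[OF oC z(1)] eventually_not_pole[OF z(2)] by eventually_elim simp
    ultimately have e4: "\<forall>\<^sub>F \<xi>' in at \<xi>. s (\<psi> \<xi>') \<in> C \<and> \<not> is_pole g (s (\<psi> \<xi>'))"
      by (rule eventually_compose_filterlim[rotated])
    have ev: "\<forall>\<^sub>F \<xi>' in at \<xi>. norm (Y \<xi>') = hopf_norm (\<psi> \<xi>') * (norm (deriv \<psi> \<xi>'))\<^sup>2 * (norm \<xi>')\<^sup>2"
      using e1 e2 e4
    proof eventually_elim
      case (elim \<xi>')
      define y where "y = s (\<psi> \<xi>')"
      have y: "y \<in> U" "p y = \<psi> \<xi>'" "y \<in> C" "\<not> is_pole g y" using elim s(5)[of "\<psi> \<xi>'"] by (auto simp: y_def)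
      have \<xi>': "\<xi>' \<in> B" "\<xi>' \<in> cball 0 r2 - {0}" using elim r(3,4) by auto
      have "hopf y = q \<xi>' * (deriv p y / deriv \<psi> \<xi>')\<^sup>2"
        using qC[OF y(3) \<xi>'(1) y(2)[symmetric] y(4)] hopf_eq[OF y(1,4)] by simp
      then have "hopf_norm (\<psi> \<xi>') * (norm (deriv p y))\<^sup>2 = norm (q \<xi>') * (norm (deriv p y) / norm (deriv \<psi> \<xi>'))\<^sup>2"
        using hopf_norm_eq(1)[OF y(1)] unfolding y(2) by (simp add: norm_mult norm_power norm_divide)
      then have "hopf_norm (\<psi> \<xi>') * (norm (deriv \<psi> \<xi>'))\<^sup>2 = norm (q \<xi>')"
        using deriv_p_nonzero[OF y(1)] \<psi>'[OF \<xi>'(1)] by (simp add: power_divide field_simps)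
      moreover have "norm (q \<xi>') * (norm \<xi>')\<^sup>2 = norm (Y \<xi>')"
        using r2(3)[OF \<xi>'(2)] \<xi>'(2) by (simp add: norm_divide norm_power)
      ultimately show ?case by simp
    qed
    have cn: "isCont hopf_norm (\<psi> \<xi>)"
      using continuous_hopf_norm open_M r0(2) \<xi>B by (simp add: continuous_on_eq_continuous_at B_def[symmetric] image_subset_iff)
    have cd: "isCont (deriv \<psi>) \<xi>"
      using holomorphic_on_imp_continuous_on[OF holomorphic_deriv[OF \<psi>B(1) B(1)]] \<xi>B B(1) by (simp add: continuous_on_eq_continuous_at)
    have cY: "isCont Y \<xi>" using holomorphic_on_imp_continuous_on[OF Yh] \<xi> by (simp add: continuous_on_eq_continuous_at)
    have cl: "isCont (\<lambda>\<xi>. hopf_norm (\<psi> \<xi>) * (norm (deriv \<psi> \<xi>))\<^sup>2 * (norm \<xi>)\<^sup>2) \<xi>"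
      by (intro continuous_intros isCont_o2[OF c\<psi> cn] cd)
    have "((\<lambda>\<xi>. norm (Y \<xi>)) \<longlongrightarrow> norm (Y \<xi>)) (at \<xi>)" using cY unfolding isCont_def by (rule tendsto_norm)
    then have l1: "((\<lambda>\<xi>. hopf_norm (\<psi> \<xi>) * (norm (deriv \<psi> \<xi>))\<^sup>2 * (norm \<xi>)\<^sup>2) \<longlongrightarrow> norm (Y \<xi>)) (at \<xi>)"
      using ev by (rule Lim_transform_eventually)
    show ?thesis by (rule tendsto_unique[OF at_neq_bot cl[unfolded isCont_def] l1])
  qed
  show thesis
  proof (rule that[OF r(1,2) _ Yh _ main])
    show "\<psi> ` (ball 0 r - {0}) \<subseteq> M" using r0(2) r(3) unfolding B_def by blast
    show "Y \<xi> \<noteq> 0" if "\<xi> \<in> ball 0 r" for \<xi> using Y0 r2(3)[of \<xi>] r(4) that by (cases "\<xi> = 0") auto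
  qed
qed

text \<open>The double poles at 0 and 1 are cancelled by z^2 (z - 1)^2, so \<Theta> is locally the
  modulus of a holomorphic function up to finitely many zeros, on the whole plane, and
  \<open>global_function_of_modulus\<close> applies. Dividing back gives a function on M with the
  modulus of the Hopf differential; lifted to U it differs from \<open>hopf\<close> by a constant of
  modulus 1, which is absorbed into Q.\<close>

lemma hopf_globalises:
  assumes M: "M = UNIV - {0, 1}"
    and ends: "catenoidal_end M U p g \<alpha> (\<lambda>w. w)" "catenoidal_end M U p g \<alpha> (\<lambda>w. 1 + w)" "catenoidal_end M U p g \<alpha> (\<lambda>w. inverse w)"
  obtains Q where "Q holomorphic_on M" "\<And>z. z \<in> U \<Longrightarrow> hopf z = Q (p z) * (deriv p z)\<^sup>2" "\<exists>z\<in>M. Q z \<noteq> 0"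
    "end_lower_bound Q (\<lambda>w. w)" "end_lower_bound Q (\<lambda>w. 1 + w)"
    "end_lower_bound Q (\<lambda>w. inverse w)"
proof -
  obtain r0 Y0 where r0: "0 < r0" "r0 \<le> 1" "Y0 holomorphic_on ball 0 r0" "\<And>\<xi>. \<xi> \<in> ball 0 r0 \<Longrightarrow> Y0 \<xi> \<noteq> 0"
    "\<And>\<xi>. \<xi> \<in> ball 0 r0 - {0} \<Longrightarrow> hopf_norm \<xi> * (norm (deriv (\<lambda>w. w) \<xi>))\<^sup>2 * (norm \<xi>)\<^sup>2 = norm (Y0 \<xi>)"
    by (rule catenoid_modulus[OF ends(1)]) (auto intro: that)
  obtain r1 Y1 where r1: "0 < r1" "r1 \<le> 1" "Y1 holomorphic_on ball 0 r1" "\<And>\<xi>. \<xi> \<in> ball 0 r1 \<Longrightarrow> Y1 \<xi> \<noteq> 0"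
    "\<And>\<xi>. \<xi> \<in> ball 0 r1 - {0} \<Longrightarrow> hopf_norm (1 + \<xi>) * (norm (deriv (\<lambda>w. 1 + w) \<xi>))\<^sup>2 * (norm \<xi>)\<^sup>2 = norm (Y1 \<xi>)"
    by (rule catenoid_modulus[OF ends(2)]) (auto intro: that intro!: holomorphic_intros simp: inj_on_def)
  obtain r2 Y2 where r2: "0 < r2" "r2 \<le> 1" "Y2 holomorphic_on ball 0 r2" "\<And>\<xi>. \<xi> \<in> ball 0 r2 \<Longrightarrow> Y2 \<xi> \<noteq> 0"
    "\<And>\<xi>. \<xi> \<in> ball 0 r2 - {0} \<Longrightarrow> hopf_norm (inverse \<xi>) * (norm (deriv (\<lambda>w. inverse w) \<xi>))\<^sup>2 * (norm \<xi>)\<^sup>2 = norm (Y2 \<xi>)"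
    by (rule catenoid_modulus[OF ends(3)]) (auto intro: that intro!: holomorphic_intros simp: inj_on_def)
  have d1: "deriv (\<lambda>w. 1 + w) \<xi> = 1" for \<xi> :: complex
    by (rule DERIV_imp_deriv) (auto intro!: derivative_eq_intros)
  have e0: "hopf_norm \<xi> * (norm \<xi>)\<^sup>2 = norm (Y0 \<xi>)" if "\<xi> \<in> ball 0 r0 - {0}" for \<xi> using r0(5)[OF that] by simp
  have e1: "hopf_norm (1 + \<xi>) * (norm \<xi>)\<^sup>2 = norm (Y1 \<xi>)" if "\<xi> \<in> ball 0 r1 - {0}" for \<xi> using r1(5)[OF that] by (simp add: d1)
  define P where "P w = w\<^sup>2 * (w - 1)\<^sup>2" for w :: complex
  define \<Theta> where "\<Theta> w = hopf_norm w * norm (P w)" for w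
  have Pnz: "P w \<noteq> 0" if "w \<in> M" for w using that by (auto simp: P_def M)
  \<comment> \<open>If the modulus vanished on an open set, \<open>hopf\<close> would vanish on the
    connected U, against Y0 \<noteq> 0 at the end 0. This ensures that zeros have finite
    order.\<close>
  have hopf_nz: "\<exists>z\<in>V. hopf_norm z \<noteq> 0" if V: "open V" "V \<subseteq> M" "V \<noteq> {}" for V
  proof (rule ccontr)
    assume "\<not> ?thesis"
    then have V0: "hopf_norm z = 0" if "z \<in> V" for z using that by blast
    define W where "W = {z \<in> U. p z \<in> V}"
    have oW: "open W" unfolding W_def
      by (rule continuous_open_preimage[OF holomorphic_on_imp_continuous_on[OF p_hol] open_U V(1), unfolded vimage_def Int_def mem_Collect_eq])
    obtain v where "v \<in> V" using V(3) by blast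
    then obtain x where "x \<in> U" "p x = v" using p_surj V(2) by blast
    then have "W \<noteq> {}" using \<open>v \<in> V\<close> by (auto simp: W_def)
    moreover have "hopf z = 0" if "z \<in> W" for z using hopf_norm_eq(1)[of z] V0[of "p z"] that by (simp add: W_def)
    ultimately have h0: "hopf z = 0" if "z \<in> U" for z
      using analytic_continuation_open[OF oW open_U _ connected_U _ hopf_holomorphic, of "\<lambda>_. 0"] that by (auto simp: W_def)
    define \<xi> :: complex where "\<xi> = of_real (r0 / 2)"
    have "r0 / 2 \<noteq> 1" "r0 / 2 \<noteq> 0" using r0(1,2) by auto
    then have "\<xi> \<noteq> 1" "\<xi> \<noteq> 0" unfolding \<xi>_def of_real_eq_1_iff of_real_eq_0_iff .
    then have "\<xi> \<in> M" unfolding M by blast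
    moreover have "\<xi> \<in> ball 0 r0 - {0}" using r0(1,2) by (simp add: \<xi>_def)
    ultimately have \<xi>: "\<xi> \<in> ball 0 r0 - {0}" "\<xi> \<in> M" by blast+
    obtain x where x: "x \<in> U" "p x = \<xi>" using p_surj \<xi>(2) by blast
    have "hopf_norm \<xi> = 0" using hopf_norm_eq(1)[OF x(1)] h0[OF x(1)] deriv_p_nonzero[OF x(1)] x(2) by simp
    then show False using e0[OF \<xi>(1)] r0(4)[of \<xi>] \<xi>(1) by simp
  qed
  have c\<Theta>: "continuous_on M \<Theta>" unfolding \<Theta>_def[abs_def] P_def by (intro continuous_intros continuous_hopf_norm)
  obtain R where R: "R holomorphic_on UNIV" "\<And>w. (\<Theta> \<longlongrightarrow> norm (R w)) (at w)"
  proof (rule global_function_of_modulus[of \<Theta> "1 / r2"])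
    fix z
    show "\<exists>r Y n. 0 < r \<and> Y holomorphic_on ball z r \<and> (\<forall>w\<in>ball z r. Y w \<noteq> 0) \<and>
      (\<forall>w\<in>ball z r - {z}. \<Theta> w = norm (Y w) * norm (w - z) ^ n)"
    proof (cases "z \<in> M")
      case False
      then consider "z = 0" | "z = 1" by (auto simp: M)
      then show ?thesis
      proof cases
        case 1
        have "0 < r0 \<and> (\<lambda>w. Y0 w * (w - 1)\<^sup>2) holomorphic_on ball z r0 \<and> (\<forall>w\<in>ball z r0. Y0 w * (w - 1)\<^sup>2 \<noteq> 0) \<and>
            (\<forall>w\<in>ball z r0 - {z}. \<Theta> w = norm (Y0 w * (w - 1)\<^sup>2) * norm (w - z) ^ 0)"
          unfolding 1 using r0(1-4) by (auto intro!: holomorphic_intros simp: \<Theta>_def P_def norm_mult norm_power e0[symmetric])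
        then show ?thesis by blast
      next
        case 2
        have s: "(\<lambda>w. w - 1) ` ball 1 r1 \<subseteq> ball (0::complex) r1" by (auto simp: dist_norm norm_minus_commute)
        have "(\<lambda>w. w - 1) holomorphic_on ball 1 r1" by (intro holomorphic_intros)
        from holomorphic_on_compose_gen[OF this r1(3) s]
        have "(\<lambda>w. Y1 (w - 1)) holomorphic_on ball 1 r1" by (simp add: o_def)
        moreover have "w \<noteq> 0 \<and> w - 1 \<in> ball 0 r1" if "w \<in> ball 1 r1" for w :: complex
          using that r1(2) s by (auto simp: dist_norm)
        moreover have "\<Theta> w = norm (Y1 (w - 1) * w\<^sup>2)" if "w - 1 \<in> ball 0 r1 - {0}" for w
          using e1[OF that] by (simp add: \<Theta>_def P_def norm_mult norm_power)
        ultimately have "0 < r1 \<and> (\<lambda>w. Y1 (w - 1) * w\<^sup>2) holomorphic_on ball z r1 \<and> (\<forall>w\<in>ball z r1. Y1 (w - 1) * w\<^sup>2 \<noteq> 0) \<and>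
            (\<forall>w\<in>ball z r1 - {z}. \<Theta> w = norm (Y1 (w - 1) * w\<^sup>2) * norm (w - z) ^ 0)"
          unfolding 2 using r1(1,4) by (auto intro!: holomorphic_intros)
        then show ?thesis by blast
      qed
    next
      case True
      obtain x where x: "x \<in> U" "p x = z" using p_surj[OF True] by blast
      obtain \<rho> s where s: "0 < \<rho>" "ball z \<rho> \<subseteq> M" "s holomorphic_on ball z \<rho>" "s z = x"
        "\<And>w. w \<in> ball z \<rho> \<Longrightarrow> s w \<in> U \<and> p (s w) = w \<and> deriv p (s w) * deriv s w = 1"
        by (rule local_section[OF x(1), unfolded x(2)]) (rule that, assumption+)
      define f where "f w = hopf (s w) * (deriv s w)\<^sup>2" for w
      have fn: "hopf_norm w = norm (f w)" if "w \<in> ball z \<rho>" for w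
        using hopf_norm_via_section[of "s w" "deriv s w"] s(5)[OF that] by (simp add: f_def)
      have "s ` ball z \<rho> \<subseteq> U" using s(5) by blast
      then have "(\<lambda>v. hopf (s v)) holomorphic_on ball z \<rho>"
        using holomorphic_on_compose_gen[OF s(3) hopf_holomorphic] by (simp add: o_def)
      then have fh: "f holomorphic_on ball z \<rho>" unfolding f_def[abs_def]
        by (intro holomorphic_intros holomorphic_deriv s(3) open_ball)
      have "\<exists>w\<in>ball z \<rho>. hopf_norm w \<noteq> 0" by (rule hopf_nz) (use s(1,2) in auto)
      then have f0: "\<exists>w\<in>ball z \<rho>. f w \<noteq> 0" using fn by force
      have zb: "z \<in> ball z \<rho>" using s(1) by simp
      obtain r where r: "0 < r" "cball z r \<subseteq> ball z \<rho>" "zor_poly f z holomorphic_on cball z r"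
        "\<And>w. w \<in> cball z r \<Longrightarrow> f w = zor_poly f z w * (w - z) ^ nat (zorder f z) \<and> zor_poly f z w \<noteq> 0"
      proof -
        from conjunct2[OF zorder_exist_zero[OF fh open_ball connected_ball zb f0]]
        show ?thesis using that by (elim exE conjE) blast
      qed
      define h where "h = zor_poly f z"
      have b: "ball z r \<subseteq> cball z r" by auto
      have "(\<lambda>w. h w * P w) holomorphic_on ball z r"
        using holomorphic_on_subset[OF r(3) b] unfolding h_def P_def by (intro holomorphic_intros)
      moreover have "h w * P w \<noteq> 0" "\<Theta> w = norm (h w * P w) * norm (w - z) ^ nat (zorder f z)" if w: "w \<in> ball z r" for w
      proof -
        have w': "w \<in> cball z r" "w \<in> ball z \<rho>" "w \<in> M" using w b r(2) s(2) by blast+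
        show "h w * P w \<noteq> 0" using r(4)[OF w'(1)] Pnz[OF w'(3)] by (simp add: h_def)
        have "norm (f w) = norm (h w) * norm (w - z) ^ nat (zorder f z)"
          using r(4)[OF w'(1)] unfolding h_def by (metis norm_mult norm_power)
        then show "\<Theta> w = norm (h w * P w) * norm (w - z) ^ nat (zorder f z)"
          by (simp add: \<Theta>_def fn[OF w'(2)] norm_mult)
      qed
      ultimately show ?thesis using r(1) by blast
    qed
  next
    \<comment> \<open>Beyond radius 1 / r2 a point lies in the end at \<infinity>, where Y2 has no
      zeros; this confines the zeros of \<Theta> to a disc.\<close>
    have far: "w \<in> M" "inverse w \<in> ball 0 r2 - {0}" if "1 / r2 < norm w" for w :: complex
    proof -
      have "1 \<le> 1 / r2" using r2(1,2) by simp
      then have w1: "1 < norm w" using that by linarith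
      then show "w \<in> M" by (auto simp: M)
      have "w \<noteq> 0" using w1 by auto
      moreover have "inverse (norm w) < r2" using that less_trans[OF zero_less_one w1] r2(1) by (simp only: inverse_eq_divide pos_divide_less_eq mult.commute)
      ultimately show "inverse w \<in> ball 0 r2 - {0}" using that r2(1) by (simp add: norm_inverse)
    qed
    show "\<Theta> w \<noteq> 0" if "1 / r2 < norm w" for w
      using r2(4,5)[of "inverse w"] far[OF that] Pnz[of w] by (auto simp: \<Theta>_def)
    show "continuous_on {w. 1 / r2 < norm w} \<Theta>" using c\<Theta> by (rule continuous_on_subset) (use far in blast)
  qed (rule that)
  have RM: "\<Theta> w = norm (R w)" if "w \<in> M" for w
    using c\<Theta> open_M that R(2)[of w] by (auto simp: continuous_on_eq_continuous_at isCont_def intro: tendsto_unique[OF at_neq_bot])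
  define q where "q w = R w / P w" for w
  have qh: "q holomorphic_on M" unfolding q_def[abs_def]
  proof (rule holomorphic_on_divide)
    show "R holomorphic_on M" using R(1) by (rule holomorphic_on_subset) simp
    show "P holomorphic_on M" unfolding P_def[abs_def] by (intro holomorphic_intros)
  qed (rule Pnz)
  have qn: "norm (q w) = hopf_norm w" if "w \<in> M" for w
    using RM[OF that] Pnz[OF that] by (simp add: q_def norm_divide \<Theta>_def field_simps)
  have "(\<lambda>z. q (p z)) holomorphic_on U"
    using holomorphic_on_compose_gen[OF p_hol qh] p_in by (auto simp: o_def image_subset_iff)
  then have lift: "(\<lambda>z. q (p z) * (deriv p z)\<^sup>2) holomorphic_on U"
    by (intro holomorphic_intros holomorphic_deriv p_hol open_U)
  obtain c where c: "norm c = 1" "\<And>z. z \<in> U \<Longrightarrow> hopf z = c * (q (p z) * (deriv p z)\<^sup>2)"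
  proof (rule eq_norm_imp_unit_multiple[OF hopf_holomorphic lift open_U connected_U])
    show "norm (hopf z) = norm (q (p z) * (deriv p z)\<^sup>2)" if "z \<in> U" for z
      using hopf_norm_eq(1)[OF that] qn[OF p_in[OF that]] by (simp add: norm_mult norm_power)
  qed (rule that)
  have cn: "norm (c * q w) = hopf_norm w" if "w \<in> M" for w using qn[OF that] c(1) by (simp add: norm_mult)
  have b1: "w \<in> M" "1 + w \<in> M" "inverse w \<in> M" if "w \<in> ball 0 1 - {0}" for w :: complex
    using that by (auto simp: M add_eq_0_iff inverse_eq_1_iff)
  have b: "w \<in> ball 0 1 - {0}" if "w \<in> ball 0 r - {0}" "r \<le> 1" for r and w :: complex using that by auto
  show thesis
  proof (rule that[of "\<lambda>w. c * q w"])
    show "(\<lambda>w. c * q w) holomorphic_on M" by (intro holomorphic_intros qh)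
    show "hopf z = c * q (p z) * (deriv p z)\<^sup>2" if "z \<in> U" for z using c(2)[OF that] by simp
    have "\<exists>z\<in>M. hopf_norm z \<noteq> 0" by (rule hopf_nz) (use open_M M_ne in auto)
    then show "\<exists>z\<in>M. c * q z \<noteq> 0" using cn by (metis norm_zero)
    show "end_lower_bound (\<lambda>w. c * q w) (\<lambda>w. w)"
      by (rule modulus_end_lower_bound[OF r0(3,1,4)]) (use r0(5) cn[OF b1(1)[OF b[OF _ r0(2)]]] in simp_all)
    show "end_lower_bound (\<lambda>w. c * q w) (\<lambda>w. 1 + w)"
      by (rule modulus_end_lower_bound[OF r1(3,1,4)]) (use r1(5) cn[OF b1(2)[OF b[OF _ r1(2)]]] in simp_all)
    show "end_lower_bound (\<lambda>w. c * q w) (\<lambda>w. inverse w)"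
      by (rule modulus_end_lower_bound[OF r2(3,1,4)]) (use r2(5) cn[OF b1(3)[OF b[OF _ r2(2)]]] in simp_all)
  qed
qed

text \<open>From E = (A G)^2 and Q = A times the derivative of G, E times the square of the
  logarithmic derivative of G is Q^2. Multiplying G by a constant, or inverting it, does not change
  that square, and this is all that deck transformations do to the rotated g.\<close>

lemma developing_log_derivative:
  assumes x: "x \<in> U" and ab: "(norm a)\<^sup>2 + (norm b)\<^sup>2 = 1"
    and \<Gamma>: "unitary_moebius a b (sphere_map g x) \<noteq> None" "unitary_moebius a b (sphere_map g x) \<noteq> Some 0"
  obtains V \<gamma> where "open V" "x \<in> V" "V \<subseteq> U" "\<gamma> holomorphic_on V"
    "\<And>v. v \<in> V \<Longrightarrow> \<gamma> v \<noteq> 0 \<and> unitary_moebius a b (sphere_map g v) = Some (\<gamma> v) \<and>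
       axis_form a b v * (deriv \<gamma> v / \<gamma> v)\<^sup>2 = (hopf v)\<^sup>2"
proof -
  obtain r G A where r: "ball x r \<subseteq> U" and ld: "local_data lamU hopf (axis_form a b) x r G A"
    and alt: "(\<forall>z\<in>ball x r. unitary_moebius a b (sphere_map g z) = Some (G z)) \<or>
     (\<forall>z\<in>ball x r. unitary_moebius a b (sphere_map g z) = (if G z = 0 then None else Some (- 1 / G z)))"
    by (rule cover_local_data[OF x ab]) (rule that, assumption+)
  have r0: "0 < r" and G: "G holomorphic_on ball x r"
    and eq: "\<And>z. z \<in> ball x r \<Longrightarrow> deriv G z * A z = hopf z \<and> (A z * G z)\<^sup>2 = axis_form a b z"
    using ld by (auto simp: local_data_def)
  define V where "V = {v \<in> ball x r. G v \<in> - {0}}"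
  have oV: "open V" unfolding V_def
    by (rule continuous_open_preimage[OF holomorphic_on_imp_continuous_on[OF G] open_ball, unfolded vimage_def Int_def mem_Collect_eq]) auto
  have xb: "x \<in> ball x r" using r0 by simp
  have xV: "x \<in> V"
  proof -
    have "G x \<noteq> 0" using alt
    proof
      assume "\<forall>z\<in>ball x r. unitary_moebius a b (sphere_map g z) = Some (G z)"
      then show ?thesis using \<Gamma>(2) xb by metis
    next
      assume "\<forall>z\<in>ball x r. unitary_moebius a b (sphere_map g z) = (if G z = 0 then None else Some (- 1 / G z))"
      then show ?thesis using \<Gamma>(1) xb by metis
    qed
    then show ?thesis using xb by (simp add: V_def)
  qed
  have GV: "G holomorphic_on V" using G by (rule holomorphic_on_subset) (auto simp: V_def)
  have VU: "V \<subseteq> U" using r by (auto simp: V_def)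
  have form: "axis_form a b v * (deriv G v / G v)\<^sup>2 = (hopf v)\<^sup>2" "G v \<noteq> 0" "v \<in> ball x r" if "v \<in> V" for v
  proof -
    show v: "G v \<noteq> 0" "v \<in> ball x r" using that by (auto simp: V_def)
    have "axis_form a b v * (deriv G v / G v)\<^sup>2 = (A v * G v)\<^sup>2 * (deriv G v / G v)\<^sup>2" using eq[OF v(2)] by simp
    also have "\<dots> = (deriv G v * A v)\<^sup>2" using v(1) by (simp add: power_mult_distrib power_divide)
    finally show "axis_form a b v * (deriv G v / G v)\<^sup>2 = (hopf v)\<^sup>2" using eq[OF v(2)] by simp
  qed
  show thesis using alt
  proof
    assume "\<forall>z\<in>ball x r. unitary_moebius a b (sphere_map g z) = Some (G z)"
    then show thesis using form by (intro that[OF oV xV VU GV]) blast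
  next
    assume \<Gamma>': "\<forall>z\<in>ball x r. unitary_moebius a b (sphere_map g z) = (if G z = 0 then None else Some (- 1 / G z))"
    show thesis
    proof (rule that[OF oV xV VU, of "\<lambda>v. - 1 / G v"])
      show "(\<lambda>v. - 1 / G v) holomorphic_on V" using form(2) by (intro holomorphic_intros GV)
      fix v assume v: "v \<in> V"
      have "((\<lambda>v. - 1 / G v) has_field_derivative deriv G v / (G v)\<^sup>2) (at v)"
        using holomorphic_derivI[OF GV oV v] form(2)[OF v] by (auto intro!: derivative_eq_intros simp: power2_eq_square)
      then have d: "deriv (\<lambda>v. - 1 / G v) v = deriv G v / (G v)\<^sup>2" by (rule DERIV_imp_deriv)
      have "deriv G v / (G v)\<^sup>2 / (- 1 / G v) = - (deriv G v / G v)" using form(2)[OF v] by (simp add: power2_eq_square)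
      then have "axis_form a b v * (deriv (\<lambda>v. - 1 / G v) v / (- 1 / G v))\<^sup>2 = (hopf v)\<^sup>2"
        unfolding d using form(1)[OF v] by simp
      then show "- 1 / G v \<noteq> 0 \<and> unitary_moebius a b (sphere_map g v) = Some (- 1 / G v) \<and>
         axis_form a b v * (deriv (\<lambda>v. - 1 / G v) v / (- 1 / G v))\<^sup>2 = (hopf v)\<^sup>2"
        using form(2,3)[OF v] \<Gamma>' by simp
    qed
  qed
qed

text \<open>The rotated g is not constant near z0, as the Hopf differential does not vanish there;
  so some nearby point avoids the values 0 and \<infinity> while the Hopf differential is still
  nonzero.\<close>

lemma good_point:
  assumes ab: "(norm a)\<^sup>2 + (norm b)\<^sup>2 = 1" and nz: "z0 \<in> U" "hopf z0 \<noteq> 0"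
  obtains x where "x \<in> U" "hopf x \<noteq> 0"
    "unitary_moebius a b (sphere_map g x) \<noteq> None" "unitary_moebius a b (sphere_map g x) \<noteq> Some 0"
proof -
  obtain r G A where r: "ball z0 r \<subseteq> U" and ld: "local_data lamU hopf (axis_form a b) z0 r G A"
    and alt: "(\<forall>z\<in>ball z0 r. unitary_moebius a b (sphere_map g z) = Some (G z)) \<or>
     (\<forall>z\<in>ball z0 r. unitary_moebius a b (sphere_map g z) = (if G z = 0 then None else Some (- 1 / G z)))"
    by (rule cover_local_data[OF nz(1) ab]) (rule that, assumption+)
  have r0: "0 < r" and G: "G holomorphic_on ball z0 r"
    and eq: "\<And>z. z \<in> ball z0 r \<Longrightarrow> deriv G z * A z = hopf z"
    using ld by (auto simp: local_data_def)
  have zb: "z0 \<in> ball z0 r" using r0 by simp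
  have "\<exists>x\<in>ball z0 r. G x * hopf x \<noteq> 0"
  proof (rule ccontr)
    assume "\<not> ?thesis"
    then have z: "G x * hopf x = 0" if "x \<in> ball z0 r" for x using that by blast
    have "G x = 0" if "x \<in> ball z0 r" for x
      using holomorphic_mult_eq_0[OF G holomorphic_on_subset[OF hopf_holomorphic r] open_ball connected_ball z] nz(2) zb that by blast
    then have "(G has_field_derivative 0) (at z0)"
      using has_field_derivative_transform_within_open[OF DERIV_const open_ball zb, of 0 G] by simp
    then show False using eq[OF zb] nz(2) DERIV_imp_deriv by fastforce
  qed
  then obtain x where x: "x \<in> ball z0 r" "G x \<noteq> 0" "hopf x \<noteq> 0" by auto
  have "unitary_moebius a b (sphere_map g x) = Some (G x) \<or> unitary_moebius a b (sphere_map g x) = Some (- 1 / G x)"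
    using alt x(1,2) by auto
  then show thesis using that[of x] x r by auto
qed

text \<open>The Hopf differential is invariant because it comes from M, and k \<gamma> and k /
  \<gamma> have the logarithmic derivative of \<gamma> up to sign. So the equation of
  \<open>developing_log_derivative\<close> yields invariance of the axis form on a small open set,
  and the identity theorem extends it to U.\<close>

lemma axis_form_invariant:
  assumes ab: "(norm a)\<^sup>2 + (norm b)\<^sup>2 = 1" and nz: "z0 \<in> U" "hopf z0 \<noteq> 0"
    and Q: "\<And>z. z \<in> U \<Longrightarrow> hopf z = Q (p z) * (deriv p z)\<^sup>2"
    and \<tau>: "\<tau> holomorphic_on U" "\<And>z. z \<in> U \<Longrightarrow> \<tau> z \<in> U \<and> p (\<tau> z) = p z"
    and k: "k \<noteq> 0"
    and sym: "(\<forall>z\<in>U. unitary_moebius a b (sphere_map g (\<tau> z)) = rotate_sphere k (unitary_moebius a b (sphere_map g z))) \<or>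
      (\<forall>z\<in>U. unitary_moebius a b (sphere_map g (\<tau> z)) = flip_sphere k (unitary_moebius a b (sphere_map g z)))"
    and z: "z \<in> U"
  shows "axis_form a b (\<tau> z) * (deriv \<tau> z)\<^sup>2 = axis_form a b z" "deriv p (\<tau> z) * deriv \<tau> z = deriv p z"
proof -
  have p': "deriv p (\<tau> y) * deriv \<tau> y = deriv p y" if y: "y \<in> U" for y
  proof (rule DERIV_unique)
    have "((\<lambda>y. p (\<tau> y)) has_field_derivative deriv p (\<tau> y) * deriv \<tau> y) (at y)"
      by (rule DERIV_chain2[OF holomorphic_derivI[OF p_hol open_U] holomorphic_derivI[OF \<tau>(1) open_U y]]) (use \<tau>(2)[OF y] in blast)
    then show "(p has_field_derivative deriv p (\<tau> y) * deriv \<tau> y) (at y)"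
      by (rule has_field_derivative_transform_within_open[OF _ open_U y]) (use \<tau>(2) in blast)
    show "(p has_field_derivative deriv p y) (at y)" by (rule holomorphic_derivI[OF p_hol open_U y])
  qed
  show "deriv p (\<tau> z) * deriv \<tau> z = deriv p z" by (rule p'[OF z])
  have hopf': "hopf (\<tau> y) * (deriv \<tau> y)\<^sup>2 = hopf y" if y: "y \<in> U" for y
  proof -
    have "hopf (\<tau> y) * (deriv \<tau> y)\<^sup>2 = Q (p y) * (deriv p (\<tau> y) * deriv \<tau> y)\<^sup>2"
      using Q[of "\<tau> y"] \<tau>(2)[OF y] by (simp add: power_mult_distrib)
    then show ?thesis unfolding p'[OF y] using Q[OF y] by simp
  qed
  let ?\<Gamma> = "\<lambda>z. unitary_moebius a b (sphere_map g z)"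
  obtain x where x: "x \<in> U" "hopf x \<noteq> 0" "?\<Gamma> x \<noteq> None" "?\<Gamma> x \<noteq> Some 0"
    by (rule good_point[OF ab nz]) (rule that, assumption+)
  obtain V \<gamma> where V: "open V" "x \<in> V" "V \<subseteq> U" and \<gamma>: "\<gamma> holomorphic_on V"
    and \<gamma>eq: "\<And>v. v \<in> V \<Longrightarrow> \<gamma> v \<noteq> 0 \<and> ?\<Gamma> v = Some (\<gamma> v) \<and> axis_form a b v * (deriv \<gamma> v / \<gamma> v)\<^sup>2 = (hopf v)\<^sup>2"
    by (rule developing_log_derivative[OF x(1) ab x(3,4)]) (rule that, assumption+)
  \<comment> \<open>Where the Hopf differential does not vanish, neither does the logarithmic
    derivative of \<gamma>, and it can be cancelled.\<close>
  define V' where "V' = {v \<in> V. hopf v \<in> - {0}}"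
  have oV': "open V'" unfolding V'_def
    by (rule continuous_open_preimage[OF holomorphic_on_imp_continuous_on[OF holomorphic_on_subset[OF hopf_holomorphic V(3)]] V(1), unfolded vimage_def Int_def mem_Collect_eq]) auto
  have near: "axis_form a b (\<tau> v) * (deriv \<tau> v)\<^sup>2 = axis_form a b v" if v: "v \<in> V'" for v
  proof -
    have vV: "v \<in> V" "v \<in> U" "hopf v \<noteq> 0" using v V(3) by (auto simp: V'_def)
    have v1: "\<gamma> v \<noteq> 0" "?\<Gamma> v = Some (\<gamma> v)" and e1: "axis_form a b v * (deriv \<gamma> v / \<gamma> v)\<^sup>2 = (hopf v)\<^sup>2" using \<gamma>eq[OF vV(1)] by auto
    have \<tau>v: "\<tau> v \<in> U" using \<tau>(2)[OF vV(2)] by blast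
    have "?\<Gamma> (\<tau> v) = Some (k * \<gamma> v) \<or> ?\<Gamma> (\<tau> v) = Some (k / \<gamma> v)" using sym vV(2) v1 by auto
    then have g2: "?\<Gamma> (\<tau> v) \<noteq> None" "?\<Gamma> (\<tau> v) \<noteq> Some 0" using k v1(1) by auto
    obtain V2 \<gamma>2 where V2: "open V2" "\<tau> v \<in> V2" "V2 \<subseteq> U" and \<gamma>2: "\<gamma>2 holomorphic_on V2"
      and \<gamma>2eq: "\<And>v. v \<in> V2 \<Longrightarrow> \<gamma>2 v \<noteq> 0 \<and> ?\<Gamma> v = Some (\<gamma>2 v) \<and> axis_form a b v * (deriv \<gamma>2 v / \<gamma>2 v)\<^sup>2 = (hopf v)\<^sup>2"
      by (rule developing_log_derivative[OF \<tau>v ab g2]) (rule that, assumption+)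
    define W where "W = {u \<in> V. \<tau> u \<in> V2}"
    have "\<tau> holomorphic_on V" using \<tau>(1) V(3) by (rule holomorphic_on_subset)
    from continuous_open_preimage[OF holomorphic_on_imp_continuous_on[OF this] V(1) V2(1)]
    have oW: "open W" by (simp add: W_def vimage_def Int_def)
    have vW: "v \<in> W" using vV V2 by (simp add: W_def)
    have d\<gamma>: "(\<gamma> has_field_derivative deriv \<gamma> v) (at v)" by (rule holomorphic_derivI[OF \<gamma> V(1) vV(1)])
    have dc: "((\<lambda>u. \<gamma>2 (\<tau> u)) has_field_derivative deriv \<gamma>2 (\<tau> v) * deriv \<tau> v) (at v)"
      by (rule DERIV_chain2[OF holomorphic_derivI[OF \<gamma>2 V2(1,2)] holomorphic_derivI[OF \<tau>(1) open_U vV(2)]])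
    \<comment> \<open>In the case of a rotation the logarithmic derivatives agree, in the case of a
      half-turn they are opposite; the squares agree in both.\<close>
    have two: "(deriv \<gamma>2 (\<tau> v) * deriv \<tau> v / \<gamma>2 (\<tau> v))\<^sup>2 = (deriv \<gamma> v / \<gamma> v)\<^sup>2"
      using sym
    proof
      assume s: "\<forall>z\<in>U. ?\<Gamma> (\<tau> z) = rotate_sphere k (?\<Gamma> z)"
      have g: "\<gamma>2 (\<tau> u) = k * \<gamma> u" if "u \<in> W" for u
        using \<gamma>eq[of u] \<gamma>2eq[of "\<tau> u"] s V(3) that by (auto simp: W_def)
      have "((\<lambda>u. \<gamma>2 (\<tau> u)) has_field_derivative k * deriv \<gamma> v) (at v)"
        by (rule has_field_derivative_transform_within_open[OF DERIV_cmult[OF d\<gamma>] oW vW]) (simp add: g)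
      then have "deriv \<gamma>2 (\<tau> v) * deriv \<tau> v = k * deriv \<gamma> v" using dc DERIV_unique by blast
      then show ?thesis using g[OF vW] k by simp
    next
      assume s: "\<forall>z\<in>U. ?\<Gamma> (\<tau> z) = flip_sphere k (?\<Gamma> z)"
      have g: "\<gamma>2 (\<tau> u) = k / \<gamma> u" if "u \<in> W" for u
        using \<gamma>eq[of u] \<gamma>2eq[of "\<tau> u"] s V(3) that by (auto simp: W_def)
      have "((\<lambda>u. k / \<gamma> u) has_field_derivative - (k * deriv \<gamma> v / (\<gamma> v)\<^sup>2)) (at v)"
        using d\<gamma> v1(1) by (auto intro!: derivative_eq_intros simp: power2_eq_square)
      then have "((\<lambda>u. \<gamma>2 (\<tau> u)) has_field_derivative - (k * deriv \<gamma> v / (\<gamma> v)\<^sup>2)) (at v)"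
        by (rule has_field_derivative_transform_within_open[OF _ oW vW]) (simp add: g)
      then have "deriv \<gamma>2 (\<tau> v) * deriv \<tau> v = - (k * deriv \<gamma> v / (\<gamma> v)\<^sup>2)" using dc DERIV_unique by blast
      then have "deriv \<gamma>2 (\<tau> v) * deriv \<tau> v / \<gamma>2 (\<tau> v) = - (deriv \<gamma> v / \<gamma> v)"
        using g[OF vW] k v1(1) by (simp add: power2_eq_square)
      then show ?thesis by simp
    qed
    have e2: "axis_form a b (\<tau> v) * (deriv \<gamma>2 (\<tau> v) / \<gamma>2 (\<tau> v))\<^sup>2 = (hopf (\<tau> v))\<^sup>2" using \<gamma>2eq[OF V2(2)] by blast
    have "axis_form a b (\<tau> v) * (deriv \<tau> v)\<^sup>2 * (deriv \<gamma> v / \<gamma> v)\<^sup>2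
        = axis_form a b (\<tau> v) * (deriv \<gamma>2 (\<tau> v) / \<gamma>2 (\<tau> v))\<^sup>2 * ((deriv \<tau> v)\<^sup>2 * (deriv \<tau> v)\<^sup>2)"
      unfolding two[symmetric] by (simp add: power_mult_distrib power_divide)
    also have "\<dots> = (hopf (\<tau> v) * (deriv \<tau> v)\<^sup>2)\<^sup>2" unfolding e2 by (simp add: power_mult_distrib power2_eq_square)
    also have "\<dots> = axis_form a b v * (deriv \<gamma> v / \<gamma> v)\<^sup>2" unfolding hopf'[OF vV(2)] e1 ..
    finally have "(axis_form a b (\<tau> v) * (deriv \<tau> v)\<^sup>2) * (deriv \<gamma> v / \<gamma> v)\<^sup>2 = axis_form a b v * (deriv \<gamma> v / \<gamma> v)\<^sup>2" .
    moreover have "(deriv \<gamma> v / \<gamma> v)\<^sup>2 \<noteq> 0" using e1 vV(3) by auto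
    ultimately show ?thesis by (simp only: mult_cancel_right) simp
  qed
  note ah = axis_form_holomorphic[OF ab]
  have "(\<lambda>z. axis_form a b (\<tau> z)) holomorphic_on U"
    using holomorphic_on_compose_gen[OF \<tau>(1) ah] \<tau>(2) by (auto simp: o_def image_subset_iff)
  then have "(\<lambda>z. axis_form a b (\<tau> z) * (deriv \<tau> z)\<^sup>2) holomorphic_on U"
    by (intro holomorphic_intros holomorphic_deriv \<tau>(1) open_U)
  from analytic_continuation_open[OF oV' open_U _ connected_U _ this ah near z]
  show "axis_form a b (\<tau> z) * (deriv \<tau> z)\<^sup>2 = axis_form a b z"
    using V x by (auto simp: V'_def)
qed

text \<open>All monodromies commute, so one axis (a, b) serves the whole group. Deck transformations
  act transitively on the fibres of p, and invariance under them makes the quotient of the axis form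
  by the square of \<open>deriv p\<close> a function on M.\<close>

lemma axis_form_globalises:
  assumes red: "reducible U p g" and nz: "z0 \<in> U" "hopf z0 \<noteq> 0"
    and Q: "\<And>z. z \<in> U \<Longrightarrow> hopf z = Q (p z) * (deriv p z)\<^sup>2"
  obtains a b E where "(norm a)\<^sup>2 + (norm b)\<^sup>2 = 1" "E holomorphic_on M"
    "\<And>z. z \<in> U \<Longrightarrow> axis_form a b z = E (p z) * (deriv p z)\<^sup>2"
proof -
  obtain \<rho> where \<rho>: "monodromy_representation U p g \<rho>" and comm: "\<And>\<sigma> \<tau>. \<sigma> \<in> deck U p \<Longrightarrow> \<tau> \<in> deck U p \<Longrightarrow> \<rho> \<sigma> \<circ> \<rho> \<tau> = \<rho> \<tau> \<circ> \<rho> \<sigma>"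
    using red unfolding reducible_def by blast
  have \<rho>P: "\<rho> ` deck U p \<subseteq> PSU2" and mono: "\<And>\<tau> z. \<tau> \<in> deck U p \<Longrightarrow> z \<in> U \<Longrightarrow> sphere_map g (inv_into U \<tau> z) = \<rho> \<tau> (sphere_map g z)"
    using \<rho> unfolding monodromy_representation_def by blast+
  obtain a b where ab: "(norm a)\<^sup>2 + (norm b)\<^sup>2 = 1"
    and nf: "\<And>m. m \<in> \<rho> ` deck U p \<Longrightarrow> \<exists>k. norm k = 1 \<and> ((\<forall>P. unitary_moebius a b (m P) = rotate_sphere k (unitary_moebius a b P)) \<or>
        (\<forall>P. unitary_moebius a b (m P) = flip_sphere k (unitary_moebius a b P)))"
    by (rule commuting_PSU2_normal_form[OF \<rho>P]) (use comm in blast, rule that, assumption+)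
  have inv: "axis_form a b x' / (deriv p x')\<^sup>2 = axis_form a b x / (deriv p x)\<^sup>2"
    if x: "x \<in> U" "x' \<in> U" "p x = p x'" for x x'
  proof -
    obtain \<tau> \<delta> where \<tau>: "\<tau> holomorphic_on U" "\<And>z. z \<in> U \<Longrightarrow> \<tau> z \<in> U \<and> p (\<tau> z) = p z" "\<tau> x = x'"
      "\<delta> \<in> deck U p" "\<And>z. z \<in> U \<Longrightarrow> inv_into U \<delta> z = \<tau> z"
      by (rule deck_transitive[OF x]) (rule that, assumption+)
    have g\<tau>: "sphere_map g (\<tau> z) = \<rho> \<delta> (sphere_map g z)" if "z \<in> U" for z
      using mono[OF \<tau>(4) that] \<tau>(5)[OF that] by simp
    obtain k where k: "norm k = 1" "(\<forall>P. unitary_moebius a b (\<rho> \<delta> P) = rotate_sphere k (unitary_moebius a b P)) \<or>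
        (\<forall>P. unitary_moebius a b (\<rho> \<delta> P) = flip_sphere k (unitary_moebius a b P))"
      using nf \<tau>(4) by blast
    have k0: "k \<noteq> 0" using k(1) by auto
    have sym: "(\<forall>z\<in>U. unitary_moebius a b (sphere_map g (\<tau> z)) = rotate_sphere k (unitary_moebius a b (sphere_map g z))) \<or>
      (\<forall>z\<in>U. unitary_moebius a b (sphere_map g (\<tau> z)) = flip_sphere k (unitary_moebius a b (sphere_map g z)))"
      using k(2) g\<tau> by auto
    note i = axis_form_invariant[OF ab nz Q \<tau>(1,2) k0 sym x(1), unfolded \<tau>(3)]
    have "deriv \<tau> x \<noteq> 0" using i(2) deriv_p_nonzero[OF x(1)] by auto
    then have "axis_form a b x' * (deriv \<tau> x)\<^sup>2 / (deriv p x' * deriv \<tau> x)\<^sup>2 = axis_form a b x' / (deriv p x')\<^sup>2"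
      by (simp add: power_mult_distrib)
    then show ?thesis by (simp only: i)
  qed
  \<comment> \<open>By \<open>inv\<close> the value does not depend on the point chosen in the
    fibre.\<close>
  define E where "E w = (let x = SOME x. x \<in> U \<and> p x = w in axis_form a b x / (deriv p x)\<^sup>2)" for w
  have Ep: "E (p x) = axis_form a b x / (deriv p x)\<^sup>2" if x: "x \<in> U" for x
  proof -
    define y where "y = (SOME y. y \<in> U \<and> p y = p x)"
    have "y \<in> U \<and> p y = p x" unfolding y_def by (rule someI[of _ x]) (use x in simp)
    then show ?thesis using inv[of x y] x unfolding E_def Let_def y_def[symmetric] by simp
  qed
  have hE: "E field_differentiable at w" if w: "w \<in> M" for w
  proof -
    obtain x where x: "x \<in> U" "p x = w" using p_surj[OF w] by blast
    obtain r s where s: "0 < r" "ball w r \<subseteq> M" "s holomorphic_on ball w r" "s w = x"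
        "\<And>v. v \<in> ball w r \<Longrightarrow> s v \<in> U \<and> p (s v) = v \<and> deriv p (s v) * deriv s v = 1"
      by (rule local_section[OF x(1), unfolded x(2)]) (rule that, assumption+)
    have sU: "s ` ball w r \<subseteq> U" using s(5) by blast
    have "(\<lambda>v. axis_form a b (s v)) holomorphic_on ball w r" "(\<lambda>v. deriv p (s v)) holomorphic_on ball w r"
      using holomorphic_on_compose_gen[OF s(3) axis_form_holomorphic[OF ab] sU]
        holomorphic_on_compose_gen[OF s(3) holomorphic_deriv[OF p_hol open_U] sU] by (simp_all add: o_def)
    then have "(\<lambda>v. axis_form a b (s v) / (deriv p (s v))\<^sup>2) holomorphic_on ball w r"
      using deriv_p_nonzero s(5) by (intro holomorphic_intros) auto
    then have "E holomorphic_on ball w r"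
      by (rule holomorphic_transform) (use Ep s(5) in metis)
    then show ?thesis using s(1) by (auto intro: holomorphic_on_imp_differentiable_at)
  qed
  show thesis
  proof (rule that[OF ab])
    show "E holomorphic_on M" using hE by (simp add: holomorphic_on_def field_differentiable_at_within)
    show "axis_form a b z = E (p z) * (deriv p z)\<^sup>2" if "z \<in> U" for z
      using Ep[OF that] deriv_p_nonzero[OF that] by simp
  qed
qed

end

section \<open>Nonexistence\<close>

text \<open>The maps w, 1 + w and inverse w are the inverses of coordinates centred at 0, 1 and
  \<infinity> that \<open>catenoidal_end\<close> takes as its last argument.\<close>

theorem theorem6p4:
  fixes l :: real
  assumes "0 < l" and "l < 1"
  shows "\<not> (\<exists>M lam U p g \<alpha>.
    M = UNIV - {0, 1} \<and>
    ricci_surface M lam \<and> nonpositively_curved M lam \<and> complete_metric M lam \<and>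
    finite_total_curvature M lam \<and>
    weierstrass_data M lam U p g \<alpha> \<and>
    catenoidal_end M U p g \<alpha> (\<lambda>w. w) \<and>
    catenoidal_end M U p g \<alpha> (\<lambda>w. 1 + w) \<and>
    catenoidal_end M U p g \<alpha> (\<lambda>w. inverse w) \<and>
    reducible U p g \<and>
    total_curvature M lam = - 4 * pi * l)"
proof (intro notI, elim exE conjE)
  fix M lam U p g \<alpha>
  assume M: "M = UNIV - {0, 1}" and ricci: "ricci_surface M lam" and fin: "finite_total_curvature M lam"
    and data: "weierstrass_data M lam U p g \<alpha>"
    and ends: "catenoidal_end M U p g \<alpha> (\<lambda>w. w)" "catenoidal_end M U p g \<alpha> (\<lambda>w. 1 + w)"
      "catenoidal_end M U p g \<alpha> (\<lambda>w. inverse w)"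
    and red: "reducible U p g" and total: "total_curvature M lam = - 4 * pi * l"
  interpret weierstrass_cover M lam U p g \<alpha>
    by unfold_locales (use ricci data in \<open>auto simp: ricci_surface_def\<close>)
  obtain Q where Q: "Q holomorphic_on M" "\<And>z. z \<in> U \<Longrightarrow> hopf z = Q (p z) * (deriv p z)\<^sup>2" "\<exists>z\<in>M. Q z \<noteq> 0"
    "end_lower_bound Q (\<lambda>w. w)" "end_lower_bound Q (\<lambda>w. 1 + w)" "end_lower_bound Q (\<lambda>w. inverse w)"
    by (rule hopf_globalises[OF M ends]) (rule that, assumption+)
  obtain w0 where w0: "w0 \<in> M" "Q w0 \<noteq> 0" using Q(3) by blast
  obtain z0 where z0: "z0 \<in> U" "p z0 = w0" using p_surj[OF w0(1)] by blast
  have h0: "hopf z0 \<noteq> 0" using Q(2)[OF z0(1)] w0(2) z0(2) deriv_p_nonzero[OF z0(1)] by simp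
  obtain a b E where ab: "(norm a)\<^sup>2 + (norm b)\<^sup>2 = 1" and E: "E holomorphic_on M"
    "\<And>z. z \<in> U \<Longrightarrow> axis_form a b z = E (p z) * (deriv p z)\<^sup>2"
    by (rule axis_form_globalises[OF red z0(1) h0 Q(2)]) (assumption | rule that)+
  \<comment> \<open>This turns the total curvature into the area 4 pi l required by
    \<open>reduced_surface\<close>.\<close>
  have K: "(norm (Q w))\<^sup>2 / lam w = - (gauss_curvature lam w * lam w)" if w: "w \<in> M" for w
  proof -
    obtain x where x: "x \<in> U" "p x = w" using p_surj[OF w] by blast
    have "hopf_norm w = norm (Q w)"
      using hopf_norm_eq(1)[OF x(1)] Q(2)[OF x(1)] deriv_p_nonzero[OF x(1)] by (simp add: x(2) norm_mult norm_power)
    then show ?thesis using hopf_norm_eq(2)[OF x(1)] by (simp add: x(2))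
  qed
  have "(\<lambda>w. (- 1) *\<^sub>R (gauss_curvature lam w * lam w)) absolutely_integrable_on M"
    using fin unfolding finite_total_curvature_def by (rule absolutely_integrable_scaleR_left)
  then have ai: "(\<lambda>w. (norm (Q w))\<^sup>2 / lam w) absolutely_integrable_on M"
    by (rule set_integrable_cong[THEN iffD1, OF refl refl, rotated]) (simp add: K)
  have area: "integral M (\<lambda>w. (norm (Q w))\<^sup>2 / lam w) = 4 * pi * l"
  proof -
    have "integral M (\<lambda>w. (norm (Q w))\<^sup>2 / lam w) = integral M (\<lambda>w. - (gauss_curvature lam w * lam w))"
      by (rule integral_cong) (rule K)
    then show ?thesis using total by (simp add: total_curvature_def)
  qed
  \<comment> \<open>Along a section s of p the forms on U become Q and E, since
    \<open>deriv p (s v)\<close> and \<open>deriv s v\<close> are inverse to each other.\<close>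
  have ld: "\<exists>r G A. ball w r \<subseteq> M \<and> local_data lam Q E w r G A" if w: "w \<in> M" for w
  proof -
    obtain x where x: "x \<in> U" "p x = w" using p_surj[OF w] by blast
    obtain \<rho> s where s: "0 < \<rho>" "ball (p x) \<rho> \<subseteq> M" "s holomorphic_on ball (p x) \<rho>" "s (p x) = x"
        "\<And>v. v \<in> ball (p x) \<rho> \<Longrightarrow> s v \<in> U \<and> p (s v) = v \<and> deriv p (s v) * deriv s v = 1"
      by (rule local_section[OF x(1)]) (rule that, assumption+)
    obtain r G A where r: "ball (p x) r \<subseteq> ball (p x) \<rho>"
      "local_data lam (\<lambda>v. hopf (s v) * (deriv s v)\<^sup>2) (\<lambda>v. axis_form a b (s v) * (deriv s v)\<^sup>2) (p x) r G A"
      by (rule base_local_data[OF x(1) ab s(1,3,4,5)]) (assumption | rule that)+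
    have "local_data lam Q E (p x) r G A"
    proof (rule local_data_cong[OF r(2)])
      fix v assume "v \<in> ball (p x) r"
      then have v: "s v \<in> U" "p (s v) = v" "deriv p (s v) * deriv s v = 1" using s(5) r(1) by blast+
      have "(deriv p (s v))\<^sup>2 * (deriv s v)\<^sup>2 = 1" using v(3) by (simp flip: power_mult_distrib)
      then show "lam v = lam v \<and> Q v = hopf (s v) * (deriv s v)\<^sup>2 \<and> E v = axis_form a b (s v) * (deriv s v)\<^sup>2"
        unfolding Q(2)[OF v(1)] E(2)[OF v(1)] v(2) by (simp add: mult.assoc)
    qed
    then show ?thesis using r(1) s(2) x(2) by blast
  qed
  note bounds = Q(4-6)
  interpret reduced_surface lam Q E l M
    by unfold_locales (use M ld Q(1,3) E(1) ai area in auto)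
  show False by (rule no_reduced_surface[OF assms(2) bounds])
qed

end
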